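(* Let $G$ be a locally compact group. (Banach algebra version) Let $SA(G)$ be a Segal algebra in the Fourier algebra $A(G)$. Then the following are equivalent: (i) $SA(G)$ has an approximate identity and $G$ is discrete; (ii) $SA(G)$ has an approximate identity and is approximately biprojective; (iii) $SA(G)$ is pseudo-contractible. (Operator version) Let $SA(G)$ be an operator Segal algebra in $A(G)$. Then the following are equivalent: (i) $SA(G)$ has an approximate identity and $G$ is discrete; (ii) $SA(G)$ has an approximate identity and is operator approximately biprojective; (iii) $SA(G)$ is operator pseudo-contractible.
   Context: $A(G)$ is the Fourier algebra with pointwise multiplication, with its operator space structure as the predual of the group von Neumann algebra $VN(G)$; it is a completely contractive Banach algebra, i.e. multiplication extends to a complete contraction on the operator projective tensor product $A(G)\widehat{\otimes}_{op}A(G)$. $\widehat{\otimes}$ is the Banach space projective tensor product. A Segal algebra (respectively operator Segal algebra) in a Banach algebra (respectively completely contractive Banach algebra) $A$ is a dense left ideal $B$ of $A$, with a norm (respectively operator space structure) under which $B$ is complete, the inclusion $B\hookrightarrow A$ is contractive (respectively completely contractive), $B$ is a contractive (respectively completely contractive) left $A$-module, i.e. the product extends to a contraction $A\widehat{\otimes}B\to B$ (respectively complete contraction $A\widehat{\otimes}_{op}B\to B$), and $B$ is essential, i.e. $A\cdot B$ is dense in $B$ for the norm of $B$. For a Banach algebra $B$, with $a\cdot(b\otimes c)=(ab)\otimes c$, $(b\otimes c)\cdot a=b\otimes(ca)$, $\pi(b\otimes c)=bc$: $B$ is (operator) pseudo-contractible if there is a net $(m_\alpha)$ in $B\widehat{\otimes}B$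 (respectively $B\widehat{\otimes}_{op}B$) with $a\cdot m_\alpha=m_\alpha\cdot a$ for all $\alpha$ and $\pi(m_\alpha)a\to a$ in norm, for all $a\in B$. $B$ is (operator) approximately biprojective if there is a net of bounded (respectively completely bounded) $B$-bimodule maps $\xi_\alpha:B\to B\widehat{\otimes}B$ (respectively $B\to B\widehat{\otimes}_{op}B$) with $\pi\circ\xi_\alpha(a)\to a$ in norm for all $a\in B$. *)

theory Defs
  imports
    "HOL-Analysis.Analysis"
    "HOL-Library.Function_Algebras"
    "Jordan_Normal_Form.Matrix"
begin

section \<open>Complex vector spaces and algebras\<close>

class scaleC =
  fixes scaleC :: "complex \<Rightarrow> 'a \<Rightarrow> 'a"  (infixr "*\<^sub>C" 75)

class complex_vector = scaleC + ab_group_add +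
  assumes scaleC_add_right: "c *\<^sub>C (x + y) = c *\<^sub>C x + c *\<^sub>C y"
    and scaleC_add_left: "(c + d) *\<^sub>C x = c *\<^sub>C x + d *\<^sub>C x"
    and scaleC_scaleC: "c *\<^sub>C (d *\<^sub>C x) = (c * d) *\<^sub>C x"
    and scaleC_one: "1 *\<^sub>C x = x"

class complex_algebra = complex_vector + ring +
  assumes mult_scaleC_left: "(c *\<^sub>C x) * y = c *\<^sub>C (x * y)"
    and mult_scaleC_right: "x * (c *\<^sub>C y) = c *\<^sub>C (x * y)"

instantiation complex :: complex_algebra
begin
definition scaleC_complex :: "complex \<Rightarrow> complex \<Rightarrow> complex" where
  "scaleC_complex c x = c * x"
instance by standard (simp_all add: scaleC_complex_def algebra_simps)
end

text \<open>Functions carry the pointwise operations, addition and multiplication being those of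
  \<^theory>\<open>HOL-Library.Function_Algebras\<close>.\<close>

instantiation "fun" :: (type, complex_vector) complex_vector
begin
definition scaleC_fun :: "complex \<Rightarrow> ('a \<Rightarrow> 'b) \<Rightarrow> 'a \<Rightarrow> 'b" where
  "scaleC_fun c f = (\<lambda>x. c *\<^sub>C f x)"
instance
  by standard
    (simp_all add: scaleC_fun_def fun_eq_iff scaleC_add_right scaleC_add_left scaleC_scaleC scaleC_one)
end

instance "fun" :: (type, complex_algebra) complex_algebra
  by standard (simp_all add: scaleC_fun_def fun_eq_iff mult_scaleC_left mult_scaleC_right)

global_interpretation complex_vector: vector_space "scaleC :: complex \<Rightarrow> 'a \<Rightarrow> 'a::complex_vector"
  by standard (rule scaleC_add_right scaleC_add_left scaleC_scaleC scaleC_one)+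


section \<open>Normed spaces and bounded linear maps on carrier sets\<close>

text \<open>A normed space is a subspace \<open>X\<close> of an ambient vector space together with a function \<open>N\<close>
  whose values on \<open>X\<close> form a norm; values of \<open>N\<close>, and of linear maps, off \<open>X\<close> are irrelevant.\<close>

definition normed_on :: "'a::complex_vector set \<Rightarrow> ('a \<Rightarrow> real) \<Rightarrow> bool" where
  "normed_on X N \<longleftrightarrow> complex_vector.subspace X
     \<and> (\<forall>x\<in>X. 0 \<le> N x \<and> (N x = 0 \<longleftrightarrow> x = 0))
     \<and> (\<forall>x\<in>X. \<forall>y\<in>X. N (x + y) \<le> N x + N y)
     \<and> (\<forall>c. \<forall>x\<in>X. N (c *\<^sub>C x) = cmod c * N x)"

definition Cauchy_wrt :: "('a::complex_vector \<Rightarrow> real) \<Rightarrow> (nat \<Rightarrow> 'a) \<Rightarrow> bool" where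
  "Cauchy_wrt N s \<longleftrightarrow> (\<forall>e>0. \<exists>k. \<forall>m\<ge>k. \<forall>n\<ge>k. N (s m - s n) < e)"

definition banach_on :: "'a::complex_vector set \<Rightarrow> ('a \<Rightarrow> real) \<Rightarrow> bool" where
  "banach_on X N \<longleftrightarrow> normed_on X N
     \<and> (\<forall>s. (\<forall>n. s n \<in> X) \<and> Cauchy_wrt N s \<longrightarrow> (\<exists>x\<in>X. (\<lambda>n. N (s n - x)) \<longlonglongrightarrow> 0))"

definition dense_wrt :: "('a::complex_vector \<Rightarrow> real) \<Rightarrow> 'a set \<Rightarrow> 'a set \<Rightarrow> bool" where
  "dense_wrt N D X \<longleftrightarrow> D \<subseteq> X \<and> (\<forall>x\<in>X. \<forall>e>0. \<exists>d\<in>D. N (x - d) < e)"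

definition linear_between :: "'a::complex_vector set \<Rightarrow> 'b::complex_vector set \<Rightarrow> ('a \<Rightarrow> 'b) \<Rightarrow> bool" where
  "linear_between X Y T \<longleftrightarrow> (\<forall>x\<in>X. T x \<in> Y)
     \<and> (\<forall>x\<in>X. \<forall>y\<in>X. T (x + y) = T x + T y)
     \<and> (\<forall>c. \<forall>x\<in>X. T (c *\<^sub>C x) = c *\<^sub>C T x)"

definition bounded_between ::
  "'a::complex_vector set \<Rightarrow> ('a \<Rightarrow> real) \<Rightarrow> 'b::complex_vector set \<Rightarrow> ('b \<Rightarrow> real) \<Rightarrow> ('a \<Rightarrow> 'b) \<Rightarrow> bool" where
  "bounded_between X NX Y NY T \<longleftrightarrow>
     linear_between X Y T \<and> (\<exists>C. \<forall>x\<in>X. NY (T x) \<le> C * NX x)"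

definition contraction_between ::
  "'a::complex_vector set \<Rightarrow> ('a \<Rightarrow> real) \<Rightarrow> 'b::complex_vector set \<Rightarrow> ('b \<Rightarrow> real) \<Rightarrow> ('a \<Rightarrow> 'b) \<Rightarrow> bool" where
  "contraction_between X NX Y NY T \<longleftrightarrow>
     linear_between X Y T \<and> (\<forall>x\<in>X. NY (T x) \<le> NX x)"


section \<open>Operator spaces\<close>

text \<open>A matrix norm is one function on square matrices of all sizes. Size \<open>0\<close> is
  harmless: the axioms force the norm of the empty matrix to be \<open>0\<close>.\<close>

definition mats :: "nat \<Rightarrow> 'a set \<Rightarrow> 'a mat set" where
  "mats n X = {x \<in> carrier_mat n n. elements_mat x \<subseteq> X}"

text \<open>The operator norm of a complex matrix as a map between Euclidean spaces.\<close>

definition mat_opnorm :: "complex mat \<Rightarrow> real" where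
  "mat_opnorm \<alpha> = Sup {L2_set (\<lambda>i. cmod (\<Sum>j<dim_col \<alpha>. \<alpha> $$ (i, j) * v j)) {..<dim_row \<alpha>} |
      v :: nat \<Rightarrow> complex. L2_set (\<lambda>j. cmod (v j)) {..<dim_col \<alpha>} \<le> 1}"

text \<open>The product \<open>\<alpha> x \<beta>\<close> of scalar matrices \<open>\<alpha>\<close>, \<open>\<beta>\<close> with a matrix \<open>x\<close> of vectors.\<close>

definition scal_mult :: "complex mat \<Rightarrow> 'a::complex_vector mat \<Rightarrow> complex mat \<Rightarrow> 'a mat" where
  "scal_mult \<alpha> x \<beta> = mat (dim_row \<alpha>) (dim_col \<beta>)
     (\<lambda>(i, j). \<Sum>k<dim_row x. \<Sum>l<dim_col x. (\<alpha> $$ (i, k) * \<beta> $$ (l, j)) *\<^sub>C x $$ (k, l))"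

definition norm1 :: "('a mat \<Rightarrow> real) \<Rightarrow> 'a \<Rightarrow> real" where
  "norm1 N x = N (mat 1 1 (\<lambda>_. x))"

text \<open>Operator spaces in the abstract sense, given by Ruan's axioms.\<close>

definition operator_space :: "'a::complex_vector set \<Rightarrow> ('a mat \<Rightarrow> real) \<Rightarrow> bool" where
  "operator_space X N \<longleftrightarrow> complex_vector.subspace X
     \<and> (\<forall>n. \<forall>x\<in>mats n X. 0 \<le> N x \<and> (N x = 0 \<longleftrightarrow> x = 0\<^sub>m n n))
     \<and> (\<forall>n. \<forall>x\<in>mats n X. \<forall>y\<in>mats n X. N (x + y) \<le> N x + N y)
     \<and> (\<forall>n. \<forall>c. \<forall>x\<in>mats n X. N (map_mat (scaleC c) x) = cmod c * N x)
     \<and> (\<forall>n m. \<forall>x\<in>mats n X. \<forall>y\<in>mats m X.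
          N (four_block_mat x (0\<^sub>m n m) (0\<^sub>m m n) y) = max (N x) (N y))
     \<and> (\<forall>n m. \<forall>\<alpha>\<in>carrier_mat m n. \<forall>x\<in>mats n X. \<forall>\<beta>\<in>carrier_mat n m.
          N (scal_mult \<alpha> x \<beta>) \<le> mat_opnorm \<alpha> * N x * mat_opnorm \<beta>)"

definition complete_operator_space :: "'a::complex_vector set \<Rightarrow> ('a mat \<Rightarrow> real) \<Rightarrow> bool" where
  "complete_operator_space X N \<longleftrightarrow> operator_space X N \<and> banach_on X (norm1 N)"

definition cb_between ::
  "'a::complex_vector set \<Rightarrow> ('a mat \<Rightarrow> real) \<Rightarrow> 'b::complex_vector set \<Rightarrow> ('b mat \<Rightarrow> real) \<Rightarrow> ('a \<Rightarrow> 'b) \<Rightarrow> bool" where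
  "cb_between X NX Y NY T \<longleftrightarrow>
     linear_between X Y T \<and> (\<exists>C. \<forall>n. \<forall>x\<in>mats n X. NY (map_mat T x) \<le> C * NX x)"

definition complete_contraction_between ::
  "'a::complex_vector set \<Rightarrow> ('a mat \<Rightarrow> real) \<Rightarrow> 'b::complex_vector set \<Rightarrow> ('b mat \<Rightarrow> real) \<Rightarrow> ('a \<Rightarrow> 'b) \<Rightarrow> bool" where
  "complete_contraction_between X NX Y NY T \<longleftrightarrow>
     linear_between X Y T \<and> (\<forall>n. \<forall>x\<in>mats n X. NY (map_mat T x) \<le> NX x)"


section \<open>Completion\<close>

text \<open>The completion of a normed space is realised as the closure of its canonical image in its
  bidual. Dual functionals are taken to vanish off \<open>X\<close>, and bidual elements to vanish off the dual,
  so that equality in the completion is equality of functions.\<close>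

definition dual_of :: "'a::complex_vector set \<Rightarrow> ('a \<Rightarrow> real) \<Rightarrow> ('a \<Rightarrow> complex) set" where
  "dual_of X N = {f. bounded_between X N UNIV cmod f \<and> (\<forall>x. x \<notin> X \<longrightarrow> f x = 0)}"

definition completion_embed ::
  "'a::complex_vector set \<Rightarrow> ('a \<Rightarrow> real) \<Rightarrow> 'a \<Rightarrow> ('a \<Rightarrow> complex) \<Rightarrow> complex" where
  "completion_embed X N x = (\<lambda>f. if f \<in> dual_of X N then f x else 0)"

text \<open>The Cauchy sequence \<open>s\<close> in \<open>X\<close> represents \<open>\<Phi>\<close>. For a norm-Cauchy sequence pointwise
  convergence in the bidual is the same as convergence in norm.\<close>

definition represents ::
  "'a::complex_vector set \<Rightarrow> ('a \<Rightarrow> real) \<Rightarrow> (nat \<Rightarrow> 'a) \<Rightarrow> (('a \<Rightarrow> complex) \<Rightarrow> complex) \<Rightarrow> bool" where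
  "represents X N s \<Phi> \<longleftrightarrow> (\<forall>n. s n \<in> X) \<and> Cauchy_wrt N s
     \<and> (\<forall>f. (\<lambda>n. completion_embed X N (s n) f) \<longlonglongrightarrow> \<Phi> f)"

definition completion ::
  "'a::complex_vector set \<Rightarrow> ('a \<Rightarrow> real) \<Rightarrow> (('a \<Rightarrow> complex) \<Rightarrow> complex) set" where
  "completion X N = {\<Phi>. \<exists>s. represents X N s \<Phi>}"

definition completion_norm ::
  "'a::complex_vector set \<Rightarrow> ('a \<Rightarrow> real) \<Rightarrow> (('a \<Rightarrow> complex) \<Rightarrow> complex) \<Rightarrow> real" where
  "completion_norm X N \<Phi> = (THE r. \<forall>s. represents X N s \<Phi> \<longrightarrow> (\<lambda>n. N (s n)) \<longlonglongrightarrow> r)"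

text \<open>The completion of an operator space, as a Banach space, is the completion for the norm of
  \<open>1 \<times> 1\<close> matrices; the matrix norms extend by continuity.\<close>

definition completion_mat_norm ::
  "'a::complex_vector set \<Rightarrow> ('a mat \<Rightarrow> real) \<Rightarrow> (('a \<Rightarrow> complex) \<Rightarrow> complex) mat \<Rightarrow> real" where
  "completion_mat_norm X N \<Phi> = (THE r. \<forall>s.
     (\<forall>k. s k \<in> carrier_mat (dim_row \<Phi>) (dim_col \<Phi>)) \<and>
     (\<forall>i<dim_row \<Phi>. \<forall>j<dim_col \<Phi>. represents X (norm1 N) (\<lambda>k. s k $$ (i, j)) (\<Phi> $$ (i, j)))
     \<longrightarrow> (\<lambda>k. N (s k)) \<longlonglongrightarrow> r)"


section \<open>Tensor products\<close>

text \<open>The elementary tensor \<open>x \<otimes> y\<close> is evaluation at \<open>(x, y)\<close> of bilinear forms. Since every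
  bilinear form on a pair of subspaces extends to the ambient spaces, the span of the elementary
  tensors with \<open>x \<in> X\<close>, \<open>y \<in> Y\<close> is the algebraic tensor product of \<open>X\<close> and \<open>Y\<close>.\<close>

definition bilinear_form :: "('a::complex_vector \<Rightarrow> 'b::complex_vector \<Rightarrow> complex) \<Rightarrow> bool" where
  "bilinear_form \<phi> \<longleftrightarrow> (\<forall>x. Vector_Spaces.linear scaleC scaleC (\<phi> x))
     \<and> (\<forall>y. Vector_Spaces.linear scaleC scaleC (\<lambda>x. \<phi> x y))"

type_synonym ('a, 'b) tensor = "('a \<Rightarrow> 'b \<Rightarrow> complex) \<Rightarrow> complex"

definition tensor :: "'a::complex_vector \<Rightarrow> 'b::complex_vector \<Rightarrow> ('a, 'b) tensor" where
  "tensor x y = (\<lambda>\<phi>. if bilinear_form \<phi> then \<phi> x y else 0)"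

definition alg_tensor :: "'a::complex_vector set \<Rightarrow> 'b::complex_vector set \<Rightarrow> ('a, 'b) tensor set" where
  "alg_tensor X Y = complex_vector.span {tensor x y | x y. x \<in> X \<and> y \<in> Y}"

definition proj_norm ::
  "'a::complex_vector set \<Rightarrow> ('a \<Rightarrow> real) \<Rightarrow> 'b::complex_vector set \<Rightarrow> ('b \<Rightarrow> real) \<Rightarrow> ('a, 'b) tensor \<Rightarrow> real" where
  "proj_norm X NX Y NY u = Inf {\<Sum>i<n. NX (x i) * NY (y i) | (n::nat) x y.
     (\<forall>i<n. x i \<in> X \<and> y i \<in> Y) \<and> u = (\<Sum>i<n. tensor (x i) (y i))}"

definition mat_tensor :: "'a::complex_vector mat \<Rightarrow> 'b::complex_vector mat \<Rightarrow> ('a, 'b) tensor mat" where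
  "mat_tensor x y = mat (dim_row x * dim_row y) (dim_col x * dim_col y)
     (\<lambda>(r, s). tensor (x $$ (r div dim_row y, s div dim_col y)) (y $$ (r mod dim_row y, s mod dim_col y)))"

definition op_proj_norm ::
  "'a::complex_vector set \<Rightarrow> ('a mat \<Rightarrow> real) \<Rightarrow> 'b::complex_vector set \<Rightarrow> ('b mat \<Rightarrow> real)
    \<Rightarrow> ('a, 'b) tensor mat \<Rightarrow> real" where
  "op_proj_norm X NX Y NY u = Inf {mat_opnorm \<alpha> * NX x * NY y * mat_opnorm \<beta> | \<alpha> x y \<beta> p q.
     x \<in> mats p X \<and> y \<in> mats q Y
     \<and> \<alpha> \<in> carrier_mat (dim_row u) (p * q) \<and> \<beta> \<in> carrier_mat (p * q) (dim_col u)
     \<and> u = scal_mult \<alpha> (mat_tensor x y) \<beta>}"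

type_synonym ('a, 'b) ctensor = "(('a, 'b) tensor \<Rightarrow> complex) \<Rightarrow> complex"

definition ptensor ::
  "'a::complex_vector set \<Rightarrow> ('a \<Rightarrow> real) \<Rightarrow> 'b::complex_vector set \<Rightarrow> ('b \<Rightarrow> real) \<Rightarrow> ('a, 'b) ctensor set" where
  "ptensor X NX Y NY = completion (alg_tensor X Y) (proj_norm X NX Y NY)"

definition ptensor_norm ::
  "'a::complex_vector set \<Rightarrow> ('a \<Rightarrow> real) \<Rightarrow> 'b::complex_vector set \<Rightarrow> ('b \<Rightarrow> real) \<Rightarrow> ('a, 'b) ctensor \<Rightarrow> real" where
  "ptensor_norm X NX Y NY = completion_norm (alg_tensor X Y) (proj_norm X NX Y NY)"

definition ptensor_elem ::
  "'a::complex_vector set \<Rightarrow> ('a \<Rightarrow> real) \<Rightarrow> 'b::complex_vector set \<Rightarrow> ('b \<Rightarrow> real)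
    \<Rightarrow> 'a \<Rightarrow> 'b \<Rightarrow> ('a, 'b) ctensor" where
  "ptensor_elem X NX Y NY x y = completion_embed (alg_tensor X Y) (proj_norm X NX Y NY) (tensor x y)"

definition op_ptensor ::
  "'a::complex_vector set \<Rightarrow> ('a mat \<Rightarrow> real) \<Rightarrow> 'b::complex_vector set \<Rightarrow> ('b mat \<Rightarrow> real) \<Rightarrow> ('a, 'b) ctensor set" where
  "op_ptensor X NX Y NY = completion (alg_tensor X Y) (norm1 (op_proj_norm X NX Y NY))"

definition op_ptensor_norm ::
  "'a::complex_vector set \<Rightarrow> ('a mat \<Rightarrow> real) \<Rightarrow> 'b::complex_vector set \<Rightarrow> ('b mat \<Rightarrow> real)
    \<Rightarrow> ('a, 'b) ctensor mat \<Rightarrow> real" where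
  "op_ptensor_norm X NX Y NY = completion_mat_norm (alg_tensor X Y) (op_proj_norm X NX Y NY)"

definition op_ptensor_elem ::
  "'a::complex_vector set \<Rightarrow> ('a mat \<Rightarrow> real) \<Rightarrow> 'b::complex_vector set \<Rightarrow> ('b mat \<Rightarrow> real)
    \<Rightarrow> 'a \<Rightarrow> 'b \<Rightarrow> ('a, 'b) ctensor" where
  "op_ptensor_elem X NX Y NY x y =
     completion_embed (alg_tensor X Y) (norm1 (op_proj_norm X NX Y NY)) (tensor x y)"


section \<open>Segal algebras\<close>

text \<open>In \<open>A \<cdot> B\<close> the linear span of the products is meant.\<close>

definition segal_algebra ::
  "'a::complex_algebra set \<Rightarrow> ('a \<Rightarrow> real) \<Rightarrow> 'a set \<Rightarrow> ('a \<Rightarrow> real) \<Rightarrow> bool" where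
  "segal_algebra A NA B NB \<longleftrightarrow>
     complex_vector.subspace B \<and> dense_wrt NA B A \<and> (\<forall>a\<in>A. \<forall>b\<in>B. a * b \<in> B)
     \<and> banach_on B NB
     \<and> contraction_between B NB A NA (\<lambda>b. b)
     \<and> (\<exists>L. contraction_between (ptensor A NA B NB) (ptensor_norm A NA B NB) B NB L
          \<and> (\<forall>a\<in>A. \<forall>b\<in>B. L (ptensor_elem A NA B NB a b) = a * b))
     \<and> dense_wrt NB (complex_vector.span {a * b | a b. a \<in> A \<and> b \<in> B}) B"

definition operator_segal_algebra ::
  "'a::complex_algebra set \<Rightarrow> ('a mat \<Rightarrow> real) \<Rightarrow> 'a set \<Rightarrow> ('a mat \<Rightarrow> real) \<Rightarrow> bool" where
  "operator_segal_algebra A NA B NB \<longleftrightarrow>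
     complex_vector.subspace B \<and> dense_wrt (norm1 NA) B A \<and> (\<forall>a\<in>A. \<forall>b\<in>B. a * b \<in> B)
     \<and> complete_operator_space B NB
     \<and> complete_contraction_between B NB A NA (\<lambda>b. b)
     \<and> (\<exists>L. complete_contraction_between (op_ptensor A NA B NB) (op_ptensor_norm A NA B NB) B NB L
          \<and> (\<forall>a\<in>A. \<forall>b\<in>B. L (op_ptensor_elem A NA B NB a b) = a * b))
     \<and> dense_wrt (norm1 NB) (complex_vector.span {a * b | a b. a \<in> A \<and> b \<in> B}) B"


section \<open>Pseudo-contractibility and approximate biprojectivity\<close>

text \<open>Nets are rendered as proper filters: a net yields the image of its tail filter, and a proper
  filter \<open>F\<close> yields the net \<open>(U, m) \<mapsto> m\<close> indexed by the pairs with \<open>U \<in> F\<close>, \<open>m \<in> U\<close>. What holds for all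
  members of the net is required to hold eventually.\<close>

definition has_approximate_identity :: "'a::complex_algebra set \<Rightarrow> ('a \<Rightarrow> real) \<Rightarrow> bool" where
  "has_approximate_identity B NB \<longleftrightarrow> (\<exists>F. F \<noteq> bot \<and> (\<forall>\<^sub>F e in F. e \<in> B)
     \<and> (\<forall>a\<in>B. ((\<lambda>e. NB (e * a - a)) \<longlongrightarrow> 0) F \<and> ((\<lambda>e. NB (a * e - a)) \<longlongrightarrow> 0) F))"

text \<open>Below \<open>(P, NP)\<close> is a completed tensor product of \<open>B\<close> with itself with elementary tensors \<open>te\<close>.
  \<open>extension B te P NP W NW \<beta> m\<close> is the value at \<open>m \<in> P\<close> of the unique bounded linear map
  from \<open>P\<close> to \<open>W\<close> sending \<open>te b c\<close> to \<open>\<beta> b c\<close>.\<close>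

definition extension ::
  "'a set \<Rightarrow> ('a \<Rightarrow> 'a \<Rightarrow> 'p) \<Rightarrow> 'p::complex_vector set \<Rightarrow> ('p \<Rightarrow> real) \<Rightarrow> 'w::complex_vector set \<Rightarrow> ('w \<Rightarrow> real)
    \<Rightarrow> ('a \<Rightarrow> 'a \<Rightarrow> 'w) \<Rightarrow> 'p \<Rightarrow> 'w" where
  "extension B te P NP W NW \<beta> m = (THE w. \<exists>L. bounded_between P NP W NW L
     \<and> (\<forall>b\<in>B. \<forall>c\<in>B. L (te b c) = \<beta> b c) \<and> w = L m)"

definition left_act ::
  "'a::complex_algebra set \<Rightarrow> ('a \<Rightarrow> 'a \<Rightarrow> 'p) \<Rightarrow> 'p::complex_vector set \<Rightarrow> ('p \<Rightarrow> real) \<Rightarrow> 'a \<Rightarrow> 'p \<Rightarrow> 'p" where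
  "left_act B te P NP a = extension B te P NP P NP (\<lambda>b c. te (a * b) c)"

definition right_act ::
  "'a::complex_algebra set \<Rightarrow> ('a \<Rightarrow> 'a \<Rightarrow> 'p) \<Rightarrow> 'p::complex_vector set \<Rightarrow> ('p \<Rightarrow> real) \<Rightarrow> 'p \<Rightarrow> 'a \<Rightarrow> 'p" where
  "right_act B te P NP m a = extension B te P NP P NP (\<lambda>b c. te b (c * a)) m"

definition mult_map ::
  "'a::complex_algebra set \<Rightarrow> ('a \<Rightarrow> real) \<Rightarrow> ('a \<Rightarrow> 'a \<Rightarrow> 'p) \<Rightarrow> 'p::complex_vector set \<Rightarrow> ('p \<Rightarrow> real) \<Rightarrow> 'p \<Rightarrow> 'a" where
  "mult_map B NB te P NP = extension B te P NP B NB (\<lambda>b c. b * c)"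

definition pseudo_contractible_via ::
  "'a::complex_algebra set \<Rightarrow> ('a \<Rightarrow> real) \<Rightarrow> ('a \<Rightarrow> 'a \<Rightarrow> 'p) \<Rightarrow> 'p::complex_vector set \<Rightarrow> ('p \<Rightarrow> real) \<Rightarrow> bool" where
  "pseudo_contractible_via B NB te P NP \<longleftrightarrow> (\<exists>F. F \<noteq> bot
     \<and> (\<forall>\<^sub>F m in F. m \<in> P \<and> (\<forall>a\<in>B. left_act B te P NP a m = right_act B te P NP m a))
     \<and> (\<forall>a\<in>B. ((\<lambda>m. NB (mult_map B NB te P NP m * a - a)) \<longlongrightarrow> 0) F))"

definition bimodule_map_via ::
  "'a::complex_algebra set \<Rightarrow> ('a \<Rightarrow> 'a \<Rightarrow> 'p) \<Rightarrow> 'p::complex_vector set \<Rightarrow> ('p \<Rightarrow> real) \<Rightarrow> ('a \<Rightarrow> 'p) \<Rightarrow> bool" where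
  "bimodule_map_via B te P NP \<xi> \<longleftrightarrow> (\<forall>a\<in>B. \<forall>b\<in>B.
     \<xi> (a * b) = left_act B te P NP a (\<xi> b) \<and> \<xi> (a * b) = right_act B te P NP (\<xi> a) b)"

definition pseudo_contractible :: "'a::complex_algebra set \<Rightarrow> ('a \<Rightarrow> real) \<Rightarrow> bool" where
  "pseudo_contractible B N \<longleftrightarrow>
     pseudo_contractible_via B N (ptensor_elem B N B N) (ptensor B N B N) (ptensor_norm B N B N)"

definition operator_pseudo_contractible :: "'a::complex_algebra set \<Rightarrow> ('a mat \<Rightarrow> real) \<Rightarrow> bool" where
  "operator_pseudo_contractible B N \<longleftrightarrow>
     pseudo_contractible_via B (norm1 N) (op_ptensor_elem B N B N) (op_ptensor B N B N)
       (norm1 (op_ptensor_norm B N B N))"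

definition approximately_biprojective :: "'a::complex_algebra set \<Rightarrow> ('a \<Rightarrow> real) \<Rightarrow> bool" where
  "approximately_biprojective B N \<longleftrightarrow> (let te = ptensor_elem B N B N; P = ptensor B N B N;
       NP = ptensor_norm B N B N in
     \<exists>F. F \<noteq> bot
       \<and> (\<forall>\<^sub>F \<xi> in F. bounded_between B N P NP \<xi> \<and> bimodule_map_via B te P NP \<xi>)
       \<and> (\<forall>a\<in>B. ((\<lambda>\<xi>. N (mult_map B N te P NP (\<xi> a) - a)) \<longlongrightarrow> 0) F))"

definition operator_approximately_biprojective :: "'a::complex_algebra set \<Rightarrow> ('a mat \<Rightarrow> real) \<Rightarrow> bool" where
  "operator_approximately_biprojective B N \<longleftrightarrow> (let te = op_ptensor_elem B N B N; P = op_ptensor B N B N;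
       NP = op_ptensor_norm B N B N in
     \<exists>F. F \<noteq> bot
       \<and> (\<forall>\<^sub>F \<xi> in F. cb_between B N P NP \<xi> \<and> bimodule_map_via B te P (norm1 NP) \<xi>)
       \<and> (\<forall>a\<in>B. ((\<lambda>\<xi>. norm1 N (mult_map B (norm1 N) te P (norm1 NP) (\<xi> a) - a)) \<longlongrightarrow> 0) F))"


section \<open>The group von Neumann algebra and the Fourier algebra\<close>

text \<open>Groups are types of class \<open>topological_group_add\<close>, the distribution's class of topological
  groups. The group law is written additively but is not assumed to be commutative.\<close>

definition left_haar_measure :: "'g::topological_group_add measure \<Rightarrow> bool" where
  "left_haar_measure \<mu> \<longleftrightarrow> sets \<mu> = sets borel
     \<and> (\<forall>K. compact K \<longrightarrow> emeasure \<mu> K < \<infinity>)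
     \<and> (\<forall>S\<in>sets borel. emeasure \<mu> S = (INF U\<in>{U. open U \<and> S \<subseteq> U}. emeasure \<mu> U))
     \<and> (\<forall>U. open U \<longrightarrow> emeasure \<mu> U = (SUP K\<in>{K. compact K \<and> K \<subseteq> U}. emeasure \<mu> K))
     \<and> (\<forall>x. \<forall>S\<in>sets borel. emeasure \<mu> ((+) x ` S) = emeasure \<mu> S)
     \<and> emeasure \<mu> UNIV \<noteq> 0"

definition L2 :: "'g measure \<Rightarrow> ('g \<Rightarrow> complex) set" where
  "L2 \<mu> = {f \<in> borel_measurable \<mu>. integrable \<mu> (\<lambda>x. (cmod (f x))\<^sup>2)}"

definition L2_norm :: "'g measure \<Rightarrow> ('g \<Rightarrow> complex) \<Rightarrow> real" where
  "L2_norm \<mu> f = sqrt (\<integral>x. (cmod (f x))\<^sup>2 \<partial>\<mu>)"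

definition L2_inner :: "'g measure \<Rightarrow> ('g \<Rightarrow> complex) \<Rightarrow> ('g \<Rightarrow> complex) \<Rightarrow> complex" where
  "L2_inner \<mu> f g = (\<integral>x. f x * cnj (g x) \<partial>\<mu>)"

text \<open>Bounded operators on the Hilbert space \<open>L\<^sup>2\<close> are given by their action on representing
  functions; linearity and equality are understood almost everywhere. Boundedness and linearity
  make such a map respect almost everywhere equality.\<close>

definition L2_operator :: "'g measure \<Rightarrow> (('g \<Rightarrow> complex) \<Rightarrow> 'g \<Rightarrow> complex) \<Rightarrow> bool" where
  "L2_operator \<mu> T \<longleftrightarrow> (\<forall>f\<in>L2 \<mu>. T f \<in> L2 \<mu>)
     \<and> (\<forall>f\<in>L2 \<mu>. \<forall>g\<in>L2 \<mu>. AE x in \<mu>. T (f + g) x = T f x + T g x)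
     \<and> (\<forall>c. \<forall>f\<in>L2 \<mu>. AE x in \<mu>. T (c *\<^sub>C f) x = c * T f x)
     \<and> (\<exists>C. \<forall>f\<in>L2 \<mu>. L2_norm \<mu> (T f) \<le> C * L2_norm \<mu> f)"

definition L2_commute ::
  "'g measure \<Rightarrow> (('g \<Rightarrow> complex) \<Rightarrow> 'g \<Rightarrow> complex) \<Rightarrow> (('g \<Rightarrow> complex) \<Rightarrow> 'g \<Rightarrow> complex) \<Rightarrow> bool" where
  "L2_commute \<mu> S T \<longleftrightarrow> (\<forall>f\<in>L2 \<mu>. AE x in \<mu>. S (T f) x = T (S f) x)"

definition left_regular :: "'g::group_add \<Rightarrow> ('g \<Rightarrow> complex) \<Rightarrow> 'g \<Rightarrow> complex" where
  "left_regular x f = (\<lambda>t. f (- x + t))"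

text \<open>\<open>VN(G)\<close> is the bicommutant of the left regular representation.\<close>

definition group_vN :: "'g::group_add measure \<Rightarrow> (('g \<Rightarrow> complex) \<Rightarrow> 'g \<Rightarrow> complex) set" where
  "group_vN \<mu> = {T. L2_operator \<mu> T \<and>
     (\<forall>S. L2_operator \<mu> S \<and> (\<forall>x. L2_commute \<mu> S (left_regular x)) \<longrightarrow> L2_commute \<mu> S T)}"

text \<open>The norm of an \<open>n \<times> n\<close> matrix of operators acting on the direct sum of \<open>n\<close> copies of \<open>L\<^sup>2\<close>.\<close>

definition op_mat_norm :: "'g measure \<Rightarrow> (('g \<Rightarrow> complex) \<Rightarrow> 'g \<Rightarrow> complex) mat \<Rightarrow> real" where
  "op_mat_norm \<mu> T = Sup {L2_set (\<lambda>i. L2_norm \<mu> (\<Sum>j<dim_col T. (T $$ (i, j)) (f j))) {..<dim_row T} |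
     f :: nat \<Rightarrow> 'g \<Rightarrow> complex. (\<forall>j<dim_col T. f j \<in> L2 \<mu>) \<and> L2_set (\<lambda>j. L2_norm \<mu> (f j)) {..<dim_col T} \<le> 1}"

definition coefficient :: "'g::group_add measure \<Rightarrow> ('g \<Rightarrow> complex) \<Rightarrow> ('g \<Rightarrow> complex) \<Rightarrow> 'g \<Rightarrow> complex" where
  "coefficient \<mu> f g = (\<lambda>x. L2_inner \<mu> (left_regular x f) g)"

definition fourier_algebra :: "'g::group_add measure \<Rightarrow> ('g \<Rightarrow> complex) set" where
  "fourier_algebra \<mu> = {coefficient \<mu> f g | f g. f \<in> L2 \<mu> \<and> g \<in> L2 \<mu>}"

text \<open>The duality between \<open>VN(G)\<close> and its predual \<open>A(G)\<close>: a coefficient function \<open>u\<close> of \<open>f\<close>, \<open>g\<close> pairs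
  with \<open>T\<close> to \<open>\<langle>T f, g\<rangle>\<close>, which depends only on \<open>T\<close> and \<open>u\<close>.\<close>

definition vN_pairing ::
  "'g::group_add measure \<Rightarrow> (('g \<Rightarrow> complex) \<Rightarrow> 'g \<Rightarrow> complex) \<Rightarrow> ('g \<Rightarrow> complex) \<Rightarrow> complex" where
  "vN_pairing \<mu> T u = (THE c. \<forall>f\<in>L2 \<mu>. \<forall>g\<in>L2 \<mu>. u = coefficient \<mu> f g \<longrightarrow> c = L2_inner \<mu> (T f) g)"

definition fourier_norm :: "'g::group_add measure \<Rightarrow> ('g \<Rightarrow> complex) \<Rightarrow> real" where
  "fourier_norm \<mu> u =
     Sup {cmod (vN_pairing \<mu> T u) | T. T \<in> group_vN \<mu> \<and> op_mat_norm \<mu> (mat 1 1 (\<lambda>_. T)) \<le> 1}"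

text \<open>The predual operator space structure: a matrix \<open>[u\<^sub>i\<^sub>j]\<close> has the completely bounded norm of the
  map \<open>T \<mapsto> [\<langle>T, u\<^sub>i\<^sub>j\<rangle>]\<close> from \<open>VN(G)\<close> to scalar matrices.\<close>

definition fourier_mat_norm :: "'g::group_add measure \<Rightarrow> ('g \<Rightarrow> complex) mat \<Rightarrow> real" where
  "fourier_mat_norm \<mu> u = Sup {mat_opnorm (mat (m * dim_row u) (m * dim_col u)
       (\<lambda>(r, s). vN_pairing \<mu> (T $$ (r div dim_row u, s div dim_col u)) (u $$ (r mod dim_row u, s mod dim_col u)))) |
     m T. T \<in> mats m (group_vN \<mu>) \<and> op_mat_norm \<mu> T \<le> 1}"

definition discrete_group :: "'g::topological_group_add itself \<Rightarrow> bool" where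
  "discrete_group _ \<longleftrightarrow> (euclidean :: 'g topology) = discrete_topology UNIV"

end

theory Submission
  imports Defs
begin

text \<open>Evaluation at \<open>(x, y)\<close> extends to the completed tensor square of \<open>B\<close>, because evaluation at a
  point is the pairing with a left translation. If \<open>m\<close> commutes with \<open>B\<close>, its value at \<open>(x, y)\<close> is \<open>0\<close> for
  \<open>x \<noteq> y\<close>, since \<open>A(G)\<close> separates points and \<open>B\<close> is an ideal, and its value at \<open>(x, x)\<close> is \<open>\<pi>(m)(x)\<close>. The
  values are continuous in \<open>y\<close>, being uniform limits of sums of products of functions in \<open>B\<close>; hence
  \<open>\<pi>(m)(x) \<noteq> 0\<close> makes \<open>{x}\<close> open and \<open>G\<close> discrete. Such an \<open>m\<close> occurs in every net that witnesses
  pseudo-contractibility, and, as \<open>B\<close> is commutative, among the values of approximately biprojective maps.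

  If \<open>G\<close> is discrete, the point masses \<open>\<delta>\<^sub>z\<close> lie in \<open>A(G)\<close> and the finitely supported functions are dense
  in \<open>B\<close>. A finitely supported approximate unit \<open>u\<close> gives the commuting tensors
  \<open>\<Sum>\<^sub>z u(z) \<delta>\<^sub>z \<otimes> \<delta>\<^sub>z\<close> and the bimodule maps \<open>a \<mapsto> \<Sum>\<^sub>z u(z) \<delta>\<^sub>z a \<otimes> \<delta>\<^sub>z\<close>, which are completely bounded
  because multiplication by \<open>\<delta>\<^sub>z\<close> is.\<close>

section \<open>Seminorms and the Hahn-Banach theorem\<close>

text \<open>Extensions to completions, completion norms and the duality with VN(G) are all given by
  definite descriptions, so each must be shown well posed before it can be computed: the completion
  norm by Hahn-Banach, the extended module actions by density, the duality by a bicommutant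
  argument. Elements of a completion are functions on a dual, so "the value of \<open>m\<close> at
  \<open>(x, y)\<close>" is literally \<open>m\<close> applied to a functional. A second obstacle is
  that A(G) is the set of single coefficient functions, where a sum of two coefficients is not
  visibly a coefficient. The tensor norms are therefore developed from \<open>gauge_on\<close> and
  \<open>matrix_gauge\<close>, which speak only of scalar multiples and direct sums. Both versions
  run through one locale, \<open>segal_ctx\<close>, which collects the estimates they share as
  Banach spaces. What the operator version adds is the verification of these estimates by
  factorizations, where point evaluations have to be bounded on matrices of every size, and the
  complete boundedness of the diagonal maps.\<close>

lemma subspace_minus:
  assumes "complex_vector.subspace X" "x \<in> X" "y \<in> X"
  shows "x - y \<in> X"
  using complex_vector.subspace_diff assms by blast

lemma scaleC_minus1: "(-1) *\<^sub>C x = - (x::'a::complex_vector)"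
  using complex_vector.scale_minus_left[of 1 x] by (simp add: scaleC_one)

lemma diff_eq_scaleC: "x - y = x + (-1) *\<^sub>C (y::'a::complex_vector)"
  by (simp add: scaleC_minus1)

text \<open>Definiteness is left out because the tensor norms enter only as seminorms; the
  completion identifies vectors at distance zero.\<close>

definition seminorm_on :: "'a::complex_vector set \<Rightarrow> ('a \<Rightarrow> real) \<Rightarrow> bool" where
  "seminorm_on X N \<longleftrightarrow> complex_vector.subspace X
     \<and> (\<forall>x\<in>X. 0 \<le> N x)
     \<and> (\<forall>x\<in>X. \<forall>y\<in>X. N (x + y) \<le> N x + N y)
     \<and> (\<forall>c. \<forall>x\<in>X. N (c *\<^sub>C x) = cmod c * N x)"

lemma normed_on_seminorm: "normed_on X N \<Longrightarrow> seminorm_on X N"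
  by (auto simp: normed_on_def seminorm_on_def)

lemma seminorm_onD:
  assumes "seminorm_on X N"
  shows "complex_vector.subspace X" "x \<in> X \<Longrightarrow> 0 \<le> N x"
    "x \<in> X \<Longrightarrow> y \<in> X \<Longrightarrow> N (x + y) \<le> N x + N y"
    "x \<in> X \<Longrightarrow> N (c *\<^sub>C x) = cmod c * N x"
  using assms by (auto simp: seminorm_on_def)

lemma seminorm_on_0:
  assumes "seminorm_on X N" shows "N 0 = 0"
proof -
  have "0 \<in> X" using seminorm_onD(1)[OF assms] complex_vector.subspace_0 by blast
  from seminorm_onD(4)[OF assms this, of 0] show ?thesis by simp
qed

lemma seminorm_on_minus_commute:
  assumes "seminorm_on X N" "x \<in> X" "y \<in> X" shows "N (x - y) = N (y - x)"
proof -
  have "y - x \<in> X" using subspace_minus seminorm_onD(1) assms by blast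
  from seminorm_onD(4)[OF assms(1) this, of "-1"] show ?thesis
    by (simp add: scaleC_minus1)
qed

lemma seminorm_on_diff:
  assumes "seminorm_on X N" "x \<in> X" "y \<in> X" shows "N (x - y) \<le> N x + N y"
proof -
  have "(-1) *\<^sub>C y \<in> X" using assms seminorm_onD(1) complex_vector.subspace_scale by blast
  with seminorm_onD(3)[OF assms(1,2) this] seminorm_onD(4)[OF assms(1,3), of "-1"]
  show ?thesis by (simp add: scaleC_minus1)
qed

lemma seminorm_on_reverse:
  assumes "seminorm_on X N" "x \<in> X" "y \<in> X" shows "\<bar>N x - N y\<bar> \<le> N (x - y)"
proof -
  have d: "x - y \<in> X" "y - x \<in> X" using subspace_minus seminorm_onD(1) assms by blast+
  have "N x \<le> N y + N (x - y)" using seminorm_onD(3)[OF assms(1,3) d(1)] by simp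
  moreover have "N y \<le> N x + N (y - x)" using seminorm_onD(3)[OF assms(1,2) d(2)] by simp
  ultimately show ?thesis using seminorm_on_minus_commute[OF assms] by linarith
qed

section \<open>Sublinear functionals and the Hahn-Banach theorem\<close>

abbreviation scR :: "real \<Rightarrow> 'a::complex_vector \<Rightarrow> 'a" where
  "scR r x \<equiv> complex_of_real r *\<^sub>C x"

text \<open>Functionals vanish off \<open>X\<close>, so that agreement on \<open>X\<close> is
  equality; antisymmetry of the order in Zorn's lemma rests on this. Homogeneity is stated as an
  inequality because equality follows by rescaling with \<open>1 / r\<close>.\<close>

definition sublin :: "'a::complex_vector set \<Rightarrow> ('a \<Rightarrow> real) \<Rightarrow> bool" where
  "sublin X q \<longleftrightarrow> (\<forall>x\<in>X. \<forall>y\<in>X. q (x + y) \<le> q x + q y)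
     \<and> (\<forall>r>0. \<forall>x\<in>X. q (scR r x) \<le> r * q x) \<and> (\<forall>x. x \<notin> X \<longrightarrow> q x = 0)"

lemma sublin_scale:
  assumes X: "complex_vector.subspace X" and q: "sublin X q" and "x \<in> X" "r \<ge> 0"
  shows "q (scR r x) = r * q x"
proof -
  have pos: "q (scR r x) = r * q x" if "r > 0" "x \<in> X" for r x
  proof (rule antisym)
    show "q (scR r x) \<le> r * q x" using q that by (auto simp: sublin_def)
    have "scR r x \<in> X" using X that complex_vector.subspace_scale by blast
    then have "q (scR (1/r) (scR r x)) \<le> 1/r * q (scR r x)"
      using q that unfolding sublin_def by (metis zero_less_divide_1_iff)
    moreover have "scR (1/r) (scR r x) = x"
      using that by (simp add: scaleC_scaleC scaleC_one flip: of_real_mult)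
    ultimately show "r * q x \<le> q (scR r x)" using that by (simp add: field_simps)
  qed
  have "(0::'a) \<in> X" using X complex_vector.subspace_0 by blast
  from pos[OF _ this, of 2] have "q 0 = 0" by simp
  then show ?thesis using pos assms(3,4) by (cases "r = 0") auto
qed

lemma sublin_lower:
  assumes X: "complex_vector.subspace X" and q: "sublin X q" and "x \<in> X"
  shows "- q (- x) \<le> q x"
proof -
  have m: "- x \<in> X" using X assms(3) complex_vector.subspace_neg by blast
  have "q (x + - x) \<le> q x + q (- x)" using q assms(3) m unfolding sublin_def by blast
  moreover have "q 0 = 0" using sublin_scale[OF X q assms(3), of 0] by simp
  ultimately show ?thesis by simp
qed

text \<open>The auxiliary functional of the classical Hahn-Banach proof: it lies below
  \<open>q\<close>, and the choice \<open>t = 1\<close> shows that at \<open>- x0\<close> it is at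
  most \<open>- q x0\<close>.\<close>

definition shrink :: "'a::complex_vector set \<Rightarrow> ('a \<Rightarrow> real) \<Rightarrow> 'a \<Rightarrow> 'a \<Rightarrow> real" where
  "shrink X q x0 x = (if x \<in> X then (INF t\<in>{0..}. q (x + scR t x0) - t * q x0) else 0)"

lemma
  assumes X: "complex_vector.subspace X" and q: "sublin X q" and x0: "x0 \<in> X"
  shows shrink_le: "x \<in> X \<Longrightarrow> t \<ge> 0 \<Longrightarrow> shrink X q x0 x \<le> q (x + scR t x0) - t * q x0"
    and sublin_shrink: "sublin X (shrink X q x0)"
proof -
  have mem: "x + scR t x0 \<in> X" if "x \<in> X" for x t
    using that X x0 by (intro complex_vector.subspace_add complex_vector.subspace_scale)
  have neg: "- x \<in> X" if "x \<in> X" for x using that X complex_vector.subspace_neg by blast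
  \<comment> \<open>A lower bound free of \<open>t\<close>, which makes the infimum in
    \<open>shrink\<close> finite.\<close>
  have low: "- q (- x) \<le> q (x + scR t x0) - t * q x0" if "x \<in> X" "t \<ge> 0" for x t
  proof -
    have "q (scR t x0) \<le> q (x + scR t x0) + q (- x)"
    proof -
      have "q ((x + scR t x0) + - x) \<le> q (x + scR t x0) + q (- x)"
        using q mem[OF that(1)] neg[OF that(1)] unfolding sublin_def by blast
      then show ?thesis by simp
    qed
    then show ?thesis using sublin_scale[OF X q x0 that(2)] by linarith
  qed
  have bdd: "bdd_below ((\<lambda>t. q (x + scR t x0) - t * q x0) ` {0..})" if "x \<in> X" for x
    using low[OF that] by (intro bdd_belowI[where m="- q (- x)"]) auto
  show le: "shrink X q x0 x \<le> q (x + scR t x0) - t * q x0" if "x \<in> X" "t \<ge> 0" for x t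
    unfolding shrink_def using that bdd[OF that(1)] by (auto intro!: cINF_lower)
  show "sublin X (shrink X q x0)"
    unfolding sublin_def
  proof (intro conjI ballI allI impI)
    fix x y assume xy: "x \<in> X" "y \<in> X"
    have sum: "x + y \<in> X" using xy X complex_vector.subspace_add by blast
    have "shrink X q x0 (x + y) \<le> (q (x + scR s x0) - s * q x0) + (q (y + scR t x0) - t * q x0)"
      if "s \<ge> 0" "t \<ge> 0" for s t
    proof -
      have "shrink X q x0 (x + y) \<le> q (x + y + scR (s + t) x0) - (s + t) * q x0"
        using le[OF sum, of "s + t"] that by simp
      also have "x + y + scR (s + t) x0 = (x + scR s x0) + (y + scR t x0)"
        by (simp add: scaleC_add_left algebra_simps)
      also have "q \<dots> \<le> q (x + scR s x0) + q (y + scR t x0)"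
        using q mem xy unfolding sublin_def by blast
      finally show ?thesis by (simp add: algebra_simps)
    qed
    \<comment> \<open>The terms are separated so that the infima over \<open>s\<close> and
      \<open>t\<close> can be taken one after the other.\<close>
    then have *: "shrink X q x0 (x + y) - (q (y + scR t x0) - t * q x0) \<le> q (x + scR s x0) - s * q x0"
      if "s \<ge> 0" "t \<ge> 0" for s t using that by force
    have **: "shrink X q x0 (x + y) - (q (y + scR t x0) - t * q x0) \<le> shrink X q x0 x" if "t \<ge> 0" for t
      using xy(1) *[OF _ that] unfolding shrink_def[of X q x0 x] if_P[OF xy(1)]
      by (intro cINF_greatest) auto
    have "shrink X q x0 (x + y) - shrink X q x0 x \<le> shrink X q x0 y"
      unfolding shrink_def[of X q x0 y] if_P[OF xy(2)] using ** by (intro cINF_greatest) force+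
    then show "shrink X q x0 (x + y) \<le> shrink X q x0 x + shrink X q x0 y" by simp
  next
    fix r :: real and x assume r: "r > 0" and x: "x \<in> X"
    have sx: "scR r x \<in> X" using x X complex_vector.subspace_scale by blast
    have "shrink X q x0 (scR r x) / r \<le> q (x + scR t x0) - t * q x0" if "t \<ge> 0" for t
    proof -
      have "shrink X q x0 (scR r x) \<le> q (scR r x + scR (r * t) x0) - r * t * q x0"
        using le[OF sx, of "r * t"] r that by simp
      also have "scR r x + scR (r * t) x0 = scR r (x + scR t x0)"
        by (simp add: scaleC_add_right scaleC_scaleC)
      also have "q \<dots> = r * q (x + scR t x0)" using sublin_scale[OF X q mem[OF x]] r by simp
      finally show ?thesis using r by (simp add: field_simps)
    qed
    then have "shrink X q x0 (scR r x) / r \<le> shrink X q x0 x"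
      using x unfolding shrink_def[of X q x0 x] by (auto intro!: cINF_greatest)
    then show "shrink X q x0 (scR r x) \<le> r * shrink X q x0 x" using r by (simp add: field_simps)
  qed (auto simp: shrink_def)
qed

text \<open>A minimal sublinear functional \<open>q\<close> equals each of its shrinkings, so \<open>q (- x) \<le> - q x\<close>,
  which makes it linear. Hence Zorn's lemma is needed only once.\<close>

lemma minimal_sublin_exists:
  assumes X: "complex_vector.subspace X" and p: "sublin X p"
  obtains q where "sublin X q" "\<And>x. x \<in> X \<Longrightarrow> q x \<le> p x"
    "\<And>q'. sublin X q' \<Longrightarrow> (\<And>x. x \<in> X \<Longrightarrow> q' x \<le> q x) \<Longrightarrow> q' = q"
proof -
  define A where "A = {q. sublin X q \<and> (\<forall>x\<in>X. q x \<le> p x)}"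
  \<comment> \<open>The order is reversed: a maximal element for \<open>R\<close> is a minimal
    functional.\<close>
  define R where "R = (\<lambda>a b :: 'a \<Rightarrow> real. \<forall>x\<in>X. b x \<le> a x)"
  have po: "partial_order_on A (relation_of R A)"
  proof (rule partial_order_on_relation_ofI)
    show "R a a" for a by (simp add: R_def)
    show "R a c" if "R a b" "R b c" for a b c using that unfolding R_def by (meson order_trans)
    show "a = b" if "a \<in> A" "b \<in> A" "R a b" "R b a" for a b
    proof
      fix x show "a x = b x" using that by (cases "x \<in> X") (auto simp: A_def R_def sublin_def intro: antisym)
    qed
  qed
  have ub: "\<exists>u\<in>A. \<forall>a\<in>C. R a u" if C: "C \<in> Chains (relation_of R A)" for C
  proof (cases "C = {}")
    case True
    then show ?thesis using p by (intro bexI[of _ p]) (auto simp: A_def)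
  next
    case False
    have CA: "q \<in> A" if "q \<in> C" for q using C that by (auto simp: Chains_def relation_of_def)
    have comp: "R a b \<or> R b a" if "a \<in> C" "b \<in> C" for a b
      using C that by (auto simp: Chains_def relation_of_def)
    \<comment> \<open>The pointwise infimum bounds a nonempty chain; domination by \<open>p\<close>
      at \<open>- x\<close> keeps it finite at \<open>x\<close>.\<close>
    define u where "u x = (if x \<in> X then (INF q\<in>C. q x) else 0)" for x
    have low: "- p (- x) \<le> q x" if "x \<in> X" "q \<in> C" for x q
    proof -
      have "- x \<in> X" using that X complex_vector.subspace_neg by blast
      then have "q (- x) \<le> p (- x)" using CA[OF that(2)] by (auto simp: A_def)
      then show ?thesis using sublin_lower[OF X _ that(1), of q] CA[OF that(2)] by (auto simp: A_def)
    qed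
    have bdd: "bdd_below ((\<lambda>q. q x) ` C)" if "x \<in> X" for x
      using low[OF that] by (intro bdd_belowI[where m="- p (- x)"]) auto
    have le: "u x \<le> q x" if "x \<in> X" "q \<in> C" for x q
      unfolding u_def using that bdd by (auto intro: cINF_lower)
    have "sublin X u"
      unfolding sublin_def
    proof (intro conjI ballI allI impI)
      fix x y assume xy: "x \<in> X" "y \<in> X"
      have sum: "x + y \<in> X" using xy X complex_vector.subspace_add by blast
      have "u (x + y) \<le> q1 x + q2 y" if q12: "q1 \<in> C" "q2 \<in> C" for q1 q2
      proof -
        have "R q1 q1" "R q2 q2" by (simp_all add: R_def)
        \<comment> \<open>Comparability in the chain supplies one functional below both, so that the
          subadditivity of a single member applies.\<close>
        then obtain q where q: "q \<in> C" "R q1 q" "R q2 q" using comp[OF q12] q12 by blast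
        have "u (x + y) \<le> q (x + y)" using le[OF sum q(1)] .
        also have "\<dots> \<le> q x + q y" using CA[OF q(1)] xy by (auto simp: A_def sublin_def)
        also have "\<dots> \<le> q1 x + q2 y" using q xy unfolding R_def by (meson add_mono)
        finally show ?thesis .
      qed
      then have *: "u (x + y) - q2 y \<le> q1 x" if "q1 \<in> C" "q2 \<in> C" for q1 q2 using that by force
      have **: "u (x + y) - q2 y \<le> u x" if "q2 \<in> C" for q2
        using False *[OF _ that] unfolding u_def[of x] if_P[OF xy(1)] by (intro cINF_greatest) auto
      have "u (x + y) - u x \<le> u y"
        using False ** unfolding u_def[of y] if_P[OF xy(2)] by (intro cINF_greatest) force+
      then show "u (x + y) \<le> u x + u y" by simp
    next
      fix r :: real and x assume r: "r > 0" and x: "x \<in> X"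
      have sx: "scR r x \<in> X" using x X complex_vector.subspace_scale by blast
      have "u (scR r x) / r \<le> q x" if "q \<in> C" for q
      proof -
        have "u (scR r x) \<le> q (scR r x)" using le[OF sx that] .
        also have "\<dots> \<le> r * q x" using CA[OF that] r x by (auto simp: A_def sublin_def)
        finally show ?thesis using r by (simp add: field_simps)
      qed
      then have "u (scR r x) / r \<le> u x"
        using x False unfolding u_def[of x] by (auto intro!: cINF_greatest)
      then show "u (scR r x) \<le> r * u x" using r by (simp add: field_simps)
    qed (auto simp: u_def)
    moreover have "u x \<le> p x" if "x \<in> X" for x
    proof -
      obtain q where "q \<in> C" using False by auto
      then show ?thesis using le[OF that] CA that by (force simp: A_def)
    qed
    ultimately show ?thesis using le by (intro bexI[of _ u]) (auto simp: A_def R_def)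
  qed
  from predicate_Zorn[OF po ub] obtain q where "q \<in> A" and max: "\<And>a. a \<in> A \<Longrightarrow> R q a \<Longrightarrow> a = q"
    by blast
  have q: "sublin X q" "\<And>x. x \<in> X \<Longrightarrow> q x \<le> p x" using \<open>q \<in> A\<close> by (auto simp: A_def)
  show ?thesis
  proof (rule that[OF q])
    fix q' assume q': "sublin X q'" "\<And>x. x \<in> X \<Longrightarrow> q' x \<le> q x"
    then have "q' x \<le> p x" if "x \<in> X" for x using q(2) that by (meson order_trans)
    then show "q' = q" using q' max by (auto simp: A_def R_def)
  qed
qed

text \<open>Minimality is sought below \<open>shrink X p x0\<close> rather than below
  \<open>p\<close>: there the value at \<open>- x0\<close> is at most \<open>- p x0\<close>, and
  linearity turns this into \<open>p x0 \<le> g x0\<close>.\<close>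

lemma real_hahn_banach:
  assumes X: "complex_vector.subspace X" and p: "sublin X p" and x0: "x0 \<in> X"
  obtains g where "\<And>x y. x \<in> X \<Longrightarrow> y \<in> X \<Longrightarrow> g (x + y) = g x + g y"
    "\<And>r x. x \<in> X \<Longrightarrow> g (scR r x) = r * g x" "\<And>x. x \<in> X \<Longrightarrow> g x \<le> p x" "p x0 \<le> g x0"
proof -
  obtain q where q: "sublin X q" and qp: "\<And>x. x \<in> X \<Longrightarrow> q x \<le> shrink X p x0 x"
    and min: "\<And>q'. sublin X q' \<Longrightarrow> (\<And>x. x \<in> X \<Longrightarrow> q' x \<le> q x) \<Longrightarrow> q' = q"
    using minimal_sublin_exists[OF X sublin_shrink[OF X p x0]] by metis
  have neg: "- x \<in> X" if "x \<in> X" for x using that X complex_vector.subspace_neg by blast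
  have shr: "shrink X r x (- x) \<le> - r x" if "sublin X r" "x \<in> X" for r x
    using shrink_le[OF X that neg[OF that(2)], of 1] sublin_scale[OF X that, of 0] by (simp add: scaleC_one)
  have shr0: "shrink X r y x \<le> r x" if "sublin X r" "y \<in> X" "x \<in> X" for r x y
    using shrink_le[OF X that, of 0] by simp
  have "q (- x) = - q x" if x: "x \<in> X" for x
  proof -
    have "shrink X q x = q" using min[OF sublin_shrink[OF X q x]] shr0[OF q x] by blast
    then have "q (- x) \<le> - q x" using shr[OF q x] by simp
    then show ?thesis using sublin_lower[OF X q x] by linarith
  qed note qneg = this
  have add: "q (x + y) = q x + q y" if "x \<in> X" "y \<in> X" for x y
  proof -
    have s: "x + y \<in> X" using that X complex_vector.subspace_add by blast
    have "q (x + y) \<le> q x + q y" using q that by (auto simp: sublin_def)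
    moreover have "q ((x + y) + - y) \<le> q (x + y) + q (- y)"
      using q s neg[OF that(2)] unfolding sublin_def by blast
    ultimately show ?thesis using qneg[OF that(2)] by simp
  qed
  show thesis
  proof (rule that[of q])
    show "q (scR r x) = r * q x" if "x \<in> X" for r x
    proof (cases "r \<ge> 0")
      case True then show ?thesis using sublin_scale[OF X q that] by simp
    next
      case False
      have "scR (- r) x \<in> X" using X that complex_vector.subspace_scale by blast
      then have "q (- scR (- r) x) = - q (scR (- r) x)" using qneg by blast
      then show ?thesis using sublin_scale[OF X q that, of "- r"] False by simp
    qed
    show "q x \<le> p x" if "x \<in> X" for x using qp[OF that] shr0[OF p x0 that] by linarith
    show "p x0 \<le> q x0" using qneg[OF x0] qp[OF neg[OF x0]] shr[OF p x0] by linarith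
  qed (use add in auto)
qed

text \<open>The real functional \<open>g\<close> becomes the real part of \<open>f\<close>; rotating
  \<open>f x\<close> onto the positive axis transfers the bound from real parts to the
  modulus.\<close>

theorem complex_hahn_banach:
  assumes N: "seminorm_on X N" and x0: "x0 \<in> X"
  obtains f where "f \<in> dual_of X N" "f x0 = of_real (N x0)" "\<And>x. x \<in> X \<Longrightarrow> cmod (f x) \<le> N x"
proof -
  note X = seminorm_onD(1)[OF N]
  define p where "p x = (if x \<in> X then N x else 0)" for x
  have p: "sublin X p"
    unfolding sublin_def p_def
    using seminorm_onD(3,4)[OF N] complex_vector.subspace_add[OF X] complex_vector.subspace_scale[OF X]
    by auto
  from real_hahn_banach[OF X p x0] obtain g where
    g: "\<And>x y. x \<in> X \<Longrightarrow> y \<in> X \<Longrightarrow> g (x + y) = g x + g y"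
    "\<And>r x. x \<in> X \<Longrightarrow> g (scR r x) = r * g x" "\<And>x. x \<in> X \<Longrightarrow> g x \<le> p x" "p x0 \<le> g x0" by metis
  have gN: "g x \<le> N x" if "x \<in> X" for x using g(3)[OF that] that by (simp add: p_def)
  have sc: "c *\<^sub>C x \<in> X" if "x \<in> X" for c x using that X complex_vector.subspace_scale by blast
  define f where "f x = (if x \<in> X then Complex (g x) (- g (\<i> *\<^sub>C x)) else 0)" for x
  have fadd: "f (x + y) = f x + f y" if "x \<in> X" "y \<in> X" for x y
    using that g(1) sc complex_vector.subspace_add[OF X]
    by (simp add: f_def scaleC_add_right complex_eq_iff)
  have fscR: "f (scR r x) = of_real r * f x" if "x \<in> X" for x r
  proof -
    have "\<i> *\<^sub>C scR r x = scR r (\<i> *\<^sub>C x)" by (simp add: scaleC_scaleC mult.commute)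
    then have "g (\<i> *\<^sub>C scR r x) = r * g (\<i> *\<^sub>C x)" using g(2)[OF sc[OF that]] by metis
    then show ?thesis using that sc[OF that] g(2)[OF that] by (simp only: f_def if_True complex_eq_iff) simp
  qed
  have fi: "f (\<i> *\<^sub>C x) = \<i> * f x" if "x \<in> X" for x
  proof -
    have "\<i> *\<^sub>C \<i> *\<^sub>C x = scR (-1) x" by (simp add: scaleC_scaleC)
    then show ?thesis using that sc[of x] g(2)[of x "-1"] by (simp add: f_def complex_eq_iff)
  qed
  have fscale: "f (c *\<^sub>C x) = c * f x" if "x \<in> X" for c x
  proof -
    have "c *\<^sub>C x = scR (Re c) x + \<i> *\<^sub>C scR (Im c) x"
      by (simp add: scaleC_scaleC complex_eq_iff flip: scaleC_add_left)
    then have "f (c *\<^sub>C x) = f (scR (Re c) x) + f (\<i> *\<^sub>C scR (Im c) x)"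
      using fadd[OF sc[OF that] sc[OF sc[OF that]]] by simp
    also have "\<dots> = (of_real (Re c) + \<i> * of_real (Im c)) * f x"
      by (simp only: fi[OF sc[OF that]] fscR[OF that]) (simp add: algebra_simps)
    finally show ?thesis using complex_eq[of c] by simp
  qed
  have bound: "cmod (f x) \<le> N x" if "x \<in> X" for x
  proof (cases "f x = 0")
    case True then show ?thesis using seminorm_onD(2)[OF N that] by simp
  next
    case False
    define c where "c = of_real (cmod (f x)) / f x"
    have c: "cmod c = 1" using False by (simp add: c_def norm_divide)
    have "of_real (cmod (f x)) = f (c *\<^sub>C x)" using False fscale[OF that] by (simp add: c_def)
    then have "cmod (f x) = g (c *\<^sub>C x)" using sc[OF that] by (simp add: f_def complex_eq_iff)
    also have "\<dots> \<le> N (c *\<^sub>C x)" using gN sc[OF that] by blast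
    also have "\<dots> = N x" using seminorm_onD(4)[OF N that] c by simp
    finally show ?thesis .
  qed
  have "f x0 = of_real (N x0)"
  proof -
    have re: "Re (f x0) = N x0" using g(4) gN[OF x0] x0 by (simp add: f_def p_def)
    \<comment> \<open>The real part at \<open>x0\<close> already exhausts the bound on the modulus,
      which leaves no imaginary part.\<close>
    have "(Re (f x0))\<^sup>2 + (Im (f x0))\<^sup>2 \<le> (N x0)\<^sup>2"
      using power_mono[OF bound[OF x0], of 2] by (simp add: cmod_power2)
    then have "Im (f x0) = 0" using re by simp
    then show ?thesis using re by (simp add: complex_eq_iff)
  qed
  moreover have "f \<in> dual_of X N"
    unfolding dual_of_def bounded_between_def linear_between_def
    using fadd fscale bound by (auto simp: f_def scaleC_complex_def intro!: exI[of _ 1])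
  ultimately show thesis using that bound by blast
qed

section \<open>Completions\<close>

lemma dual_ofI:
  assumes "\<And>x y. x \<in> X \<Longrightarrow> y \<in> X \<Longrightarrow> f (x + y) = f x + f y"
    "\<And>c x. x \<in> X \<Longrightarrow> f (c *\<^sub>C x) = c * f x"
    "\<And>x. x \<in> X \<Longrightarrow> cmod (f x) \<le> C * N x" "\<And>x. x \<notin> X \<Longrightarrow> f x = 0"
  shows "f \<in> dual_of X N"
  using assms unfolding dual_of_def bounded_between_def linear_between_def
  by (auto simp: scaleC_complex_def intro!: exI[of _ C])

lemma dual_ofD:
  assumes "f \<in> dual_of X N"
  shows "x \<in> X \<Longrightarrow> y \<in> X \<Longrightarrow> f (x + y) = f x + f y"
    "x \<in> X \<Longrightarrow> f (c *\<^sub>C x) = c * f x"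
    "\<exists>C. \<forall>x\<in>X. cmod (f x) \<le> C * N x" "x \<notin> X \<Longrightarrow> f x = 0"
  using assms unfolding dual_of_def bounded_between_def linear_between_def
  by (auto simp: scaleC_complex_def)

lemma additive_diff:
  fixes T :: "'a::complex_vector \<Rightarrow> 'b::complex_vector"
  assumes X: "complex_vector.subspace X"
    and add: "\<And>x y. x \<in> X \<Longrightarrow> y \<in> X \<Longrightarrow> T (x + y) = T x + T y"
    and "x \<in> X" "y \<in> X"
  shows "T (x - y) = T x - T y"
  using add[of "x - y" y] assms subspace_minus[OF X] by (simp add: algebra_simps)

lemma linear_betweenD:
  assumes "linear_between X Y T"
  shows "x \<in> X \<Longrightarrow> T x \<in> Y" "x \<in> X \<Longrightarrow> y \<in> X \<Longrightarrow> T (x + y) = T x + T y"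
    "x \<in> X \<Longrightarrow> T (c *\<^sub>C x) = c *\<^sub>C T x"
  using assms by (auto simp: linear_between_def)

lemma bounded_between_nonneg_bound:
  assumes "bounded_between X NX Y NY T" "seminorm_on X NX"
  obtains C where "C \<ge> 0" "\<And>x. x \<in> X \<Longrightarrow> NY (T x) \<le> C * NX x"
proof -
  obtain C where C: "\<And>x. x \<in> X \<Longrightarrow> NY (T x) \<le> C * NX x"
    using assms by (auto simp: bounded_between_def)
  have "NY (T x) \<le> max C 0 * NX x" if "x \<in> X" for x
    using C[OF that] seminorm_onD(2)[OF assms(2) that]
    by (meson max.cobounded1 mult_right_mono order_trans)
  then show thesis using that[of "max C 0"] by simp
qed

lemma bounded_between_cong:
  assumes "\<And>x. x \<in> X \<Longrightarrow> NX x = NX' x" "\<And>y. y \<in> Y \<Longrightarrow> NY y = NY' y"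
  shows "bounded_between X NX Y NY T \<longleftrightarrow> bounded_between X NX' Y NY' T"
proof -
  have "(\<forall>x\<in>X. NY (T x) \<le> C * NX x) = (\<forall>x\<in>X. NY' (T x) \<le> C * NX' x)" if "linear_between X Y T" for C
    using assms that by (auto simp: linear_between_def)
  then show ?thesis by (auto simp: bounded_between_def)
qed

text \<open>A norm enters only through its values on the carrier. This lets the norm of
  \<open>1 \<times> 1\<close> matrices over a completed tensor product be exchanged for
  \<open>completion_norm\<close>.\<close>

lemma extension_cong:
  assumes "\<And>x. x \<in> P \<Longrightarrow> NP x = NP' x" "\<And>y. y \<in> W \<Longrightarrow> NW y = NW' y"
  shows "extension B te P NP W NW \<beta> m = extension B te P NP' W NW' \<beta> m"
proof -
  have "bounded_between P NP W NW L = bounded_between P NP' W NW' L" for L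
    by (rule bounded_between_cong) (use assms in auto)
  then show ?thesis by (simp only: extension_def)
qed

locale seminormed =
  fixes X :: "'a::complex_vector set" and N :: "'a \<Rightarrow> real"
  assumes seminorm: "seminorm_on X N"
begin

lemmas subspace = seminorm_onD(1)[OF seminorm]
lemmas N_nonneg = seminorm_onD(2)[OF seminorm]
lemmas N_add = seminorm_onD(3)[OF seminorm]
lemmas N_scale = seminorm_onD(4)[OF seminorm]
lemmas N_0 = seminorm_on_0[OF seminorm]
lemmas diff_mem = subspace_minus[OF subspace]
lemmas add_mem = complex_vector.subspace_add[OF subspace]
lemmas scale_mem = complex_vector.subspace_scale[OF subspace]
lemmas zero_mem = complex_vector.subspace_0[OF subspace]

abbreviation "emb \<equiv> completion_embed X N"
abbreviation "cn \<equiv> completion_norm X N"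

lemma dual_diff: "f \<in> dual_of X N \<Longrightarrow> x \<in> X \<Longrightarrow> y \<in> X \<Longrightarrow> f (x - y) = f x - f y"
  by (rule additive_diff[OF subspace]) (auto dest: dual_ofD)

lemma representsD:
  assumes "represents X N s \<Phi>"
  shows "s n \<in> X" "e > 0 \<Longrightarrow> \<exists>k. \<forall>m\<ge>k. \<forall>n\<ge>k. N (s m - s n) < e"
    "f \<in> dual_of X N \<Longrightarrow> (\<lambda>n. f (s n)) \<longlonglongrightarrow> \<Phi> f" "f \<notin> dual_of X N \<Longrightarrow> \<Phi> f = 0"
proof -
  show "s n \<in> X" "e > 0 \<Longrightarrow> \<exists>k. \<forall>m\<ge>k. \<forall>n\<ge>k. N (s m - s n) < e"
    using assms by (auto simp: represents_def Cauchy_wrt_def)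
  have lim: "(\<lambda>n. completion_embed X N (s n) f) \<longlonglongrightarrow> \<Phi> f"
    using assms by (auto simp: represents_def)
  then show "f \<in> dual_of X N \<Longrightarrow> (\<lambda>n. f (s n)) \<longlonglongrightarrow> \<Phi> f" by (simp add: completion_embed_def)
  show "f \<notin> dual_of X N \<Longrightarrow> \<Phi> f = 0"
    using lim LIMSEQ_unique[OF _ tendsto_const] by (simp add: completion_embed_def)
qed

lemma representsI:
  assumes "\<And>n. s n \<in> X" "\<And>e. e > 0 \<Longrightarrow> \<exists>k. \<forall>m\<ge>k. \<forall>n\<ge>k. N (s m - s n) < e"
    "\<And>f. f \<in> dual_of X N \<Longrightarrow> (\<lambda>n. f (s n)) \<longlonglongrightarrow> \<Phi> f" "\<And>f. f \<notin> dual_of X N \<Longrightarrow> \<Phi> f = 0"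
  shows "represents X N s \<Phi>"
proof -
  have "(\<lambda>n. completion_embed X N (s n) f) \<longlonglongrightarrow> \<Phi> f" for f
    using assms(3,4)[of f] by (cases "f \<in> dual_of X N") (auto simp: completion_embed_def)
  then show ?thesis unfolding represents_def Cauchy_wrt_def using assms by auto
qed

text \<open>A functional that norms \<open>s n\<close> sends \<open>s n - s m\<close> close to its
  value at \<open>s n\<close> as \<open>m\<close> grows, while the Cauchy condition keeps that value
  small. Hence the pointwise limits in \<open>represents\<close> determine the limits of
  norms.\<close>

lemma weakly_null_Cauchy:
  assumes s: "\<And>n. s n \<in> X" and C: "\<And>e. e > 0 \<Longrightarrow> \<exists>k. \<forall>m\<ge>k. \<forall>n\<ge>k. N (s m - s n) < e"
    and w: "\<And>f. f \<in> dual_of X N \<Longrightarrow> (\<lambda>n. f (s n)) \<longlonglongrightarrow> 0"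
  shows "(\<lambda>n. N (s n)) \<longlonglongrightarrow> 0"
proof (rule LIMSEQ_I)
  fix e :: real assume "e > 0"
  then obtain k where k: "\<And>m n. m \<ge> k \<Longrightarrow> n \<ge> k \<Longrightarrow> N (s m - s n) < e / 2"
    using C[of "e/2"] by auto
  have "N (s n) < e" if n: "n \<ge> k" for n
  proof -
    obtain f where f: "f \<in> dual_of X N" "f (s n) = of_real (N (s n))"
      and b: "\<And>x. x \<in> X \<Longrightarrow> cmod (f x) \<le> N x"
      using complex_hahn_banach[OF seminorm s] by blast
    have "(\<lambda>m. cmod (f (s n - s m))) \<longlonglongrightarrow> cmod (of_real (N (s n)) - 0)"
      unfolding dual_diff[OF f(1) s s] f(2) by (intro tendsto_intros w f)
    moreover have "\<forall>\<^sub>F m in sequentially. cmod (f (s n - s m)) \<le> e / 2"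
      using eventually_ge_at_top[of k]
    proof eventually_elim
      case (elim m)
      show ?case using b[OF diff_mem[OF s s], of n m] k[OF n elim] by simp
    qed
    ultimately have "N (s n) \<le> e / 2"
      using tendsto_upperbound[of _ "cmod (of_real (N (s n)) - 0)" sequentially "e / 2"] N_nonneg[OF s, of n] by auto
    then show ?thesis using \<open>e > 0\<close> by linarith
  qed
  then show "\<exists>no. \<forall>n\<ge>no. norm (N (s n) - 0) < e" using N_nonneg[OF s] by auto
qed

lemma represents_add:
  assumes r: "represents X N s \<Phi>" "represents X N t \<Psi>"
  shows "represents X N (\<lambda>n. s n + t n) (\<Phi> + \<Psi>)"
proof (rule representsI)
  fix e :: real assume "e > 0"
  then obtain k l where k: "\<And>m n. m \<ge> k \<Longrightarrow> n \<ge> k \<Longrightarrow> N (s m - s n) < e / 2"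
     and l: "\<And>m n. m \<ge> l \<Longrightarrow> n \<ge> l \<Longrightarrow> N (t m - t n) < e / 2"
    using representsD(2)[OF r(1), of "e/2"] representsD(2)[OF r(2), of "e/2"] by (meson half_gt_zero)
  have "N ((s m + t m) - (s n + t n)) < e" if "m \<ge> max k l" "n \<ge> max k l" for m n
  proof -
    have "(s m + t m) - (s n + t n) = (s m - s n) + (t m - t n)" by simp
    also have "N \<dots> \<le> N (s m - s n) + N (t m - t n)"
      by (intro N_add diff_mem representsD(1)[OF r(1)] representsD(1)[OF r(2)])
    finally show ?thesis using k[of m n] l[of m n] that by simp
  qed
  then show "\<exists>k. \<forall>m\<ge>k. \<forall>n\<ge>k. N ((s m + t m) - (s n + t n)) < e" by blast
next
  fix f assume "f \<in> dual_of X N"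
  then show "(\<lambda>n. f (s n + t n)) \<longlonglongrightarrow> (\<Phi> + \<Psi>) f"
    using representsD(1,3)[OF r(1)] representsD(1,3)[OF r(2)]
    by (simp add: dual_ofD(1) tendsto_add)
next
  show "s n + t n \<in> X" for n using representsD(1)[OF r(1)] representsD(1)[OF r(2)] add_mem by blast
  show "(\<Phi> + \<Psi>) f = 0" if "f \<notin> dual_of X N" for f
    using representsD(4)[OF r(1) that] representsD(4)[OF r(2) that] by simp
qed

lemma represents_scale:
  assumes r: "represents X N s \<Phi>"
  shows "represents X N (\<lambda>n. c *\<^sub>C s n) (c *\<^sub>C \<Phi>)"
proof (rule representsI)
  fix e :: real assume "e > 0"
  \<comment> \<open>The summand \<open>1\<close> covers \<open>c = 0\<close>; the same margin recurs
    in later estimates.\<close>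
  then have "e / (1 + cmod c) > 0" by (simp add: add_pos_nonneg)
  from representsD(2)[OF r this] obtain k
    where k: "\<And>m n. m \<ge> k \<Longrightarrow> n \<ge> k \<Longrightarrow> N (s m - s n) < e / (1 + cmod c)" by auto
  have "N (c *\<^sub>C s m - c *\<^sub>C s n) < e" if "m \<ge> k" "n \<ge> k" for m n
  proof -
    have d: "s m - s n \<in> X" using diff_mem representsD(1)[OF r] by blast
    have "N (c *\<^sub>C s m - c *\<^sub>C s n) = cmod c * N (s m - s n)"
      using N_scale[OF d, of c] by (simp add: complex_vector.scale_right_diff_distrib)
    also have "\<dots> \<le> (1 + cmod c) * N (s m - s n)" using N_nonneg[OF d] by (simp add: mult_right_mono)
    also have "\<dots> < (1 + cmod c) * (e / (1 + cmod c))"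
      using k[OF that] by (intro mult_strict_left_mono) (auto simp: add_pos_nonneg)
    also have "1 + cmod c \<noteq> 0" using norm_ge_zero[of c] by linarith
    then have "(1 + cmod c) * (e / (1 + cmod c)) = e" by simp
    finally show ?thesis .
  qed
  then show "\<exists>k. \<forall>m\<ge>k. \<forall>n\<ge>k. N (c *\<^sub>C s m - c *\<^sub>C s n) < e" by blast
next
  fix f assume "f \<in> dual_of X N"
  then show "(\<lambda>n. f (c *\<^sub>C s n)) \<longlonglongrightarrow> (c *\<^sub>C \<Phi>) f"
    using representsD(1,3)[OF r]
    by (simp add: dual_ofD(2) scaleC_fun_def scaleC_complex_def tendsto_mult_left)
next
  show "c *\<^sub>C s n \<in> X" for n using representsD(1)[OF r] scale_mem by blast
  show "(c *\<^sub>C \<Phi>) f = 0" if "f \<notin> dual_of X N" for f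
    using representsD(4)[OF r that] by (simp add: scaleC_fun_def scaleC_complex_def)
qed

lemma represents_diff:
  assumes "represents X N s \<Phi>" "represents X N t \<Psi>"
  shows "represents X N (\<lambda>n. s n - t n) (\<Phi> - \<Psi>)"
  unfolding diff_eq_scaleC by (rule represents_add[OF assms(1) represents_scale[OF assms(2)]])

lemma represents_emb: "x \<in> X \<Longrightarrow> represents X N (\<lambda>_. x) (emb x)"
  by (rule representsI) (simp_all add: completion_embed_def N_0)

lemma represents_null:
  assumes "represents X N s 0"
  shows "(\<lambda>n. N (s n)) \<longlonglongrightarrow> 0"
proof (rule weakly_null_Cauchy)
  show "s n \<in> X" for n using representsD(1)[OF assms] .
  show "\<exists>k. \<forall>m\<ge>k. \<forall>n\<ge>k. N (s m - s n) < e" if "e > 0" for e using representsD(2)[OF assms that] .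
  show "(\<lambda>n. f (s n)) \<longlonglongrightarrow> 0" if "f \<in> dual_of X N" for f using representsD(3)[OF assms that] by simp
qed

lemma represents_unique_null:
  assumes "represents X N s \<Phi>" "represents X N t \<Phi>"
  shows "(\<lambda>n. N (s n - t n)) \<longlonglongrightarrow> 0"
  by (rule represents_null) (metis represents_diff[OF assms] diff_self)

text \<open>Two sequences representing the same element differ by a null sequence. So the
  description in \<open>completion_norm\<close> has exactly one solution, the limit along any
  representing sequence.\<close>

lemma cn_lim:
  assumes r: "represents X N s \<Phi>"
  shows "(\<lambda>n. N (s n)) \<longlonglongrightarrow> cn \<Phi>"
proof -
  have "Cauchy (\<lambda>n. N (s n))"
  proof (rule CauchyI)
    fix e :: real assume "e > 0"
    from representsD(2)[OF r this] obtain k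
      where k: "\<And>m n. m \<ge> k \<Longrightarrow> n \<ge> k \<Longrightarrow> N (s m - s n) < e" by auto
    have "norm (N (s m) - N (s n)) < e" if "m \<ge> k" "n \<ge> k" for m n
      using seminorm_on_reverse[OF seminorm representsD(1)[OF r] representsD(1)[OF r], of m n] k[OF that]
      by simp
    then show "\<exists>M. \<forall>m\<ge>M. \<forall>n\<ge>M. norm (N (s m) - N (s n)) < e" by blast
  qed
  then obtain l where l: "(\<lambda>n. N (s n)) \<longlonglongrightarrow> l" using Cauchy_convergent convergent_def by blast
  have all: "(\<lambda>n. N (t n)) \<longlonglongrightarrow> l" if t: "represents X N t \<Phi>" for t
  proof -
    have "(\<lambda>n. N (t n) - N (s n)) \<longlonglongrightarrow> 0"
      by (rule Lim_null_comparison[OF _ represents_unique_null[OF t r]])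
        (use seminorm_on_reverse[OF seminorm representsD(1)[OF t] representsD(1)[OF r]] in auto)
    from tendsto_add[OF this l] show ?thesis by simp
  qed
  have "cn \<Phi> = l"
    unfolding completion_norm_def
  proof (rule the_equality)
    show "r = l" if "\<forall>s. represents X N s \<Phi> \<longrightarrow> (\<lambda>n. N (s n)) \<longlonglongrightarrow> r" for r
      using that r l LIMSEQ_unique by blast
  qed (use all in blast)
  then show ?thesis using l by simp
qed

lemma cn_emb: "x \<in> X \<Longrightarrow> cn (emb x) = N x"
  using cn_lim[OF represents_emb] LIMSEQ_unique tendsto_const by blast

lemma completionE:
  assumes "\<Phi> \<in> completion X N" obtains s where "represents X N s \<Phi>"
  using assms by (auto simp: completion_def)

lemma completionI: "represents X N s \<Phi> \<Longrightarrow> \<Phi> \<in> completion X N"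
  by (auto simp: completion_def)

lemma emb_mem: "x \<in> X \<Longrightarrow> emb x \<in> completion X N"
  using represents_emb completionI by blast

lemma emb_add: "x \<in> X \<Longrightarrow> y \<in> X \<Longrightarrow> emb (x + y) = emb x + emb y"
  by (auto simp: completion_embed_def fun_eq_iff dual_ofD(1))

lemma emb_scale: "x \<in> X \<Longrightarrow> emb (c *\<^sub>C x) = c *\<^sub>C emb x"
  by (auto simp: completion_embed_def fun_eq_iff dual_ofD(2) scaleC_fun_def scaleC_complex_def)

lemma emb_0: "emb 0 = 0"
  using emb_scale[OF zero_mem, of 0] by simp

lemma emb_sum: "(\<And>i. i \<in> I \<Longrightarrow> f i \<in> X) \<Longrightarrow> emb (sum f I) = (\<Sum>i\<in>I. emb (f i))"
proof (induction I rule: infinite_finite_induct)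
  case (insert i I)
  then show ?case using complex_vector.subspace_sum[OF subspace, of I f] by (simp add: emb_add)
qed (auto simp: emb_0)

lemma completion_normed: "normed_on (completion X N) cn"
  unfolding normed_on_def
proof (intro conjI ballI allI)
  show "complex_vector.subspace (completion X N)"
  proof (rule complex_vector.subspaceI)
    show "0 \<in> completion X N" using emb_mem[OF zero_mem] by (simp add: emb_0)
    show "\<Phi> + \<Psi> \<in> completion X N" if "\<Phi> \<in> completion X N" "\<Psi> \<in> completion X N" for \<Phi> \<Psi>
      using that represents_add by (fastforce simp: completion_def)
    show "c *\<^sub>C \<Phi> \<in> completion X N" if "\<Phi> \<in> completion X N" for c \<Phi>
      using that represents_scale by (fastforce simp: completion_def)
  qed
next
  fix \<Phi> assume "\<Phi> \<in> completion X N"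
  then obtain s where s: "represents X N s \<Phi>" by (rule completionE)
  show "0 \<le> cn \<Phi>"
    by (rule LIMSEQ_le_const[OF cn_lim[OF s]]) (auto intro: N_nonneg representsD(1)[OF s])
  show "cn (c *\<^sub>C \<Phi>) = cmod c * cn \<Phi>" for c
  proof (rule LIMSEQ_unique[OF cn_lim[OF represents_scale[OF s]]])
    show "(\<lambda>n. N (c *\<^sub>C s n)) \<longlonglongrightarrow> cmod c * cn \<Phi>"
      using representsD(1)[OF s] by (simp add: N_scale tendsto_mult_left cn_lim[OF s])
  qed
  show "(cn \<Phi> = 0) = (\<Phi> = 0)"
  proof
    assume "\<Phi> = 0" then show "cn \<Phi> = 0" using cn_emb[OF zero_mem] by (simp add: emb_0 N_0)
  next
    assume 0: "cn \<Phi> = 0"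
    show "\<Phi> = 0"
    proof
      fix f
      show "\<Phi> f = 0 f"
      proof (cases "f \<in> dual_of X N")
        case True
        \<comment> \<open>Norms that tend to zero kill every bounded functional, hence
          \<open>\<Phi>\<close> itself: the completion norm is definite although \<open>N\<close>
          need not be.\<close>
        from dual_ofD(3)[OF True] obtain C where C: "\<And>x. x \<in> X \<Longrightarrow> cmod (f x) \<le> C * N x" by blast
        have "(\<lambda>n. C * N (s n)) \<longlonglongrightarrow> C * 0" using cn_lim[OF s] 0 by (intro tendsto_intros) simp
        then have lim: "(\<lambda>n. C * N (s n)) \<longlonglongrightarrow> 0" by simp
        have "norm (f (s n)) \<le> C * N (s n)" for n using C[OF representsD(1)[OF s]] .
        then have "(\<lambda>n. f (s n)) \<longlonglongrightarrow> 0"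
          by (intro Lim_null_comparison[OF _ lim] always_eventually allI)
        then have "\<Phi> f = 0" by (rule LIMSEQ_unique[OF representsD(3)[OF s True]])
        then show ?thesis by simp
      next
        case False then show ?thesis using representsD(4)[OF s] by simp
      qed
    qed
  qed
next
  fix \<Phi> \<Psi> assume "\<Phi> \<in> completion X N" "\<Psi> \<in> completion X N"
  then obtain s t where s: "represents X N s \<Phi>" and t: "represents X N t \<Psi>" by (meson completionE)
  show "cn (\<Phi> + \<Psi>) \<le> cn \<Phi> + cn \<Psi>"
    by (rule LIMSEQ_le[OF cn_lim[OF represents_add[OF s t]] tendsto_add[OF cn_lim[OF s] cn_lim[OF t]]])
      (intro exI allI impI N_add representsD(1)[OF s] representsD(1)[OF t])
qed

text \<open>Density of the canonical image, with the representing sequence itself as the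
  approximation.\<close>

lemma emb_approx:
  assumes s: "represents X N s \<Phi>"
  shows "(\<lambda>n. cn (\<Phi> - emb (s n))) \<longlonglongrightarrow> 0"
proof (rule LIMSEQ_I)
  fix e :: real assume "e > 0"
  then obtain k where k: "\<And>m n. m \<ge> k \<Longrightarrow> n \<ge> k \<Longrightarrow> N (s m - s n) < e / 2"
    using representsD(2)[OF s, of "e/2"] by auto
  have "norm (cn (\<Phi> - emb (s n)) - 0) < e" if "n \<ge> k" for n
  proof -
    have r: "represents X N (\<lambda>m. s m - s n) (\<Phi> - emb (s n))"
      using represents_diff[OF s represents_emb[OF representsD(1)[OF s]]] .
    have "cn (\<Phi> - emb (s n)) \<le> e / 2"
    proof (rule LIMSEQ_le_const2[OF cn_lim[OF r]])
      have "N (s m - s n) \<le> e / 2" if "m \<ge> k" for m using k[OF that \<open>n \<ge> k\<close>] by simp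
      then show "\<exists>K. \<forall>m\<ge>K. N (s m - s n) \<le> e / 2" by blast
    qed
    moreover have "cn (\<Phi> - emb (s n)) \<ge> 0"
      using completion_normed completionI[OF r] by (auto simp: normed_on_def)
    ultimately show ?thesis using \<open>e > 0\<close> by simp
  qed
  then show "\<exists>no. \<forall>n\<ge>no. norm (cn (\<Phi> - emb (s n)) - 0) < e" by blast
qed

text \<open>Uniqueness by density. It settles the descriptions by which module actions and
  multiplication are extended to completed tensor products.\<close>

lemma bounded_unique:
  assumes W: "normed_on W NW"
    and L: "bounded_between (completion X N) cn W NW L" "bounded_between (completion X N) cn W NW L'"
    and eq: "\<And>x. x \<in> X \<Longrightarrow> L (emb x) = L' (emb x)" and \<Phi>: "\<Phi> \<in> completion X N"
  shows "L \<Phi> = L' \<Phi>"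
proof -
  note cs = normed_on_seminorm[OF completion_normed]
  note Ws = normed_on_seminorm[OF W]
  obtain s where s: "represents X N s \<Phi>" using \<Phi> by (rule completionE)
  obtain C where C: "\<And>x. x \<in> completion X N \<Longrightarrow> NW (L x) \<le> C * cn x"
    using bounded_between_nonneg_bound[OF L(1) cs] by blast
  obtain C' where C': "\<And>x. x \<in> completion X N \<Longrightarrow> NW (L' x) \<le> C' * cn x"
    using bounded_between_nonneg_bound[OF L(2) cs] by blast
  have lin: "linear_between (completion X N) W L" "linear_between (completion X N) W L'"
    using L by (auto simp: bounded_between_def)
  have d: "\<Phi> - emb (s n) \<in> completion X N" "emb (s n) \<in> completion X N" for n
    using subspace_minus[OF seminorm_onD(1)[OF cs]] \<Phi> emb_mem representsD(1)[OF s] by blast+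
  have bd: "NW (L \<Phi> - L' \<Phi>) \<le> (C + C') * cn (\<Phi> - emb (s n))" for n
  proof -
    have "L (\<Phi> - emb (s n)) = L \<Phi> - L (emb (s n))"
      by (rule additive_diff[OF seminorm_onD(1)[OF cs] linear_betweenD(2)[OF lin(1)] \<Phi> d(2)])
    moreover have "L' (\<Phi> - emb (s n)) = L' \<Phi> - L' (emb (s n))"
      by (rule additive_diff[OF seminorm_onD(1)[OF cs] linear_betweenD(2)[OF lin(2)] \<Phi> d(2)])
    ultimately have "L \<Phi> - L' \<Phi> = L (\<Phi> - emb (s n)) - L' (\<Phi> - emb (s n))"
      using eq[OF representsD(1)[OF s]] by simp
    also have "NW \<dots> \<le> NW (L (\<Phi> - emb (s n))) + NW (L' (\<Phi> - emb (s n)))"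
      using linear_betweenD(1)[OF lin(1) d(1)] linear_betweenD(1)[OF lin(2) d(1)]
      by (intro seminorm_on_diff[OF Ws])
    also have "\<dots> \<le> C * cn (\<Phi> - emb (s n)) + C' * cn (\<Phi> - emb (s n))"
      by (intro add_mono C C' d)
    finally show ?thesis by (simp add: algebra_simps)
  qed
  have "(\<lambda>n. (C + C') * cn (\<Phi> - emb (s n))) \<longlonglongrightarrow> (C + C') * 0"
    by (intro tendsto_intros emb_approx s)
  then have "NW (L \<Phi> - L' \<Phi>) \<le> (C + C') * 0"
    by (rule LIMSEQ_le_const) (use bd in blast)
  then have "NW (L \<Phi> - L' \<Phi>) \<le> 0" by simp
  moreover have "L \<Phi> - L' \<Phi> \<in> W"
    using linear_betweenD(1)[OF lin(1) \<Phi>] linear_betweenD(1)[OF lin(2) \<Phi>]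
      subspace_minus[OF seminorm_onD(1)[OF Ws]] by blast
  ultimately have "L \<Phi> - L' \<Phi> = 0" using W by (metis antisym normed_on_def)
  then show ?thesis by simp
qed

text \<open>Elements of the completion are functions on the dual, so
  \<open>\<Phi> \<mapsto> \<Phi> f\<close> already is the continuous extension of
  \<open>f\<close>.\<close>

lemma eval_bounded:
  assumes "f \<in> dual_of X N" and b: "\<And>x. x \<in> X \<Longrightarrow> cmod (f x) \<le> C * N x"
  shows "\<Phi> \<in> completion X N \<Longrightarrow> cmod (\<Phi> f) \<le> C * cn \<Phi>"
    and "bounded_between (completion X N) cn UNIV cmod (\<lambda>\<Phi>. \<Phi> f)"
proof -
  show bd: "cmod (\<Phi> f) \<le> C * cn \<Phi>" if \<Phi>: "\<Phi> \<in> completion X N" for \<Phi>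
  proof -
    obtain s where s: "represents X N s \<Phi>" using \<Phi> by (rule completionE)
    have "(\<lambda>n. cmod (f (s n))) \<longlonglongrightarrow> cmod (\<Phi> f)" "(\<lambda>n. C * N (s n)) \<longlonglongrightarrow> C * cn \<Phi>"
      using representsD(3)[OF s assms(1)] cn_lim[OF s] by (auto intro!: tendsto_intros)
    then show ?thesis by (rule LIMSEQ_le) (intro exI allI impI b representsD(1)[OF s])
  qed
  then show "bounded_between (completion X N) cn UNIV cmod (\<lambda>\<Phi>. \<Phi> f)"
    by (auto simp: bounded_between_def linear_between_def scaleC_fun_def)
qed

end

text \<open>The second transpose of \<open>T\<close>, restricted to the completion. The composite of
  \<open>f\<close> with \<open>T\<close> is cut off outside \<open>X\<close> to meet the convention
  of \<open>dual_of\<close>.\<close>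

definition completion_map ::
  "'a::complex_vector set \<Rightarrow> 'b::complex_vector set \<Rightarrow> ('b \<Rightarrow> real) \<Rightarrow> ('a \<Rightarrow> 'b)
    \<Rightarrow> (('a \<Rightarrow> complex) \<Rightarrow> complex) \<Rightarrow> ('b \<Rightarrow> complex) \<Rightarrow> complex" where
  "completion_map X X' N' T \<Phi> =
     (\<lambda>f. if f \<in> dual_of X' N' then \<Phi> (\<lambda>x. if x \<in> X then f (T x) else 0) else 0)"

lemma completion_map:
  assumes N: "seminorm_on X N" and N': "seminorm_on X' N'" and T: "linear_between X X' T"
    and C: "\<And>x. x \<in> X \<Longrightarrow> N' (T x) \<le> C * N x"
  shows "bounded_between (completion X N) (completion_norm X N)
      (completion X' N') (completion_norm X' N') (completion_map X X' N' T)" (is ?bounded)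
    and "\<Phi> \<in> completion X N \<Longrightarrow> completion_norm X' N' (completion_map X X' N' T \<Phi>) \<le> C * completion_norm X N \<Phi>"
    and "x \<in> X \<Longrightarrow> completion_map X X' N' T (completion_embed X N x) = completion_embed X' N' (T x)"
proof -
  interpret A: seminormed X N by standard fact
  interpret B: seminormed X' N' by standard fact
  let ?M = "completion_map X X' N' T"
  let ?p = "\<lambda>f x. if x \<in> X then f (T x) else 0"
  have p: "?p f \<in> dual_of X N" if f: "f \<in> dual_of X' N'" for f
  proof -
    from dual_ofD(3)[OF f] obtain K0 where K0: "\<forall>x\<in>X'. cmod (f x) \<le> K0 * N' x" by blast
    \<comment> \<open>The bound for \<open>f\<close> may come out negative, while the estimates to
      follow multiply by it monotonically.\<close>
    define K where "K = max K0 0"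
    have "K0 * N' x \<le> K * N' x" if "x \<in> X'" for x
      using B.N_nonneg[OF that] unfolding K_def by (intro mult_right_mono) auto
    then have K: "K \<ge> 0" "cmod (f x) \<le> K * N' x" if "x \<in> X'" for x
      using K0 that unfolding K_def by (auto intro: order_trans)
    show ?thesis
    proof (rule dual_ofI)
      show "cmod (?p f x) \<le> (K * C) * N x" if "x \<in> X" for x
      proof -
        have "cmod (f (T x)) \<le> K * N' (T x)" using K linear_betweenD(1)[OF T that] by blast
        also have "\<dots> \<le> K * (C * N x)" using C[OF that] K linear_betweenD(1)[OF T that] by (intro mult_left_mono) auto
        finally show ?thesis using that by (simp add: mult.assoc)
      qed
    qed (use dual_ofD(1,2)[OF f] linear_betweenD[OF T] A.add_mem A.scale_mem in auto)
  qed
  have Td: "T (x - y) = T x - T y" if "x \<in> X" "y \<in> X" for x y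
    using additive_diff[OF A.subspace linear_betweenD(2)[OF T]] that by blast
  have rep: "represents X' N' (\<lambda>n. T (s n)) (?M \<Phi>)" if s: "represents X N s \<Phi>" for s \<Phi>
  proof (rule B.representsI)
    fix e :: real assume "e > 0"
    then have "e / (1 + \<bar>C\<bar>) > 0" by (simp add: add_pos_nonneg)
    from A.representsD(2)[OF s this] obtain k
      where k: "\<And>m n. m \<ge> k \<Longrightarrow> n \<ge> k \<Longrightarrow> N (s m - s n) < e / (1 + \<bar>C\<bar>)" by auto
    have "N' (T (s m) - T (s n)) < e" if "m \<ge> k" "n \<ge> k" for m n
    proof -
      have d: "s m - s n \<in> X" using A.diff_mem A.representsD(1)[OF s] by blast
      have "N' (T (s m) - T (s n)) \<le> C * N (s m - s n)"
        using C[OF d] Td A.representsD(1)[OF s] by simp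
      also have "\<dots> \<le> (1 + \<bar>C\<bar>) * N (s m - s n)" using A.N_nonneg[OF d] by (intro mult_right_mono) auto
      also have "\<dots> < (1 + \<bar>C\<bar>) * (e / (1 + \<bar>C\<bar>))"
        using k[OF that] by (intro mult_strict_left_mono) auto
      also have "1 + \<bar>C\<bar> \<noteq> 0" by linarith
      then have "(1 + \<bar>C\<bar>) * (e / (1 + \<bar>C\<bar>)) = e" by simp
      finally show ?thesis .
    qed
    then show "\<exists>k. \<forall>m\<ge>k. \<forall>n\<ge>k. N' (T (s m) - T (s n)) < e" by blast
  next
    fix f assume f: "f \<in> dual_of X' N'"
    show "(\<lambda>n. f (T (s n))) \<longlonglongrightarrow> ?M \<Phi> f"
      using A.representsD(3)[OF s p[OF f]] A.representsD(1)[OF s] f by (simp add: completion_map_def)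
  next
    show "T (s n) \<in> X'" for n using A.representsD(1)[OF s] linear_betweenD(1)[OF T] by blast
    show "?M \<Phi> f = 0" if "f \<notin> dual_of X' N'" for f using that by (simp add: completion_map_def)
  qed
  show bd: "completion_norm X' N' (?M \<Phi>) \<le> C * completion_norm X N \<Phi>" if \<Phi>: "\<Phi> \<in> completion X N" for \<Phi>
  proof -
    obtain s where s: "represents X N s \<Phi>" using \<Phi> by (rule A.completionE)
    show ?thesis
      by (rule LIMSEQ_le[OF B.cn_lim[OF rep[OF s]] tendsto_mult_left[OF A.cn_lim[OF s]]])
        (intro exI allI impI C A.representsD(1)[OF s])
  qed
  show ?bounded
    unfolding bounded_between_def linear_between_def
  proof (intro conjI ballI allI exI[of _ C])
    show "?M \<Phi> \<in> completion X' N'" if "\<Phi> \<in> completion X N" for \<Phi>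
      using that rep B.completionI A.completionE by meson
    show "completion_norm X' N' (?M \<Phi>) \<le> C * completion_norm X N \<Phi>" if "\<Phi> \<in> completion X N" for \<Phi>
      using bd[OF that] .
  qed (auto simp: completion_map_def fun_eq_iff scaleC_fun_def scaleC_complex_def)
  show "?M (completion_embed X N x) = completion_embed X' N' (T x)" if "x \<in> X"
    using p that by (auto simp: completion_map_def completion_embed_def fun_eq_iff)
qed

section \<open>Tensor products\<close>

text \<open>\<open>S \<otimes> R\<close> acts by pulling bilinear forms back, so linearity is
  immediate and no representation by elementary tensors has to be chosen. The value \<open>0\<close>
  on other arguments follows the convention of \<open>tensor\<close>.\<close>

definition tensor_map :: "('a::complex_vector \<Rightarrow> 'a) \<Rightarrow> ('b::complex_vector \<Rightarrow> 'b) \<Rightarrow> ('a, 'b) tensor \<Rightarrow> ('a, 'b) tensor" where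
  "tensor_map S R u = (\<lambda>\<phi>. if bilinear_form \<phi> then u (\<lambda>b c. \<phi> (S b) (R c)) else 0)"

abbreviation clinear :: "('a::complex_vector \<Rightarrow> 'b::complex_vector) \<Rightarrow> bool" where
  "clinear \<equiv> Vector_Spaces.linear scaleC scaleC"

lemma clinearI:
  fixes T :: "'a::complex_vector \<Rightarrow> 'b::complex_vector"
  assumes "\<And>x y. T (x + y) = T x + T y" "\<And>c x. T (c *\<^sub>C x) = c *\<^sub>C T x"
  shows "clinear T"
  by unfold_locales (use assms in \<open>auto simp: complex_vector.scale_right_distrib\<close>)

lemma clinearD:
  fixes T :: "'a::complex_vector \<Rightarrow> 'b::complex_vector"
  assumes "clinear T"
  shows "T (x + y) = T x + T y" "T (c *\<^sub>C x) = c *\<^sub>C T x"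
proof -
  interpret Vector_Spaces.linear scaleC scaleC T by fact
  show "T (x + y) = T x + T y" "T (c *\<^sub>C x) = c *\<^sub>C T x" by (rule add scale)+
qed

lemma clinear_sum:
  assumes "clinear T" shows "T (sum f I) = (\<Sum>i\<in>I. T (f i))"
proof -
  have "T 0 = 0" using clinearD(2)[OF assms, of 0 0] by simp
  then show ?thesis
    by (induction I rule: infinite_finite_induct) (auto simp: clinearD(1)[OF assms])
qed

lemma bilinear_formI:
  assumes "\<And>x x' y. \<phi> (x + x') y = \<phi> x y + \<phi> x' y" "\<And>x y y'. \<phi> x (y + y') = \<phi> x y + \<phi> x y'"
    "\<And>c x y. \<phi> (c *\<^sub>C x) y = c * \<phi> x y" "\<And>c x y. \<phi> x (c *\<^sub>C y) = c * \<phi> x y"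
  shows "bilinear_form \<phi>"
  unfolding bilinear_form_def
  by (intro conjI allI clinearI) (simp_all only: assms scaleC_complex_def)

lemma bilinear_formD:
  assumes "bilinear_form \<phi>"
  shows "\<phi> (x + x') y = \<phi> x y + \<phi> x' y" "\<phi> x (y + y') = \<phi> x y + \<phi> x y'"
    "\<phi> (c *\<^sub>C x) y = c * \<phi> x y" "\<phi> x (c *\<^sub>C y) = c * \<phi> x y"
proof -
  have l: "clinear (\<phi> x)" for x using assms by (auto simp: bilinear_form_def)
  have r: "clinear (\<lambda>x. \<phi> x y)" for y using assms by (auto simp: bilinear_form_def)
  show "\<phi> (x + x') y = \<phi> x y + \<phi> x' y" "\<phi> (c *\<^sub>C x) y = c * \<phi> x y"
    using clinearD[OF r] by (auto simp: scaleC_complex_def)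
  show "\<phi> x (y + y') = \<phi> x y + \<phi> x y'" "\<phi> x (c *\<^sub>C y) = c * \<phi> x y"
    using clinearD[OF l] by (auto simp: scaleC_complex_def)
qed

lemma bilinear_form_compose:
  assumes "bilinear_form \<phi>" "clinear S" "clinear R"
  shows "bilinear_form (\<lambda>b c. \<phi> (S b) (R c))"
  by (rule bilinear_formI)
    (simp_all only: clinearD[OF assms(2)] clinearD[OF assms(3)] bilinear_formD[OF assms(1)])

lemma tensor_scale_left: "tensor (c *\<^sub>C x) y = c *\<^sub>C tensor x y"
  by (auto simp: tensor_def fun_eq_iff bilinear_formD scaleC_fun_def scaleC_complex_def)

lemma tensor_scale_right: "tensor x (c *\<^sub>C y) = c *\<^sub>C tensor x y"
  by (auto simp: tensor_def fun_eq_iff bilinear_formD scaleC_fun_def scaleC_complex_def)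

lemma tensor_0_left [simp]: "tensor 0 y = 0"
  using tensor_scale_left[of 0 0 y] by simp

lemma clinear_tensor_map: "clinear (tensor_map S R)"
  by (rule clinearI) (auto simp: tensor_map_def fun_eq_iff scaleC_fun_def scaleC_complex_def)

lemma tensor_map_tensor:
  assumes "clinear S" "clinear R"
  shows "tensor_map S R (tensor x y) = tensor (S x) (R y)"
  using bilinear_form_compose[OF _ assms] by (auto simp: tensor_map_def tensor_def fun_eq_iff)

lemma tensor_eval: "bilinear_form \<phi> \<Longrightarrow> tensor x y \<phi> = \<phi> x y"
  by (simp add: tensor_def)

lemma subspace_alg_tensor: "complex_vector.subspace (alg_tensor X Y)"
  unfolding alg_tensor_def by (rule complex_vector.subspace_span)

lemma tensor_mem: "x \<in> X \<Longrightarrow> y \<in> Y \<Longrightarrow> tensor x y \<in> alg_tensor X Y"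
  unfolding alg_tensor_def by (rule complex_vector.span_base) blast

lemma tensor_sum_mem:
  assumes "\<And>i. i \<in> I \<Longrightarrow> x i \<in> X \<and> y i \<in> Y"
  shows "(\<Sum>i\<in>I. tensor (x i) (y i)) \<in> alg_tensor X Y"
  using assms tensor_mem by (intro complex_vector.subspace_sum[OF subspace_alg_tensor]) blast

text \<open>Scalars are absorbed into the left factor, so sums of elementary tensors suffice. Of
  \<open>X\<close> only scalar multiples are asked, which admits the Fourier algebra as a set of
  single coefficients.\<close>

lemma alg_tensor_induct [consumes 1, case_names tensor add]:
  assumes u: "u \<in> alg_tensor X Y" and sc: "\<And>c x. x \<in> X \<Longrightarrow> c *\<^sub>C x \<in> X" and "X \<noteq> {}" "Y \<noteq> {}"
    and t: "\<And>x y. x \<in> X \<Longrightarrow> y \<in> Y \<Longrightarrow> Q (tensor x y)"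
    and a: "\<And>u v. u \<in> alg_tensor X Y \<Longrightarrow> v \<in> alg_tensor X Y \<Longrightarrow> Q u \<Longrightarrow> Q v \<Longrightarrow> Q (u + v)"
  shows "Q u"
proof -
  obtain x0 y0 where x0: "x0 \<in> X" "y0 \<in> Y" using assms(3,4) by blast
  have "Q 0" using t[OF sc[OF x0(1), of 0] x0(2)] by simp
  have "u \<in> alg_tensor X Y \<and> Q u"
    using u unfolding alg_tensor_def
  proof (induction rule: complex_vector.span_induct_alt)
    case base
    then show ?case using \<open>Q 0\<close> complex_vector.span_zero by blast
  next
    case (step c s v)
    then obtain x y where s: "s = tensor x y" "x \<in> X" "y \<in> Y" by blast
    have m: "tensor (c *\<^sub>C x) y \<in> alg_tensor X Y" using s sc tensor_mem by blast
    have "Q (tensor (c *\<^sub>C x) y)" using s sc t by blast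
    have v: "v \<in> alg_tensor X Y" "Q v" using step unfolding alg_tensor_def by auto
    have "tensor (c *\<^sub>C x) y + v \<in> alg_tensor X Y"
      by (rule complex_vector.subspace_add[OF subspace_alg_tensor m v(1)])
    moreover have "Q (tensor (c *\<^sub>C x) y + v)" by (rule a[OF m v(1) \<open>Q (tensor (c *\<^sub>C x) y)\<close> v(2)])
    moreover have "c *\<^sub>C s + v = tensor (c *\<^sub>C x) y + v" by (simp only: tensor_scale_left s)
    ultimately show ?case unfolding alg_tensor_def by (simp only:)
  qed
  then show ?thesis by blast
qed

text \<open>The reverse inequality for scalars comes from the given one, applied to
  \<open>1 / c\<close>.\<close>

lemma seminorm_onI:
  assumes X: "complex_vector.subspace X" and "\<And>x. x \<in> X \<Longrightarrow> 0 \<le> N x"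
    "\<And>x y. x \<in> X \<Longrightarrow> y \<in> X \<Longrightarrow> N (x + y) \<le> N x + N y"
    and sc: "\<And>c x. x \<in> X \<Longrightarrow> N (c *\<^sub>C x) \<le> cmod c * N x"
  shows "seminorm_on X N"
  unfolding seminorm_on_def
proof (intro conjI ballI allI)
  fix c x assume x: "x \<in> X"
  have cx: "c *\<^sub>C x \<in> X" for c using x complex_vector.subspace_scale[OF X] by blast
  have "cmod c * N x \<le> N (c *\<^sub>C x)"
  proof (cases "c = 0")
    case True
    then show ?thesis using assms(2)[OF cx[of 0]] by simp
  next
    case False
    have "N ((1/c) *\<^sub>C c *\<^sub>C x) \<le> cmod (1/c) * N (c *\<^sub>C x)" by (rule sc[OF cx])
    then show ?thesis using False by (simp add: scaleC_one norm_divide field_simps)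
  qed
  then show "N (c *\<^sub>C x) = cmod c * N x" using sc[OF x, of c] by simp
qed (use assms in auto)

text \<open>What can be read off a single vector. For the coefficient functions in
  \<open>fourier_algebra\<close> scalar multiples are immediate, whereas sums are not.\<close>

definition gauge_on :: "'a::complex_vector set \<Rightarrow> ('a \<Rightarrow> real) \<Rightarrow> bool" where
  "gauge_on X N \<longleftrightarrow> X \<noteq> {} \<and> (\<forall>x\<in>X. 0 \<le> N x) \<and> (\<forall>c. \<forall>x\<in>X. c *\<^sub>C x \<in> X \<and> N (c *\<^sub>C x) \<le> cmod c * N x)"

lemma gauge_onD:
  assumes "gauge_on X N"
  shows "X \<noteq> {}" "x \<in> X \<Longrightarrow> 0 \<le> N x" "x \<in> X \<Longrightarrow> c *\<^sub>C x \<in> X" "x \<in> X \<Longrightarrow> N (c *\<^sub>C x) \<le> cmod c * N x"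
  using assms by (auto simp: gauge_on_def)

lemma seminorm_on_gauge: "seminorm_on X N \<Longrightarrow> gauge_on X N"
proof -
  assume N: "seminorm_on X N"
  have "c *\<^sub>C x \<in> X" if "x \<in> X" for c x
    by (rule complex_vector.subspace_scale[OF seminorm_onD(1)[OF N] that])
  moreover have "0 \<in> X" by (rule complex_vector.subspace_0[OF seminorm_onD(1)[OF N]])
  ultimately show ?thesis
    unfolding gauge_on_def using N unfolding seminorm_on_def by (metis empty_iff order_refl)
qed

section \<open>The Banach space projective norm\<close>

lemma sum_lessThan_add:
  fixes f :: "nat \<Rightarrow> 'a::comm_monoid_add"
  shows "(\<Sum>i<n + m. f i) = (\<Sum>i<n. f i) + (\<Sum>i<m. f (n + i))"
proof (induction m)
  case (Suc m)
  then show ?case by (simp add: add.assoc)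
qed simp

text \<open>The costs of representations as a relation, so that representations can be concatenated
  and scaled before any infimum is taken.\<close>

definition tensor_rep ::
  "'a::complex_vector set \<Rightarrow> ('a \<Rightarrow> real) \<Rightarrow> 'b::complex_vector set \<Rightarrow> ('b \<Rightarrow> real) \<Rightarrow> ('a, 'b) tensor \<Rightarrow> real \<Rightarrow> bool" where
  "tensor_rep X NX Y NY u r \<longleftrightarrow> (\<exists>(n::nat) x y. r = (\<Sum>i<n. NX (x i) * NY (y i)) \<and>
     (\<forall>i<n. x i \<in> X \<and> y i \<in> Y) \<and> u = (\<Sum>i<n. tensor (x i) (y i)))"

lemma proj_norm_eq: "proj_norm X NX Y NY u = Inf {r. tensor_rep X NX Y NY u r}"
  by (simp add: proj_norm_def tensor_rep_def)

lemma tensor_rep_add: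
  assumes "tensor_rep X NX Y NY u r" "tensor_rep X NX Y NY v s"
  shows "tensor_rep X NX Y NY (u + v) (r + s)"
proof -
  obtain n :: nat and x y where 1: "r = (\<Sum>i<n. NX (x i) * NY (y i))"
     "\<forall>i<n. x i \<in> X \<and> y i \<in> Y" "u = (\<Sum>i<n. tensor (x i) (y i))"
    using assms(1) unfolding tensor_rep_def by blast
  obtain m :: nat and x' y' where 2: "s = (\<Sum>i<m. NX (x' i) * NY (y' i))"
     "\<forall>i<m. x' i \<in> X \<and> y' i \<in> Y" "v = (\<Sum>i<m. tensor (x' i) (y' i))"
    using assms(2) unfolding tensor_rep_def by blast
  define z w where "z i = (if i < n then x i else x' (i - n))" and "w i = (if i < n then y i else y' (i - n))" for i
  have "r + s = (\<Sum>i<n + m. NX (z i) * NY (w i))" "u + v = (\<Sum>i<n + m. tensor (z i) (w i))"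
    unfolding 1 2 sum_lessThan_add by (simp_all add: z_def w_def)
  moreover have "\<forall>i<n + m. z i \<in> X \<and> w i \<in> Y" using 1(2) 2(2) by (auto simp: z_def w_def)
  ultimately show ?thesis unfolding tensor_rep_def by blast
qed

lemma tensor_rep_tensor: "x \<in> X \<Longrightarrow> y \<in> Y \<Longrightarrow> tensor_rep X NX Y NY (tensor x y) (NX x * NY y)"
  unfolding tensor_rep_def
  by (rule exI[of _ "Suc 0"], rule exI[of _ "\<lambda>_. x"], rule exI[of _ "\<lambda>_. y"])
    (simp only: sum.lessThan_Suc lessThan_0 sum.empty add_0_left simp_thms)

lemma tensor_rep_scale:
  assumes "gauge_on X NX" "gauge_on Y NY" "tensor_rep X NX Y NY u r"
  shows "\<exists>s\<le>cmod c * r. tensor_rep X NX Y NY (c *\<^sub>C u) s"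
proof -
  obtain n :: nat and x y where 1: "r = (\<Sum>i<n. NX (x i) * NY (y i))"
     "\<forall>i<n. x i \<in> X \<and> y i \<in> Y" "u = (\<Sum>i<n. tensor (x i) (y i))"
    using assms(3) unfolding tensor_rep_def by blast
  have "(\<Sum>i<n. NX (c *\<^sub>C x i) * NY (y i)) \<le> (\<Sum>i<n. (cmod c * NX (x i)) * NY (y i))"
    by (intro sum_mono mult_right_mono) (use 1(2) gauge_onD[OF assms(1)] gauge_onD[OF assms(2)] in auto)
  also have "\<dots> = cmod c * r" by (simp add: 1 sum_distrib_left mult.assoc)
  finally have le: "(\<Sum>i<n. NX (c *\<^sub>C x i) * NY (y i)) \<le> cmod c * r" .
  have "c *\<^sub>C u = (\<Sum>i<n. tensor (c *\<^sub>C x i) (y i))"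
    unfolding 1 tensor_scale_left by (rule complex_vector.scale_sum_right)
  moreover have "\<forall>i<n. c *\<^sub>C x i \<in> X \<and> y i \<in> Y" using 1(2) gauge_onD(3)[OF assms(1)] by blast
  ultimately have "tensor_rep X NX Y NY (c *\<^sub>C u) (\<Sum>i<n. NX (c *\<^sub>C x i) * NY (y i))"
    unfolding tensor_rep_def
    by (intro exI[of _ n] exI[of _ "\<lambda>i. c *\<^sub>C x i"] exI[of _ y] conjI refl)
  with le show ?thesis by blast
qed

lemma Inf_lessE:
  assumes "Inf {r. R r} < (c::real)" "R r0"
  obtains r where "R r" "r < c"
proof -
  have "{r. R r} \<noteq> {}" using assms(2) by blast
  from cInf_lessD[OF this assms(1)] show thesis using that by blast
qed

context
  fixes X :: "'a::complex_vector set" and NX and Y :: "'b::complex_vector set" and NY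
  assumes gX: "gauge_on X NX" and gY: "gauge_on Y NY"
begin

lemma tensor_rep_nonneg: "tensor_rep X NX Y NY u r \<Longrightarrow> 0 \<le> r"
proof -
  assume "tensor_rep X NX Y NY u r"
  then obtain n :: nat and x y where 1: "r = (\<Sum>i<n. NX (x i) * NY (y i))" "\<forall>i<n. x i \<in> X \<and> y i \<in> Y"
    unfolding tensor_rep_def by blast
  have "NX (x i) * NY (y i) \<ge> 0" if "i < n" for i
    using 1(2) that gauge_onD(2)[OF gX] gauge_onD(2)[OF gY] by simp
  then show ?thesis unfolding 1(1) by (intro sum_nonneg) simp
qed

lemma tensor_rep_ex:
  assumes u: "u \<in> alg_tensor X Y"
  shows "\<exists>r. tensor_rep X NX Y NY u r"
proof (rule alg_tensor_induct[OF u])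
  show "c *\<^sub>C x \<in> X" if "x \<in> X" for c x using gauge_onD(3)[OF gX that] .
  show "X \<noteq> {}" "Y \<noteq> {}" using gauge_onD(1)[OF gX] gauge_onD(1)[OF gY] .
  show "\<exists>r. tensor_rep X NX Y NY (tensor x y) r" if "x \<in> X" "y \<in> Y" for x y
    using tensor_rep_tensor[OF that] by blast
  show "\<exists>r. tensor_rep X NX Y NY (u + v) r"
    if "\<exists>r. tensor_rep X NX Y NY u r" "\<exists>r. tensor_rep X NX Y NY v r" for u v
    using that tensor_rep_add by blast
qed

lemma proj_norm_le: "tensor_rep X NX Y NY u r \<Longrightarrow> proj_norm X NX Y NY u \<le> r"
proof -
  assume "tensor_rep X NX Y NY u r"
  moreover have "bdd_below {r. tensor_rep X NX Y NY u r}"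
    by (rule bdd_belowI[of _ 0]) (drule CollectD, erule tensor_rep_nonneg)
  ultimately show ?thesis unfolding proj_norm_eq by (intro cInf_lower CollectI)
qed

lemma proj_norm_lessE:
  assumes "u \<in> alg_tensor X Y" "proj_norm X NX Y NY u < c"
  obtains r where "tensor_rep X NX Y NY u r" "r < c"
  using assms tensor_rep_ex[OF assms(1)] unfolding proj_norm_eq by (meson Inf_lessE)

lemma proj_norm_tensor_le: "x \<in> X \<Longrightarrow> y \<in> Y \<Longrightarrow> proj_norm X NX Y NY (tensor x y) \<le> NX x * NY y"
  by (rule proj_norm_le[OF tensor_rep_tensor])

lemma proj_norm_seminorm: "seminorm_on (alg_tensor X Y) (proj_norm X NX Y NY)"
proof (rule seminorm_onI[OF subspace_alg_tensor])
  fix u assume u: "u \<in> alg_tensor X Y"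
  show "0 \<le> proj_norm X NX Y NY u"
    unfolding proj_norm_eq
  proof (rule cInf_greatest)
    show "{r. tensor_rep X NX Y NY u r} \<noteq> {}" using tensor_rep_ex[OF u] by blast
    show "0 \<le> r" if "r \<in> {r. tensor_rep X NX Y NY u r}" for r using that tensor_rep_nonneg by blast
  qed
  show "proj_norm X NX Y NY (c *\<^sub>C u) \<le> cmod c * proj_norm X NX Y NY u" for c
  proof (rule field_le_epsilon)
    fix e :: real assume e: "e > 0"
    have "0 < 1 + cmod c" using norm_ge_zero[of c] by linarith
    then have "proj_norm X NX Y NY u < proj_norm X NX Y NY u + e / (1 + cmod c)"
      using e by simp
    from proj_norm_lessE[OF u this] obtain r
      where r: "tensor_rep X NX Y NY u r" "r < proj_norm X NX Y NY u + e / (1 + cmod c)" by blast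
    obtain s where s: "s \<le> cmod c * r" "tensor_rep X NX Y NY (c *\<^sub>C u) s"
      using tensor_rep_scale[OF gX gY r(1)] by blast
    have "proj_norm X NX Y NY (c *\<^sub>C u) \<le> cmod c * r" using proj_norm_le[OF s(2)] s(1) by simp
    also have "\<dots> \<le> cmod c * (proj_norm X NX Y NY u + e / (1 + cmod c))"
      using r(2) by (intro mult_left_mono) auto
    also have "\<dots> = cmod c * proj_norm X NX Y NY u + (cmod c / (1 + cmod c)) * e"
      by (simp add: algebra_simps)
    also have "\<dots> \<le> cmod c * proj_norm X NX Y NY u + 1 * e"
    proof (intro add_left_mono mult_right_mono)
      have "0 < 1 + cmod c" using norm_ge_zero[of c] by linarith
      then show "cmod c / (1 + cmod c) \<le> 1" by (simp add: divide_le_eq_1)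
    qed (use e in simp)
    finally show "proj_norm X NX Y NY (c *\<^sub>C u) \<le> cmod c * proj_norm X NX Y NY u + e" by simp
  qed
next
  fix u v assume u: "u \<in> alg_tensor X Y" and v: "v \<in> alg_tensor X Y"
  show "proj_norm X NX Y NY (u + v) \<le> proj_norm X NX Y NY u + proj_norm X NX Y NY v"
  proof (rule field_le_epsilon)
    fix e :: real assume e: "e > 0"
    obtain r where r: "tensor_rep X NX Y NY u r" "r < proj_norm X NX Y NY u + e / 2"
      using proj_norm_lessE[OF u, of "proj_norm X NX Y NY u + e / 2"] e by auto
    obtain s where s: "tensor_rep X NX Y NY v s" "s < proj_norm X NX Y NY v + e / 2"
      using proj_norm_lessE[OF v, of "proj_norm X NX Y NY v + e / 2"] e by auto
    show "proj_norm X NX Y NY (u + v) \<le> proj_norm X NX Y NY u + proj_norm X NX Y NY v + e"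
      using proj_norm_le[OF tensor_rep_add[OF r(1) s(1)]] r(2) s(2) by linarith
  qed
qed

text \<open>The universal property in quantitative form: a bound on elementary tensors carries over
  to all tensors. In the Banach algebra version the module actions, the evaluation at a pair of
  points and the comparison of the norms on \<open>B \<otimes> B\<close> and
  \<open>A \<otimes> B\<close> are estimated this way.\<close>

lemma proj_norm_bound:
  assumes T: "linear_between (alg_tensor X Y) W T" and W: "seminorm_on W NW" and C: "C \<ge> 0"
    and b: "\<And>x y. x \<in> X \<Longrightarrow> y \<in> Y \<Longrightarrow> NW (T (tensor x y)) \<le> C * (NX x * NY y)"
    and u: "u \<in> alg_tensor X Y"
  shows "NW (T u) \<le> C * proj_norm X NX Y NY u"
proof -
  have rep: "NW (T u) \<le> C * r" if r: "tensor_rep X NX Y NY u r" for r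
  proof -
    obtain n :: nat and x y where 1: "r = (\<Sum>i<n. NX (x i) * NY (y i))"
       "\<forall>i<n. x i \<in> X \<and> y i \<in> Y" "u = (\<Sum>i<n. tensor (x i) (y i))"
      using r unfolding tensor_rep_def by blast
    have "NW (T (\<Sum>i<m. tensor (x i) (y i))) \<le> C * (\<Sum>i<m. NX (x i) * NY (y i))" if "m \<le> n" for m
      using that
    proof (induction m)
      case 0
      have "T (0 *\<^sub>C 0) = 0 *\<^sub>C T 0"
        by (rule linear_betweenD(3)[OF T]) (rule complex_vector.subspace_0[OF subspace_alg_tensor])
      then have "T 0 = 0" by (simp only: complex_vector.scale_zero_left)
      then show ?case using seminorm_on_0[OF W] by (simp only: lessThan_0 sum.empty mult_zero_right)
    next
      case (Suc m)
      have mem: "(\<Sum>i<m. tensor (x i) (y i)) \<in> alg_tensor X Y" "tensor (x m) (y m) \<in> alg_tensor X Y"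
        using 1(2) Suc.prems by (auto intro!: tensor_sum_mem tensor_mem)
      have "T (\<Sum>i<Suc m. tensor (x i) (y i)) = T (\<Sum>i<m. tensor (x i) (y i)) + T (tensor (x m) (y m))"
        unfolding sum.lessThan_Suc by (rule linear_betweenD(2)[OF T mem])
      also have "NW \<dots> \<le> NW (T (\<Sum>i<m. tensor (x i) (y i))) + NW (T (tensor (x m) (y m)))"
        by (intro seminorm_onD(3)[OF W] linear_betweenD(1)[OF T] mem)
      also have "\<dots> \<le> C * (\<Sum>i<m. NX (x i) * NY (y i)) + C * (NX (x m) * NY (y m))"
        using Suc 1(2) by (intro add_mono b) auto
      finally show ?case by (simp only: sum.lessThan_Suc distrib_left)
    qed
    then show ?thesis using 1 by blast
  qed
  show ?thesis
  \<comment> \<open>The infimum is compared after division by \<open>C\<close>; for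
    \<open>C = 0\<close> any one representation gives the claim.\<close>
  proof (cases "C = 0")
    case True
    obtain r where "tensor_rep X NX Y NY u r" using tensor_rep_ex[OF u] by blast
    then show ?thesis using rep[of r] True by simp
  next
    case False
    have pos: "C > 0" using C False by simp
    have "NW (T u) / C \<le> proj_norm X NX Y NY u"
      unfolding proj_norm_eq
    proof (rule cInf_greatest)
      show "{r. tensor_rep X NX Y NY u r} \<noteq> {}" using tensor_rep_ex[OF u] by blast
      show "NW (T u) / C \<le> r" if "r \<in> {r. tensor_rep X NX Y NY u r}" for r
        using rep[of r] that pos by (simp add: pos_divide_le_eq mult.commute)
    qed
    then show ?thesis unfolding pos_divide_le_eq[OF pos] by (simp only: mult.commute)
  qed
qed

end

section \<open>Operator norms of scalar matrices\<close>

text \<open>\<open>K\<close> bounds the square of the operator norm, which avoids square roots when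
  bounds are added. Arbitrary index sets let Kronecker products be indexed by pairs.\<close>

definition opb :: "'i set \<Rightarrow> 'j set \<Rightarrow> ('i \<Rightarrow> 'j \<Rightarrow> complex) \<Rightarrow> real \<Rightarrow> bool" where
  "opb I J a K \<longleftrightarrow> (\<forall>v. (\<Sum>i\<in>I. (cmod (\<Sum>j\<in>J. a i j * v j))\<^sup>2) \<le> K * (\<Sum>j\<in>J. (cmod (v j))\<^sup>2))"

lemma opbD: "opb I J a K \<Longrightarrow> (\<Sum>i\<in>I. (cmod (\<Sum>j\<in>J. a i j * v j))\<^sup>2) \<le> K * (\<Sum>j\<in>J. (cmod (v j))\<^sup>2)"
  by (simp add: opb_def)

lemma opbI: "(\<And>v. (\<Sum>i\<in>I. (cmod (\<Sum>j\<in>J. a i j * v j))\<^sup>2) \<le> K * (\<Sum>j\<in>J. (cmod (v j))\<^sup>2)) \<Longrightarrow> opb I J a K"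
  by (simp add: opb_def)

lemma opb_mono: "opb I J a K \<Longrightarrow> K \<le> K' \<Longrightarrow> opb I J a K'"
  unfolding opb_def by (meson order_trans mult_right_mono sum_nonneg zero_le_power2)

lemma opb_cong:
  assumes "\<And>i j. i \<in> I \<Longrightarrow> j \<in> J \<Longrightarrow> a i j = b i j"
  shows "opb I J a K = opb I J b K"
proof -
  have "(\<Sum>j\<in>J. a i j * v j) = (\<Sum>j\<in>J. b i j * v j)" if "i \<in> I" for i v
    using assms that by (intro sum.cong) auto
  then show ?thesis unfolding opb_def by (simp cong: sum.cong)
qed

lemma opb_scale:
  assumes "opb I J a K" shows "opb I J (\<lambda>i j. c * a i j) ((cmod c)\<^sup>2 * K)"
proof (rule opbI)
  fix v :: "'b \<Rightarrow> complex"
  have "(\<Sum>i\<in>I. (cmod (\<Sum>j\<in>J. (c * a i j) * v j))\<^sup>2) = (cmod c)\<^sup>2 * (\<Sum>i\<in>I. (cmod (\<Sum>j\<in>J. a i j * v j))\<^sup>2)"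
    by (simp add: sum_distrib_left norm_mult power_mult_distrib mult.assoc flip: sum_distrib_left)
  also have "\<dots> \<le> (cmod c)\<^sup>2 * (K * (\<Sum>j\<in>J. (cmod (v j))\<^sup>2))"
    by (intro mult_left_mono opbD assms) simp
  finally show "(\<Sum>i\<in>I. (cmod (\<Sum>j\<in>J. (c * a i j) * v j))\<^sup>2) \<le> (cmod c)\<^sup>2 * K * (\<Sum>j\<in>J. (cmod (v j))\<^sup>2)"
    by (simp add: mult.assoc)
qed

text \<open>Serves to pass between pairs of indices and the numbering of rows and columns by
  \<open>div\<close> and \<open>mod\<close>.\<close>

lemma opb_reindex:
  assumes f: "bij_betw f I I'" and g: "bij_betw g J J'"
  shows "opb I J (\<lambda>i j. a (f i) (g j)) K \<longleftrightarrow> opb I' J' a K"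
proof -
  have key: "(\<Sum>i\<in>I. (cmod (\<Sum>j\<in>J. a (f i) (g j) * w (g j)))\<^sup>2) = (\<Sum>i\<in>I'. (cmod (\<Sum>j\<in>J'. a i j * w j))\<^sup>2)"
    "(\<Sum>j\<in>J. (cmod (w (g j)))\<^sup>2) = (\<Sum>j\<in>J'. (cmod (w j))\<^sup>2)" for w
  proof -
    have "(\<Sum>j\<in>J. a i (g j) * w (g j)) = (\<Sum>j\<in>J'. a i j * w j)" for i
      by (rule sum.reindex_bij_betw[OF g])
    then show "(\<Sum>i\<in>I. (cmod (\<Sum>j\<in>J. a (f i) (g j) * w (g j)))\<^sup>2) = (\<Sum>i\<in>I'. (cmod (\<Sum>j\<in>J'. a i j * w j))\<^sup>2)"
      by (simp add: sum.reindex_bij_betw[OF f, of "\<lambda>i. (cmod (\<Sum>j\<in>J'. a i j * w j))\<^sup>2"])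
    show "(\<Sum>j\<in>J. (cmod (w (g j)))\<^sup>2) = (\<Sum>j\<in>J'. (cmod (w j))\<^sup>2)"
      by (rule sum.reindex_bij_betw[OF g])
  qed
  show ?thesis
  proof
    assume "opb I' J' a K"
    show "opb I J (\<lambda>i j. a (f i) (g j)) K"
    proof (rule opbI)
      fix v :: "'c \<Rightarrow> complex"
      define w where "w = v \<circ> inv_into J g"
      have w: "w (g j) = v j" if "j \<in> J" for j
        using g that by (simp add: w_def bij_betw_inv_into_left)
      have "(\<Sum>j\<in>J. a i (g j) * w (g j)) = (\<Sum>j\<in>J. a i (g j) * v j)" for i
        by (rule sum.cong) (auto simp: w)
      moreover have "(\<Sum>j\<in>J. (cmod (w (g j)))\<^sup>2) = (\<Sum>j\<in>J. (cmod (v j))\<^sup>2)"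
        by (rule sum.cong) (auto simp: w)
      ultimately show "(\<Sum>i\<in>I. (cmod (\<Sum>j\<in>J. a (f i) (g j) * v j))\<^sup>2) \<le> K * (\<Sum>j\<in>J. (cmod (v j))\<^sup>2)"
        using opbD[OF \<open>opb I' J' a K\<close>, of w] key[of w] by simp
    qed
  next
    assume o: "opb I J (\<lambda>i j. a (f i) (g j)) K"
    show "opb I' J' a K"
    proof (rule opbI)
      fix w
      show "(\<Sum>i\<in>I'. (cmod (\<Sum>j\<in>J'. a i j * w j))\<^sup>2) \<le> K * (\<Sum>j\<in>J'. (cmod (w j))\<^sup>2)"
        using opbD[OF o, of "\<lambda>j. w (g j)"] unfolding key .
    qed
  qed
qed

text \<open>The product acts by \<open>b\<close> on the second index and then by \<open>a\<close> on
  the first; \<open>z\<close> is the intermediate vector. The bound for \<open>a\<close> is used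
  with the second index fixed, the one for \<open>b\<close> with the first index fixed.\<close>

lemma opb_kron:
  assumes a: "opb P P' a K" and b: "opb Q Q' b L" and K: "K \<ge> 0"
  shows "opb (P \<times> Q) (P' \<times> Q') (\<lambda>\<kappa> \<nu>. a (fst \<kappa>) (fst \<nu>) * b (snd \<kappa>) (snd \<nu>)) (K * L)"
proof (rule opbI)
  fix v :: "'b \<times> 'd \<Rightarrow> complex"
  define z where "z k' l = (\<Sum>l'\<in>Q'. b k' l' * v (l, l'))" for k' l
  have inner: "(\<Sum>\<nu>\<in>P' \<times> Q'. (a k (fst \<nu>) * b k' (snd \<nu>)) * v \<nu>) = (\<Sum>l\<in>P'. a k l * z k' l)" for k k'
    by (simp add: z_def sum.cartesian_product' sum_distrib_left mult.assoc)
  have "(\<Sum>\<kappa>\<in>P \<times> Q. (cmod (\<Sum>\<nu>\<in>P' \<times> Q'. (a (fst \<kappa>) (fst \<nu>) * b (snd \<kappa>) (snd \<nu>)) * v \<nu>))\<^sup>2)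
      = (\<Sum>k\<in>P. \<Sum>k'\<in>Q. (cmod (\<Sum>l\<in>P'. a k l * z k' l))\<^sup>2)"
    unfolding inner by (simp add: sum.cartesian_product')
  also have "\<dots> = (\<Sum>k'\<in>Q. \<Sum>k\<in>P. (cmod (\<Sum>l\<in>P'. a k l * z k' l))\<^sup>2)" by (rule sum.swap)
  also have "\<dots> \<le> (\<Sum>k'\<in>Q. K * (\<Sum>l\<in>P'. (cmod (z k' l))\<^sup>2))" by (intro sum_mono opbD a)
  also have "\<dots> = K * (\<Sum>l\<in>P'. \<Sum>k'\<in>Q. (cmod (z k' l))\<^sup>2)"
    by (subst sum.swap) (simp flip: sum_distrib_left)
  also have "\<dots> \<le> K * (\<Sum>l\<in>P'. L * (\<Sum>l'\<in>Q'. (cmod (v (l, l')))\<^sup>2))"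
    unfolding z_def by (intro mult_left_mono sum_mono opbD b K)
  also have "\<dots> = K * L * (\<Sum>\<nu>\<in>P' \<times> Q'. (cmod (v \<nu>))\<^sup>2)"
    unfolding sum.cartesian_product' by (simp add: mult.assoc flip: sum_distrib_left)
  finally show "(\<Sum>\<kappa>\<in>P \<times> Q. (cmod (\<Sum>\<nu>\<in>P' \<times> Q'. (a (fst \<kappa>) (fst \<nu>) * b (snd \<kappa>) (snd \<nu>)) * v \<nu>))\<^sup>2)
      \<le> K * L * (\<Sum>\<nu>\<in>P' \<times> Q'. (cmod (v \<nu>))\<^sup>2)" .
qed

lemma L2_set_le_iff: "C \<ge> 0 \<Longrightarrow> L2_set f A \<le> C \<longleftrightarrow> (\<Sum>i\<in>A. (f i)\<^sup>2) \<le> C\<^sup>2"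
  unfolding L2_set_def by (meson sqrt_le_D real_le_lsqrt sum_nonneg zero_le_power2)

text \<open>On the unit ball all values are at most the sum of the moduli of the entries, so the
  supremum in \<open>mat_opnorm\<close> is a genuine one.\<close>

lemma mat_opnorm_bound:
  fixes \<alpha> :: "complex mat"
  defines "S \<equiv> {L2_set (\<lambda>i. cmod (\<Sum>j<dim_col \<alpha>. \<alpha> $$ (i, j) * v j)) {..<dim_row \<alpha>} |
      v :: nat \<Rightarrow> complex. L2_set (\<lambda>j. cmod (v j)) {..<dim_col \<alpha>} \<le> 1}"
  shows mat_opnorm_bdd: "bdd_above S" and mat_opnorm_nonempty: "S \<noteq> {}"
    and mat_opnorm_nonneg: "0 \<le> mat_opnorm \<alpha>"
proof -
  show bdd: "bdd_above S"
  proof (rule bdd_aboveI)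
    fix y assume "y \<in> S"
    then obtain v where y: "y = L2_set (\<lambda>i. cmod (\<Sum>j<dim_col \<alpha>. \<alpha> $$ (i, j) * v j)) {..<dim_row \<alpha>}"
      and v: "L2_set (\<lambda>j. cmod (v j)) {..<dim_col \<alpha>} \<le> 1" unfolding S_def by blast
    have v1: "cmod (v j) \<le> 1" if "j < dim_col \<alpha>" for j
      using member_le_L2_set[of "{..<dim_col \<alpha>}" j "\<lambda>j. cmod (v j)"] that v by simp
    have "y \<le> (\<Sum>i<dim_row \<alpha>. cmod (\<Sum>j<dim_col \<alpha>. \<alpha> $$ (i, j) * v j))"
      unfolding y by (rule L2_set_le_sum) simp
    also have "\<dots> \<le> (\<Sum>i<dim_row \<alpha>. \<Sum>j<dim_col \<alpha>. cmod (\<alpha> $$ (i, j)) * 1)"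
      by (intro sum_mono order_trans[OF norm_sum]) (auto simp: norm_mult intro!: sum_mono mult_left_le v1)
    finally show "y \<le> (\<Sum>i<dim_row \<alpha>. \<Sum>j<dim_col \<alpha>. cmod (\<alpha> $$ (i, j)) * 1)" .
  qed
  have z: "0 \<in> S"
  proof -
    have "L2_set (\<lambda>i. cmod (\<Sum>j<dim_col \<alpha>. \<alpha> $$ (i, j) * (\<lambda>_. 0) j)) {..<dim_row \<alpha>} = 0"
      "L2_set (\<lambda>j. cmod ((\<lambda>_. 0) j)) {..<dim_col \<alpha>} \<le> 1" by (simp_all add: L2_set_def)
    then show ?thesis unfolding S_def by (intro CollectI exI[of _ "\<lambda>_. 0"]) simp
  qed
  then show "S \<noteq> {}" by blast
  show "0 \<le> mat_opnorm \<alpha>" unfolding mat_opnorm_def using cSup_upper[OF z bdd] unfolding S_def .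
qed

lemma opb_mat_opnorm:
  "opb {..<dim_row \<alpha>} {..<dim_col \<alpha>} (\<lambda>i j. \<alpha> $$ (i, j)) ((mat_opnorm \<alpha>)\<^sup>2)"
proof (rule opbI)
  fix v :: "nat \<Rightarrow> complex"
  define s where "s = L2_set (\<lambda>j. cmod (v j)) {..<dim_col \<alpha>}"
  have s2: "s\<^sup>2 = (\<Sum>j<dim_col \<alpha>. (cmod (v j))\<^sup>2)" by (simp add: s_def L2_set_def sum_nonneg)
  show "(\<Sum>i<dim_row \<alpha>. (cmod (\<Sum>j<dim_col \<alpha>. \<alpha> $$ (i, j) * v j))\<^sup>2)
      \<le> (mat_opnorm \<alpha>)\<^sup>2 * (\<Sum>j<dim_col \<alpha>. (cmod (v j))\<^sup>2)"
  proof (cases "s = 0")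
    case True
    then have "v j = 0" if "j < dim_col \<alpha>" for j
      using that unfolding s_def by (subst (asm) L2_set_eq_0_iff) auto
    then show ?thesis by simp
  next
    case False
    have s: "s > 0" using False by (simp add: s_def order_less_le)
    define w where "w j = v j / of_real s" for j
    have "L2_set (\<lambda>j. cmod (w j)) {..<dim_col \<alpha>} = L2_set (\<lambda>j. cmod (v j) * (1 / s)) {..<dim_col \<alpha>}"
      using s by (simp add: w_def norm_divide)
    also have "\<dots> = 1"
      using s by (subst L2_set_left_distrib[symmetric]) (auto simp flip: s_def)
    finally have w1: "L2_set (\<lambda>j. cmod (w j)) {..<dim_col \<alpha>} \<le> 1" by simp
    have "L2_set (\<lambda>i. cmod (\<Sum>j<dim_col \<alpha>. \<alpha> $$ (i, j) * w j)) {..<dim_row \<alpha>} \<le> mat_opnorm \<alpha>"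
      unfolding mat_opnorm_def by (rule cSup_upper[OF _ mat_opnorm_bdd]) (use w1 in blast)
    then have "(\<Sum>i<dim_row \<alpha>. (cmod (\<Sum>j<dim_col \<alpha>. \<alpha> $$ (i, j) * w j))\<^sup>2) \<le> (mat_opnorm \<alpha>)\<^sup>2"
      by (subst (asm) L2_set_le_iff[OF mat_opnorm_nonneg])
    moreover have "(\<Sum>j<dim_col \<alpha>. \<alpha> $$ (i, j) * v j) = of_real s * (\<Sum>j<dim_col \<alpha>. \<alpha> $$ (i, j) * w j)" for i
      using s by (simp add: w_def sum_distrib_left)
    then have "(\<Sum>i<dim_row \<alpha>. (cmod (\<Sum>j<dim_col \<alpha>. \<alpha> $$ (i, j) * v j))\<^sup>2)
        = s\<^sup>2 * (\<Sum>i<dim_row \<alpha>. (cmod (\<Sum>j<dim_col \<alpha>. \<alpha> $$ (i, j) * w j))\<^sup>2)"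
      by (simp add: norm_mult power_mult_distrib flip: sum_distrib_left)
    ultimately show ?thesis unfolding s2[symmetric] by (simp add: mult_left_mono mult.commute)
  qed
qed

lemma mat_opnorm_le:
  assumes K: "K \<ge> 0" and o: "opb {..<dim_row \<alpha>} {..<dim_col \<alpha>} (\<lambda>i j. \<alpha> $$ (i, j)) (K\<^sup>2)"
  shows "mat_opnorm \<alpha> \<le> K"
  unfolding mat_opnorm_def
proof (rule cSup_least[OF mat_opnorm_nonempty])
  fix y assume "y \<in> {L2_set (\<lambda>i. cmod (\<Sum>j<dim_col \<alpha>. \<alpha> $$ (i, j) * v j)) {..<dim_row \<alpha>} |
      v :: nat \<Rightarrow> complex. L2_set (\<lambda>j. cmod (v j)) {..<dim_col \<alpha>} \<le> 1}"
  then obtain v where y: "y = L2_set (\<lambda>i. cmod (\<Sum>j<dim_col \<alpha>. \<alpha> $$ (i, j) * v j)) {..<dim_row \<alpha>}"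
      and v: "L2_set (\<lambda>j. cmod (v j)) {..<dim_col \<alpha>} \<le> 1" by blast
  have "(\<Sum>i<dim_row \<alpha>. (cmod (\<Sum>j<dim_col \<alpha>. \<alpha> $$ (i, j) * v j))\<^sup>2)
      \<le> K\<^sup>2 * (\<Sum>j<dim_col \<alpha>. (cmod (v j))\<^sup>2)" by (rule opbD[OF o])
  also have "\<dots> \<le> K\<^sup>2 * 1"
    using v by (intro mult_left_mono) (subst (asm) L2_set_le_iff; simp)+
  finally show "y \<le> K" unfolding y L2_set_le_iff[OF K] by simp
qed

lemma mat_opnorm_mat_le:
  assumes "K \<ge> 0" "opb {..<m} {..<n} f (K\<^sup>2)"
  shows "mat_opnorm (mat m n (\<lambda>(i, j). f i j)) \<le> K"
proof (rule mat_opnorm_le[OF assms(1)])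
  show "opb {..<dim_row (mat m n (\<lambda>(i, j). f i j))} {..<dim_col (mat m n (\<lambda>(i, j). f i j))}
    (\<lambda>i j. mat m n (\<lambda>(i, j). f i j) $$ (i, j)) (K\<^sup>2)"
    using assms(2) by (subst opb_cong[of _ _ _ f]) auto
qed

lemma opb_mat:
  assumes "\<alpha> \<in> carrier_mat m n"
  shows "opb {..<m} {..<n} (\<lambda>i j. \<alpha> $$ (i, j)) ((mat_opnorm \<alpha>)\<^sup>2)"
  using opb_mat_opnorm[of \<alpha>] assms by simp

section \<open>The operator space projective tensor norm\<close>

lemma mats_iff: "A \<in> mats n X \<longleftrightarrow> A \<in> carrier_mat n n \<and> (\<forall>i<n. \<forall>j<n. A $$ (i, j) \<in> X)"
  unfolding mats_def by (auto simp: elements_mat_def UN_subset_iff image_subset_iff)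

lemma mat_in_mats: "(\<And>i j. i < n \<Longrightarrow> j < n \<Longrightarrow> f i j \<in> X) \<Longrightarrow> mat n n (\<lambda>(i, j). f i j) \<in> mats n X"
  by (auto simp: mats_iff)

text \<open>What scaling and adding of factorizations requires of a matrix norm: scalar multiples
  and direct sums. Operator spaces satisfy it by Ruan's axioms, the Fourier algebra by the
  definition of its norm through the pairing.\<close>

definition matrix_gauge :: "'a::complex_vector set \<Rightarrow> ('a mat \<Rightarrow> real) \<Rightarrow> bool" where
  "matrix_gauge X N \<longleftrightarrow> 0 \<in> X \<and> (\<forall>c. \<forall>x\<in>X. c *\<^sub>C x \<in> X)
     \<and> (\<forall>n. \<forall>x\<in>mats n X. 0 \<le> N x)
     \<and> (\<forall>n. \<forall>c. \<forall>x\<in>mats n X. N (map_mat (scaleC c) x) \<le> cmod c * N x)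
     \<and> (\<forall>n m. \<forall>x\<in>mats n X. \<forall>y\<in>mats m X. N (four_block_mat x (0\<^sub>m n m) (0\<^sub>m m n) y) \<le> max (N x) (N y))"

abbreviation fmat :: "nat \<Rightarrow> (nat \<Rightarrow> nat \<Rightarrow> 'a) \<Rightarrow> 'a mat" where
  "fmat n f \<equiv> mat n n (\<lambda>(i, j). f i j)"

lemma mats_fmat: "x \<in> mats n X \<Longrightarrow> x = fmat n (\<lambda>i j. x $$ (i, j))"
  by (rule eq_matI) (auto simp: mats_iff)

lemma matrix_gaugeD:
  assumes "matrix_gauge X N"
  shows "0 \<in> X" "x \<in> X \<Longrightarrow> c *\<^sub>C x \<in> X" "A \<in> mats n X \<Longrightarrow> 0 \<le> N A"
    "(\<And>i j. i < n \<Longrightarrow> j < n \<Longrightarrow> f i j \<in> X) \<Longrightarrow> N (fmat n (\<lambda>i j. c *\<^sub>C f i j)) \<le> cmod c * N (fmat n f)"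
    "A \<in> mats n X \<Longrightarrow> B \<in> mats m X \<Longrightarrow> N (four_block_mat A (0\<^sub>m n m) (0\<^sub>m m n) B) \<le> max (N A) (N B)"
proof -
  show "N (fmat n (\<lambda>i j. c *\<^sub>C f i j)) \<le> cmod c * N (fmat n f)" if f: "\<And>i j. i < n \<Longrightarrow> j < n \<Longrightarrow> f i j \<in> X"
  proof -
    have "fmat n f \<in> mats n X" using f by (rule mat_in_mats)
    then have "N (map_mat (scaleC c) (fmat n f)) \<le> cmod c * N (fmat n f)"
      using assms unfolding matrix_gauge_def by blast
    moreover have "map_mat (scaleC c) (fmat n f) = fmat n (\<lambda>i j. c *\<^sub>C f i j)"
      by (rule eq_matI) auto
    ultimately show ?thesis by (simp only:)
  qed
qed (use assms in \<open>unfold matrix_gauge_def, blast+\<close>)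

lemma operator_space_matrix_gauge:
  assumes "operator_space X N" shows "matrix_gauge X N"
proof -
  have X: "complex_vector.subspace X" using assms by (simp add: operator_space_def)
  show ?thesis
    unfolding matrix_gauge_def
    using assms complex_vector.subspace_0[OF X] complex_vector.subspace_scale[OF X]
    by (auto simp: operator_space_def)
qed

text \<open>The equation \<open>u = \<alpha> (x \<otimes> y) \<beta>\<close> entry by entry, with
  pairs as inner indices in place of the numbering by \<open>div\<close> and \<open>mod\<close> in
  \<open>mat_tensor\<close>.\<close>

definition tensor_factorization ::
  "'a::complex_vector set \<Rightarrow> ('a mat \<Rightarrow> real) \<Rightarrow> 'b::complex_vector set \<Rightarrow> ('b mat \<Rightarrow> real)
    \<Rightarrow> nat \<Rightarrow> (nat \<Rightarrow> nat \<Rightarrow> ('a, 'b) tensor) \<Rightarrow> nat \<Rightarrow> nat \<Rightarrow> (nat \<Rightarrow> nat \<Rightarrow> 'a) \<Rightarrow> (nat \<Rightarrow> nat \<Rightarrow> 'b)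
    \<Rightarrow> (nat \<Rightarrow> nat \<times> nat \<Rightarrow> complex) \<Rightarrow> (nat \<times> nat \<Rightarrow> nat \<Rightarrow> complex) \<Rightarrow> bool" where
  "tensor_factorization X NX Y NY n u p q x y \<alpha> \<beta> \<longleftrightarrow>
     (\<forall>i<p. \<forall>j<p. x i j \<in> X) \<and> (\<forall>i<q. \<forall>j<q. y i j \<in> Y) \<and>
     (\<forall>i<n. \<forall>j<n. u i j = (\<Sum>\<kappa>\<in>{..<p} \<times> {..<q}. \<Sum>\<nu>\<in>{..<p} \<times> {..<q}.
        (\<alpha> i \<kappa> * \<beta> \<nu> j) *\<^sub>C tensor (x (fst \<kappa>) (fst \<nu>)) (y (snd \<kappa>) (snd \<nu>))))"

text \<open>\<open>op_rep n u r\<close> says that \<open>u\<close> factors through \<open>x \<otimes> y\<close> with \<open>x\<close>, \<open>y\<close> in the unit balls and with scalar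
  matrices of squared norm at most \<open>r\<close>. In this balanced form factorizations can be added.\<close>

definition op_rep ::
  "'a::complex_vector set \<Rightarrow> ('a mat \<Rightarrow> real) \<Rightarrow> 'b::complex_vector set \<Rightarrow> ('b mat \<Rightarrow> real)
    \<Rightarrow> nat \<Rightarrow> (nat \<Rightarrow> nat \<Rightarrow> ('a, 'b) tensor) \<Rightarrow> real \<Rightarrow> bool" where
  "op_rep X NX Y NY n u r \<longleftrightarrow> r > 0 \<and> (\<exists>p q x y \<alpha> \<beta>.
     tensor_factorization X NX Y NY n u p q x y \<alpha> \<beta> \<and> NX (fmat p x) \<le> 1 \<and> NY (fmat q y) \<le> 1 \<and>
     opb {..<n} ({..<p} \<times> {..<q}) \<alpha> r \<and> opb ({..<p} \<times> {..<q}) {..<n} \<beta> r)"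

lemma op_repE:
  assumes "op_rep X NX Y NY n u r"
  obtains p q x y \<alpha> \<beta> where "r > 0" "\<And>i j. i < p \<Longrightarrow> j < p \<Longrightarrow> x i j \<in> X" "\<And>i j. i < q \<Longrightarrow> j < q \<Longrightarrow> y i j \<in> Y"
    "NX (fmat p x) \<le> 1" "NY (fmat q y) \<le> 1"
    "opb {..<n} ({..<p} \<times> {..<q}) \<alpha> r" "opb ({..<p} \<times> {..<q}) {..<n} \<beta> r"
    "\<And>i j. i < n \<Longrightarrow> j < n \<Longrightarrow> u i j = (\<Sum>\<kappa>\<in>{..<p} \<times> {..<q}. \<Sum>\<nu>\<in>{..<p} \<times> {..<q}.
        (\<alpha> i \<kappa> * \<beta> \<nu> j) *\<^sub>C tensor (x (fst \<kappa>) (fst \<nu>)) (y (snd \<kappa>) (snd \<nu>)))"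
proof -
  obtain p q x y \<alpha> \<beta> where f: "r > 0" "tensor_factorization X NX Y NY n u p q x y \<alpha> \<beta>"
     "NX (fmat p x) \<le> 1" "NY (fmat q y) \<le> 1"
     "opb {..<n} ({..<p} \<times> {..<q}) \<alpha> r" "opb ({..<p} \<times> {..<q}) {..<n} \<beta> r"
    using assms unfolding op_rep_def by (elim conjE exE) (rule that)
  from f(2) have "\<forall>i<p. \<forall>j<p. x i j \<in> X" "\<forall>i<q. \<forall>j<q. y i j \<in> Y"
    "\<forall>i<n. \<forall>j<n. u i j = (\<Sum>\<kappa>\<in>{..<p} \<times> {..<q}. \<Sum>\<nu>\<in>{..<p} \<times> {..<q}.
        (\<alpha> i \<kappa> * \<beta> \<nu> j) *\<^sub>C tensor (x (fst \<kappa>) (fst \<nu>)) (y (snd \<kappa>) (snd \<nu>)))"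
    unfolding tensor_factorization_def by simp_all
  then show thesis
    by (intro that[where p=p and q=q and x=x and y=y and \<alpha>=\<alpha> and \<beta>=\<beta>] f(1,3-6)) (simp_all only:)
qed

lemma op_repI:
  assumes "r > 0" "\<And>i j. i < p \<Longrightarrow> j < p \<Longrightarrow> x i j \<in> X" "\<And>i j. i < q \<Longrightarrow> j < q \<Longrightarrow> y i j \<in> Y"
    "NX (fmat p x) \<le> 1" "NY (fmat q y) \<le> 1"
    "opb {..<n} ({..<p} \<times> {..<q}) \<alpha> r" "opb ({..<p} \<times> {..<q}) {..<n} \<beta> r"
    "\<And>i j. i < n \<Longrightarrow> j < n \<Longrightarrow> u i j = (\<Sum>\<kappa>\<in>{..<p} \<times> {..<q}. \<Sum>\<nu>\<in>{..<p} \<times> {..<q}.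
        (\<alpha> i \<kappa> * \<beta> \<nu> j) *\<^sub>C tensor (x (fst \<kappa>) (fst \<nu>)) (y (snd \<kappa>) (snd \<nu>)))"
  shows "op_rep X NX Y NY n u r"
  unfolding op_rep_def tensor_factorization_def
  by (rule conjI[OF assms(1)], rule exI[of _ p], rule exI[of _ q], rule exI[of _ x], rule exI[of _ y],
      rule exI[of _ \<alpha>], rule exI[of _ \<beta>], intro conjI allI impI assms; assumption)

lemma tensor_scale_both: "tensor (c *\<^sub>C x) (d *\<^sub>C y) = (c * d) *\<^sub>C tensor x y"
  unfolding tensor_scale_left tensor_scale_right scaleC_scaleC by (simp add: mult.commute)

lemma sum_times_singleton:
  "(\<Sum>\<kappa>\<in>{..<n} \<times> {..<1::nat}. f \<kappa>) = (\<Sum>k<(n::nat). f (k, 0))"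
proof -
  have "{..<n} \<times> {..<1::nat} = (\<lambda>k. (k, 0)) ` {..<n}" by auto
  moreover have "inj_on (\<lambda>k. (k, 0::nat)) {..<n}" by (auto simp: inj_on_def)
  ultimately show ?thesis by (simp add: sum.reindex)
qed

text \<open>Rebalancing: \<open>x\<close> and \<open>y\<close> are brought into the unit balls, and
  their sizes are shared between the outer matrices so that both end with the same bound.\<close>

lemma op_rep_scaled:
  assumes gX: "matrix_gauge X NX" and gY: "matrix_gauge Y NY"
    and mem: "\<And>i j. i < p \<Longrightarrow> j < p \<Longrightarrow> x i j \<in> X" "\<And>i j. i < q \<Longrightarrow> j < q \<Longrightarrow> y i j \<in> Y"
    and pos: "a > 0" "b > 0" "s > 0" "t > 0"
    and N: "NX (fmat p x) \<le> s" "NY (fmat q y) \<le> t"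
    and o: "opb {..<n} ({..<p} \<times> {..<q}) \<alpha> (a\<^sup>2)" "opb ({..<p} \<times> {..<q}) {..<n} \<beta> (b\<^sup>2)"
    and u: "\<And>i j. i < n \<Longrightarrow> j < n \<Longrightarrow> u i j = (\<Sum>\<kappa>\<in>{..<p} \<times> {..<q}. \<Sum>\<nu>\<in>{..<p} \<times> {..<q}.
        (\<alpha> i \<kappa> * \<beta> \<nu> j) *\<^sub>C tensor (x (fst \<kappa>) (fst \<nu>)) (y (snd \<kappa>) (snd \<nu>)))"
  shows "op_rep X NX Y NY n u (a * s * t * b)"
proof -
  define P where "P = a * s * t * b"
  have P: "P > 0" using pos by (simp add: P_def)
  \<comment> \<open>Chosen so that \<open>g * a\<close> and \<open>h * b\<close> both equal
    \<open>sqrt P\<close>; then \<open>g * h = s * t\<close> compensates exactly the factors taken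
    out of \<open>x\<close> and \<open>y\<close>.\<close>
  define g h where "g = sqrt P / a" and "h = sqrt P / b"
  have gh: "g * h = s * t"
    using pos P by (simp add: g_def h_def) (simp add: P_def)
  show ?thesis
    unfolding P_def[symmetric]
  proof (rule op_repI[where p=p and q=q and x="\<lambda>i j. scR (1/s) (x i j)" and y="\<lambda>i j. scR (1/t) (y i j)"
        and \<alpha>="\<lambda>i \<kappa>. of_real g * \<alpha> i \<kappa>" and \<beta>="\<lambda>\<kappa> i. of_real h * \<beta> \<kappa> i"])
    show "P > 0" by fact
    show "scR (1/s) (x i j) \<in> X" if "i < p" "j < p" for i j
      using matrix_gaugeD(2)[OF gX mem(1)[OF that]] .
    show "scR (1/t) (y i j) \<in> Y" if "i < q" "j < q" for i j
      using matrix_gaugeD(2)[OF gY mem(2)[OF that]] .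
    have "NX (fmat p (\<lambda>i j. scR (1/s) (x i j))) \<le> cmod (of_real (1/s)) * NX (fmat p x)"
      by (rule matrix_gaugeD(4)[OF gX]) (rule mem)
    also have "\<dots> \<le> cmod (of_real (1/s)) * s" by (rule mult_left_mono[OF N(1)]) simp
    also have "\<dots> = 1" using pos(3) by (simp add: norm_divide)
    finally show "NX (fmat p (\<lambda>i j. scR (1/s) (x i j))) \<le> 1" .
    have "NY (fmat q (\<lambda>i j. scR (1/t) (y i j))) \<le> cmod (of_real (1/t)) * NY (fmat q y)"
      by (rule matrix_gaugeD(4)[OF gY]) (rule mem)
    also have "\<dots> \<le> cmod (of_real (1/t)) * t" by (rule mult_left_mono[OF N(2)]) simp
    also have "\<dots> = 1" using pos(4) by (simp add: norm_divide)
    finally show "NY (fmat q (\<lambda>i j. scR (1/t) (y i j))) \<le> 1" .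
    have "(cmod (of_real g))\<^sup>2 * a\<^sup>2 = P" "(cmod (of_real h))\<^sup>2 * b\<^sup>2 = P"
      using pos P by (simp_all add: g_def h_def norm_divide power_divide)
    then show "opb {..<n} ({..<p} \<times> {..<q}) (\<lambda>i \<kappa>. of_real g * \<alpha> i \<kappa>) P"
      "opb ({..<p} \<times> {..<q}) {..<n} (\<lambda>\<kappa> i. of_real h * \<beta> \<kappa> i) P"
      using opb_scale[OF o(1), of "of_real g"] opb_scale[OF o(2), of "of_real h"] by simp_all
    fix i j assume ij: "i < n" "j < n"
    have "((of_real g * \<alpha> i \<kappa>) * (of_real h * \<beta> \<nu> j)) *\<^sub>C tensor (scR (1/s) (x k l)) (scR (1/t) (y k' l'))
        = (\<alpha> i \<kappa> * \<beta> \<nu> j) *\<^sub>C tensor (x k l) (y k' l')" for \<kappa> \<nu> k l k' l'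
    proof -
      have "(of_real g * \<alpha> i \<kappa>) * (of_real h * \<beta> \<nu> j) * (complex_of_real (1/s) * complex_of_real (1/t))
        = (\<alpha> i \<kappa> * \<beta> \<nu> j) * of_real (g * h * (1/s) * (1/t))" by simp
      also have "g * h * (1/s) * (1/t) = 1" unfolding gh using pos by simp
      finally have e: "(of_real g * \<alpha> i \<kappa>) * (of_real h * \<beta> \<nu> j) * (complex_of_real (1/s) * complex_of_real (1/t))
        = \<alpha> i \<kappa> * \<beta> \<nu> j" by simp
      show ?thesis unfolding tensor_scale_both scaleC_scaleC e ..
    qed
    then show "u i j = (\<Sum>\<kappa>\<in>{..<p} \<times> {..<q}. \<Sum>\<nu>\<in>{..<p} \<times> {..<q}.
        ((of_real g * \<alpha> i \<kappa>) * (of_real h * \<beta> \<nu> j)) *\<^sub>C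
          tensor (scR (1/s) (x (fst \<kappa>) (fst \<nu>))) (scR (1/t) (y (snd \<kappa>) (snd \<nu>))))"
      unfolding u[OF ij] by (simp only:)
  qed
qed

text \<open>As \<open>y\<close> is a single vector, the outer matrices are identities, read along
  the index set \<open>n \<times> 1\<close>.\<close>

lemma op_rep_tensor:
  assumes gX: "matrix_gauge X NX" and gY: "matrix_gauge Y NY"
    and mem: "\<And>i j. i < n \<Longrightarrow> j < n \<Longrightarrow> x i j \<in> X" "y \<in> Y" and pos: "s > 0" "t > 0"
    and N: "NX (fmat n x) \<le> s" "norm1 NY y \<le> t"
  shows "op_rep X NX Y NY n (\<lambda>i j. tensor (x i j) y) (s * t)"
proof -
  have "op_rep X NX Y NY n (\<lambda>i j. tensor (x i j) y) (1 * s * t * 1)"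
  proof (rule op_rep_scaled[OF gX gY, where p=n and q=1 and x=x and y="\<lambda>_ _. y" and
        \<alpha>="\<lambda>i \<kappa>. if i = fst \<kappa> then 1 else 0" and \<beta>="\<lambda>\<kappa> i. if i = fst \<kappa> then 1 else 0"])
    note S = sum_times_singleton
    have D: "(\<Sum>k<n. (if i = k then 1 else 0) * f k) = (if i < n then f i else 0)" for i and f :: "nat \<Rightarrow> complex"
    proof -
      have "(\<Sum>k<n. (if i = k then 1 else 0) * f k) = (\<Sum>k<n. if i = k then f k else 0)"
        by (intro sum.cong) auto
      then show ?thesis by (simp add: sum.delta')
    qed
    have D': "(\<Sum>k<n. (if k = i then 1 else 0) * f k) = (if i < n then f i else 0)" for i and f :: "nat \<Rightarrow> complex"
      using D[of i f] by (simp only: eq_commute)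
    show "opb {..<n} ({..<n} \<times> {..<1::nat}) (\<lambda>i \<kappa>. if i = fst \<kappa> then 1 else 0) (1\<^sup>2)"
      unfolding opb_def S fst_conv D by simp
    show "opb ({..<n} \<times> {..<1::nat}) {..<n} (\<lambda>\<kappa> i. if i = fst \<kappa> then 1 else 0) (1\<^sup>2)"
      unfolding opb_def S fst_conv D' by simp
    show "NY (fmat 1 (\<lambda>_ _. y)) \<le> t" using N(2) unfolding norm1_def case_prod_unfold .
    fix i j assume ij: "i < n" "j < n"
    have "(\<Sum>\<kappa>\<in>{..<n} \<times> {..<1::nat}. \<Sum>\<nu>\<in>{..<n} \<times> {..<1::nat}.
        ((if i = fst \<kappa> then 1 else 0) * (if j = fst \<nu> then 1 else 0)) *\<^sub>C tensor (x (fst \<kappa>) (fst \<nu>)) y)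
      = (\<Sum>k<n. \<Sum>l<n. if i = k then (if j = l then tensor (x k l) y else 0) else 0)"
      unfolding S by (intro sum.cong refl) (auto simp: scaleC_one)
    also have "\<dots> = (\<Sum>k<n. if i = k then (\<Sum>l<n. if j = l then tensor (x k l) y else 0) else 0)"
      by (intro sum.cong refl) auto
    also have "\<dots> = tensor (x i j) y" using ij by (simp only: sum.delta' finite_lessThan lessThan_iff if_True)
    finally show "tensor (x i j) y = (\<Sum>\<kappa>\<in>{..<n} \<times> {..<1::nat}. \<Sum>\<nu>\<in>{..<n} \<times> {..<1::nat}.
        ((if i = fst \<kappa> then 1 else 0) * (if j = fst \<nu> then 1 else 0)) *\<^sub>C tensor (x (fst \<kappa>) (fst \<nu>)) y)"
      by (rule sym)
  qed (use mem pos N in auto)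
  then show ?thesis by simp
qed

text \<open>Row \<open>i0\<close> of the left matrix and column \<open>j0\<close> of the right one
  carry the given factorization. Together with addition this assembles a matrix from its
  entries.\<close>

lemma op_rep_single:
  assumes r: "op_rep X NX Y NY 1 (\<lambda>_ _. v) r"
  shows "op_rep X NX Y NY n (\<lambda>i j. if i = i0 \<and> j = j0 then v else 0) r"
proof -
  obtain p q x y \<alpha> \<beta> where w: "r > 0" "\<And>i j. i < p \<Longrightarrow> j < p \<Longrightarrow> x i j \<in> X" "\<And>i j. i < q \<Longrightarrow> j < q \<Longrightarrow> y i j \<in> Y"
    "NX (fmat p x) \<le> 1" "NY (fmat q y) \<le> 1"
    "opb {..<1::nat} ({..<p} \<times> {..<q}) \<alpha> r" "opb ({..<p} \<times> {..<q}) {..<1::nat} \<beta> r"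
    and u: "\<And>i j :: nat. i < 1 \<Longrightarrow> j < 1 \<Longrightarrow> v = (\<Sum>\<kappa>\<in>{..<p} \<times> {..<q}. \<Sum>\<nu>\<in>{..<p} \<times> {..<q}.
        (\<alpha> i \<kappa> * \<beta> \<nu> j) *\<^sub>C tensor (x (fst \<kappa>) (fst \<nu>)) (y (snd \<kappa>) (snd \<nu>)))"
    using r by (rule op_repE) blast
  let ?I = "{..<p} \<times> {..<q}"
  let ?\<alpha> = "\<lambda>i \<kappa>. if i = i0 then \<alpha> 0 \<kappa> else 0" and ?\<beta> = "\<lambda>\<kappa> j. if j = j0 then \<beta> \<kappa> 0 else 0"
  show ?thesis
  proof (rule op_repI[where p=p and q=q and x=x and y=y and \<alpha>="?\<alpha>" and \<beta>="?\<beta>"])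
    show "opb {..<n} ?I ?\<alpha> r"
    proof (rule opbI)
      fix z :: "nat \<times> nat \<Rightarrow> complex"
      have "(\<Sum>i<n. (cmod (\<Sum>\<kappa>\<in>?I. ?\<alpha> i \<kappa> * z \<kappa>))\<^sup>2) = (\<Sum>i<n. if i = i0 then (cmod (\<Sum>\<kappa>\<in>?I. \<alpha> 0 \<kappa> * z \<kappa>))\<^sup>2 else 0)"
        by (intro sum.cong refl) auto
      also have "\<dots> \<le> (cmod (\<Sum>\<kappa>\<in>?I. \<alpha> 0 \<kappa> * z \<kappa>))\<^sup>2" by (simp add: sum.delta)
      also have "\<dots> \<le> r * (\<Sum>\<kappa>\<in>?I. (cmod (z \<kappa>))\<^sup>2)" using opbD[OF w(6), of z] by simp
      finally show "(\<Sum>i<n. (cmod (\<Sum>\<kappa>\<in>?I. ?\<alpha> i \<kappa> * z \<kappa>))\<^sup>2) \<le> r * (\<Sum>\<kappa>\<in>?I. (cmod (z \<kappa>))\<^sup>2)" .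
    qed
    show "opb ?I {..<n} ?\<beta> r"
    proof (rule opbI)
      fix z :: "nat \<Rightarrow> complex"
      have e: "(\<Sum>j<n. ?\<beta> \<kappa> j * z j) = (if j0 < n then \<beta> \<kappa> 0 * z j0 else 0)" for \<kappa>
      proof -
        have "(\<Sum>j<n. ?\<beta> \<kappa> j * z j) = (\<Sum>j<n. if j = j0 then \<beta> \<kappa> 0 * z j else 0)"
          by (intro sum.cong refl) auto
        then show ?thesis by (simp add: sum.delta)
      qed
      show "(\<Sum>\<kappa>\<in>?I. (cmod (\<Sum>j<n. ?\<beta> \<kappa> j * z j))\<^sup>2) \<le> r * (\<Sum>j<n. (cmod (z j))\<^sup>2)"
      proof (cases "j0 < n")
        case True
        have "(\<Sum>\<kappa>\<in>?I. (cmod (\<beta> \<kappa> 0 * z j0))\<^sup>2) \<le> r * (cmod (z j0))\<^sup>2"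
          using opbD[OF w(7), of "\<lambda>_. z j0"] by simp
        also have "\<dots> \<le> r * (\<Sum>j<n. (cmod (z j))\<^sup>2)"
          using True w(1) by (intro mult_left_mono member_le_sum[of j0 "{..<n}" "\<lambda>j. (cmod (z j))\<^sup>2"]) auto
        finally show ?thesis unfolding e using True by simp
      next
        case False
        then show ?thesis unfolding e using w(1) by (simp add: sum_nonneg)
      qed
    qed
    fix i j
    show "(if i = i0 \<and> j = j0 then v else 0) = (\<Sum>\<kappa>\<in>?I. \<Sum>\<nu>\<in>?I.
        (?\<alpha> i \<kappa> * ?\<beta> \<nu> j) *\<^sub>C tensor (x (fst \<kappa>) (fst \<nu>)) (y (snd \<kappa>) (snd \<nu>)))"
    proof (cases "i = i0 \<and> j = j0")
      case True
      then show ?thesis using u[of 0 0] by simp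
    next
      case False
      then have "(?\<alpha> i \<kappa> * ?\<beta> \<nu> j) = 0" for \<kappa> \<nu> by auto
      then show ?thesis using False by (simp only: complex_vector.scale_zero_left sum.neutral_const if_False)
    qed
  qed (use w in auto)
qed

lemma op_rep_scale:
  assumes r: "op_rep X NX Y NY n u r" and c: "c \<noteq> 0"
  shows "op_rep X NX Y NY n (\<lambda>i j. c *\<^sub>C u i j) (cmod c * r)"
proof -
  obtain p q x y \<alpha> \<beta> where w: "r > 0" "\<And>i j. i < p \<Longrightarrow> j < p \<Longrightarrow> x i j \<in> X" "\<And>i j. i < q \<Longrightarrow> j < q \<Longrightarrow> y i j \<in> Y"
    "NX (fmat p x) \<le> 1" "NY (fmat q y) \<le> 1"
    "opb {..<n} ({..<p} \<times> {..<q}) \<alpha> r" "opb ({..<p} \<times> {..<q}) {..<n} \<beta> r"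
    and u: "\<And>i j. i < n \<Longrightarrow> j < n \<Longrightarrow> u i j = (\<Sum>\<kappa>\<in>{..<p} \<times> {..<q}. \<Sum>\<nu>\<in>{..<p} \<times> {..<q}.
        (\<alpha> i \<kappa> * \<beta> \<nu> j) *\<^sub>C tensor (x (fst \<kappa>) (fst \<nu>)) (y (snd \<kappa>) (snd \<nu>)))"
    using r by (rule op_repE) blast
  \<comment> \<open>Splits \<open>c\<close> into two factors of equal modulus, which keeps the
    factorization balanced.\<close>
  define h where "h = complex_of_real (sqrt (cmod c))"
  have h: "h \<noteq> 0" "(cmod h)\<^sup>2 = cmod c" using c by (simp_all add: h_def)
  have ch: "(cmod (c / h))\<^sup>2 = cmod c"
    using c by (simp add: norm_divide power_divide h(2)) (simp add: power2_eq_square)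
  show ?thesis
  proof (rule op_repI[where p=p and q=q and x=x and y=y and \<alpha>="\<lambda>i \<kappa>. (c / h) * \<alpha> i \<kappa>" and \<beta>="\<lambda>\<kappa> i. h * \<beta> \<kappa> i"])
    show "opb {..<n} ({..<p} \<times> {..<q}) (\<lambda>i \<kappa>. (c / h) * \<alpha> i \<kappa>) (cmod c * r)"
      using opb_scale[OF w(6), of "c / h"] unfolding ch .
    show "opb ({..<p} \<times> {..<q}) {..<n} (\<lambda>\<kappa> i. h * \<beta> \<kappa> i) (cmod c * r)"
      using opb_scale[OF w(7), of h] unfolding h(2) .
    fix i j assume ij: "i < n" "j < n"
    have "((c / h) * \<alpha> i \<kappa>) * (h * \<beta> \<nu> j) = c * (\<alpha> i \<kappa> * \<beta> \<nu> j)" for \<kappa> \<nu> using h(1) by simp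
    then show "c *\<^sub>C u i j = (\<Sum>\<kappa>\<in>{..<p} \<times> {..<q}. \<Sum>\<nu>\<in>{..<p} \<times> {..<q}.
        (((c / h) * \<alpha> i \<kappa>) * (h * \<beta> \<nu> j)) *\<^sub>C tensor (x (fst \<kappa>) (fst \<nu>)) (y (snd \<kappa>) (snd \<nu>)))"
      unfolding u[OF ij] by (simp only: complex_vector.scale_sum_right scaleC_scaleC)
  qed (use w c in auto)
qed

lemma op_rep_cong:
  assumes "op_rep X NX Y NY n u r" "\<And>i j. i < n \<Longrightarrow> j < n \<Longrightarrow> u i j = v i j"
  shows "op_rep X NX Y NY n v r"
proof -
  obtain p q x y \<alpha> \<beta> where w: "r > 0" "\<And>i j. i < p \<Longrightarrow> j < p \<Longrightarrow> x i j \<in> X" "\<And>i j. i < q \<Longrightarrow> j < q \<Longrightarrow> y i j \<in> Y"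
    "NX (fmat p x) \<le> 1" "NY (fmat q y) \<le> 1"
    "opb {..<n} ({..<p} \<times> {..<q}) \<alpha> r" "opb ({..<p} \<times> {..<q}) {..<n} \<beta> r"
    and u: "\<And>i j. i < n \<Longrightarrow> j < n \<Longrightarrow> u i j = (\<Sum>\<kappa>\<in>{..<p} \<times> {..<q}. \<Sum>\<nu>\<in>{..<p} \<times> {..<q}.
        (\<alpha> i \<kappa> * \<beta> \<nu> j) *\<^sub>C tensor (x (fst \<kappa>) (fst \<nu>)) (y (snd \<kappa>) (snd \<nu>)))"
    using assms(1) by (rule op_repE) blast
  show ?thesis
    by (rule op_repI[where p=p and q=q and x=x and y=y and \<alpha>=\<alpha> and \<beta>=\<beta>], (rule w; assumption?)+)
      (simp only: assms(2)[symmetric] u)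
qed

lemma op_rep_mono:
  assumes r: "op_rep X NX Y NY n u r" and s: "r \<le> s"
  shows "op_rep X NX Y NY n u s"
proof -
  obtain p q x y \<alpha> \<beta> where w: "r > 0" "\<And>i j. i < p \<Longrightarrow> j < p \<Longrightarrow> x i j \<in> X" "\<And>i j. i < q \<Longrightarrow> j < q \<Longrightarrow> y i j \<in> Y"
    "NX (fmat p x) \<le> 1" "NY (fmat q y) \<le> 1"
    "opb {..<n} ({..<p} \<times> {..<q}) \<alpha> r" "opb ({..<p} \<times> {..<q}) {..<n} \<beta> r"
    and u: "\<And>i j. i < n \<Longrightarrow> j < n \<Longrightarrow> u i j = (\<Sum>\<kappa>\<in>{..<p} \<times> {..<q}. \<Sum>\<nu>\<in>{..<p} \<times> {..<q}.
        (\<alpha> i \<kappa> * \<beta> \<nu> j) *\<^sub>C tensor (x (fst \<kappa>) (fst \<nu>)) (y (snd \<kappa>) (snd \<nu>)))"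
    using r by (rule op_repE) blast
  show ?thesis
  proof (rule op_repI[where p=p and q=q and x=x and y=y and \<alpha>=\<alpha> and \<beta>=\<beta>])
    show "s > 0" using w(1) s by simp
    show "opb {..<n} ({..<p} \<times> {..<q}) \<alpha> s" "opb ({..<p} \<times> {..<q}) {..<n} \<beta> s"
      using opb_mono[OF w(6) s] opb_mono[OF w(7) s] .
  qed ((rule w(2-5) u; assumption)+)
qed

text \<open>The index pairs of a product of two direct sums fall into four blocks. When
  factorizations are added, the outer matrices live on the two unmixed ones.\<close>

lemma sum_two_blocks:
  fixes f :: "nat \<times> nat \<Rightarrow> 'c::comm_monoid_add"
  assumes z: "\<And>\<kappa>. \<kappa> \<in> {..<p1 + p2} \<times> {..<q1 + q2} \<Longrightarrow> \<kappa> \<notin> {..<p1} \<times> {..<q1} \<Longrightarrow>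
      \<kappa> \<notin> (\<lambda>\<kappa>. (p1 + fst \<kappa>, q1 + snd \<kappa>)) ` ({..<p2} \<times> {..<q2}) \<Longrightarrow> f \<kappa> = 0"
  shows "(\<Sum>\<kappa>\<in>{..<p1 + p2} \<times> {..<q1 + q2}. f \<kappa>) =
    (\<Sum>\<kappa>\<in>{..<p1} \<times> {..<q1}. f \<kappa>) + (\<Sum>\<kappa>\<in>{..<p2} \<times> {..<q2}. f (p1 + fst \<kappa>, q1 + snd \<kappa>))"
proof -
  let ?sh = "\<lambda>\<kappa>. (p1 + fst \<kappa>, q1 + snd \<kappa>)"
  let ?I1 = "{..<p1} \<times> {..<q1}" and ?I2 = "{..<p2} \<times> {..<q2}"
  have inj: "inj_on ?sh ?I2" by (auto simp: inj_on_def)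
  have "(\<Sum>\<kappa>\<in>{..<p1 + p2} \<times> {..<q1 + q2}. f \<kappa>) = (\<Sum>\<kappa>\<in>?I1 \<union> ?sh ` ?I2. f \<kappa>)"
    by (rule sum.mono_neutral_right) (use z in auto)
  also have "\<dots> = (\<Sum>\<kappa>\<in>?I1. f \<kappa>) + (\<Sum>\<kappa>\<in>?sh ` ?I2. f \<kappa>)"
    by (rule sum.union_disjoint) auto
  also have "(\<Sum>\<kappa>\<in>?sh ` ?I2. f \<kappa>) = (\<Sum>\<kappa>\<in>?I2. f (?sh \<kappa>))"
    by (rule sum.reindex_cong[OF inj]) auto
  finally show ?thesis .
qed

lemma sum_two_blocks_le:
  fixes f :: "nat \<times> nat \<Rightarrow> real"
  assumes z: "\<And>\<kappa>. 0 \<le> f \<kappa>"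
  shows "(\<Sum>\<kappa>\<in>{..<p1} \<times> {..<q1}. f \<kappa>) + (\<Sum>\<kappa>\<in>{..<p2} \<times> {..<q2}. f (p1 + fst \<kappa>, q1 + snd \<kappa>))
    \<le> (\<Sum>\<kappa>\<in>{..<p1 + p2} \<times> {..<q1 + q2}. f \<kappa>)"
proof -
  let ?S = "{..<p1} \<times> {..<q1} \<union> (\<lambda>\<kappa>. (p1 + fst \<kappa>, q1 + snd \<kappa>)) ` ({..<p2} \<times> {..<q2})"
  define g where "g \<kappa> = (if \<kappa> \<in> ?S then f \<kappa> else 0)" for \<kappa>
  have "(\<Sum>\<kappa>\<in>{..<p1 + p2} \<times> {..<q1 + q2}. g \<kappa>) =
    (\<Sum>\<kappa>\<in>{..<p1} \<times> {..<q1}. g \<kappa>) + (\<Sum>\<kappa>\<in>{..<p2} \<times> {..<q2}. g (p1 + fst \<kappa>, q1 + snd \<kappa>))"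
    by (rule sum_two_blocks) (simp add: g_def)
  also have "(\<Sum>\<kappa>\<in>{..<p1} \<times> {..<q1}. g \<kappa>) = (\<Sum>\<kappa>\<in>{..<p1} \<times> {..<q1}. f \<kappa>)"
    by (rule sum.cong) (auto simp: g_def)
  also have "(\<Sum>\<kappa>\<in>{..<p2} \<times> {..<q2}. g (p1 + fst \<kappa>, q1 + snd \<kappa>)) = (\<Sum>\<kappa>\<in>{..<p2} \<times> {..<q2}. f (p1 + fst \<kappa>, q1 + snd \<kappa>))"
    by (rule sum.cong) (auto simp: g_def)
  also have "(\<Sum>\<kappa>\<in>{..<p1 + p2} \<times> {..<q1 + q2}. g \<kappa>) \<le> (\<Sum>\<kappa>\<in>{..<p1 + p2} \<times> {..<q1 + q2}. f \<kappa>)"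
    by (rule sum_mono) (simp add: g_def z)
  ultimately show ?thesis by simp
qed

text \<open>Cauchy-Schwarz with weights \<open>r\<close> and \<open>s\<close>. The weights are what
  makes the costs of two factorizations add up to \<open>r1 + r2\<close>, without a further
  constant.\<close>

lemma cmod_add_squared_le:
  assumes "r > 0" "s > 0"
  shows "(cmod (a + b))\<^sup>2 \<le> (r + s) * ((cmod a)\<^sup>2 / r + (cmod b)\<^sup>2 / s)"
proof -
  have "(cmod (a + b))\<^sup>2 \<le> (cmod a + cmod b)\<^sup>2"
    by (intro power_mono norm_triangle_ineq) simp
  also have "\<dots> \<le> (r + s) * ((cmod a)\<^sup>2 / r + (cmod b)\<^sup>2 / s)"
  proof -
    have "0 \<le> (s * cmod a - r * cmod b)\<^sup>2 / (r * s)" using assms by simp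
    also have "\<dots> = (r + s) * ((cmod a)\<^sup>2 / r + (cmod b)\<^sup>2 / s) - (cmod a + cmod b)\<^sup>2"
      using assms by (simp add: field_simps power2_eq_square)
    finally show ?thesis by simp
  qed
  finally show ?thesis .
qed

lemma fmat_four_block:
  "fmat (p1 + p2) (\<lambda>i j. if i < p1 \<and> j < p1 then x i j else if p1 \<le> i \<and> p1 \<le> j then x' (i - p1) (j - p1) else 0)
    = four_block_mat (fmat p1 x) (0\<^sub>m p1 p2) (0\<^sub>m p2 p1) (fmat p2 x')"
  by (rule eq_matI) auto

text \<open>The factorizations are placed side by side: direct sums in the middle, outer matrices
  extended by zero to the mixed index pairs. The exact cost \<open>r1 + r2\<close> is what the
  triangle inequality for the norm demands.\<close>

lemma op_rep_add:
  assumes gX: "matrix_gauge X NX" and gY: "matrix_gauge Y NY"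
    and r1: "op_rep X NX Y NY n u1 r1" and r2: "op_rep X NX Y NY n u2 r2"
  shows "op_rep X NX Y NY n (\<lambda>i j. u1 i j + u2 i j) (r1 + r2)"
proof -
  obtain p1 q1 x1 y1 \<alpha>1 \<beta>1 where w1: "r1 > 0" "\<And>i j. i < p1 \<Longrightarrow> j < p1 \<Longrightarrow> x1 i j \<in> X"
    "\<And>i j. i < q1 \<Longrightarrow> j < q1 \<Longrightarrow> y1 i j \<in> Y"
    "NX (fmat p1 x1) \<le> 1" "NY (fmat q1 y1) \<le> 1"
    "opb {..<n} ({..<p1} \<times> {..<q1}) \<alpha>1 r1" "opb ({..<p1} \<times> {..<q1}) {..<n} \<beta>1 r1"
    and u1: "\<And>i j. i < n \<Longrightarrow> j < n \<Longrightarrow> u1 i j = (\<Sum>\<kappa>\<in>{..<p1} \<times> {..<q1}. \<Sum>\<nu>\<in>{..<p1} \<times> {..<q1}.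
        (\<alpha>1 i \<kappa> * \<beta>1 \<nu> j) *\<^sub>C tensor (x1 (fst \<kappa>) (fst \<nu>)) (y1 (snd \<kappa>) (snd \<nu>)))"
    using r1 by (rule op_repE) blast
  obtain p2 q2 x2 y2 \<alpha>2 \<beta>2 where w2: "r2 > 0" "\<And>i j. i < p2 \<Longrightarrow> j < p2 \<Longrightarrow> x2 i j \<in> X"
    "\<And>i j. i < q2 \<Longrightarrow> j < q2 \<Longrightarrow> y2 i j \<in> Y"
    "NX (fmat p2 x2) \<le> 1" "NY (fmat q2 y2) \<le> 1"
    "opb {..<n} ({..<p2} \<times> {..<q2}) \<alpha>2 r2" "opb ({..<p2} \<times> {..<q2}) {..<n} \<beta>2 r2"
    and u2: "\<And>i j. i < n \<Longrightarrow> j < n \<Longrightarrow> u2 i j = (\<Sum>\<kappa>\<in>{..<p2} \<times> {..<q2}. \<Sum>\<nu>\<in>{..<p2} \<times> {..<q2}.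
        (\<alpha>2 i \<kappa> * \<beta>2 \<nu> j) *\<^sub>C tensor (x2 (fst \<kappa>) (fst \<nu>)) (y2 (snd \<kappa>) (snd \<nu>)))"
    using r2 by (rule op_repE) blast
  let ?I1 = "{..<p1} \<times> {..<q1}" and ?I2 = "{..<p2} \<times> {..<q2}" and ?I = "{..<p1 + p2} \<times> {..<q1 + q2}"
  let ?sh = "\<lambda>\<kappa>. (p1 + fst \<kappa>, q1 + snd \<kappa>)"
  define x where "x i j = (if i < p1 \<and> j < p1 then x1 i j else if p1 \<le> i \<and> p1 \<le> j then x2 (i - p1) (j - p1) else 0)" for i j
  define y where "y i j = (if i < q1 \<and> j < q1 then y1 i j else if q1 \<le> i \<and> q1 \<le> j then y2 (i - q1) (j - q1) else 0)" for i j
  define \<alpha> where "\<alpha> i \<kappa> = (if \<kappa> \<in> ?I1 then \<alpha>1 i \<kappa> else if \<kappa> \<in> ?sh ` ?I2 then \<alpha>2 i (fst \<kappa> - p1, snd \<kappa> - q1) else 0)" for i \<kappa>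
  define \<beta> where "\<beta> \<kappa> j = (if \<kappa> \<in> ?I1 then \<beta>1 \<kappa> j else if \<kappa> \<in> ?sh ` ?I2 then \<beta>2 (fst \<kappa> - p1, snd \<kappa> - q1) j else 0)" for \<kappa> j
  have out: "\<alpha> i \<kappa> = 0" "\<beta> \<kappa> j = 0" if "\<kappa> \<notin> ?I1" "\<kappa> \<notin> ?sh ` ?I2" for i j \<kappa>
    using that unfolding \<alpha>_def \<beta>_def by (simp_all only: if_False)
  have in1: "\<alpha> i \<kappa> = \<alpha>1 i \<kappa>" "\<beta> \<kappa> j = \<beta>1 \<kappa> j" if "\<kappa> \<in> ?I1" for i j \<kappa>
    using that unfolding \<alpha>_def \<beta>_def by (simp_all only: if_True)
  have in2: "\<alpha> i (?sh \<kappa>) = \<alpha>2 i \<kappa>" "\<beta> (?sh \<kappa>) j = \<beta>2 \<kappa> j" if "\<kappa> \<in> ?I2" for i j \<kappa>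
  proof -
    have "?sh \<kappa> \<notin> ?I1" "?sh \<kappa> \<in> ?sh ` ?I2" using that by auto
    then show "\<alpha> i (?sh \<kappa>) = \<alpha>2 i \<kappa>" "\<beta> (?sh \<kappa>) j = \<beta>2 \<kappa> j"
      unfolding \<alpha>_def \<beta>_def by (simp_all only: if_True if_False fst_conv snd_conv add_diff_cancel_left' prod.collapse)
  qed
  have x11: "x (fst \<kappa>) (fst \<nu>) = x1 (fst \<kappa>) (fst \<nu>)" "y (snd \<kappa>) (snd \<nu>) = y1 (snd \<kappa>) (snd \<nu>)"
    if "\<kappa> \<in> ?I1" "\<nu> \<in> ?I1" for \<kappa> \<nu> using that by (auto simp: x_def y_def)
  have x22: "x (fst (?sh \<kappa>)) (fst (?sh \<nu>)) = x2 (fst \<kappa>) (fst \<nu>)" "y (snd (?sh \<kappa>)) (snd (?sh \<nu>)) = y2 (snd \<kappa>) (snd \<nu>)"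
    if "\<kappa> \<in> ?I2" "\<nu> \<in> ?I2" for \<kappa> \<nu> by (simp_all add: x_def y_def)
  \<comment> \<open>A pair from one block against a pair from the other meets a zero entry of
    \<open>x\<close>, which kills the tensor.\<close>
  have x12: "x (fst \<kappa>) (fst (?sh \<nu>)) = 0" "x (fst (?sh \<nu>)) (fst \<kappa>) = 0"
    if "\<kappa> \<in> ?I1" "\<nu> \<in> ?I2" for \<kappa> \<nu> using that by (auto simp: x_def)
  show ?thesis
  proof (rule op_repI[where p="p1 + p2" and q="q1 + q2" and x=x and y=y and \<alpha>=\<alpha> and \<beta>=\<beta>])
    show "r1 + r2 > 0" using w1(1) w2(1) by simp
    show "x i j \<in> X" if "i < p1 + p2" "j < p1 + p2" for i j
    proof -
      have "p1 \<le> i \<Longrightarrow> i - p1 < p2" "p1 \<le> j \<Longrightarrow> j - p1 < p2" using that by auto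
      then show ?thesis using w1(2)[of i j] w2(2)[of "i - p1" "j - p1"] matrix_gaugeD(1)[OF gX]
        unfolding x_def by presburger
    qed
    show "y i j \<in> Y" if "i < q1 + q2" "j < q1 + q2" for i j
    proof -
      have "q1 \<le> i \<Longrightarrow> i - q1 < q2" "q1 \<le> j \<Longrightarrow> j - q1 < q2" using that by auto
      then show ?thesis using w1(3)[of i j] w2(3)[of "i - q1" "j - q1"] matrix_gaugeD(1)[OF gY]
        unfolding y_def by presburger
    qed
    have "NX (fmat (p1 + p2) x) \<le> max (NX (fmat p1 x1)) (NX (fmat p2 x2))"
      unfolding x_def fmat_four_block by (rule matrix_gaugeD(5)[OF gX]) (rule mat_in_mats; fact w1(2) w2(2))+
    then show "NX (fmat (p1 + p2) x) \<le> 1" using w1(4) w2(4) by simp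
    have "NY (fmat (q1 + q2) y) \<le> max (NY (fmat q1 y1)) (NY (fmat q2 y2))"
      unfolding y_def fmat_four_block by (rule matrix_gaugeD(5)[OF gY]) (rule mat_in_mats; fact w1(3) w2(3))+
    then show "NY (fmat (q1 + q2) y) \<le> 1" using w1(5) w2(5) by simp
    \<comment> \<open>The left matrix is a row of two blocks, whose contributions are added inside
      the modulus; this is where the weighted inequality is used.\<close>
    show "opb {..<n} ?I \<alpha> (r1 + r2)"
    proof (rule opbI)
      fix v :: "nat \<times> nat \<Rightarrow> complex"
      define A where "A i = (\<Sum>\<kappa>\<in>?I1. \<alpha>1 i \<kappa> * v \<kappa>)" for i
      define B where "B i = (\<Sum>\<kappa>\<in>?I2. \<alpha>2 i \<kappa> * v (?sh \<kappa>))" for i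
      have AB: "(\<Sum>\<kappa>\<in>?I. \<alpha> i \<kappa> * v \<kappa>) = A i + B i" for i
      proof -
        have "(\<Sum>\<kappa>\<in>?I. \<alpha> i \<kappa> * v \<kappa>) = (\<Sum>\<kappa>\<in>?I1. \<alpha> i \<kappa> * v \<kappa>) + (\<Sum>\<kappa>\<in>?I2. \<alpha> i (?sh \<kappa>) * v (?sh \<kappa>))"
          by (rule sum_two_blocks) (simp only: out not_False_eq_True mult_zero_left)
        then show ?thesis unfolding A_def B_def by (simp only: in1 in2 cong: sum.cong)
      qed
      have "(\<Sum>i<n. (cmod (\<Sum>\<kappa>\<in>?I. \<alpha> i \<kappa> * v \<kappa>))\<^sup>2) \<le> (\<Sum>i<n. (r1 + r2) * ((cmod (A i))\<^sup>2 / r1 + (cmod (B i))\<^sup>2 / r2))"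
        unfolding AB by (intro sum_mono cmod_add_squared_le w1(1) w2(1))
      also have "\<dots> = (r1 + r2) * ((\<Sum>i<n. (cmod (A i))\<^sup>2) / r1 + (\<Sum>i<n. (cmod (B i))\<^sup>2) / r2)"
        by (simp only: sum_distrib_left[symmetric] sum.distrib sum_divide_distrib[symmetric])
      also have "\<dots> \<le> (r1 + r2) * ((r1 * (\<Sum>\<kappa>\<in>?I1. (cmod (v \<kappa>))\<^sup>2)) / r1 + (r2 * (\<Sum>\<kappa>\<in>?I2. (cmod (v (?sh \<kappa>)))\<^sup>2)) / r2)"
        unfolding A_def B_def using w1(1) w2(1) opbD[OF w1(6), of v] opbD[OF w2(6), of "\<lambda>\<kappa>. v (?sh \<kappa>)"]
        by (intro mult_left_mono add_mono divide_right_mono) simp_all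
      also have "\<dots> = (r1 + r2) * ((\<Sum>\<kappa>\<in>?I1. (cmod (v \<kappa>))\<^sup>2) + (\<Sum>\<kappa>\<in>?I2. (cmod (v (?sh \<kappa>)))\<^sup>2))"
        using w1(1) w2(1) by simp
      also have "\<dots> \<le> (r1 + r2) * (\<Sum>\<kappa>\<in>?I. (cmod (v \<kappa>))\<^sup>2)"
        using w1(1) w2(1) by (intro mult_left_mono sum_two_blocks_le) simp_all
      finally show "(\<Sum>i<n. (cmod (\<Sum>\<kappa>\<in>?I. \<alpha> i \<kappa> * v \<kappa>))\<^sup>2) \<le> (r1 + r2) * (\<Sum>\<kappa>\<in>?I. (cmod (v \<kappa>))\<^sup>2)" .
    qed
    \<comment> \<open>The right matrix is a column of two blocks, so the squares simply add.\<close>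
    show "opb ?I {..<n} \<beta> (r1 + r2)"
    proof (rule opbI)
      fix v :: "nat \<Rightarrow> complex"
      have "(\<Sum>\<kappa>\<in>?I. (cmod (\<Sum>j<n. \<beta> \<kappa> j * v j))\<^sup>2)
        = (\<Sum>\<kappa>\<in>?I1. (cmod (\<Sum>j<n. \<beta> \<kappa> j * v j))\<^sup>2) + (\<Sum>\<kappa>\<in>?I2. (cmod (\<Sum>j<n. \<beta> (?sh \<kappa>) j * v j))\<^sup>2)"
        by (rule sum_two_blocks) (simp only: out not_False_eq_True mult_zero_left sum.neutral_const norm_zero zero_power2)
      also have "\<dots> = (\<Sum>\<kappa>\<in>?I1. (cmod (\<Sum>j<n. \<beta>1 \<kappa> j * v j))\<^sup>2) + (\<Sum>\<kappa>\<in>?I2. (cmod (\<Sum>j<n. \<beta>2 \<kappa> j * v j))\<^sup>2)"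
        by (simp only: in1 in2 cong: sum.cong)
      also have "\<dots> \<le> r1 * (\<Sum>j<n. (cmod (v j))\<^sup>2) + r2 * (\<Sum>j<n. (cmod (v j))\<^sup>2)"
        by (intro add_mono opbD w1(7) w2(7))
      finally show "(\<Sum>\<kappa>\<in>?I. (cmod (\<Sum>j<n. \<beta> \<kappa> j * v j))\<^sup>2) \<le> (r1 + r2) * (\<Sum>j<n. (cmod (v j))\<^sup>2)"
        by (simp only: distrib_right)
    qed
    fix i j assume ij: "i < n" "j < n"
    let ?g = "\<lambda>\<kappa> \<nu>. (\<alpha> i \<kappa> * \<beta> \<nu> j) *\<^sub>C tensor (x (fst \<kappa>) (fst \<nu>)) (y (snd \<kappa>) (snd \<nu>))"
    have inner: "(\<Sum>\<nu>\<in>?I. ?g \<kappa> \<nu>) = (\<Sum>\<nu>\<in>?I1. ?g \<kappa> \<nu>) + (\<Sum>\<nu>\<in>?I2. ?g \<kappa> (?sh \<nu>))" for \<kappa>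
      by (rule sum_two_blocks) (simp only: out not_False_eq_True mult_zero_right complex_vector.scale_zero_left)
    have "(\<Sum>\<kappa>\<in>?I. \<Sum>\<nu>\<in>?I. ?g \<kappa> \<nu>) = (\<Sum>\<kappa>\<in>?I1. \<Sum>\<nu>\<in>?I. ?g \<kappa> \<nu>) + (\<Sum>\<kappa>\<in>?I2. \<Sum>\<nu>\<in>?I. ?g (?sh \<kappa>) \<nu>)"
      by (rule sum_two_blocks) (simp only: out not_False_eq_True mult_zero_left complex_vector.scale_zero_left sum.neutral_const)
    also have "(\<Sum>\<kappa>\<in>?I1. \<Sum>\<nu>\<in>?I. ?g \<kappa> \<nu>) = u1 i j"
    proof -
      have z: "(\<Sum>\<nu>\<in>?I2. ?g \<kappa> (?sh \<nu>)) = 0" if "\<kappa> \<in> ?I1" for \<kappa>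
        by (rule sum.neutral, intro ballI) (simp only: x12(1)[OF that] tensor_0_left complex_vector.scale_zero_right)
      have "(\<Sum>\<nu>\<in>?I. ?g \<kappa> \<nu>) = (\<Sum>\<nu>\<in>?I1. (\<alpha>1 i \<kappa> * \<beta>1 \<nu> j) *\<^sub>C tensor (x1 (fst \<kappa>) (fst \<nu>)) (y1 (snd \<kappa>) (snd \<nu>)))"
        if "\<kappa> \<in> ?I1" for \<kappa>
        unfolding inner z[OF that] add_0_right
        by (rule sum.cong[OF refl]) (simp only: in1[OF that] in1 x11[OF that])
      then show ?thesis unfolding u1[OF ij] by (rule sum.cong[OF refl])
    qed
    also have "(\<Sum>\<kappa>\<in>?I2. \<Sum>\<nu>\<in>?I. ?g (?sh \<kappa>) \<nu>) = u2 i j"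
    proof -
      have z: "(\<Sum>\<nu>\<in>?I1. ?g (?sh \<kappa>) \<nu>) = 0" if "\<kappa> \<in> ?I2" for \<kappa>
        by (rule sum.neutral, intro ballI) (simp only: x12(2)[OF _ that] tensor_0_left complex_vector.scale_zero_right)
      have "(\<Sum>\<nu>\<in>?I. ?g (?sh \<kappa>) \<nu>) = (\<Sum>\<nu>\<in>?I2. (\<alpha>2 i \<kappa> * \<beta>2 \<nu> j) *\<^sub>C tensor (x2 (fst \<kappa>) (fst \<nu>)) (y2 (snd \<kappa>) (snd \<nu>)))"
        if "\<kappa> \<in> ?I2" for \<kappa>
        unfolding inner z[OF that] add_0_left
        by (rule sum.cong[OF refl]) (simp only: in2[OF that] in2 x22[OF that])
      then show ?thesis unfolding u2[OF ij] by (rule sum.cong[OF refl])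
    qed
    finally show "u1 i j + u2 i j = (\<Sum>\<kappa>\<in>?I. \<Sum>\<nu>\<in>?I. ?g \<kappa> \<nu>)" by (rule sym)
  qed
qed

section \<open>The operator space projective norm through factorizations\<close>

lemma bij_betw_div_mod:
  "bij_betw (\<lambda>k. (k div q, k mod q)) {..<p * q} ({..<p} \<times> {..<(q::nat)})"
proof (rule bij_betw_byWitness[where f'="\<lambda>(a, b). a * q + b"])
  show "(\<lambda>k. (k div q, k mod q)) ` {..<p * q} \<subseteq> {..<p} \<times> {..<q}"
  proof (intro subsetI, elim imageE, hypsubst)
    fix k assume "k \<in> {..<p * q}"
    then have k: "k < p * q" by simp
    then have "q > 0" by (metis gr0I less_nat_zero_code mult_0_right)
    then show "(k div q, k mod q) \<in> {..<p} \<times> {..<q}" using k by (simp add: less_mult_imp_div_less)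
  qed
  show "(\<lambda>(a, b). a * q + b) ` ({..<p} \<times> {..<q}) \<subseteq> {..<p * q}"
  proof (intro subsetI, elim imageE, hypsubst)
    fix z assume "z \<in> {..<p} \<times> {..<q}"
    then obtain a b where z: "z = (a, b)" "a < p" "b < q" by auto
    have "a * q + b < a * q + q" using z by simp
    also have "\<dots> = Suc a * q" by simp
    also have "\<dots> \<le> p * q" using z by (intro mult_le_mono1) simp
    finally show "(case z of (a, b) \<Rightarrow> a * q + b) \<in> {..<p * q}" using z by simp
  qed
qed auto

context
  fixes X :: "'a::complex_vector set" and NX and Y :: "'b::complex_vector set" and NY
  assumes gX: "matrix_gauge X NX" and gY: "matrix_gauge Y NY"
begin

abbreviation "op_costs u \<equiv> {mat_opnorm \<alpha> * NX x * NY y * mat_opnorm \<beta> | \<alpha> x y \<beta> p q.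
     x \<in> mats p X \<and> y \<in> mats q Y
     \<and> \<alpha> \<in> carrier_mat (dim_row u) (p * q) \<and> \<beta> \<in> carrier_mat (p * q) (dim_col u)
     \<and> u = scal_mult \<alpha> (mat_tensor x y) \<beta>}"

lemma op_costs_nonneg: "c \<in> op_costs u \<Longrightarrow> 0 \<le> c"
proof -
  assume "c \<in> op_costs u"
  then obtain \<alpha> x y \<beta> p q where c: "c = mat_opnorm \<alpha> * NX x * NY y * mat_opnorm \<beta>" "x \<in> mats p X" "y \<in> mats q Y"
    by blast
  show "0 \<le> c" unfolding c(1)
    by (intro mult_nonneg_nonneg mat_opnorm_nonneg matrix_gaugeD(3)[OF gX c(2)] matrix_gaugeD(3)[OF gY c(3)])
qed

lemma op_costs_bdd: "bdd_below (op_costs u)"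
  by (rule bdd_belowI[of _ 0]) (erule op_costs_nonneg)

lemma scal_mult_tensor_entry:
  assumes "x \<in> carrier_mat p p" "y \<in> carrier_mat q q" "\<alpha> \<in> carrier_mat n (p * q)" "\<beta> \<in> carrier_mat (p * q) n"
    "i < n" "j < n"
  shows "scal_mult \<alpha> (mat_tensor x y) \<beta> $$ (i, j) = (\<Sum>k<p * q. \<Sum>l<p * q.
    (\<alpha> $$ (i, k) * \<beta> $$ (l, j)) *\<^sub>C tensor (x $$ (k div q, l div q)) (y $$ (k mod q, l mod q)))"
  using assms by (simp add: scal_mult_def mat_tensor_def)

text \<open>Each outer matrix has norm at most \<open>sqrt r\<close> and each middle factor at most
  \<open>1\<close>. The first conclusion records that a cost exists at all, for the nonemptiness of
  \<open>op_costs\<close>.\<close>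

lemma op_rep_imp_le:
  assumes r: "op_rep X NX Y NY n u r"
  shows "r \<in> {r. \<exists>c\<in>op_costs (fmat n u). c \<le> r}" and "op_proj_norm X NX Y NY (fmat n u) \<le> r"
proof -
  obtain p q x y \<alpha> \<beta> where w: "r > 0" "\<And>i j. i < p \<Longrightarrow> j < p \<Longrightarrow> x i j \<in> X" "\<And>i j. i < q \<Longrightarrow> j < q \<Longrightarrow> y i j \<in> Y"
    "NX (fmat p x) \<le> 1" "NY (fmat q y) \<le> 1"
    "opb {..<n} ({..<p} \<times> {..<q}) \<alpha> r" "opb ({..<p} \<times> {..<q}) {..<n} \<beta> r"
    and u: "\<And>i j. i < n \<Longrightarrow> j < n \<Longrightarrow> u i j = (\<Sum>\<kappa>\<in>{..<p} \<times> {..<q}. \<Sum>\<nu>\<in>{..<p} \<times> {..<q}.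
        (\<alpha> i \<kappa> * \<beta> \<nu> j) *\<^sub>C tensor (x (fst \<kappa>) (fst \<nu>)) (y (snd \<kappa>) (snd \<nu>)))"
    using r by (rule op_repE) blast
  let ?e = "\<lambda>k. (k div q, k mod q)"
  let ?\<alpha> = "mat n (p * q) (\<lambda>(i, k). \<alpha> i (?e k))" and ?\<beta> = "mat (p * q) n (\<lambda>(k, i). \<beta> (?e k) i)"
  have bij: "bij_betw ?e {..<p * q} ({..<p} \<times> {..<q})" by (rule bij_betw_div_mod)
  have s: "0 \<le> sqrt r" "(sqrt r)\<^sup>2 = r" using w(1) by simp_all
  have na: "mat_opnorm ?\<alpha> \<le> sqrt r"
    by (rule mat_opnorm_mat_le[OF s(1)]) (use opb_reindex[OF bij_betw_id bij, of "{..<n}" \<alpha> r] w(6) s(2) in simp)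
  have nb: "mat_opnorm ?\<beta> \<le> sqrt r"
    by (rule mat_opnorm_mat_le[OF s(1)]) (use opb_reindex[OF bij bij_betw_id, of "{..<n}" \<beta> r] w(7) s(2) in simp)
  have xm: "fmat p x \<in> mats p X" by (rule mat_in_mats) (rule w(2))
  have ym: "fmat q y \<in> mats q Y" by (rule mat_in_mats) (rule w(3))
  have eq: "fmat n u = scal_mult ?\<alpha> (mat_tensor (fmat p x) (fmat q y)) ?\<beta>"
  proof (rule eq_matI)
    fix i j assume "i < dim_row (scal_mult ?\<alpha> (mat_tensor (fmat p x) (fmat q y)) ?\<beta>)"
      "j < dim_col (scal_mult ?\<alpha> (mat_tensor (fmat p x) (fmat q y)) ?\<beta>)"
    then have ij: "i < n" "j < n" by (simp_all add: scal_mult_def)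
    have q: "k div q < p" "k mod q < q" if "k < p * q" for k
      using bij_betwE[OF bij] that by auto
    have "u i j = (\<Sum>k<p * q. \<Sum>l<p * q. (\<alpha> i (?e k) * \<beta> (?e l) j) *\<^sub>C
      tensor (x (fst (?e k)) (fst (?e l))) (y (snd (?e k)) (snd (?e l))))"
      unfolding u[OF ij] sum.reindex_bij_betw[OF bij, symmetric] ..
    also have "\<dots> = scal_mult ?\<alpha> (mat_tensor (fmat p x) (fmat q y)) ?\<beta> $$ (i, j)"
      by (subst scal_mult_tensor_entry[of _ p _ q _ n]) (use ij q in \<open>auto intro!: sum.cong\<close>)
    finally show "fmat n u $$ (i, j) = scal_mult ?\<alpha> (mat_tensor (fmat p x) (fmat q y)) ?\<beta> $$ (i, j)"
      using ij by simp
  qed (simp_all add: scal_mult_def)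
  have mem: "mat_opnorm ?\<alpha> * NX (fmat p x) * NY (fmat q y) * mat_opnorm ?\<beta> \<in> op_costs (fmat n u)"
    by (intro CollectI, rule exI[of _ ?\<alpha>], rule exI[of _ "fmat p x"], rule exI[of _ "fmat q y"],
        rule exI[of _ ?\<beta>], rule exI[of _ p], rule exI[of _ q], intro conjI refl xm ym eq) simp_all
  have "mat_opnorm ?\<alpha> * NX (fmat p x) * NY (fmat q y) * mat_opnorm ?\<beta> \<le> sqrt r * 1 * 1 * sqrt r"
    using matrix_gaugeD(3)[OF gX xm] matrix_gaugeD(3)[OF gY ym] s(1)
    by (intro mult_mono na nb w mult_nonneg_nonneg mat_opnorm_nonneg) simp_all
  also have "\<dots> = r" using s by (simp add: power2_eq_square)
  finally have le: "mat_opnorm ?\<alpha> * NX (fmat p x) * NY (fmat q y) * mat_opnorm ?\<beta> \<le> r" .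
  show "r \<in> {r. \<exists>c\<in>op_costs (fmat n u). c \<le> r}" using mem le by blast
  show "op_proj_norm X NX Y NY (fmat n u) \<le> r"
    unfolding op_proj_norm_def by (rule order_trans[OF cInf_lower[OF mem op_costs_bdd] le])
qed

text \<open>Rebalancing needs four positive bounds, while some of the norms may vanish. All four are
  enlarged by a small \<open>d\<close>, for which the strict inequality \<open>c < r\<close> leaves
  room.\<close>

lemma op_cost_imp_rep:
  assumes c: "c \<in> op_costs (fmat n u)" and "c < r"
  shows "op_rep X NX Y NY n u r"
proof -
  obtain \<alpha> x y \<beta> p q where ceq: "c = mat_opnorm \<alpha> * NX x * NY y * mat_opnorm \<beta>"
    and xm: "x \<in> mats p X" and ym: "y \<in> mats q Y"
    and am0: "\<alpha> \<in> carrier_mat (dim_row (fmat n u)) (p * q)" and bm0: "\<beta> \<in> carrier_mat (p * q) (dim_col (fmat n u))"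
    and ueq: "fmat n u = scal_mult \<alpha> (mat_tensor x y) \<beta>"
    using c by blast
  have am: "\<alpha> \<in> carrier_mat n (p * q)" and bm: "\<beta> \<in> carrier_mat (p * q) n"
    using am0 bm0 by (simp_all only: dim_row_mat dim_col_mat)
  let ?e = "\<lambda>k. (k div q, k mod q)"
  have bij: "bij_betw ?e {..<p * q} ({..<p} \<times> {..<q})" by (rule bij_betw_div_mod)
  define A where "A i \<kappa> = \<alpha> $$ (i, fst \<kappa> * q + snd \<kappa>)" for i and \<kappa> :: "nat \<times> nat"
  define B where "B \<kappa> i = \<beta> $$ (fst \<kappa> * q + snd \<kappa>, i)" for i and \<kappa> :: "nat \<times> nat"
  have Ae: "A i (?e k) = \<alpha> $$ (i, k)" "B (?e k) i = \<beta> $$ (k, i)" for i k by (simp_all add: A_def B_def)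
  have oA: "opb {..<n} ({..<p} \<times> {..<q}) A ((mat_opnorm \<alpha>)\<^sup>2)"
    using opb_reindex[OF bij_betw_id bij, of "{..<n}" A "(mat_opnorm \<alpha>)\<^sup>2"] opb_mat[OF am] by (simp add: Ae)
  have oB: "opb ({..<p} \<times> {..<q}) {..<n} B ((mat_opnorm \<beta>)\<^sup>2)"
    using opb_reindex[OF bij bij_betw_id, of "{..<n}" B "(mat_opnorm \<beta>)\<^sup>2"] opb_mat[OF bm] by (simp add: Ae)
  have u: "u i j = (\<Sum>\<kappa>\<in>{..<p} \<times> {..<q}. \<Sum>\<nu>\<in>{..<p} \<times> {..<q}.
        (A i \<kappa> * B \<nu> j) *\<^sub>C tensor (x $$ (fst \<kappa>, fst \<nu>)) (y $$ (snd \<kappa>, snd \<nu>)))" if ij: "i < n" "j < n" for i j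
  proof -
    have "u i j = scal_mult \<alpha> (mat_tensor x y) \<beta> $$ (i, j)" using ij by (simp flip: ueq)
    also have "\<dots> = (\<Sum>k<p * q. \<Sum>l<p * q. (A i (?e k) * B (?e l) j) *\<^sub>C
       tensor (x $$ (fst (?e k), fst (?e l))) (y $$ (snd (?e k), snd (?e l))))"
      unfolding Ae fst_conv snd_conv
      by (rule scal_mult_tensor_entry) (use xm ym am bm ij in \<open>simp_all add: mats_iff\<close>)
    also have "\<dots> = (\<Sum>\<kappa>\<in>{..<p} \<times> {..<q}. \<Sum>\<nu>\<in>{..<p} \<times> {..<q}.
        (A i \<kappa> * B \<nu> j) *\<^sub>C tensor (x $$ (fst \<kappa>, fst \<nu>)) (y $$ (snd \<kappa>, snd \<nu>)))"
      unfolding sum.reindex_bij_betw[OF bij, symmetric] ..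
    finally show ?thesis .
  qed
  have Npos: "0 \<le> NX x" "0 \<le> NY y" "0 \<le> mat_opnorm \<alpha>" "0 \<le> mat_opnorm \<beta>"
    using matrix_gaugeD(3)[OF gX xm] matrix_gaugeD(3)[OF gY ym] mat_opnorm_nonneg by simp_all
  have "((\<lambda>d. (mat_opnorm \<alpha> + d) * (NX x + d) * (NY y + d) * (mat_opnorm \<beta> + d))
      \<longlongrightarrow> (mat_opnorm \<alpha> + 0) * (NX x + 0) * (NY y + 0) * (mat_opnorm \<beta> + 0)) (at_right 0)"
    by (intro tendsto_intros)
  then have "\<forall>\<^sub>F d in at_right 0. (mat_opnorm \<alpha> + d) * (NX x + d) * (NY y + d) * (mat_opnorm \<beta> + d) < r"
    by (rule order_tendstoD(2)) (use \<open>c < r\<close> ceq in simp)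
  then obtain d0 where d0: "d0 > 0" "\<And>d. d > 0 \<Longrightarrow> d < d0 \<Longrightarrow> (mat_opnorm \<alpha> + d) * (NX x + d) * (NY y + d) * (mat_opnorm \<beta> + d) < r"
    unfolding eventually_at_right_field by blast
  define d where "d = d0 / 2"
  have d: "d > 0" "(mat_opnorm \<alpha> + d) * (NX x + d) * (NY y + d) * (mat_opnorm \<beta> + d) < r"
    using d0(1) d0(2)[of d] by (simp_all add: d_def)
  have "op_rep X NX Y NY n u ((mat_opnorm \<alpha> + d) * (NX x + d) * (NY y + d) * (mat_opnorm \<beta> + d))"
  proof (rule op_rep_scaled[OF gX gY, where p=p and q=q and x="\<lambda>i j. x $$ (i, j)" and y="\<lambda>i j. y $$ (i, j)" and \<alpha>=A and \<beta>=B])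
    show "opb {..<n} ({..<p} \<times> {..<q}) A ((mat_opnorm \<alpha> + d)\<^sup>2)"
      by (rule opb_mono[OF oA]) (use Npos d in \<open>intro power_mono, simp_all\<close>)
    show "opb ({..<p} \<times> {..<q}) {..<n} B ((mat_opnorm \<beta> + d)\<^sup>2)"
      by (rule opb_mono[OF oB]) (use Npos d in \<open>intro power_mono, simp_all\<close>)
    show "NX (fmat p (\<lambda>i j. x $$ (i, j))) \<le> NX x + d" "NY (fmat q (\<lambda>i j. y $$ (i, j))) \<le> NY y + d"
      unfolding mats_fmat[OF xm, symmetric] mats_fmat[OF ym, symmetric] using d(1) by simp_all
  qed (use xm ym Npos d(1) u in \<open>simp_all add: mats_iff add_nonneg_pos\<close>)
  then show ?thesis by (rule op_rep_mono) (use d(2) in simp)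
qed

end

lemma norm1_fmat: "norm1 N t = N (fmat 1 (\<lambda>_ _. t))"
  by (simp only: norm1_def case_prod_unfold)

lemma matrix_gauge_zero:
  assumes "matrix_gauge X N" shows "N (fmat n (\<lambda>_ _. 0)) = 0"
proof -
  have "N (fmat n (\<lambda>_ _. 0 *\<^sub>C 0)) \<le> cmod 0 * N (fmat n (\<lambda>_ _. 0))"
    by (rule matrix_gaugeD(4)[OF assms]) (rule matrix_gaugeD(1)[OF assms])
  moreover have "0 \<le> N (fmat n (\<lambda>_ _. 0))"
    by (rule matrix_gaugeD(3)[OF assms], rule mat_in_mats) (rule matrix_gaugeD(1)[OF assms])
  ultimately show ?thesis by simp
qed

context
  fixes X :: "'a::complex_vector set" and NX and Y :: "'b::complex_vector set" and NY
  assumes gX: "matrix_gauge X NX" and gY: "matrix_gauge Y NY"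
begin

lemma op_rep_zero:
  assumes "e > 0" shows "op_rep X NX Y NY n (\<lambda>_ _. 0) e"
proof -
  have "op_rep X NX Y NY n (\<lambda>_ _. tensor 0 0) (e * 1)"
    by (rule op_rep_tensor[OF gX gY])
      (use assms matrix_gaugeD(1)[OF gX] matrix_gaugeD(1)[OF gY] matrix_gauge_zero[OF gX] matrix_gauge_zero[OF gY, of 1]
        in \<open>simp_all add: norm1_fmat\<close>)
  then show ?thesis by (simp only: tensor_0_left mult_1_right)
qed

lemma op_rep_single_ex:
  assumes "t \<in> alg_tensor X Y" shows "\<exists>r. op_rep X NX Y NY 1 (\<lambda>_ _. t) r"
proof (rule alg_tensor_induct[OF assms])
  show "c *\<^sub>C x \<in> X" if "x \<in> X" for c x using matrix_gaugeD(2)[OF gX that] .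
  show "X \<noteq> {}" "Y \<noteq> {}" using matrix_gaugeD(1)[OF gX] matrix_gaugeD(1)[OF gY] by auto
  show "\<exists>r. op_rep X NX Y NY 1 (\<lambda>_ _. tensor x y) r" if xy: "x \<in> X" "y \<in> Y" for x y
  proof -
    have "0 \<le> norm1 NX x" "0 \<le> norm1 NY y"
      unfolding norm1_fmat using matrix_gaugeD(3)[OF gX mat_in_mats] matrix_gaugeD(3)[OF gY mat_in_mats] xy by simp_all
    then have "op_rep X NX Y NY 1 (\<lambda>_ _. tensor x y) ((norm1 NX x + 1) * (norm1 NY y + 1))"
      by (intro op_rep_tensor[OF gX gY]) (use xy in \<open>simp_all add: norm1_fmat\<close>)
    then show ?thesis by blast
  qed
  show "\<exists>r. op_rep X NX Y NY 1 (\<lambda>_ _. u + v) r"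
    if "\<exists>r. op_rep X NX Y NY 1 (\<lambda>_ _. u) r" "\<exists>r. op_rep X NX Y NY 1 (\<lambda>_ _. v) r" for u v
    using that op_rep_add[OF gX gY, of 1 "\<lambda>_ _. u" _ "\<lambda>_ _. v"] by blast
qed

text \<open>The margin \<open>e\<close> pays for the empty sum, since the cost of a factorization is
  positive even for zero.\<close>

lemma op_rep_sum_single:
  assumes F: "finite F" and c: "\<And>z. z \<in> F \<Longrightarrow> op_rep X NX Y NY 1 (\<lambda>_ _. t z) (c z)" and e: "e > 0"
  shows "op_rep X NX Y NY n (\<lambda>i j. \<Sum>z\<in>F. if i = fst z \<and> j = snd z then t z else 0) (e + sum c F)"
  using F c
proof (induction F)
  case empty
  then show ?case using op_rep_zero[OF e] by (simp only: sum.empty add_0_right)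
next
  case (insert z F)
  have "op_rep X NX Y NY n (\<lambda>i j. (if i = fst z \<and> j = snd z then t z else 0) +
      (\<Sum>z\<in>F. if i = fst z \<and> j = snd z then t z else 0)) (c z + (e + sum c F))"
    using insert by (intro op_rep_add[OF gX gY] op_rep_single) simp_all
  then show ?case by (simp only: sum.insert[OF insert(1,2)] add.left_commute[of "c z" e])
qed

lemma sum_single_entries:
  assumes "i < n" "j < (n::nat)"
  shows "(\<Sum>z\<in>{..<n} \<times> {..<n}. if i = fst z \<and> j = snd z then t z else 0) = t (i, j)"
proof -
  have "(\<Sum>z\<in>{..<n} \<times> {..<n}. if i = fst z \<and> j = snd z then t z else 0) = (\<Sum>z\<in>{..<n} \<times> {..<n}. if z = (i, j) then t z else 0)"
    by (rule sum.cong) auto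
  also have "\<dots> = t (i, j)" using assms by (simp add: sum.delta)
  finally show ?thesis .
qed

lemma op_rep_entries:
  assumes c: "\<And>i j. i < n \<Longrightarrow> j < n \<Longrightarrow> op_rep X NX Y NY 1 (\<lambda>_ _. u i j) (c i j)" and e: "e > 0"
  shows "op_rep X NX Y NY n u (e + (\<Sum>i<n. \<Sum>j<n. c i j))"
proof -
  have "op_rep X NX Y NY n (\<lambda>i j. \<Sum>z\<in>{..<n} \<times> {..<n}. if i = fst z \<and> j = snd z then u (fst z) (snd z) else 0)
      (e + (\<Sum>z\<in>{..<n} \<times> {..<n}. c (fst z) (snd z)))"
    by (rule op_rep_sum_single[OF _ _ e]) (use c in auto)
  then have "op_rep X NX Y NY n u (e + (\<Sum>z\<in>{..<n} \<times> {..<n}. c (fst z) (snd z)))"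
    by (rule op_rep_cong) (simp only: sum_single_entries fst_conv snd_conv)
  then show ?thesis by (simp add: sum.cartesian_product')
qed

abbreviation "opn \<equiv> op_proj_norm X NX Y NY"

lemma op_rep_ex:
  assumes "\<And>i j. i < n \<Longrightarrow> j < n \<Longrightarrow> u i j \<in> alg_tensor X Y"
  shows "\<exists>r. op_rep X NX Y NY n u r"
proof -
  have "\<forall>i j. \<exists>r. i < n \<longrightarrow> j < n \<longrightarrow> op_rep X NX Y NY 1 (\<lambda>_ _. u i j) r"
    using op_rep_single_ex assms by blast
  then obtain c where "\<And>i j. i < n \<Longrightarrow> j < n \<Longrightarrow> op_rep X NX Y NY 1 (\<lambda>_ _. u i j) (c i j)" by metis
  note c = this
  have pos: "(0::real) < 1" by simp
  have "op_rep X NX Y NY n u (1 + (\<Sum>i<n. \<Sum>j<n. c i j))"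
    by (rule op_rep_entries[OF c pos])
  then show ?thesis by blast
qed

lemma op_costs_nonempty:
  assumes u: "\<And>i j. i < n \<Longrightarrow> j < n \<Longrightarrow> u i j \<in> alg_tensor X Y"
  shows "op_costs X NX Y NY (fmat n u) \<noteq> {}"
proof -
  have "\<exists>r. op_rep X NX Y NY n u r" by (rule op_rep_ex) (rule u)
  then obtain r where r: "op_rep X NX Y NY n u r" by (rule exE)
  from op_rep_imp_le(1)[OF gX gY r] show ?thesis by blast
qed

lemma opn_lessD:
  assumes u: "\<And>i j. i < n \<Longrightarrow> j < n \<Longrightarrow> u i j \<in> alg_tensor X Y" and r: "opn (fmat n u) < r"
  shows "op_rep X NX Y NY n u r"
proof -
  have "op_costs X NX Y NY (fmat n u) \<noteq> {}" by (rule op_costs_nonempty) (rule u)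
  from cInf_lessD[OF this r[unfolded op_proj_norm_def]]
  obtain c where "c \<in> op_costs X NX Y NY (fmat n u)" "c < r" by blast
  then show ?thesis by (rule op_cost_imp_rep[OF gX gY])
qed

lemma opn_nonneg:
  assumes u: "\<And>i j. i < n \<Longrightarrow> j < n \<Longrightarrow> u i j \<in> alg_tensor X Y"
  shows "0 \<le> opn (fmat n u)"
proof -
  have "op_costs X NX Y NY (fmat n u) \<noteq> {}" by (rule op_costs_nonempty) (rule u)
  then show ?thesis unfolding op_proj_norm_def
    by (rule cInf_greatest) (rule op_costs_nonneg[OF gX gY])
qed

lemma opn_add:
  assumes u: "\<And>i j. i < n \<Longrightarrow> j < n \<Longrightarrow> u i j \<in> alg_tensor X Y"
    and v: "\<And>i j. i < n \<Longrightarrow> j < n \<Longrightarrow> v i j \<in> alg_tensor X Y"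
  shows "opn (fmat n (\<lambda>i j. u i j + v i j)) \<le> opn (fmat n u) + opn (fmat n v)"
proof (rule field_le_epsilon)
  fix e :: real assume "e > 0"
  then have "op_rep X NX Y NY n (\<lambda>i j. u i j + v i j) ((opn (fmat n u) + e / 2) + (opn (fmat n v) + e / 2))"
    by (intro op_rep_add[OF gX gY] opn_lessD u v) simp_all
  then show "opn (fmat n (\<lambda>i j. u i j + v i j)) \<le> opn (fmat n u) + opn (fmat n v) + e"
    using op_rep_imp_le(2)[OF gX gY, of n "\<lambda>i j. u i j + v i j"] by fastforce
qed

text \<open>Factorizations come arbitrarily close to the infimum, so an estimate valid for all of
  them passes to the norm. Functionals and maps on the tensor product are bounded in this
  way.\<close>

lemma opn_le_via_rep:
  assumes u: "\<And>i j. i < n \<Longrightarrow> j < n \<Longrightarrow> u i j \<in> alg_tensor X Y" and C: "C \<ge> 0"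
    and r: "\<And>r. op_rep X NX Y NY n u r \<Longrightarrow> f \<le> C * r"
  shows "f \<le> C * opn (fmat n u)"
proof (rule field_le_epsilon)
  fix e :: real assume e: "e > 0"
  have C1: "1 + C > 0" using C by simp
  have "op_rep X NX Y NY n u (opn (fmat n u) + e / (1 + C))"
    by (rule opn_lessD[OF u]) (use e C1 in simp_all)
  then have "f \<le> C * (opn (fmat n u) + e / (1 + C))" by (rule r)
  also have "\<dots> = C * opn (fmat n u) + (C / (1 + C)) * e" by (simp add: algebra_simps)
  also have "\<dots> \<le> C * opn (fmat n u) + 1 * e"
  proof (intro add_left_mono mult_right_mono)
    show "C / (1 + C) \<le> 1" using C1 by (simp add: divide_le_eq_1)
  qed (use e in simp)
  finally show "f \<le> C * opn (fmat n u) + e" by simp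
qed

lemma opn_scale:
  assumes u: "\<And>i j. i < n \<Longrightarrow> j < n \<Longrightarrow> u i j \<in> alg_tensor X Y"
  shows "opn (fmat n (\<lambda>i j. c *\<^sub>C u i j)) \<le> cmod c * opn (fmat n u)"
\<comment> \<open>Scaling by \<open>0\<close> would produce the excluded cost \<open>0\<close>; the
  zero matrix is instead given arbitrarily small costs.\<close>
proof (cases "c = 0")
  case True
  have "opn (fmat n (\<lambda>_ _. 0)) \<le> 0"
  proof (rule field_le_epsilon)
    show "opn (fmat n (\<lambda>_ _. 0)) \<le> 0 + e" if "e > 0" for e
      using op_rep_imp_le(2)[OF gX gY op_rep_zero[OF that]] by simp
  qed
  then show ?thesis using True by (simp only: complex_vector.scale_zero_left norm_zero mult_zero_left)
next
  case False
  show ?thesis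
    by (rule opn_le_via_rep[OF u]) (simp_all only: op_rep_imp_le(2)[OF gX gY op_rep_scale[OF _ False]] norm_ge_zero)
qed

text \<open>Crude, but enough to make entrywise convergence imply convergence in the matrix norm,
  which the completed norms rest on.\<close>

lemma opn_le_entries:
  assumes u: "\<And>i j. i < n \<Longrightarrow> j < n \<Longrightarrow> u i j \<in> alg_tensor X Y"
  shows "opn (fmat n u) \<le> (\<Sum>i<n. \<Sum>j<n. norm1 opn (u i j))"
proof (rule field_le_epsilon)
  fix e :: real assume e: "e > 0"
  \<comment> \<open>Each of the \<open>n * n\<close> entries and the initial zero matrix spends one
    \<open>d\<close>.\<close>
  define d where "d = e / (1 + real n * real n)"
  have pos: "1 + real n * real n > 0" by (simp add: add_pos_nonneg)
  have d: "d > 0" "d * (1 + real n * real n) = e" using e pos by (simp_all add: d_def)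
  have "op_rep X NX Y NY n u (d + (\<Sum>i<n. \<Sum>j<n. norm1 opn (u i j) + d))"
  proof (rule op_rep_entries[OF _ d(1)])
    show "op_rep X NX Y NY 1 (\<lambda>_ _. u i j) (norm1 opn (u i j) + d)" if "i < n" "j < n" for i j
      by (rule opn_lessD) (use u[OF that] d(1) in \<open>simp_all add: norm1_fmat\<close>)
  qed
  then have "opn (fmat n u) \<le> d + (\<Sum>i<n. \<Sum>j<n. norm1 opn (u i j) + d)" by (rule op_rep_imp_le(2)[OF gX gY])
  also have "\<dots> = (\<Sum>i<n. \<Sum>j<n. norm1 opn (u i j)) + d * (1 + real n * real n)"
    by (simp add: sum.distrib algebra_simps)
  finally show "opn (fmat n u) \<le> (\<Sum>i<n. \<Sum>j<n. norm1 opn (u i j)) + e" unfolding d(2) .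
qed

lemma opn_seminorm: "seminorm_on (alg_tensor X Y) (norm1 opn)"
proof (rule seminorm_onI[OF subspace_alg_tensor])
  show "0 \<le> norm1 opn t" if "t \<in> alg_tensor X Y" for t
    unfolding norm1_fmat by (rule opn_nonneg) (rule that)
  show "norm1 opn (t + t') \<le> norm1 opn t + norm1 opn t'" if "t \<in> alg_tensor X Y" "t' \<in> alg_tensor X Y" for t t'
    unfolding norm1_fmat by (rule opn_add) (rule that)+
  show "norm1 opn (c *\<^sub>C t) \<le> cmod c * norm1 opn t" if "t \<in> alg_tensor X Y" for c t
    unfolding norm1_fmat by (rule opn_scale) (rule that)
qed

text \<open>Factorizations need positive bounds; they are obtained by adding \<open>d\<close>, which
  then tends to \<open>0\<close>.\<close>

lemma opn_tensor_le:
  assumes x: "\<And>i j. i < n \<Longrightarrow> j < n \<Longrightarrow> x i j \<in> X" and y: "y \<in> Y"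
  shows "opn (fmat n (\<lambda>i j. tensor (x i j) y)) \<le> NX (fmat n x) * norm1 NY y"
proof -
  have pos: "0 \<le> NX (fmat n x)" "0 \<le> norm1 NY y"
    unfolding norm1_fmat using matrix_gaugeD(3)[OF gX mat_in_mats] matrix_gaugeD(3)[OF gY mat_in_mats] x y by simp_all
  have lim: "((\<lambda>d. (NX (fmat n x) + d) * (norm1 NY y + d)) \<longlongrightarrow> (NX (fmat n x) + 0) * (norm1 NY y + 0)) (at_right 0)"
    by (intro tendsto_intros)
  have ev: "\<forall>\<^sub>F d in at_right 0. opn (fmat n (\<lambda>i j. tensor (x i j) y)) \<le> (NX (fmat n x) + d) * (norm1 NY y + d)"
    unfolding eventually_at_right_field
  proof (intro exI[of _ 1] conjI allI impI)
    fix d :: real assume "0 < d"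
    then show "opn (fmat n (\<lambda>i j. tensor (x i j) y)) \<le> (NX (fmat n x) + d) * (norm1 NY y + d)"
      by (intro op_rep_imp_le(2)[OF gX gY] op_rep_tensor[OF gX gY]) (use x y pos in simp_all)
  qed simp
  show ?thesis using tendsto_lowerbound[OF lim ev] by simp
qed

text \<open>On a factorization the value is a row times the Kronecker product of
  \<open>[f x]\<close> and \<open>[g y]\<close> times a column. The middle factor is controlled by
  bounds for \<open>f\<close> and \<open>g\<close> on matrices of every size.\<close>

lemma opn_functional_le:
  assumes f: "clinear f" and g: "clinear g"
    and fb: "\<And>n x. (\<And>i j. i < n \<Longrightarrow> j < n \<Longrightarrow> x i j \<in> X) \<Longrightarrow> opb {..<n} {..<n} (\<lambda>i j. f (x i j)) ((NX (fmat n x))\<^sup>2)"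
    and gb: "\<And>n y. (\<And>i j. i < n \<Longrightarrow> j < n \<Longrightarrow> y i j \<in> Y) \<Longrightarrow> opb {..<n} {..<n} (\<lambda>i j. g (y i j)) ((NY (fmat n y))\<^sup>2)"
    and t: "t \<in> alg_tensor X Y"
  shows "cmod (t (\<lambda>b c. f b * g c)) \<le> norm1 opn t"
proof -
  let ?\<phi> = "\<lambda>b c. f b * g c"
  have bil: "bilinear_form ?\<phi>"
    by (rule bilinear_formI) (simp_all add: clinearD[OF f] clinearD[OF g] scaleC_complex_def algebra_simps)
  have "cmod (t ?\<phi>) \<le> 1 * opn (fmat 1 (\<lambda>_ _. t))"
  proof (rule opn_le_via_rep)
    fix r assume "op_rep X NX Y NY 1 (\<lambda>_ _. t) r"
    then obtain p q x y \<alpha> \<beta> where w: "r > 0" "\<And>i j. i < p \<Longrightarrow> j < p \<Longrightarrow> x i j \<in> X" "\<And>i j. i < q \<Longrightarrow> j < q \<Longrightarrow> y i j \<in> Y"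
      "NX (fmat p x) \<le> 1" "NY (fmat q y) \<le> 1"
      "opb {..<1::nat} ({..<p} \<times> {..<q}) \<alpha> r" "opb ({..<p} \<times> {..<q}) {..<1::nat} \<beta> r"
      and u: "\<And>i j :: nat. i < 1 \<Longrightarrow> j < 1 \<Longrightarrow> t = (\<Sum>\<kappa>\<in>{..<p} \<times> {..<q}. \<Sum>\<nu>\<in>{..<p} \<times> {..<q}.
          (\<alpha> i \<kappa> * \<beta> \<nu> j) *\<^sub>C tensor (x (fst \<kappa>) (fst \<nu>)) (y (snd \<kappa>) (snd \<nu>)))"
      by (rule op_repE) blast
    let ?I = "{..<p} \<times> {..<q}"
    \<comment> \<open>The Kronecker product applied to the column \<open>\<beta>\<close>.\<close>
    define w' where "w' \<kappa> = (\<Sum>\<nu>\<in>?I. (f (x (fst \<kappa>) (fst \<nu>)) * g (y (snd \<kappa>) (snd \<nu>))) * \<beta> \<nu> 0)" for \<kappa>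
    have N1: "(NX (fmat p x))\<^sup>2 \<le> 1" "(NY (fmat q y))\<^sup>2 \<le> 1"
      using matrix_gaugeD(3)[OF gX mat_in_mats, OF w(2)] matrix_gaugeD(3)[OF gY mat_in_mats, OF w(3)] w(4,5)
      by (simp_all add: power_le_one)
    have "opb ?I ?I (\<lambda>\<kappa> \<nu>. f (x (fst \<kappa>) (fst \<nu>)) * g (y (snd \<kappa>) (snd \<nu>))) (1 * 1)"
      by (rule opb_kron[OF opb_mono[OF fb N1(1)] opb_mono[OF gb N1(2)]]) (simp_all add: w)
    from opbD[OF this, of "\<lambda>\<nu>. \<beta> \<nu> 0"]
    have "(\<Sum>\<kappa>\<in>?I. (cmod (w' \<kappa>))\<^sup>2) \<le> (\<Sum>\<nu>\<in>?I. (cmod (\<beta> \<nu> 0))\<^sup>2)" by (simp add: w'_def)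
    also have "\<dots> \<le> r" using opbD[OF w(7), of "\<lambda>_. 1"] by simp
    finally have w'r: "(\<Sum>\<kappa>\<in>?I. (cmod (w' \<kappa>))\<^sup>2) \<le> r" .
    have sum_apply: "(sum h I) ?\<phi> = (\<Sum>i\<in>I. h i ?\<phi>)" for h :: "nat \<times> nat \<Rightarrow> ('a, 'b) tensor" and I
      by (induction I rule: infinite_finite_induct) auto
    have "t ?\<phi> = (\<Sum>\<kappa>\<in>?I. \<Sum>\<nu>\<in>?I. (\<alpha> 0 \<kappa> * \<beta> \<nu> 0) * (f (x (fst \<kappa>) (fst \<nu>)) * g (y (snd \<kappa>) (snd \<nu>))))"
      by (subst u[of 0 0]) (simp_all add: sum_apply scaleC_fun_def scaleC_complex_def tensor_eval[OF bil])
    also have "\<dots> = (\<Sum>\<kappa>\<in>?I. \<alpha> 0 \<kappa> * w' \<kappa>)"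
      unfolding w'_def by (simp add: sum_distrib_left mult_ac)
    finally have "(cmod (t ?\<phi>))\<^sup>2 \<le> r * (\<Sum>\<kappa>\<in>?I. (cmod (w' \<kappa>))\<^sup>2)"
      using opbD[OF w(6), of w'] by simp
    also have "\<dots> \<le> r * r" using w'r w(1) by (intro mult_left_mono) simp_all
    finally show "cmod (t ?\<phi>) \<le> 1 * r" using w(1) by (simp add: power2_eq_square[symmetric] power2_le_iff_abs_le)
  qed (use t in simp_all)
  then show ?thesis by (simp add: norm1_fmat)
qed

end

text \<open>\<open>S\<close> and \<open>R\<close> are applied to the middle factors of a
  factorization. The constants are \<open>s + 1\<close> and \<open>t + 1\<close> because rebalancing
  asks for positive bounds.\<close>

lemma opn_tensor_map_le:
  assumes gX: "matrix_gauge X NX" and gY: "matrix_gauge Y NY"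
    and gX': "matrix_gauge X' NX'" and gY': "matrix_gauge Y' NY'"
    and S: "clinear S" "\<And>x. x \<in> X \<Longrightarrow> S x \<in> X'" and R: "clinear R" "\<And>y. y \<in> Y \<Longrightarrow> R y \<in> Y'"
    and s: "s \<ge> 0" "\<And>n x. (\<And>i j. i < n \<Longrightarrow> j < n \<Longrightarrow> x i j \<in> X) \<Longrightarrow> NX' (fmat n (\<lambda>i j. S (x i j))) \<le> s * NX (fmat n x)"
    and t: "t \<ge> 0" "\<And>n y. (\<And>i j. i < n \<Longrightarrow> j < n \<Longrightarrow> y i j \<in> Y) \<Longrightarrow> NY' (fmat n (\<lambda>i j. R (y i j))) \<le> t * NY (fmat n y)"
    and v: "v \<in> alg_tensor X Y"
  shows "norm1 (op_proj_norm X' NX' Y' NY') (tensor_map S R v) \<le> (s + 1) * (t + 1) * norm1 (op_proj_norm X NX Y NY) v"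
proof -
  have "norm1 (op_proj_norm X' NX' Y' NY') (tensor_map S R v) \<le> ((s + 1) * (t + 1)) * op_proj_norm X NX Y NY (fmat 1 (\<lambda>_ _. v))"
  proof (rule opn_le_via_rep[OF gX gY])
    fix r assume "op_rep X NX Y NY 1 (\<lambda>_ _. v) r"
    then obtain p q x y \<alpha> \<beta> where w: "r > 0" "\<And>i j. i < p \<Longrightarrow> j < p \<Longrightarrow> x i j \<in> X" "\<And>i j. i < q \<Longrightarrow> j < q \<Longrightarrow> y i j \<in> Y"
      "NX (fmat p x) \<le> 1" "NY (fmat q y) \<le> 1"
      "opb {..<1::nat} ({..<p} \<times> {..<q}) \<alpha> r" "opb ({..<p} \<times> {..<q}) {..<1::nat} \<beta> r"
      and u: "\<And>i j :: nat. i < 1 \<Longrightarrow> j < 1 \<Longrightarrow> v = (\<Sum>\<kappa>\<in>{..<p} \<times> {..<q}. \<Sum>\<nu>\<in>{..<p} \<times> {..<q}.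
          (\<alpha> i \<kappa> * \<beta> \<nu> j) *\<^sub>C tensor (x (fst \<kappa>) (fst \<nu>)) (y (snd \<kappa>) (snd \<nu>)))"
      by (rule op_repE) blast
    have sq: "(sqrt r)\<^sup>2 = r" "sqrt r > 0" using w(1) by simp_all
    have "op_rep X' NX' Y' NY' 1 (\<lambda>_ _. tensor_map S R v) (sqrt r * (s + 1) * (t + 1) * sqrt r)"
    proof (rule op_rep_scaled[OF gX' gY', where p=p and q=q and x="\<lambda>i j. S (x i j)" and y="\<lambda>i j. R (y i j)" and \<alpha>=\<alpha> and \<beta>=\<beta>])
      show "S (x i j) \<in> X'" if "i < p" "j < p" for i j by (rule S(2)[OF w(2)[OF that]])
      show "R (y i j) \<in> Y'" if "i < q" "j < q" for i j by (rule R(2)[OF w(3)[OF that]])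
      have "NX' (fmat p (\<lambda>i j. S (x i j))) \<le> s * NX (fmat p x)" by (rule s(2)) (rule w(2))
      also have "\<dots> \<le> s * 1" by (rule mult_left_mono[OF w(4) s(1)])
      finally show "NX' (fmat p (\<lambda>i j. S (x i j))) \<le> s + 1" by simp
      have "NY' (fmat q (\<lambda>i j. R (y i j))) \<le> t * NY (fmat q y)" by (rule t(2)) (rule w(3))
      also have "\<dots> \<le> t * 1" by (rule mult_left_mono[OF w(5) t(1)])
      finally show "NY' (fmat q (\<lambda>i j. R (y i j))) \<le> t + 1" by simp
      show "opb {..<1} ({..<p} \<times> {..<q}) \<alpha> ((sqrt r)\<^sup>2)" "opb ({..<p} \<times> {..<q}) {..<1} \<beta> ((sqrt r)\<^sup>2)"
        unfolding sq by (rule w)+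
      show "tensor_map S R v = (\<Sum>\<kappa>\<in>{..<p} \<times> {..<q}. \<Sum>\<nu>\<in>{..<p} \<times> {..<q}.
          (\<alpha> i \<kappa> * \<beta> \<nu> j) *\<^sub>C tensor (S (x (fst \<kappa>) (fst \<nu>))) (R (y (snd \<kappa>) (snd \<nu>))))" if "i < 1" "j < 1" for i j
        by (subst u[OF that])
          (simp only: clinear_sum[OF clinear_tensor_map] clinearD(2)[OF clinear_tensor_map] tensor_map_tensor[OF S(1) R(1)])
    qed (use sq s(1) t(1) in simp_all)
    moreover have "sqrt r * (s + 1) * (t + 1) * sqrt r = (s + 1) * (t + 1) * r"
      using sq by (simp add: power2_eq_square)
    ultimately show "norm1 (op_proj_norm X' NX' Y' NY') (tensor_map S R v) \<le> (s + 1) * (t + 1) * r"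
      unfolding norm1_fmat using op_rep_imp_le(2)[OF gX' gY'] by metis
  qed (use v s(1) t(1) in simp_all)
  then show ?thesis by (simp only: norm1_fmat)
qed

text \<open>Compares the tensor norms along the inclusion of the Segal algebra in the Fourier
  algebra: a factorization for the finer norm is one for the coarser.\<close>

lemma op_rep_weaken_norm:
  assumes "op_rep X NX Y NY n u r" and sub: "\<And>x. x \<in> X \<Longrightarrow> x \<in> X'"
    and le: "\<And>n x. (\<And>i j. i < n \<Longrightarrow> j < n \<Longrightarrow> x i j \<in> X) \<Longrightarrow> NX' (fmat n x) \<le> NX (fmat n x)"
  shows "op_rep X' NX' Y NY n u r"
proof -
  obtain p q x y \<alpha> \<beta> where w: "r > 0" "\<And>i j. i < p \<Longrightarrow> j < p \<Longrightarrow> x i j \<in> X" "\<And>i j. i < q \<Longrightarrow> j < q \<Longrightarrow> y i j \<in> Y"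
    "NX (fmat p x) \<le> 1" "NY (fmat q y) \<le> 1"
    "opb {..<n} ({..<p} \<times> {..<q}) \<alpha> r" "opb ({..<p} \<times> {..<q}) {..<n} \<beta> r"
    and u: "\<And>i j. i < n \<Longrightarrow> j < n \<Longrightarrow> u i j = (\<Sum>\<kappa>\<in>{..<p} \<times> {..<q}. \<Sum>\<nu>\<in>{..<p} \<times> {..<q}.
        (\<alpha> i \<kappa> * \<beta> \<nu> j) *\<^sub>C tensor (x (fst \<kappa>) (fst \<nu>)) (y (snd \<kappa>) (snd \<nu>)))"
    using assms(1) by (rule op_repE) blast
  show ?thesis
  proof (rule op_repI[where p=p and q=q and x=x and y=y and \<alpha>=\<alpha> and \<beta>=\<beta>])
    show "x i j \<in> X'" if "i < p" "j < p" for i j by (rule sub[OF w(2)[OF that]])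
    show "NX' (fmat p x) \<le> 1" using le[of p x, OF w(2)] w(4) by simp
  qed ((rule w u; assumption)+)
qed

subsection \<open>Matrix norms on completions\<close>

text \<open>Matrices of size \<open>1\<close> and vectors have the same representing sequences, so
  the operator version can draw on everything known about \<open>completion_norm\<close>.\<close>

lemma completion_mat_norm_1:
  assumes N: "seminorm_on X (norm1 N)" and \<Phi>: "\<Phi> \<in> completion X (norm1 N)"
  shows "norm1 (completion_mat_norm X N) \<Phi> = completion_norm X (norm1 N) \<Phi>"
proof -
  interpret seminormed X "norm1 N" by standard fact
  let ?P = "\<lambda>s. (\<forall>k. s k \<in> carrier_mat 1 1) \<and> (\<forall>i<1. \<forall>j<1. represents X (norm1 N) (\<lambda>k. s k $$ (i, j)) \<Phi>)"
  have lim: "(\<lambda>k. N (s k)) \<longlonglongrightarrow> cn \<Phi>" if "?P s" for s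
  proof -
    have "s k = mat 1 1 (\<lambda>_. s k $$ (0, 0))" for k
    proof -
      have c: "s k \<in> carrier_mat 1 1" using that by blast
      show ?thesis by (rule eq_matI) (use c in auto)
    qed
    then have "N (s k) = norm1 N (s k $$ (0, 0))" for k unfolding norm1_def by metis
    moreover have "represents X (norm1 N) (\<lambda>k. s k $$ (0, 0)) \<Phi>" using that by simp
    ultimately show ?thesis using cn_lim by simp
  qed
  obtain s0 where s0: "represents X (norm1 N) s0 \<Phi>" using \<Phi> by (rule completionE)
  have P0: "?P (\<lambda>k. mat 1 1 (\<lambda>_. s0 k))" using s0 by simp
  have "(THE r. \<forall>s. ?P s \<longrightarrow> (\<lambda>k. N (s k)) \<longlonglongrightarrow> r) = cn \<Phi>"
  proof (rule the_equality)
    show "\<forall>s. ?P s \<longrightarrow> (\<lambda>k. N (s k)) \<longlonglongrightarrow> cn \<Phi>" using lim by blast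
    show "r = cn \<Phi>" if r: "\<forall>s. ?P s \<longrightarrow> (\<lambda>k. N (s k)) \<longlonglongrightarrow> r" for r
      by (rule LIMSEQ_unique[OF r[rule_format, OF P0] lim[OF P0]])
  qed
  then show ?thesis
    unfolding norm1_def[of "completion_mat_norm X N"] completion_mat_norm_def by simp
qed

text \<open>The matrix norm is dominated by the sum of the norms of the entries. Sequences that
  represent the entries of \<open>U\<close> thus converge to \<open>U\<close> in the matrix norm,
  and the description of the completed norm is met by the original one.\<close>

lemma completion_mat_norm_emb:
  assumes N: "seminorm_on X (norm1 N)"
    and add: "\<And>u v. (\<And>i j. i < n \<Longrightarrow> j < n \<Longrightarrow> u i j \<in> X) \<Longrightarrow> (\<And>i j. i < n \<Longrightarrow> j < n \<Longrightarrow> v i j \<in> X) \<Longrightarrow>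
      N (fmat n (\<lambda>i j. u i j + v i j)) \<le> N (fmat n u) + N (fmat n v)"
    and le: "\<And>u. (\<And>i j. i < n \<Longrightarrow> j < n \<Longrightarrow> u i j \<in> X) \<Longrightarrow> N (fmat n u) \<le> (\<Sum>i<n. \<Sum>j<n. norm1 N (u i j))"
    and U: "\<And>i j. i < n \<Longrightarrow> j < n \<Longrightarrow> U i j \<in> X"
  shows "completion_mat_norm X N (fmat n (\<lambda>i j. completion_embed X (norm1 N) (U i j))) = N (fmat n U)"
proof -
  interpret seminormed X "norm1 N" by standard fact
  let ?P = "\<lambda>s. (\<forall>k. s k \<in> carrier_mat n n) \<and>
    (\<forall>i<n. \<forall>j<n. represents X (norm1 N) (\<lambda>k. s k $$ (i, j)) (fmat n (\<lambda>i j. emb (U i j)) $$ (i, j)))"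
  have lim: "(\<lambda>k. N (s k)) \<longlonglongrightarrow> N (fmat n U)" if P: "?P s" for s
  proof -
    define v where "v k i j = s k $$ (i, j)" for k i j
    have s: "s k = fmat n (v k)" for k
    proof -
      have c: "s k \<in> carrier_mat n n" using P by blast
      show ?thesis by (rule eq_matI) (use c in \<open>auto simp: v_def\<close>)
    qed
    have rep: "represents X (norm1 N) (\<lambda>k. v k i j) (emb (U i j))" if "i < n" "j < n" for i j
      using P that by (simp add: v_def)
    have vX: "v k i j \<in> X" if "i < n" "j < n" for i j k by (rule representsD(1)[OF rep[OF that]])
    have bnd: "\<bar>N (fmat n (v k)) - N (fmat n U)\<bar> \<le> (\<Sum>i<n. \<Sum>j<n. norm1 N (v k i j - U i j))" for k
    proof -
      have d: "v k i j - U i j \<in> X" "U i j - v k i j \<in> X" if "i < n" "j < n" for i j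
        using diff_mem vX[OF that] U[OF that] by blast+
      have "N (fmat n (\<lambda>i j. U i j + (v k i j - U i j))) \<le> N (fmat n U) + N (fmat n (\<lambda>i j. v k i j - U i j))"
        by (rule add) (simp_all add: U d)
      moreover have "N (fmat n (\<lambda>i j. v k i j + (U i j - v k i j))) \<le> N (fmat n (v k)) + N (fmat n (\<lambda>i j. U i j - v k i j))"
        by (rule add) (simp_all add: vX d)
      moreover have "N (fmat n (\<lambda>i j. v k i j - U i j)) \<le> (\<Sum>i<n. \<Sum>j<n. norm1 N (v k i j - U i j))"
        by (rule le) (simp add: d)
      moreover have "N (fmat n (\<lambda>i j. U i j - v k i j)) \<le> (\<Sum>i<n. \<Sum>j<n. norm1 N (U i j - v k i j))"
        by (rule le) (simp add: d)
      moreover have "(\<Sum>i<n. \<Sum>j<n. norm1 N (U i j - v k i j)) = (\<Sum>i<n. \<Sum>j<n. norm1 N (v k i j - U i j))"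
        by (intro sum.cong refl seminorm_on_minus_commute[OF N]) (simp_all add: U vX)
      ultimately show ?thesis by simp
    qed
    have "(\<lambda>k. \<Sum>i<n. \<Sum>j<n. norm1 N (v k i j - U i j)) \<longlonglongrightarrow> (\<Sum>i<n. \<Sum>j<n. 0)"
      by (intro tendsto_sum represents_unique_null[OF rep represents_emb]) (simp_all add: U)
    then have null: "(\<lambda>k. \<Sum>i<n. \<Sum>j<n. norm1 N (v k i j - U i j)) \<longlonglongrightarrow> 0" by simp
    have "(\<lambda>k. N (fmat n (v k)) - N (fmat n U)) \<longlonglongrightarrow> 0"
      by (rule Lim_null_comparison[OF _ null]) (simp add: bnd)
    from tendsto_add[OF this tendsto_const[of "N (fmat n U)"]] show ?thesis unfolding s by simp
  qed
  have P0: "?P (\<lambda>_. fmat n U)" using represents_emb[OF U] by simp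
  have "(THE r. \<forall>s. ?P s \<longrightarrow> (\<lambda>k. N (s k)) \<longlonglongrightarrow> r) = N (fmat n U)"
  proof (rule the_equality)
    show "\<forall>s. ?P s \<longrightarrow> (\<lambda>k. N (s k)) \<longlonglongrightarrow> N (fmat n U)" using lim by blast
    show "r = N (fmat n U)" if r: "\<forall>s. ?P s \<longrightarrow> (\<lambda>k. N (s k)) \<longlonglongrightarrow> r" for r
      by (rule LIMSEQ_unique[OF r[rule_format, OF P0] lim[OF P0]])
  qed
  then show ?thesis unfolding completion_mat_norm_def by simp
qed

lemma op_rep_tensor_left:
  assumes gX: "matrix_gauge X NX" and gY: "matrix_gauge Y NY"
    and mem: "x \<in> X" "\<And>i j. i < n \<Longrightarrow> j < n \<Longrightarrow> y i j \<in> Y" and pos: "s > 0" "t > 0"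
    and N: "norm1 NX x \<le> s" "NY (fmat n y) \<le> t"
  shows "op_rep X NX Y NY n (\<lambda>i j. tensor x (y i j)) (s * t)"
proof -
  have "op_rep X NX Y NY n (\<lambda>i j. tensor x (y i j)) (1 * s * t * 1)"
  proof (rule op_rep_scaled[OF gX gY, where p=1 and q=n and x="\<lambda>_ _. x" and y=y and
        \<alpha>="\<lambda>i \<kappa>. if i = snd \<kappa> then 1 else 0" and \<beta>="\<lambda>\<kappa> i. if i = snd \<kappa> then 1 else 0"])
    have S: "(\<Sum>\<kappa>\<in>{..<1::nat} \<times> {..<n}. f \<kappa>) = (\<Sum>k<n. f (0, k))" for f :: "nat \<times> nat \<Rightarrow> 'c::comm_monoid_add"
      unfolding sum.cartesian_product' by simp
    have D: "(\<Sum>k<n. (if i = k then 1 else 0) * f k) = (if i < n then f i else 0)" for i and f :: "nat \<Rightarrow> complex"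
    proof -
      have "(\<Sum>k<n. (if i = k then 1 else 0) * f k) = (\<Sum>k<n. if i = k then f k else 0)"
        by (intro sum.cong) auto
      then show ?thesis by (simp add: sum.delta')
    qed
    have D': "(\<Sum>k<n. (if k = i then 1 else 0) * f k) = (if i < n then f i else 0)" for i and f :: "nat \<Rightarrow> complex"
      using D[of i f] by (simp only: eq_commute)
    show "opb {..<n} ({..<1::nat} \<times> {..<n}) (\<lambda>i \<kappa>. if i = snd \<kappa> then 1 else 0) (1\<^sup>2)"
      unfolding opb_def S snd_conv D by simp
    show "opb ({..<1::nat} \<times> {..<n}) {..<n} (\<lambda>\<kappa> i. if i = snd \<kappa> then 1 else 0) (1\<^sup>2)"
      unfolding opb_def S snd_conv D' by simp
    show "NX (fmat 1 (\<lambda>_ _. x)) \<le> s" using N(1) unfolding norm1_def case_prod_unfold .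
    fix i j assume ij: "i < n" "j < n"
    have "(\<Sum>\<kappa>\<in>{..<1::nat} \<times> {..<n}. \<Sum>\<nu>\<in>{..<1::nat} \<times> {..<n}.
        ((if i = snd \<kappa> then 1 else 0) * (if j = snd \<nu> then 1 else 0)) *\<^sub>C tensor x (y (snd \<kappa>) (snd \<nu>)))
      = (\<Sum>k<n. \<Sum>l<n. if i = k then (if j = l then tensor x (y k l) else 0) else 0)"
      unfolding S by (intro sum.cong refl) (auto simp: scaleC_one)
    also have "\<dots> = (\<Sum>k<n. if i = k then (\<Sum>l<n. if j = l then tensor x (y k l) else 0) else 0)"
      by (intro sum.cong refl) auto
    also have "\<dots> = tensor x (y i j)" using ij by (simp only: sum.delta' finite_lessThan lessThan_iff if_True)
    finally show "tensor x (y i j) = (\<Sum>\<kappa>\<in>{..<1::nat} \<times> {..<n}. \<Sum>\<nu>\<in>{..<1::nat} \<times> {..<n}.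
        ((if i = snd \<kappa> then 1 else 0) * (if j = snd \<nu> then 1 else 0)) *\<^sub>C tensor x (y (snd \<kappa>) (snd \<nu>)))"
      by simp
  qed (use mem pos N in simp_all)
  then show ?thesis by simp
qed

context
  fixes X :: "'a::complex_vector set" and NX and Y :: "'b::complex_vector set" and NY
  assumes gX: "matrix_gauge X NX" and gY: "matrix_gauge Y NY"
begin

text \<open>Applied to \<open>a\<close> against a matrix over the Segal algebra, this makes
  multiplication by a fixed \<open>a\<close> completely bounded.\<close>

lemma opn_tensor_left_le:
  assumes x: "x \<in> X" and y: "\<And>i j. i < n \<Longrightarrow> j < n \<Longrightarrow> y i j \<in> Y"
  shows "op_proj_norm X NX Y NY (fmat n (\<lambda>i j. tensor x (y i j))) \<le> norm1 NX x * NY (fmat n y)"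
proof -
  have pos: "0 \<le> norm1 NX x" "0 \<le> NY (fmat n y)"
    unfolding norm1_fmat using matrix_gaugeD(3)[OF gX mat_in_mats] matrix_gaugeD(3)[OF gY mat_in_mats] x y by simp_all
  have lim: "((\<lambda>d. (norm1 NX x + d) * (NY (fmat n y) + d)) \<longlongrightarrow> (norm1 NX x + 0) * (NY (fmat n y) + 0)) (at_right 0)"
    by (intro tendsto_intros)
  have ev: "\<forall>\<^sub>F d in at_right 0. op_proj_norm X NX Y NY (fmat n (\<lambda>i j. tensor x (y i j))) \<le> (norm1 NX x + d) * (NY (fmat n y) + d)"
    unfolding eventually_at_right_field
  proof (intro exI[of _ 1] conjI allI impI)
    fix d :: real assume "0 < d"
    then show "op_proj_norm X NX Y NY (fmat n (\<lambda>i j. tensor x (y i j))) \<le> (norm1 NX x + d) * (NY (fmat n y) + d)"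
      by (intro op_rep_imp_le(2)[OF gX gY] op_rep_tensor_left[OF gX gY]) (use x y pos in simp_all)
  qed simp
  show ?thesis using tendsto_lowerbound[OF lim ev] by simp
qed

text \<open>Estimates, at every matrix size, the finite sums that form the diagonal maps.\<close>

lemma opn_sum_le:
  assumes t: "\<And>z i j. z \<in> F \<Longrightarrow> i < n \<Longrightarrow> j < n \<Longrightarrow> t z i j \<in> alg_tensor X Y"
  shows "op_proj_norm X NX Y NY (fmat n (\<lambda>i j. \<Sum>z\<in>F. w z *\<^sub>C t z i j))
    \<le> (\<Sum>z\<in>F. cmod (w z) * op_proj_norm X NX Y NY (fmat n (t z)))"
proof -
  have "op_proj_norm X NX Y NY (fmat n (\<lambda>_ _. 0 *\<^sub>C 0)) \<le> cmod 0 * op_proj_norm X NX Y NY (fmat n (\<lambda>_ _. 0))"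
    by (rule opn_scale[OF gX gY]) (rule complex_vector.subspace_0[OF subspace_alg_tensor])
  then have z: "op_proj_norm X NX Y NY (fmat n (\<lambda>_ _. 0)) \<le> 0" by simp
  show ?thesis using t
  proof (induction F rule: infinite_finite_induct)
    case (infinite F)
    show ?case unfolding sum.infinite[OF infinite(1)] by (rule z)
  next
    case empty
    show ?case unfolding sum.empty by (rule z)
  next
    case (insert z F)
    have mem: "(\<Sum>z\<in>F. w z *\<^sub>C t z i j) \<in> alg_tensor X Y" if "i < n" "j < n" for i j
      using insert.prems that
      by (intro complex_vector.subspace_sum[OF subspace_alg_tensor] complex_vector.subspace_scale[OF subspace_alg_tensor]) simp
    have mz: "t z i j \<in> alg_tensor X Y" if "i < n" "j < n" for i j using insert.prems that by simp
    have "op_proj_norm X NX Y NY (fmat n (\<lambda>i j. w z *\<^sub>C t z i j + (\<Sum>z\<in>F. w z *\<^sub>C t z i j)))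
      \<le> op_proj_norm X NX Y NY (fmat n (\<lambda>i j. w z *\<^sub>C t z i j)) + op_proj_norm X NX Y NY (fmat n (\<lambda>i j. \<Sum>z\<in>F. w z *\<^sub>C t z i j))"
      by (rule opn_add[OF gX gY]) (rule complex_vector.subspace_scale[OF subspace_alg_tensor mz] mem; assumption)+
    moreover have "op_proj_norm X NX Y NY (fmat n (\<lambda>i j. w z *\<^sub>C t z i j)) \<le> cmod (w z) * op_proj_norm X NX Y NY (fmat n (t z))"
      by (rule opn_scale[OF gX gY]) (rule mz)
    moreover have "op_proj_norm X NX Y NY (fmat n (\<lambda>i j. \<Sum>z\<in>F. w z *\<^sub>C t z i j))
      \<le> (\<Sum>z\<in>F. cmod (w z) * op_proj_norm X NX Y NY (fmat n (t z)))"
      by (rule insert.IH) (use insert.prems in simp)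
    ultimately show ?case unfolding sum.insert[OF insert.hyps] by linarith
  qed
qed

lemma opn_completion_emb:
  assumes U: "\<And>i j. i < n \<Longrightarrow> j < n \<Longrightarrow> U i j \<in> alg_tensor X Y"
  shows "op_ptensor_norm X NX Y NY (fmat n (\<lambda>i j. completion_embed (alg_tensor X Y) (norm1 (op_proj_norm X NX Y NY)) (U i j)))
    = op_proj_norm X NX Y NY (fmat n U)"
  unfolding op_ptensor_norm_def
  by (rule completion_mat_norm_emb[OF opn_seminorm[OF gX gY] opn_add[OF gX gY] opn_le_entries[OF gX gY] U])

end

section \<open>Projections in semi-inner product spaces\<close>

lemma Re_cnj_scaled: "Re (cnj (of_real (- s) * z) * z) = - s * (cmod z)\<^sup>2"
proof -
  have "cnj (of_real (- s) * z) * z = of_real (- s * (cmod z)\<^sup>2)"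
    by (simp only: complex_cnj_mult complex_cnj_complex_of_real of_real_mult complex_norm_square) (simp add: mult_ac)
  then show ?thesis by (simp only: Re_complex_of_real)
qed

lemma cmod_scaled_squared: "(cmod (of_real (- s) * z))\<^sup>2 = s\<^sup>2 * (cmod z)\<^sup>2"
  by (simp add: norm_mult power_mult_distrib)

text \<open>The form is only semidefinite because \<open>L2\<close> consists of functions, not of
  classes, so null functions remain. The locale is used for \<open>L2\<close> and for the sum of two
  copies of it.\<close>

locale semi_inner =
  fixes H :: "'a::complex_vector set" and ip :: "'a \<Rightarrow> 'a \<Rightarrow> complex"
  assumes H: "complex_vector.subspace H"
    and ip_add: "\<And>x y z. x \<in> H \<Longrightarrow> y \<in> H \<Longrightarrow> z \<in> H \<Longrightarrow> ip (x + y) z = ip x z + ip y z"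
    and ip_scale: "\<And>c x z. x \<in> H \<Longrightarrow> z \<in> H \<Longrightarrow> ip (c *\<^sub>C x) z = c * ip x z"
    and ip_cnj: "\<And>x y. x \<in> H \<Longrightarrow> y \<in> H \<Longrightarrow> ip y x = cnj (ip x y)"
    and ip_pos: "\<And>x. x \<in> H \<Longrightarrow> 0 \<le> Re (ip x x)"
begin

definition sq :: "'a \<Rightarrow> real" where "sq x = Re (ip x x)"
definition nrm :: "'a \<Rightarrow> real" where "nrm x = sqrt (sq x)"

lemmas mem_add = complex_vector.subspace_add[OF H]
lemmas mem_scale = complex_vector.subspace_scale[OF H]
lemmas mem_diff = subspace_minus[OF H]

lemma ip_add_right: "x \<in> H \<Longrightarrow> y \<in> H \<Longrightarrow> z \<in> H \<Longrightarrow> ip z (x + y) = ip z x + ip z y"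
  using ip_cnj[of "x + y" z] ip_cnj[of x z] ip_cnj[of y z] ip_add[of x y z] mem_add by simp

lemma ip_scale_right: "x \<in> H \<Longrightarrow> z \<in> H \<Longrightarrow> ip z (c *\<^sub>C x) = cnj c * ip z x"
  using ip_cnj[of "c *\<^sub>C x" z] ip_cnj[of x z] ip_scale[of x z c] mem_scale by simp

lemma ip_diff: "x \<in> H \<Longrightarrow> y \<in> H \<Longrightarrow> z \<in> H \<Longrightarrow> ip (x - y) z = ip x z - ip y z"
  by (rule additive_diff[OF H, where T="\<lambda>x. ip x z"]) (simp_all add: ip_add)

lemma sq_nonneg: "x \<in> H \<Longrightarrow> 0 \<le> sq x"
  by (simp add: sq_def ip_pos)

lemma nrm_sq: "x \<in> H \<Longrightarrow> (nrm x)\<^sup>2 = sq x"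
  by (simp add: nrm_def sq_nonneg)

lemma nrm_nonneg: "x \<in> H \<Longrightarrow> 0 \<le> nrm x"
  by (simp add: nrm_def sq_nonneg)

lemma sq_add_scale:
  assumes "x \<in> H" "y \<in> H"
  shows "sq (x + c *\<^sub>C y) = sq x + 2 * Re (cnj c * ip x y) + (cmod c)\<^sup>2 * sq y"
proof -
  have im: "Im (ip y y) = 0" using arg_cong[OF ip_cnj[OF assms(2,2)], of Im] by simp
  have "ip (x + c *\<^sub>C y) (x + c *\<^sub>C y) = ip x x + cnj c * ip x y + (c * ip y x + c * cnj c * ip y y)"
    using assms by (simp add: ip_add ip_add_right ip_scale ip_scale_right mem_add mem_scale algebra_simps)
  moreover have "c * ip y x = cnj (cnj c * ip x y)" using ip_cnj[OF assms] by simp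
  moreover have "ip y y = of_real (sq y)" using im by (simp add: sq_def complex_eq_iff)
  then have "c * cnj c * ip y y = of_real ((cmod c)\<^sup>2 * sq y)"
    by (simp only: of_real_mult complex_norm_square)
  ultimately have "ip (x + c *\<^sub>C y) (x + c *\<^sub>C y)
      = ip x x + cnj c * ip x y + (cnj (cnj c * ip x y) + of_real ((cmod c)\<^sup>2 * sq y))" by metis
  then show ?thesis by (simp only: sq_def[of "x + c *\<^sub>C y"]) (simp add: sq_def)
qed

lemma sq_scale: "y \<in> H \<Longrightarrow> sq (c *\<^sub>C y) = (cmod c)\<^sup>2 * sq y"
proof -
  assume y: "y \<in> H"
  have "ip (0 *\<^sub>C y) z = 0" if "z \<in> H" for z using ip_scale[OF y that, of 0] by simp
  then have z: "ip 0 z = 0" if "z \<in> H" for z using that by simp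
  have "0 \<in> H" by (rule complex_vector.subspace_0[OF H])
  from sq_add_scale[OF this y, of c] show ?thesis using z[OF y] z[OF \<open>0 \<in> H\<close>] by (simp add: sq_def)
qed

lemma parallelogram:
  assumes "x \<in> H" "y \<in> H"
  shows "sq (x + y) + sq (x - y) = 2 * sq x + 2 * sq y"
  using sq_add_scale[OF assms, of 1] sq_add_scale[OF assms, of "-1"]
  by (simp add: scaleC_one scaleC_minus1)

lemma cauchy_schwarz:
  assumes "x \<in> H" "y \<in> H"
  shows "cmod (ip x y) \<le> nrm x * nrm y"
proof -
  define z where "z = ip x y"
  have key: "0 \<le> sq x - 2 * s * (cmod z)\<^sup>2 + s\<^sup>2 * (cmod z)\<^sup>2 * sq y" for s
  proof -
    have "0 \<le> sq (x + (of_real (- s) * z) *\<^sub>C y)" using assms by (intro sq_nonneg mem_add mem_scale)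
    also have "\<dots> = sq x - 2 * s * (cmod z)\<^sup>2 + s\<^sup>2 * (cmod z)\<^sup>2 * sq y"
      unfolding sq_add_scale[OF assms] z_def[symmetric] Re_cnj_scaled cmod_scaled_squared by simp
    finally show ?thesis .
  qed
  have "(cmod z)\<^sup>2 \<le> sq x * sq y"
  proof (cases "sq y = 0")
    case True
    have "(cmod z)\<^sup>2 = 0"
    proof (rule ccontr)
      assume "(cmod z)\<^sup>2 \<noteq> 0"
      then have p: "(cmod z)\<^sup>2 > 0" by simp
      \<comment> \<open>With \<open>sq y = 0\<close> the expression in \<open>s\<close> is affine,
        and this value of \<open>s\<close> makes it \<open>- sq x - 2\<close>.\<close>
      have "0 \<le> sq x - 2 * ((sq x + 1) / (cmod z)\<^sup>2) * (cmod z)\<^sup>2"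
        using key[of "(sq x + 1) / (cmod z)\<^sup>2"] True by simp
      also have "\<dots> = - sq x - 2" using p by (simp add: field_simps)
      finally show False using sq_nonneg[OF assms(1)] by linarith
    qed
    then show ?thesis using True by simp
  next
    case False
    then have p: "sq y > 0" using sq_nonneg[OF assms(2)] by simp
    \<comment> \<open>The choice \<open>s = 1 / sq y\<close> minimises the quadratic.\<close>
    have "0 \<le> sq x - 2 * (1 / sq y) * (cmod z)\<^sup>2 + (1 / sq y)\<^sup>2 * (cmod z)\<^sup>2 * sq y" by (rule key)
    also have "\<dots> = sq x - (cmod z)\<^sup>2 / sq y" using p by (simp add: power2_eq_square field_simps)
    finally show ?thesis using p by (simp add: field_simps)
  qed
  then have "(cmod z)\<^sup>2 \<le> (nrm x * nrm y)\<^sup>2" using assms by (simp add: nrm_sq power_mult_distrib)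
  then show ?thesis unfolding z_def
    by (rule power2_le_imp_le) (use assms nrm_nonneg in simp)
qed

lemma nrm_triangle:
  assumes "x \<in> H" "y \<in> H"
  shows "nrm (x + y) \<le> nrm x + nrm y"
proof (rule power2_le_imp_le)
  have "(nrm (x + y))\<^sup>2 = sq x + 2 * Re (ip x y) + sq y"
    using sq_add_scale[OF assms, of 1] assms by (simp add: nrm_sq mem_add scaleC_one)
  also have "\<dots> \<le> (nrm x + nrm y)\<^sup>2"
    using cauchy_schwarz[OF assms] complex_Re_le_cmod[of "ip x y"] assms by (simp add: power2_sum nrm_sq)
  finally show "(nrm (x + y))\<^sup>2 \<le> (nrm x + nrm y)\<^sup>2" .
qed (use assms nrm_nonneg in simp)

lemma nrm_scale: "x \<in> H \<Longrightarrow> nrm (c *\<^sub>C x) = cmod c * nrm x"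
  by (simp add: nrm_def sq_scale real_sqrt_mult)

lemma nrm_seminorm: "seminorm_on H nrm"
  by (rule seminorm_onI[OF H]) (simp_all add: nrm_nonneg nrm_triangle nrm_scale)

text \<open>A relation instead of a function, as the projection is determined only up to null
  vectors. Membership of \<open>p\<close> in the closure of \<open>K\<close> is expressed by
  approximation.\<close>

definition is_proj :: "'a set \<Rightarrow> 'a \<Rightarrow> 'a \<Rightarrow> bool" where
  "is_proj K \<xi> p \<longleftrightarrow> p \<in> H \<and> (\<forall>e>0. \<exists>k\<in>K. nrm (p - k) < e) \<and> (\<forall>k\<in>K. ip (\<xi> - p) k = 0)"

lemma orthogonal_limit:
  assumes K: "K \<subseteq> H" and p: "p \<in> H" "\<forall>e>0. \<exists>k\<in>K. nrm (p - k) < e"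
    and z: "z \<in> H" "\<And>k. k \<in> K \<Longrightarrow> ip k z = 0"
  shows "ip p z = 0"
proof -
  have "cmod (ip p z) \<le> 0"
  proof (rule field_le_epsilon)
    fix e :: real assume e: "e > 0"
    have d: "e / (nrm z + 1) > 0" using e nrm_nonneg[OF z(1)] by simp
    then obtain k where k: "k \<in> K" "nrm (p - k) < e / (nrm z + 1)" using p(2) by blast
    have kH: "k \<in> H" using k K by blast
    have "cmod (ip p z) = cmod (ip (p - k) z)" using ip_diff[OF p(1) kH z(1)] z(2)[OF k(1)] by simp
    also have "\<dots> \<le> nrm (p - k) * nrm z" by (rule cauchy_schwarz) (use p kH z mem_diff in auto)
    also have "\<dots> \<le> (e / (nrm z + 1)) * nrm z"
      using k(2) nrm_nonneg[OF z(1)] by (intro mult_right_mono) simp_all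
    also have "\<dots> \<le> e" using e nrm_nonneg[OF z(1)] by (simp add: field_simps)
    finally show "cmod (ip p z) \<le> 0 + e" by simp
  qed
  then show ?thesis by simp
qed

text \<open>A minimising sequence is Cauchy by the parallelogram law, and its limit is orthogonal to
  \<open>K\<close> because a small correction along \<open>k\<close> would come closer. As
  \<open>K\<close> need not be closed, the limit may leave it.\<close>

lemma projection_exists:
  assumes complete: "\<And>s. (\<And>n. s n \<in> H) \<Longrightarrow> (\<And>e. e > 0 \<Longrightarrow> \<exists>N. \<forall>m\<ge>N. \<forall>n\<ge>N. nrm (s m - s n) < e)
      \<Longrightarrow> \<exists>x\<in>H. (\<lambda>n. nrm (s n - x)) \<longlonglongrightarrow> 0"
    and K: "complex_vector.subspace K" "K \<subseteq> H" and \<xi>: "\<xi> \<in> H"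
  shows "\<exists>p. is_proj K \<xi> p"
proof -
  define d where "d = (INF k\<in>K. sq (\<xi> - k))"
  have K0: "0 \<in> K" by (rule complex_vector.subspace_0[OF K(1)])
  have dmem: "\<xi> - k \<in> H" if "k \<in> K" for k using that K(2) \<xi> mem_diff by blast
  have bdd: "bdd_below ((\<lambda>k. sq (\<xi> - k)) ` K)"
    by (rule bdd_belowI[of _ 0]) (use dmem sq_nonneg in auto)
  have dle: "d \<le> sq (\<xi> - k)" if "k \<in> K" for k unfolding d_def by (rule cINF_lower[OF bdd that])
  have d0: "0 \<le> d" unfolding d_def by (rule cINF_greatest) (use K0 dmem sq_nonneg in auto)
  have "\<exists>k\<in>K. sq (\<xi> - k) < d + 1 / (real n + 1)" for n
  proof -
    have "(INF k\<in>K. sq (\<xi> - k)) < d + 1 / (real n + 1)" unfolding d_def[symmetric] by (simp add: add_nonneg_pos)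
    then show ?thesis using cInf_lessD[of "(\<lambda>k. sq (\<xi> - k)) ` K"] K0 by blast
  qed
  then obtain s where s: "\<And>n. s n \<in> K" "\<And>n. sq (\<xi> - s n) < d + 1 / (real n + 1)" by metis
  have sH: "s n \<in> H" for n using s(1) K(2) by blast
  have near: "sq (s m - s n) \<le> 2 / (real m + 1) + 2 / (real n + 1)" for m n
  proof -
    let ?a = "\<xi> - s m" and ?b = "\<xi> - s n"
    \<comment> \<open>Midpoints stay in \<open>K\<close>, so their squared distance to
      \<open>\<xi>\<close> is at least \<open>d\<close>; the parallelogram law then forces
      \<open>s m\<close> and \<open>s n\<close> together.\<close>
    have mid: "(1/2) *\<^sub>C (s m + s n) \<in> K"
      by (rule complex_vector.subspace_scale[OF K(1) complex_vector.subspace_add[OF K(1) s(1) s(1)]])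
    have half: "(2::complex) *\<^sub>C (1/2) *\<^sub>C w = w" "(2::complex) *\<^sub>C w = w + w" for w :: 'a
      using scaleC_add_left[of 1 1 w] by (simp_all add: scaleC_scaleC scaleC_one)
    define h where "h = (1/2) *\<^sub>C (s m + s n)"
    have hh: "h + h = s m + s n" using half unfolding h_def by metis
    have "2 *\<^sub>C (\<xi> - h) = (\<xi> + \<xi>) - (h + h)" unfolding half(2) by (simp add: algebra_simps)
    then have "?a + ?b = 2 *\<^sub>C (\<xi> - (1/2) *\<^sub>C (s m + s n))"
      unfolding hh unfolding h_def by (simp add: algebra_simps)
    then have "sq (?a + ?b) = 4 * sq (\<xi> - (1/2) *\<^sub>C (s m + s n))"
      using sq_scale[OF dmem[OF mid], of 2] by simp
    then have "sq (?a + ?b) \<ge> 4 * d" using dle[OF mid] by simp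
    moreover have "sq (?a + ?b) + sq (?a - ?b) = 2 * sq ?a + 2 * sq ?b"
      by (rule parallelogram) (use dmem s(1) in auto)
    moreover have "?a - ?b = s n - s m" by simp
    moreover have "sq (s n - s m) = sq (s m - s n)"
      using sq_scale[OF mem_diff[OF sH sH], of "-1" m n] by (simp add: scaleC_minus1)
    ultimately show ?thesis using s(2)[of m] s(2)[of n] by simp
  qed
  have "\<exists>x\<in>H. (\<lambda>n. nrm (s n - x)) \<longlonglongrightarrow> 0"
  proof (rule complete[OF sH])
    fix e :: real assume e: "e > 0"
    obtain N where N: "real N > 4 / e\<^sup>2" using reals_Archimedean2 by blast
    have "nrm (s m - s n) < e" if "m \<ge> N" "n \<ge> N" for m n
    proof -
      have "2 / (real m + 1) \<le> 2 / (real N + 1)" "2 / (real n + 1) \<le> 2 / (real N + 1)"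
        using that by (simp_all add: frac_le)
      then have "sq (s m - s n) \<le> 2 / (real N + 1) + 2 / (real N + 1)" using near[of m n] by linarith
      also have "\<dots> = 4 / (real N + 1)" by (simp flip: add_divide_distrib)
      finally have "sq (s m - s n) \<le> 4 / (real N + 1)" .
      also have "\<dots> < e\<^sup>2"
      proof -
        have "4 < e\<^sup>2 * real N" using N e by (simp add: field_simps)
        then have "4 < e\<^sup>2 * (real N + 1)" using e by (simp add: algebra_simps add_strict_increasing)
        then show ?thesis by (simp add: divide_less_eq)
      qed
      finally have "(nrm (s m - s n))\<^sup>2 < e\<^sup>2" by (simp add: nrm_sq mem_diff sH)
      then show ?thesis by (rule power_less_imp_less_base) (use e in simp)
    qed
    then show "\<exists>N. \<forall>m\<ge>N. \<forall>n\<ge>N. nrm (s m - s n) < e" by blast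
  qed
  then obtain p where p: "p \<in> H" "(\<lambda>n. nrm (s n - p)) \<longlonglongrightarrow> 0" by blast
  note mc = seminorm_on_minus_commute[OF nrm_seminorm]
  have approx: "\<exists>k\<in>K. nrm (p - k) < e" if "e > 0" for e
  proof -
    have "\<forall>\<^sub>F n in sequentially. nrm (s n - p) < e" by (rule order_tendstoD(2)[OF p(2) that])
    then obtain n where "nrm (s n - p) < e" by (auto simp: eventually_sequentially)
    then show ?thesis using s(1)[of n] mc[OF p(1) sH[of n]] by (intro bexI[of _ "s n"]) simp_all
  qed
  \<comment> \<open>The limit \<open>p\<close> need not lie in \<open>K\<close>, so minimality
    reaches \<open>\<xi> - p + v\<close> through the approximants \<open>s n - v\<close>.\<close>
  have lower: "sqrt d \<le> nrm (\<xi> - p + v)" if v: "v \<in> K" for v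
  proof -
    have vH: "v \<in> H" using v K(2) by blast
    have "sqrt d \<le> nrm (\<xi> - p + v) + nrm (s n - p)" for n
    proof -
      have kv: "s n - v \<in> K" by (rule subspace_minus[OF K(1) s(1) v])
      have "sqrt d \<le> nrm (\<xi> - (s n - v))" unfolding nrm_def using dle[OF kv] by simp
      also have "\<xi> - (s n - v) = (\<xi> - p + v) + (p - s n)" by simp
      also have "nrm \<dots> \<le> nrm (\<xi> - p + v) + nrm (p - s n)"
        by (rule nrm_triangle) (use \<xi> p(1) vH sH mem_diff mem_add in auto)
      finally show ?thesis using mc[OF p(1) sH] by simp
    qed
    moreover have "(\<lambda>n. nrm (\<xi> - p + v) + nrm (s n - p)) \<longlonglongrightarrow> nrm (\<xi> - p + v) + 0"
      by (intro tendsto_intros p)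
    ultimately show ?thesis using LIMSEQ_le_const[of _ "nrm (\<xi> - p + v) + 0" "sqrt d"] by auto
  qed
  have upper: "nrm (\<xi> - p) \<le> sqrt d"
  proof (rule LIMSEQ_le_const)
    show "(\<lambda>n. sqrt (d + 1 / (real n + 1)) + nrm (s n - p)) \<longlonglongrightarrow> sqrt d"
    proof -
      have "(\<lambda>n. sqrt (d + 1 / (real n + 1)) + nrm (s n - p)) \<longlonglongrightarrow> sqrt (d + 0) + 0"
        using LIMSEQ_inverse_real_of_nat by (intro tendsto_intros p) (simp add: inverse_eq_divide add.commute)
      then show ?thesis by simp
    qed
    have "nrm (\<xi> - p) \<le> sqrt (d + 1 / (real n + 1)) + nrm (s n - p)" for n
    proof -
      have "nrm (\<xi> - p) = nrm ((\<xi> - s n) + (s n - p))" by simp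
      also have "\<dots> \<le> nrm (\<xi> - s n) + nrm (s n - p)" by (rule nrm_triangle) (use \<xi> sH p(1) mem_diff in auto)
      also have "nrm (\<xi> - s n) \<le> sqrt (d + 1 / (real n + 1))" unfolding nrm_def using s(2)[of n] by simp
      finally show ?thesis by simp
    qed
    then show "\<exists>N. \<forall>n\<ge>N. nrm (\<xi> - p) \<le> sqrt (d + 1 / (real n + 1)) + nrm (s n - p)" by blast
  qed
  have "ip (\<xi> - p) k = 0" if k: "k \<in> K" for k
  proof (rule ccontr)
    define z where "z = ip (\<xi> - p) k"
    assume "ip (\<xi> - p) k \<noteq> 0"
    then have z: "(cmod z)\<^sup>2 > 0" by (simp add: z_def)
    have kH: "k \<in> H" and xp: "\<xi> - p \<in> H" using k K(2) \<xi> p(1) mem_diff by auto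
    \<comment> \<open>Small enough that the quadratic term of the expansion stays below the linear
      one, which contradicts minimality.\<close>
    define r where "r = 1 / (sq k + 1)"
    have r: "r > 0" "r * sq k < 1" using sq_nonneg[OF kH] by (simp_all add: r_def)
    have "sqrt d \<le> nrm (\<xi> - p + (of_real (- r) * z) *\<^sub>C k)"
      by (rule lower[OF complex_vector.subspace_scale[OF K(1) k]])
    then have "d \<le> sq (\<xi> - p + (of_real (- r) * z) *\<^sub>C k)" by (simp add: nrm_def)
    also have "\<dots> = sq (\<xi> - p) - 2 * r * (cmod z)\<^sup>2 + r\<^sup>2 * (cmod z)\<^sup>2 * sq k"
      unfolding sq_add_scale[OF xp kH] z_def[symmetric] Re_cnj_scaled cmod_scaled_squared by simp
    also have "sq (\<xi> - p) \<le> d" using upper by (simp add: nrm_def)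
    finally have "2 * r * (cmod z)\<^sup>2 \<le> r\<^sup>2 * (cmod z)\<^sup>2 * sq k" by simp
    also have "\<dots> = (r * (cmod z)\<^sup>2) * (r * sq k)" by (simp add: power2_eq_square)
    also have "\<dots> \<le> (r * (cmod z)\<^sup>2) * 1" using r z by (intro mult_left_mono) simp_all
    finally show False using r z by simp
  qed
  then show ?thesis unfolding is_proj_def using p(1) approx by blast
qed

end

section \<open>The Hilbert space of square integrable functions\<close>

lemma L2D:
  assumes "f \<in> L2 \<mu>" shows "f \<in> borel_measurable \<mu>" "integrable \<mu> (\<lambda>x. (cmod (f x))\<^sup>2)"
  using assms by (auto simp: L2_def)

lemma L2_bound:
  assumes "f \<in> borel_measurable \<mu>" "integrable \<mu> h" "\<And>x. (cmod (f x))\<^sup>2 \<le> h x"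
  shows "f \<in> L2 \<mu>"
proof -
  have "integrable \<mu> (\<lambda>x. (cmod (f x))\<^sup>2)"
  proof (rule Bochner_Integration.integrable_bound[OF assms(2)])
    show "(\<lambda>x. (cmod (f x))\<^sup>2) \<in> borel_measurable \<mu>" using assms(1) by measurable
    show "AE x in \<mu>. norm ((cmod (f x))\<^sup>2) \<le> norm (h x)"
      using assms(3) by (intro AE_I2) (simp add: abs_of_nonneg order_trans[OF zero_le_power2 assms(3)])
  qed
  then show ?thesis using assms(1) by (simp add: L2_def)
qed

lemma cmod_add_squared_le2: "(cmod (a + b))\<^sup>2 \<le> 2 * (cmod a)\<^sup>2 + 2 * (cmod b)\<^sup>2"
  using cmod_add_squared_le[of 1 1 a b] by simp

lemma L2_subspace: "complex_vector.subspace (L2 \<mu>)"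
proof (rule complex_vector.subspaceI)
  show "0 \<in> L2 \<mu>" by (simp add: L2_def zero_fun_def)
  show "f + g \<in> L2 \<mu>" if f: "f \<in> L2 \<mu>" and g: "g \<in> L2 \<mu>" for f g
  proof (rule L2_bound)
    show "f + g \<in> borel_measurable \<mu>" unfolding plus_fun_def using L2D(1)[OF f] L2D(1)[OF g] by measurable
    show "integrable \<mu> (\<lambda>x. 2 * (cmod (f x))\<^sup>2 + 2 * (cmod (g x))\<^sup>2)"
      using L2D(2)[OF f] L2D(2)[OF g] by simp
  qed (simp add: cmod_add_squared_le2)
  show "c *\<^sub>C f \<in> L2 \<mu>" if f: "f \<in> L2 \<mu>" for c f
  proof (rule L2_bound)
    show "c *\<^sub>C f \<in> borel_measurable \<mu>"
      unfolding scaleC_fun_def scaleC_complex_def using L2D(1)[OF f] by measurable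
    show "integrable \<mu> (\<lambda>x. (cmod c)\<^sup>2 * (cmod (f x))\<^sup>2)" using L2D(2)[OF f] by simp
  qed (simp add: scaleC_fun_def scaleC_complex_def norm_mult power_mult_distrib)
qed

lemma L2_inner_integrable:
  assumes f: "f \<in> L2 \<mu>" and g: "g \<in> L2 \<mu>"
  shows "integrable \<mu> (\<lambda>x. f x * cnj (g x))"
proof (rule Bochner_Integration.integrable_bound)
  show "integrable \<mu> (\<lambda>x. (cmod (f x))\<^sup>2 + (cmod (g x))\<^sup>2)" using L2D(2)[OF f] L2D(2)[OF g] by simp
  have "(\<lambda>x. cnj (g x)) \<in> borel_measurable \<mu>"
    by (rule measurable_compose[OF L2D(1)[OF g] borel_measurable_continuous_onI[OF continuous_on_cnj[OF continuous_on_id]]])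
  then show "(\<lambda>x. f x * cnj (g x)) \<in> borel_measurable \<mu>" using L2D(1)[OF f] by measurable
  have "cmod a * cmod b \<le> (cmod a)\<^sup>2 + (cmod b)\<^sup>2" for a b :: complex
  proof -
    have "0 \<le> (cmod a - cmod b)\<^sup>2" by simp
    then have "2 * (cmod a * cmod b) \<le> (cmod a)\<^sup>2 + (cmod b)\<^sup>2" by (simp add: power2_diff)
    moreover have "0 \<le> cmod a * cmod b" by simp
    ultimately show ?thesis by linarith
  qed
  then show "AE x in \<mu>. norm (f x * cnj (g x)) \<le> norm ((cmod (f x))\<^sup>2 + (cmod (g x))\<^sup>2)"
    by (intro AE_I2) (simp add: norm_mult)
qed

lemma L2_inner_self: "L2_inner \<mu> f f = of_real (\<integral>x. (cmod (f x))\<^sup>2 \<partial>\<mu>)"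
  unfolding L2_inner_def by (simp flip: complex_norm_square integral_complex_of_real)

interpretation L2: semi_inner "L2 \<mu>" "L2_inner \<mu>" for \<mu>
proof
  show "complex_vector.subspace (L2 \<mu>)" by (rule L2_subspace)
  show "L2_inner \<mu> (f + g) h = L2_inner \<mu> f h + L2_inner \<mu> g h" if "f \<in> L2 \<mu>" "g \<in> L2 \<mu>" "h \<in> L2 \<mu>" for f g h
    unfolding L2_inner_def using that by (simp add: distrib_right L2_inner_integrable)
  show "L2_inner \<mu> (c *\<^sub>C f) h = c * L2_inner \<mu> f h" if "f \<in> L2 \<mu>" "h \<in> L2 \<mu>" for c f h
    unfolding L2_inner_def scaleC_fun_def scaleC_complex_def by (simp add: mult.assoc)
  show "L2_inner \<mu> g f = cnj (L2_inner \<mu> f g)" if "f \<in> L2 \<mu>" "g \<in> L2 \<mu>" for f g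
    unfolding L2_inner_def by (subst Bochner_Integration.integral_cnj[symmetric]) (simp add: mult.commute)
  show "0 \<le> Re (L2_inner \<mu> f f)" for f by (simp add: L2_inner_self)
qed

lemma L2_sq_eq: "L2.sq \<mu> f = (\<integral>x. (cmod (f x))\<^sup>2 \<partial>\<mu>)"
  by (simp add: L2.sq_def L2_inner_self)

lemma L2_nrm_eq: "L2.nrm \<mu> = L2_norm \<mu>"
  by (simp add: fun_eq_iff L2.nrm_def L2_norm_def L2_sq_eq)

lemma L2_norm_nonneg: "0 \<le> L2_norm \<mu> f"
  by (simp add: L2_norm_def)

lemma L2_norm_sq: "(L2_norm \<mu> f)\<^sup>2 = (\<integral>x. (cmod (f x))\<^sup>2 \<partial>\<mu>)"
  by (simp add: L2_norm_def)

lemmas L2_cauchy_schwarz = L2.cauchy_schwarz[unfolded L2_nrm_eq]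
lemmas L2_norm_triangle = L2.nrm_triangle[unfolded L2_nrm_eq]
lemmas L2_norm_scale = L2.nrm_scale[unfolded L2_nrm_eq]
lemmas L2_norm_seminorm = L2.nrm_seminorm[unfolded L2_nrm_eq]

lemma L2_norm_cong_AE:
  assumes "f \<in> borel_measurable \<mu>" "g \<in> borel_measurable \<mu>" "AE x in \<mu>. f x = g x"
  shows "L2_norm \<mu> f = L2_norm \<mu> g"
proof -
  have "(\<integral>x. (cmod (f x))\<^sup>2 \<partial>\<mu>) = (\<integral>x. (cmod (g x))\<^sup>2 \<partial>\<mu>)"
    using assms by (intro integral_cong_AE) auto
  then show ?thesis by (simp add: L2_norm_def)
qed

lemma L2_norm_0_AE:
  assumes f: "f \<in> L2 \<mu>" and "L2_norm \<mu> f = 0"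
  shows "AE x in \<mu>. f x = 0"
proof -
  have "(\<integral>x. (cmod (f x))\<^sup>2 \<partial>\<mu>) = 0" using assms(2) L2_norm_sq[of \<mu> f] by simp
  then have "AE x in \<mu>. (cmod (f x))\<^sup>2 = 0"
    using integral_nonneg_eq_0_iff_AE[OF L2D(2)[OF f]] by simp
  then show ?thesis by simp
qed

lemma L2_AE_norm_0:
  assumes "f \<in> L2 \<mu>" "AE x in \<mu>. f x = 0"
  shows "L2_norm \<mu> f = 0"
  using L2_norm_cong_AE[of f \<mu> "\<lambda>_. 0"] assms L2D(1)[OF assms(1)] by (simp add: L2_norm_def)

lemma L2_inner_cong_AE:
  assumes "f \<in> L2 \<mu>" "f' \<in> L2 \<mu>" "g \<in> L2 \<mu>" "AE x in \<mu>. f x = f' x"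
  shows "L2_inner \<mu> f g = L2_inner \<mu> f' g"
  unfolding L2_inner_def
proof (rule integral_cong_AE)
  show "(\<lambda>x. f x * cnj (g x)) \<in> borel_measurable \<mu>"
    by (rule borel_measurable_integrable[OF L2_inner_integrable[OF assms(1,3)]])
  show "(\<lambda>x. f' x * cnj (g x)) \<in> borel_measurable \<mu>"
    by (rule borel_measurable_integrable[OF L2_inner_integrable[OF assms(2,3)]])
  show "AE x in \<mu>. f x * cnj (g x) = f' x * cnj (g x)" using assms(4) by eventually_elim simp
qed

text \<open>The Riesz-Fischer argument: a fast subsequence converges almost everywhere, and Fatou's
  lemma turns this into convergence in norm of the whole sequence.\<close>

lemma L2_complete:
  assumes s: "\<And>n. s n \<in> L2 \<mu>" and C: "\<And>e. e > 0 \<Longrightarrow> \<exists>N. \<forall>m\<ge>N. \<forall>n\<ge>N. L2_norm \<mu> (s m - s n) < e"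
  shows "\<exists>f\<in>L2 \<mu>. (\<lambda>n. L2_norm \<mu> (s n - f)) \<longlonglongrightarrow> 0"
proof -
  have dmem: "s m - s n \<in> L2 \<mu>" for m n by (rule L2.mem_diff[OF s s])
  have sqint: "(\<integral>\<^sup>+x. ennreal ((cmod (f x))\<^sup>2) \<partial>\<mu>) = ennreal ((L2_norm \<mu> f)\<^sup>2)" if "f \<in> L2 \<mu>" for f
    unfolding L2_norm_sq by (rule nn_integral_eq_integral[OF L2D(2)[OF that]]) simp
  have "\<forall>k. \<exists>N. \<forall>m\<ge>N. \<forall>n\<ge>N. L2_norm \<mu> (s m - s n) < (1/2)^k" using C by simp
  then obtain M where M: "\<And>k m n. m \<ge> M k \<Longrightarrow> n \<ge> M k \<Longrightarrow> L2_norm \<mu> (s m - s n) < (1/2)^k" by metis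
  \<comment> \<open>Partial sums make \<open>r j\<close> at least \<open>M k\<close> for every
    \<open>k \<le> j\<close> at once.\<close>
  define r where "r k = (\<Sum>i\<le>k. M i)" for k
  have rM0: "r j \<ge> M k" if "k \<le> j" for j k
    unfolding r_def by (rule member_le_sum) (use that in simp_all)
  have rM: "r k \<ge> M k" "r (Suc k) \<ge> M k" for k by (simp_all add: rM0)
  define t where "t k = s (r k)" for k
  have t: "t k \<in> L2 \<mu>" for k by (simp add: t_def s)
  have tm: "t k \<in> borel_measurable \<mu>" for k by (rule L2D(1)[OF t])
  have td: "L2_norm \<mu> (t (Suc k) - t k) \<le> (1/2)^k" for k
    unfolding t_def using M[OF rM(2) rM(1)] by (rule less_imp_le)
  have "(\<integral>\<^sup>+x. (\<Sum>k. ennreal (2^k * (cmod (t (Suc k) x - t k x))\<^sup>2)) \<partial>\<mu>)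
      = (\<Sum>k. \<integral>\<^sup>+x. ennreal (2^k * (cmod (t (Suc k) x - t k x))\<^sup>2) \<partial>\<mu>)"
    by (rule nn_integral_suminf) (use tm in measurable)
  also have "\<dots> \<le> (\<Sum>k. ennreal ((1/2)^k))"
  proof (rule suminf_le)
    fix k
    have m: "t (Suc k) - t k \<in> L2 \<mu>" by (rule L2.mem_diff[OF t t])
    have "(\<integral>\<^sup>+x. ennreal (2^k * (cmod (t (Suc k) x - t k x))\<^sup>2) \<partial>\<mu>)
        = ennreal (2^k) * (\<integral>\<^sup>+x. ennreal ((cmod ((t (Suc k) - t k) x))\<^sup>2) \<partial>\<mu>)"
    proof (subst nn_integral_cmult[symmetric])
      have "(\<lambda>x. (cmod (t (Suc k) x - t k x))\<^sup>2) \<in> borel_measurable \<mu>"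
        using tm[of k] tm[of "Suc k"] by measurable
      then show "(\<lambda>x. ennreal ((cmod ((t (Suc k) - t k) x))\<^sup>2)) \<in> borel_measurable \<mu>" by simp
    qed (simp add: ennreal_mult)
    also have "\<dots> = ennreal (2^k * (L2_norm \<mu> (t (Suc k) - t k))\<^sup>2)"
      unfolding sqint[OF m] by (simp add: ennreal_mult)
    also have "2^k * (L2_norm \<mu> (t (Suc k) - t k))\<^sup>2 \<le> 2^k * ((1/2)^k)\<^sup>2"
      by (intro mult_left_mono power_mono td L2_norm_nonneg) simp
    also have "2^k * ((1/2::real)^k)\<^sup>2 = (1/2)^k"
      by (simp add: power2_eq_square power_one_over field_simps)
    finally show "(\<integral>\<^sup>+x. ennreal (2^k * (cmod (t (Suc k) x - t k x))\<^sup>2) \<partial>\<mu>) \<le> ennreal ((1/2)^k)"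
      by (simp add: ennreal_leI)
  qed auto
  also have "\<dots> < \<infinity>"
    by (subst suminf_ennreal2) (auto simp: summable_geometric)
  finally have "(\<integral>\<^sup>+x. (\<Sum>k. ennreal (2^k * (cmod (t (Suc k) x - t k x))\<^sup>2)) \<partial>\<mu>) \<noteq> \<infinity>" by simp
  then have "AE x in \<mu>. (\<Sum>k. ennreal (2^k * (cmod (t (Suc k) x - t k x))\<^sup>2)) \<noteq> \<infinity>"
    by (rule nn_integral_PInf_AE[rotated]) (use tm in measurable)
  \<comment> \<open>The weight \<open>2 ^ k\<close> still leaves integrals of order
    \<open>(1/2) ^ k\<close>. Finiteness of the weighted series makes the increments at almost every
    point decay like powers of \<open>sqrt (1/2)\<close>, hence absolutely summable.\<close>
  then have conv: "AE x in \<mu>. convergent (\<lambda>k. t k x)"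
  proof eventually_elim
    case (elim x)
    define F where "F k = ennreal (2^k * (cmod (t (Suc k) x - t k x))\<^sup>2)" for k
    obtain B where B: "(\<Sum>k. F k) = ennreal B" "B \<ge> 0"
      using elim unfolding F_def[symmetric] by (cases "\<Sum>k. F k" rule: ennreal_cases) simp_all
    have le: "2^k * (cmod (t (Suc k) x - t k x))\<^sup>2 \<le> B" for k
    proof -
      have "sum F {k} \<le> (\<Sum>k. F k)" by (rule sum_le_suminf) simp_all
      then have "ennreal (2^k * (cmod (t (Suc k) x - t k x))\<^sup>2) \<le> ennreal B"
        unfolding B(1) by (simp only: F_def sum.insert sum.empty finite.emptyI empty_iff not_False_eq_True add_0_right)
      then show ?thesis using B(2) by (simp only: ennreal_le_iff)
    qed
    have bnd: "cmod (t (Suc k) x - t k x) \<le> sqrt B * (sqrt (1/2))^k" for k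
    proof (rule power2_le_imp_le)
      have "(cmod (t (Suc k) x - t k x))\<^sup>2 \<le> B * (1/2)^k"
        using le[of k] by (simp add: power_one_over field_simps)
      also have "\<dots> = (sqrt B * (sqrt (1/2))^k)\<^sup>2"
      proof -
        have "((sqrt (1/2))^k)\<^sup>2 = ((sqrt (1/2))\<^sup>2)^k" by (simp only: power_mult[symmetric] mult.commute)
        also have "\<dots> = (1/2)^k" by simp
        finally show ?thesis using B(2) by (simp add: power_mult_distrib)
      qed
      finally show "(cmod (t (Suc k) x - t k x))\<^sup>2 \<le> (sqrt B * (sqrt (1/2))^k)\<^sup>2" .
    qed (use B(2) in simp)
    have sg: "summable (\<lambda>k. sqrt B * (sqrt (1/2))^k)"
    proof (intro summable_mult summable_geometric)
      have "sqrt (1/2) < sqrt 1" unfolding real_sqrt_less_iff by simp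
      then show "norm (sqrt (1/2)) < 1" by simp
    qed
    have "summable (\<lambda>k. t (Suc k) x - t k x)"
      by (rule summable_comparison_test'[OF sg, where N=0]) (rule bnd)
    then obtain l where "(\<lambda>n. \<Sum>k<n. t (Suc k) x - t k x) \<longlonglongrightarrow> l"
      by (auto simp: summable_def sums_def)
    then have "(\<lambda>n. t n x - t 0 x) \<longlonglongrightarrow> l"
      by (simp only: sum_lessThan_telescope[of "\<lambda>n. t n x"])
    from tendsto_add[OF this tendsto_const[of "t 0 x"]] show ?case by (simp add: convergentI)
  qed
  define f where "f x = lim (\<lambda>k. t k x)" for x
  have fm: "f \<in> borel_measurable \<mu>"
    unfolding f_def by (rule borel_measurable_lim_metric) (rule tm)
  have lim: "AE x in \<mu>. (\<lambda>k. t k x) \<longlonglongrightarrow> f x"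
    using conv by eventually_elim (simp add: f_def convergent_LIMSEQ_iff)
  \<comment> \<open>Fatou along the subsequence gives both that \<open>s n - f\<close> is square
    integrable and that it is small.\<close>
  have fatou: "(\<integral>\<^sup>+x. ennreal ((cmod (s n x - f x))\<^sup>2) \<partial>\<mu>) \<le> ennreal (((1/2)^k)\<^sup>2)" if n: "n \<ge> M k" for n k
  proof -
    have "(\<integral>\<^sup>+x. ennreal ((cmod (s n x - f x))\<^sup>2) \<partial>\<mu>) = (\<integral>\<^sup>+x. liminf (\<lambda>j. ennreal ((cmod (s n x - t j x))\<^sup>2)) \<partial>\<mu>)"
    proof (rule nn_integral_cong_AE)
      show "AE x in \<mu>. ennreal ((cmod (s n x - f x))\<^sup>2) = liminf (\<lambda>j. ennreal ((cmod (s n x - t j x))\<^sup>2))"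
        using lim
      proof eventually_elim
        case (elim x)
        have "(\<lambda>j. ennreal ((cmod (s n x - t j x))\<^sup>2)) \<longlonglongrightarrow> ennreal ((cmod (s n x - f x))\<^sup>2)"
          by (intro tendsto_intros tendsto_ennrealI elim)
        then show ?case using lim_imp_Liminf[OF sequentially_bot] by metis
      qed
    qed
    also have "\<dots> \<le> liminf (\<lambda>j. \<integral>\<^sup>+x. ennreal ((cmod (s n x - t j x))\<^sup>2) \<partial>\<mu>)"
      by (rule nn_integral_liminf) (use tm L2D(1)[OF s] in measurable)
    also have "\<dots> \<le> liminf (\<lambda>j. ennreal (((1/2)^k)\<^sup>2))"
    proof (rule Liminf_mono)
      show "\<forall>\<^sub>F j in sequentially. (\<integral>\<^sup>+x. ennreal ((cmod (s n x - t j x))\<^sup>2) \<partial>\<mu>) \<le> ennreal (((1/2)^k)\<^sup>2)"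
        using eventually_ge_at_top[of k]
      proof eventually_elim
        case (elim j)
        have "r j \<ge> M k" by (rule rM0[OF elim])
        then have "L2_norm \<mu> (s n - t j) < (1/2)^k" unfolding t_def using M n by blast
        then have "(L2_norm \<mu> (s n - t j))\<^sup>2 \<le> ((1/2)^k)\<^sup>2" by (intro power_mono) (auto simp: L2_norm_nonneg)
        then show ?case using sqint[OF L2.mem_diff[OF s[of n] t[of j]]] by (simp add: ennreal_leI)
      qed
    qed
    also have "\<dots> = ennreal (((1/2)^k)\<^sup>2)" by (simp add: Liminf_const)
    finally show ?thesis .
  qed
  have sf: "s n - f \<in> L2 \<mu>" if "n \<ge> M 0" for n
  proof -
    have m: "(\<lambda>x. s n x - f x) \<in> borel_measurable \<mu>" using L2D(1)[OF s] fm by measurable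
    have "(\<integral>\<^sup>+x. ennreal ((cmod (s n x - f x))\<^sup>2) \<partial>\<mu>) < \<infinity>"
      using fatou[OF that] by (simp add: le_less_trans)
    then have "integrable \<mu> (\<lambda>x. (cmod (s n x - f x))\<^sup>2)"
      by (intro integrableI_bounded) (use m in \<open>simp_all\<close>)
    then show ?thesis using m by (simp add: L2_def fun_diff_def)
  qed
  have f: "f \<in> L2 \<mu>" using L2.mem_diff[OF s[of "M 0"] sf[of "M 0"]] by simp
  moreover have "(\<lambda>n. L2_norm \<mu> (s n - f)) \<longlonglongrightarrow> 0"
  proof (rule LIMSEQ_I)
    fix e :: real assume "e > 0"
    obtain k where k: "(1/2::real)^k < e" using real_arch_pow_inv[of e "1/2"] \<open>e > 0\<close> by auto
    have "norm (L2_norm \<mu> (s n - f) - 0) < e" if n: "n \<ge> M k" for n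
    proof -
      have "ennreal ((L2_norm \<mu> (s n - f))\<^sup>2) \<le> ennreal (((1/2)^k)\<^sup>2)"
        using fatou[OF n] sqint[OF L2.mem_diff[OF s[of n] f]] by simp
      then have "(L2_norm \<mu> (s n - f))\<^sup>2 \<le> ((1/2)^k)\<^sup>2" by simp
      then have "L2_norm \<mu> (s n - f) \<le> (1/2)^k" by (rule power2_le_imp_le) simp
      then show ?thesis using k L2_norm_nonneg[of \<mu> "s n - f"] by simp
    qed
    then show "\<exists>N. \<forall>n\<ge>N. norm (L2_norm \<mu> (s n - f) - 0) < e" by blast
  qed
  ultimately show ?thesis by blast
qed

section \<open>Projections up to null vectors\<close>

context semi_inner
begin

context
  fixes K assumes K: "complex_vector.subspace K" "K \<subseteq> H"
begin

lemma proj_mem: "is_proj K \<xi> p \<Longrightarrow> p \<in> H"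
  by (simp add: is_proj_def)

lemma proj_orth: "is_proj K \<xi> p \<Longrightarrow> k \<in> K \<Longrightarrow> ip (\<xi> - p) k = 0"
  by (simp add: is_proj_def)

lemma proj_self: "\<xi> \<in> K \<Longrightarrow> is_proj K \<xi> \<xi>"
proof -
  assume x: "\<xi> \<in> K"
  then have xH: "\<xi> \<in> H" using K(2) by blast
  have "nrm (\<xi> - \<xi>) = 0" using nrm_scale[OF xH, of 0] by simp
  then have "\<exists>k\<in>K. nrm (\<xi> - k) < e" if "e > 0" for e using x that by (intro bexI[of _ \<xi>]) simp_all
  moreover have "ip (\<xi> - \<xi>) k = 0" if "k \<in> K" for k
    using ip_diff[OF xH xH, of k] that K(2) by (metis (no_types) cancel_comm_monoid_add_class.diff_cancel subsetD)
  ultimately show ?thesis unfolding is_proj_def using xH by blast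
qed

lemma proj_add:
  assumes "is_proj K \<xi> p" "is_proj K \<eta> q" "\<xi> \<in> H" "\<eta> \<in> H"
  shows "is_proj K (\<xi> + \<eta>) (p + q)"
proof -
  have pq: "p \<in> H" "q \<in> H" using assms proj_mem by auto
  have "\<exists>k\<in>K. nrm ((p + q) - k) < e" if e: "e > 0" for e
  proof -
    have "e / 2 > 0" using e by simp
    then obtain k l where k: "k \<in> K" "nrm (p - k) < e / 2" and l: "l \<in> K" "nrm (q - l) < e / 2"
      using assms(1,2) unfolding is_proj_def by meson
    have kl: "k \<in> H" "l \<in> H" using k l K(2) by auto
    have "(p + q) - (k + l) = (p - k) + (q - l)" by simp
    also have "nrm \<dots> \<le> nrm (p - k) + nrm (q - l)" by (intro nrm_triangle mem_diff pq kl)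
    finally have "nrm ((p + q) - (k + l)) < e" using k l by simp
    then show ?thesis using complex_vector.subspace_add[OF K(1) k(1) l(1)] by blast
  qed
  moreover have "ip ((\<xi> + \<eta>) - (p + q)) k = 0" if k: "k \<in> K" for k
  proof -
    have kH: "k \<in> H" using k K(2) by blast
    have "(\<xi> + \<eta>) - (p + q) = (\<xi> - p) + (\<eta> - q)" by simp
    also have "ip \<dots> k = ip (\<xi> - p) k + ip (\<eta> - q) k"
      by (intro ip_add mem_diff assms pq kH)
    finally show ?thesis using proj_orth[OF assms(1) k] proj_orth[OF assms(2) k] by simp
  qed
  ultimately show ?thesis unfolding is_proj_def using mem_add[OF pq] by blast
qed

lemma proj_scale:
  assumes "is_proj K \<xi> p" "\<xi> \<in> H"
  shows "is_proj K (c *\<^sub>C \<xi>) (c *\<^sub>C p)"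
proof -
  have p: "p \<in> H" using assms proj_mem by auto
  have "\<exists>k\<in>K. nrm (c *\<^sub>C p - k) < e" if e: "e > 0" for e
  proof -
    have pos: "1 + cmod c > 0" by (simp add: add_pos_nonneg)
    then have "e / (1 + cmod c) > 0" using e by simp
    then obtain k where k: "k \<in> K" "nrm (p - k) < e / (1 + cmod c)"
      using assms(1) unfolding is_proj_def by meson
    have kH: "k \<in> H" using k K(2) by auto
    have "nrm (c *\<^sub>C p - c *\<^sub>C k) = cmod c * nrm (p - k)"
      using nrm_scale[OF mem_diff[OF p kH], of c] by (simp add: complex_vector.scale_right_diff_distrib)
    also have "\<dots> \<le> (1 + cmod c) * nrm (p - k)" using nrm_nonneg[OF mem_diff[OF p kH]] by (simp add: mult_right_mono)
    also have "\<dots> < (1 + cmod c) * (e / (1 + cmod c))" by (rule mult_strict_left_mono[OF k(2) pos])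
    also have "\<dots> = e" using pos by simp
    finally show ?thesis using complex_vector.subspace_scale[OF K(1) k(1)] by blast
  qed
  moreover have "ip (c *\<^sub>C \<xi> - c *\<^sub>C p) k = 0" if k: "k \<in> K" for k
  proof -
    have kH: "k \<in> H" using k K(2) by blast
    have "ip (c *\<^sub>C (\<xi> - p)) k = c * ip (\<xi> - p) k" by (rule ip_scale[OF mem_diff[OF assms(2) p] kH])
    then show ?thesis using proj_orth[OF assms(1) k] by (simp add: complex_vector.scale_right_diff_distrib)
  qed
  ultimately show ?thesis unfolding is_proj_def using mem_scale[OF p] by blast
qed

text \<open>A vector that is approximable from \<open>K\<close> and orthogonal to \<open>K\<close>
  is orthogonal to itself.\<close>

lemma proj_zero_sq:
  assumes "p \<in> H" "\<forall>e>0. \<exists>k\<in>K. nrm (p - k) < e" "\<And>k. k \<in> K \<Longrightarrow> ip p k = 0"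
  shows "nrm p = 0"
proof -
  have "ip p p = 0"
  proof (rule orthogonal_limit[OF K(2) assms(1,2,1)])
    show "ip k p = 0" if "k \<in> K" for k
      using ip_cnj[OF assms(1), of k] assms(3)[OF that] that K(2) by (metis complex_cnj_zero subsetD)
  qed
  then show ?thesis by (simp add: nrm_def sq_def)
qed

lemma proj_unique:
  assumes "is_proj K \<xi> p" "is_proj K \<xi> q" "\<xi> \<in> H"
  shows "nrm (p - q) = 0"
proof (rule proj_zero_sq)
  have pq: "p \<in> H" "q \<in> H" using assms proj_mem by auto
  have n: "is_proj K ((-1) *\<^sub>C \<xi>) ((-1) *\<^sub>C q)" by (rule proj_scale[OF assms(2,3)])
  have "is_proj K (\<xi> + (-1) *\<^sub>C \<xi>) (p + (-1) *\<^sub>C q)"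
    by (rule proj_add[OF assms(1) n assms(3) mem_scale[OF assms(3)]])
  then have *: "is_proj K 0 (p - q)" by (simp add: scaleC_minus1)
  show "p - q \<in> H" by (rule mem_diff[OF pq])
  show "\<forall>e>0. \<exists>k\<in>K. nrm (p - q - k) < e" using * by (simp add: is_proj_def)
  show "ip (p - q) k = 0" if k: "k \<in> K" for k
  proof -
    have kH: "k \<in> H" using k K(2) by blast
    have "ip (\<xi> - p) k = 0" "ip (\<xi> - q) k = 0" using proj_orth[OF assms(1) k] proj_orth[OF assms(2) k] .
    then show ?thesis using ip_diff[OF assms(3) pq(1) kH] ip_diff[OF assms(3) pq(2) kH] ip_diff[OF pq kH] by simp
  qed
qed

text \<open>Pythagoras, after orthogonality has been extended from \<open>K\<close> to its
  closure.\<close>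

lemma proj_nrm_le:
  assumes "is_proj K \<xi> p" "\<xi> \<in> H"
  shows "nrm p \<le> nrm \<xi>"
proof -
  have p: "p \<in> H" using assms proj_mem by auto
  have d: "\<xi> - p \<in> H" by (rule mem_diff[OF assms(2) p])
  have "ip p (\<xi> - p) = 0"
  proof (rule orthogonal_limit[OF K(2) p _ d])
    show "\<forall>e>0. \<exists>k\<in>K. nrm (p - k) < e" using assms(1) by (simp add: is_proj_def)
    show "ip k (\<xi> - p) = 0" if "k \<in> K" for k
      using ip_cnj[OF d, of k] proj_orth[OF assms(1) that] that K(2) by (metis complex_cnj_zero subsetD)
  qed
  then have "sq (p + 1 *\<^sub>C (\<xi> - p)) = sq p + sq (\<xi> - p)" unfolding sq_add_scale[OF p d] by simp
  then have "sq \<xi> = sq p + sq (\<xi> - p)" by (simp add: scaleC_one)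
  then show ?thesis unfolding nrm_def using sq_nonneg[OF d] by simp
qed

end

end

section \<open>Left translations and the group von Neumann algebra\<close>

definition eqv :: "'g measure \<Rightarrow> ('g \<Rightarrow> complex) \<Rightarrow> ('g \<Rightarrow> complex) \<Rightarrow> bool" where
  "eqv \<mu> f g \<longleftrightarrow> (AE x in \<mu>. f x = g x)"

lemma eqv_sym: "eqv \<mu> f g \<Longrightarrow> eqv \<mu> g f" by (auto simp: eqv_def)

lemma eqv_trans:
  assumes "eqv \<mu> f g" "eqv \<mu> g h" shows "eqv \<mu> f h"
  using assms unfolding eqv_def by eventually_elim simp

lemma eqv_add:
  assumes "eqv \<mu> f f'" "eqv \<mu> g g'" shows "eqv \<mu> (f + g) (f' + g')"
  using assms unfolding eqv_def by eventually_elim simp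

lemma eqv_iff_norm:
  assumes "f \<in> L2 \<mu>" "g \<in> L2 \<mu>"
  shows "eqv \<mu> f g \<longleftrightarrow> L2_norm \<mu> (f - g) = 0"
proof
  assume "eqv \<mu> f g"
  then have "AE x in \<mu>. (f - g) x = 0" unfolding eqv_def by eventually_elim simp
  then show "L2_norm \<mu> (f - g) = 0" by (rule L2_AE_norm_0[OF L2.mem_diff[OF assms]])
next
  assume "L2_norm \<mu> (f - g) = 0"
  then have "AE x in \<mu>. (f - g) x = 0" by (rule L2_norm_0_AE[OF L2.mem_diff[OF assms]])
  then show "eqv \<mu> f g" unfolding eqv_def by eventually_elim simp
qed

lemma eqv_inner: "eqv \<mu> f f' \<Longrightarrow> f \<in> L2 \<mu> \<Longrightarrow> f' \<in> L2 \<mu> \<Longrightarrow> g \<in> L2 \<mu> \<Longrightarrow> L2_inner \<mu> f g = L2_inner \<mu> f' g"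
  unfolding eqv_def by (rule L2_inner_cong_AE)

lemma eqv_norm: "eqv \<mu> f f' \<Longrightarrow> f \<in> L2 \<mu> \<Longrightarrow> f' \<in> L2 \<mu> \<Longrightarrow> L2_norm \<mu> f = L2_norm \<mu> f'"
  unfolding eqv_def by (rule L2_norm_cong_AE) (auto dest: L2D)

lemma L2_operatorD:
  assumes "L2_operator \<mu> T"
  shows "f \<in> L2 \<mu> \<Longrightarrow> T f \<in> L2 \<mu>"
    "f \<in> L2 \<mu> \<Longrightarrow> g \<in> L2 \<mu> \<Longrightarrow> eqv \<mu> (T (f + g)) (T f + T g)"
    "f \<in> L2 \<mu> \<Longrightarrow> eqv \<mu> (T (c *\<^sub>C f)) (c *\<^sub>C T f)"
    "\<exists>C. \<forall>f\<in>L2 \<mu>. L2_norm \<mu> (T f) \<le> C * L2_norm \<mu> f"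
  using assms unfolding L2_operator_def eqv_def by (auto simp: scaleC_fun_def scaleC_complex_def)

text \<open>Boundedness sends the null function \<open>f - g\<close> to a null function. This
  justifies computing with representatives.\<close>

lemma L2_operator_eqv:
  assumes T: "L2_operator \<mu> T" and f: "f \<in> L2 \<mu>" "g \<in> L2 \<mu>" and e: "eqv \<mu> f g"
  shows "eqv \<mu> (T f) (T g)"
proof -
  have d: "f - g \<in> L2 \<mu>" by (rule L2.mem_diff[OF f])
  obtain C where C: "\<forall>f\<in>L2 \<mu>. L2_norm \<mu> (T f) \<le> C * L2_norm \<mu> f" using L2_operatorD(4)[OF T] by blast
  have "L2_norm \<mu> (T (f - g)) \<le> C * L2_norm \<mu> (f - g)" using C d by blast
  also have "L2_norm \<mu> (f - g) = 0" using e eqv_iff_norm[OF f] by simp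
  finally have "L2_norm \<mu> (T (f - g)) \<le> 0" by (simp only: mult_zero_right)
  then have "L2_norm \<mu> (T (f - g)) = 0" by (rule antisym) (rule L2_norm_nonneg)
  then have "AE x in \<mu>. T (f - g) x = 0" by (rule L2_norm_0_AE[OF L2_operatorD(1)[OF T d]])
  moreover have "eqv \<mu> (T ((f - g) + g)) (T (f - g) + T g)" by (rule L2_operatorD(2)[OF T d f(2)])
  then have "AE x in \<mu>. T f x = T (f - g) x + T g x" by (simp add: eqv_def)
  ultimately show ?thesis unfolding eqv_def by eventually_elim simp
qed

locale haar =
  fixes \<mu> :: "'g::{topological_group_add, t2_space} measure"
  assumes haar: "left_haar_measure \<mu>"
begin

lemma sets_mu: "sets \<mu> = sets borel" using haar by (simp add: left_haar_measure_def)

lemma space_mu: "space \<mu> = UNIV" using sets_eq_imp_space_eq[OF sets_mu] by simp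

lemma shift_measurable: "(\<lambda>t. a + t) \<in> measurable \<mu> \<mu>"
proof -
  have "(\<lambda>t. a + t) \<in> borel_measurable (borel :: 'g measure)"
    by (intro borel_measurable_continuous_onI continuous_intros)
  then show ?thesis using measurable_cong_sets[OF sets_mu sets_mu] by simp
qed

text \<open>Invariance as an equality of measures, so that integrals are shifted by change of
  variables.\<close>

lemma distr_shift: "distr \<mu> \<mu> (\<lambda>t. a + t) = \<mu>"
proof (rule measure_eqI)
  fix S assume "S \<in> sets (distr \<mu> \<mu> (\<lambda>t. a + t))"
  then have S: "S \<in> sets \<mu>" by simp
  have "(\<lambda>t. a + t) -` S = (+) (- a) ` S"
  proof
    show "(\<lambda>t. a + t) -` S \<subseteq> (+) (- a) ` S"
    proof
      fix t assume "t \<in> (\<lambda>t. a + t) -` S"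
      moreover have "t = - a + (a + t)" by (simp add: add.assoc[symmetric])
      ultimately show "t \<in> (+) (- a) ` S" by blast
    qed
  qed (auto simp: add.assoc[symmetric])
  then show "emeasure (distr \<mu> \<mu> (\<lambda>t. a + t)) S = emeasure \<mu> S"
    using haar S unfolding left_haar_measure_def sets_mu
    by (simp add: emeasure_distr[OF shift_measurable] S space_mu)
qed simp

lemma integral_shift:
  fixes h :: "'g \<Rightarrow> 'b::{banach, second_countable_topology}"
  assumes "h \<in> borel_measurable \<mu>"
  shows "(\<integral>t. h (a + t) \<partial>\<mu>) = (\<integral>t. h t \<partial>\<mu>)"
  using integral_distr[OF shift_measurable assms, of a] by (simp add: distr_shift)

lemma integrable_shift:
  fixes h :: "'g \<Rightarrow> 'b::{banach, second_countable_topology}"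
  assumes "integrable \<mu> h"
  shows "integrable \<mu> (\<lambda>t. h (a + t))"
  using integrable_distr[OF shift_measurable, of a h] assms by (simp add: distr_shift)

abbreviation "lam \<equiv> left_regular :: 'g \<Rightarrow> ('g \<Rightarrow> complex) \<Rightarrow> 'g \<Rightarrow> complex"

lemma lam_L2: "f \<in> L2 \<mu> \<Longrightarrow> lam x f \<in> L2 \<mu>"
  unfolding L2_def left_regular_def
  using integrable_shift[of "\<lambda>t. (cmod (f t))\<^sup>2" "- x"] measurable_compose[OF shift_measurable[of "- x"], of f borel]
  by simp

lemma lam_inner:
  assumes "f \<in> L2 \<mu>" "g \<in> L2 \<mu>"
  shows "L2_inner \<mu> (lam x f) (lam x g) = L2_inner \<mu> f g"
  unfolding L2_inner_def left_regular_def
  by (rule integral_shift[of "\<lambda>t. f t * cnj (g t)"])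
    (rule borel_measurable_integrable[OF L2_inner_integrable[OF assms]])

lemma lam_norm: "f \<in> L2 \<mu> \<Longrightarrow> L2_norm \<mu> (lam x f) = L2_norm \<mu> f"
  using lam_inner[of f f x] unfolding L2_inner_self L2_norm_def of_real_eq_iff by simp

lemma lam_lam: "lam x (lam y f) = lam (x + y) f"
proof
  fix t
  have "- y + (- x + t) = - (x + y) + t" by (simp only: minus_add add.assoc)
  then show "lam x (lam y f) t = lam (x + y) f t" by (simp only: left_regular_def)
qed

lemma lam_0: "lam 0 f = f"
  by (simp add: left_regular_def)

lemma lam_add: "lam x (f + g) = lam x f + lam x g"
  by (simp add: left_regular_def fun_eq_iff)

lemma lam_scale: "lam x (c *\<^sub>C f) = c *\<^sub>C lam x f"
  by (simp add: left_regular_def fun_eq_iff scaleC_fun_def)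

lemma lam_zero: "lam x 0 = 0"
  by (simp add: left_regular_def fun_eq_iff)

lemma lam_adjoint:
  assumes "f \<in> L2 \<mu>" "g \<in> L2 \<mu>"
  shows "L2_inner \<mu> (lam x f) g = L2_inner \<mu> f (lam (- x) g)"
  using lam_inner[OF assms(1) lam_L2[OF assms(2)], of x "- x"] by (simp add: lam_lam lam_0)

lemma lam_operator: "L2_operator \<mu> (lam x)"
  unfolding L2_operator_def
proof (intro conjI ballI allI)
  show "\<exists>C. \<forall>f\<in>L2 \<mu>. L2_norm \<mu> (lam x f) \<le> C * L2_norm \<mu> f"
    by (intro exI[of _ 1]) (simp add: lam_norm)
  show "lam x f \<in> L2 \<mu>" if "f \<in> L2 \<mu>" for f by (rule lam_L2[OF that])
qed (simp_all add: scaleC_fun_def scaleC_complex_def left_regular_def)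

lemma lam_vN: "lam x \<in> group_vN \<mu>"
  by (auto simp: group_vN_def lam_operator)

lemma vN_operator: "T \<in> group_vN \<mu> \<Longrightarrow> L2_operator \<mu> T"
  by (simp add: group_vN_def)

section \<open>Two copies of \<open>L2\<close> and the duality with VN(G)\<close>

definition H2 :: "(bool \<Rightarrow> 'g \<Rightarrow> complex) set" where "H2 = {F. \<forall>i. F i \<in> L2 \<mu>}"
definition ip2 :: "(bool \<Rightarrow> 'g \<Rightarrow> complex) \<Rightarrow> (bool \<Rightarrow> 'g \<Rightarrow> complex) \<Rightarrow> complex" where
  "ip2 F G = L2_inner \<mu> (F True) (G True) + L2_inner \<mu> (F False) (G False)"

sublocale D: semi_inner H2 ip2
proof
  show "complex_vector.subspace H2"
    by (rule complex_vector.subspaceI)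
      (auto simp: H2_def L2.mem_add L2.mem_scale scaleC_fun_def[where 'b="'g \<Rightarrow> complex"] complex_vector.subspace_0[OF L2_subspace])
  show "ip2 (F + F') G = ip2 F G + ip2 F' G" if "F \<in> H2" "F' \<in> H2" "G \<in> H2" for F F' G
    using that by (simp add: ip2_def H2_def L2.ip_add)
  show "ip2 (c *\<^sub>C F) G = c * ip2 F G" if "F \<in> H2" "G \<in> H2" for c F G
    using that by (simp add: ip2_def H2_def L2.ip_scale scaleC_fun_def[where 'b="'g \<Rightarrow> complex"] distrib_left)
  show "ip2 G F = cnj (ip2 F G)" if "F \<in> H2" "G \<in> H2" for F G
    using that L2.ip_cnj[of "F True" \<mu> "G True"] L2.ip_cnj[of "F False" \<mu> "G False"] by (simp add: ip2_def H2_def)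
  show "0 \<le> Re (ip2 F F)" if "F \<in> H2" for F
    using that L2.ip_pos[of "F True" \<mu>] L2.ip_pos[of "F False" \<mu>] by (simp add: ip2_def H2_def)
qed

lemma D_sq: "D.sq F = (L2_norm \<mu> (F True))\<^sup>2 + (L2_norm \<mu> (F False))\<^sup>2"
  by (simp add: D.sq_def ip2_def L2_inner_self L2_norm_sq)

lemma D_component: "L2_norm \<mu> (F i) \<le> D.nrm F"
proof (rule power2_le_imp_le)
  show "(L2_norm \<mu> (F i))\<^sup>2 \<le> (D.nrm F)\<^sup>2" by (cases i) (simp_all add: D.nrm_def D_sq)
  show "0 \<le> D.nrm F" by (simp add: D.nrm_def D_sq)
qed

lemma D_nrm_le: "D.nrm F \<le> L2_norm \<mu> (F True) + L2_norm \<mu> (F False)"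
  unfolding D.nrm_def D_sq by (rule sqrt_sum_squares_le_sum) (rule L2_norm_nonneg)+

lemma H2_mem: "F \<in> H2 \<Longrightarrow> F i \<in> L2 \<mu>" by (simp add: H2_def)

text \<open>Componentwise: the norm of each component is at most the norm of the pair, which is at
  most the sum of both.\<close>

lemma D_complete:
  assumes s: "\<And>n. s n \<in> H2" and C: "\<And>e. e > 0 \<Longrightarrow> \<exists>N. \<forall>m\<ge>N. \<forall>n\<ge>N. D.nrm (s m - s n) < e"
  shows "\<exists>x\<in>H2. (\<lambda>n. D.nrm (s n - x)) \<longlonglongrightarrow> 0"
proof -
  have "\<exists>f\<in>L2 \<mu>. (\<lambda>n. L2_norm \<mu> (s n i - f)) \<longlonglongrightarrow> 0" for i
  proof (rule L2_complete)
    show "s n i \<in> L2 \<mu>" for n by (rule H2_mem[OF s])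
    fix e :: real assume "e > 0"
    from C[OF this] obtain N where N: "\<forall>m\<ge>N. \<forall>n\<ge>N. D.nrm (s m - s n) < e" by blast
    have "L2_norm \<mu> (s m i - s n i) < e" if "m \<ge> N" "n \<ge> N" for m n
      using D_component[of "s m - s n" i] N that by (simp add: le_less_trans)
    then show "\<exists>N. \<forall>m\<ge>N. \<forall>n\<ge>N. L2_norm \<mu> (s m i - s n i) < e" by blast
  qed
  then obtain x where x: "\<And>i. x i \<in> L2 \<mu>" "\<And>i. (\<lambda>n. L2_norm \<mu> (s n i - x i)) \<longlonglongrightarrow> 0" by metis
  have "(\<lambda>n. D.nrm (s n - x)) \<longlonglongrightarrow> 0"
  proof (rule Lim_null_comparison)
    show "(\<lambda>n. L2_norm \<mu> (s n True - x True) + L2_norm \<mu> (s n False - x False)) \<longlonglongrightarrow> 0"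
      using tendsto_add[OF x(2) x(2)] by simp
    show "\<forall>\<^sub>F n in sequentially. norm (D.nrm (s n - x)) \<le> L2_norm \<mu> (s n True - x True) + L2_norm \<mu> (s n False - x False)"
    proof (intro always_eventually allI)
      fix n
      have "0 \<le> D.nrm (s n - x)" by (simp add: D.nrm_def D_sq)
      then show "norm (D.nrm (s n - x)) \<le> L2_norm \<mu> (s n True - x True) + L2_norm \<mu> (s n False - x False)"
        using D_nrm_le[of "s n - x"] by simp
    qed
  qed
  then show ?thesis using x(1) by (intro bexI[of _ x]) (simp_all add: H2_def)
qed

definition Lam :: "'g \<Rightarrow> (bool \<Rightarrow> 'g \<Rightarrow> complex) \<Rightarrow> bool \<Rightarrow> 'g \<Rightarrow> complex" where
  "Lam x F = (\<lambda>i. lam x (F i))"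

lemma Lam_H2: "F \<in> H2 \<Longrightarrow> Lam x F \<in> H2"
  by (simp add: Lam_def H2_def lam_L2)

lemma Lam_add: "Lam x (F + G) = Lam x F + Lam x G"
  by (simp add: Lam_def fun_eq_iff lam_add)

lemma Lam_scale: "Lam x (c *\<^sub>C F) = c *\<^sub>C Lam x F"
  by (simp add: Lam_def fun_eq_iff scaleC_fun_def left_regular_def)

lemma Lam_Lam: "Lam x (Lam y F) = Lam (x + y) F"
  by (simp add: Lam_def lam_lam)

lemma Lam_adjoint: "F \<in> H2 \<Longrightarrow> G \<in> H2 \<Longrightarrow> ip2 (Lam x F) G = ip2 F (Lam (- x) G)"
  by (simp add: Lam_def ip2_def lam_adjoint H2_mem)

lemma Lam_nrm: "F \<in> H2 \<Longrightarrow> D.nrm (Lam x F) = D.nrm F"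
  by (simp add: D.nrm_def D_sq Lam_def lam_norm H2_mem)

text \<open>The key point is that a functional \<open>T \<mapsto> \<langle>T f, g\<rangle>\<close> on the von Neumann algebra depends only on the
  coefficient function. The projection onto the invariant subspace of \<open>L\<^sup>2 \<oplus> L\<^sup>2\<close> generated by \<open>(f, f')\<close> is a matrix
  of operators commuting with all translations, hence with \<open>T\<close>; so \<open>(T f, T f')\<close> stays in that subspace.\<close>

lemma vN_pairing_well_defined:
  assumes T: "T \<in> group_vN \<mu>" and f: "f \<in> L2 \<mu>" "g \<in> L2 \<mu>" "f' \<in> L2 \<mu>" "g' \<in> L2 \<mu>"
    and eq: "coefficient \<mu> f g = coefficient \<mu> f' g'"
  shows "L2_inner \<mu> (T f) g = L2_inner \<mu> (T f') g'"
proof -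
  note To = vN_operator[OF T]
  define \<xi> where "\<xi> i = (if i then f else f')" for i
  \<comment> \<open>With this sign, orthogonality of \<open>\<eta>\<close> to all translates of
    \<open>\<xi>\<close> is the equality of the two coefficient functions.\<close>
  define \<eta> where "\<eta> i = (if i then g else - g')" for i
  have ng: "- g' \<in> L2 \<mu>" using L2.mem_scale[OF f(4), of "-1"] by (simp add: scaleC_minus1)
  have \<xi>: "\<xi> \<in> H2" and \<eta>: "\<eta> \<in> H2" using f ng by (auto simp: H2_def \<xi>_def \<eta>_def)
  define K where "K = complex_vector.span (range (\<lambda>x. Lam x \<xi>))"
  have KH: "K \<subseteq> H2" unfolding K_def
    by (rule complex_vector.span_minimal) (use Lam_H2[OF \<xi>] D.H in auto)
  have K: "complex_vector.subspace K" unfolding K_def by (rule complex_vector.subspace_span)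
  have LamK: "Lam x k \<in> K" if "k \<in> K" for x k
    using that unfolding K_def
  proof (induction rule: complex_vector.span_induct_alt)
    case base
    have "Lam x (0 *\<^sub>C 0) = 0 *\<^sub>C Lam x 0" by (rule Lam_scale)
    then have "Lam x 0 = 0" by (simp only: complex_vector.scale_zero_left)
    then show ?case using complex_vector.span_zero by (simp only:)
  next
    case (step c F G)
    then obtain y where y: "F = Lam y \<xi>" by blast
    have "Lam x F \<in> complex_vector.span (range (\<lambda>x. Lam x \<xi>))"
      unfolding y Lam_Lam by (rule complex_vector.span_base) blast
    then show ?case unfolding Lam_add Lam_scale
      using step by (intro complex_vector.span_add complex_vector.span_scale)
  qed
  \<comment> \<open>Membership is carried along because the form is known to be additive only on
    \<open>H2\<close>.\<close>
  have "k \<in> H2 \<and> ip2 k \<eta> = 0" if "k \<in> K" for k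
    using that unfolding K_def
  proof (induction rule: complex_vector.span_induct_alt)
    case base
    have "ip2 (0 *\<^sub>C \<eta>) \<eta> = 0 * ip2 \<eta> \<eta>" by (rule D.ip_scale[OF \<eta> \<eta>])
    then show ?case using complex_vector.subspace_0[OF D.H]
      by (simp only: complex_vector.scale_zero_left mult_zero_left)
  next
    case (step c F G)
    then obtain y where y: "F = Lam y \<xi>" by blast
    have FH: "F \<in> H2" unfolding y by (rule Lam_H2[OF \<xi>])
    have GH: "G \<in> H2" using step by blast
    have "ip2 F \<eta> = coefficient \<mu> f g y + L2_inner \<mu> (lam y f') ((-1) *\<^sub>C g')"
      by (simp add: y ip2_def Lam_def \<xi>_def \<eta>_def coefficient_def scaleC_minus1)
    also have "L2_inner \<mu> (lam y f') ((-1) *\<^sub>C g') = - coefficient \<mu> f' g' y"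
      by (subst L2.ip_scale_right[OF f(4) lam_L2[OF f(3)]]) (simp add: coefficient_def)
    finally have "ip2 F \<eta> = 0" using eq by simp
    then have "ip2 (c *\<^sub>C F + G) \<eta> = c * 0 + 0"
      unfolding D.ip_add[OF D.mem_scale[OF FH] GH \<eta>] D.ip_scale[OF FH \<eta>] using step by (simp only:)
    then have "ip2 (c *\<^sub>C F + G) \<eta> = 0" by (simp only: mult_zero_right add_0_right)
    then show ?case using D.mem_add[OF D.mem_scale[OF FH] GH] by blast
  qed
  then have \<eta>K: "ip2 k \<eta> = 0" if "k \<in> K" for k using that by blast
  \<comment> \<open>A choice of projection, determined only almost everywhere; identities for it are
    stated with \<open>eqv\<close> and come from uniqueness.\<close>
  define P where "P F = (SOME p. D.is_proj K F p)" for F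
  have P: "D.is_proj K F (P F)" if "F \<in> H2" for F
  proof -
    have "\<exists>p. D.is_proj K F p"
    proof (rule D.projection_exists[OF _ K KH that])
      fix s :: "nat \<Rightarrow> bool \<Rightarrow> 'g \<Rightarrow> complex"
      assume a: "\<And>n. s n \<in> H2" and b: "\<And>e. e > 0 \<Longrightarrow> \<exists>N. \<forall>m\<ge>N. \<forall>n\<ge>N. D.nrm (s m - s n) < (e::real)"
      show "\<exists>x\<in>H2. (\<lambda>n. D.nrm (s n - x)) \<longlonglongrightarrow> 0" by (rule D_complete, rule a, rule b, assumption)
    qed
    then show ?thesis unfolding P_def by (rule someI_ex)
  qed
  note PH = D.proj_mem[OF K KH P]
  have uniq: "eqv \<mu> (P F i) (q i)" if "F \<in> H2" "D.is_proj K F q" for F q i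
  proof -
    have "D.nrm (P F - q) = 0" by (rule D.proj_unique[OF K KH P[OF that(1)] that(2,1)])
    then have "L2_norm \<mu> ((P F - q) i) = 0"
      using D_component[of "P F - q" i] L2_norm_nonneg[of \<mu> "(P F - q) i"] by linarith
    then show ?thesis
      using eqv_iff_norm[OF H2_mem[OF PH[OF that(1)]] H2_mem[OF D.proj_mem[OF K KH that(2)]]] by simp
  qed
  define e where "e j f = (\<lambda>i. if i = j then f else 0)" for j :: bool and f :: "'g \<Rightarrow> complex"
  have eH: "e j f \<in> H2" if "f \<in> L2 \<mu>" for j f
    using that complex_vector.subspace_0[OF L2_subspace] by (auto simp: H2_def e_def)
  have e_add: "e j (f + g) = e j f + e j g" for j f g by (auto simp: e_def fun_eq_iff)
  have e_scale: "e j (c *\<^sub>C f) = c *\<^sub>C e j f" for j c f by (auto simp: e_def fun_eq_iff scaleC_fun_def scaleC_complex_def)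
  have e_lam: "e j (lam x f) = Lam x (e j f)" for j x f by (auto simp: e_def Lam_def lam_zero)
  have e_nrm: "D.nrm (e j f) = L2_norm \<mu> f" for j f
    by (cases j) (simp_all add: D.nrm_def D_sq e_def L2_norm_def)
  \<comment> \<open>The entries of \<open>P\<close> as a two by two matrix of operators on
    \<open>L2\<close>, with \<open>e j\<close> the embedding of a function as component
    \<open>j\<close>.\<close>
  define S where "S i j f = P (e j f) i" for i j f
  have So: "L2_operator \<mu> (S i j)" for i j
    unfolding L2_operator_def
  proof (intro conjI ballI allI)
    show "S i j f \<in> L2 \<mu>" if "f \<in> L2 \<mu>" for f unfolding S_def by (rule H2_mem[OF PH[OF eH[OF that]]])
    show "AE x in \<mu>. S i j (f + g) x = S i j f x + S i j g x" if h: "f \<in> L2 \<mu>" "g \<in> L2 \<mu>" for f g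
    proof -
      have "eqv \<mu> (P (e j f + e j g) i) ((P (e j f) + P (e j g)) i)"
        by (rule uniq[OF D.mem_add[OF eH[OF h(1)] eH[OF h(2)]] D.proj_add[OF K KH P[OF eH[OF h(1)]] P[OF eH[OF h(2)]] eH[OF h(1)] eH[OF h(2)]]])
      then show ?thesis by (simp add: eqv_def S_def e_add)
    qed
    show "AE x in \<mu>. S i j (c *\<^sub>C f) x = c * S i j f x" if h: "f \<in> L2 \<mu>" for c f
    proof -
      have "eqv \<mu> (P (c *\<^sub>C e j f) i) ((c *\<^sub>C P (e j f)) i)"
        by (rule uniq[OF D.mem_scale[OF eH[OF h]] D.proj_scale[OF K KH P[OF eH[OF h]] eH[OF h]]])
      then show ?thesis unfolding eqv_def S_def e_scale by (simp only: scaleC_fun_def scaleC_complex_def)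
    qed
    have "L2_norm \<mu> (S i j f) \<le> 1 * L2_norm \<mu> f" if "f \<in> L2 \<mu>" for f
      using D_component[of "P (e j f)" i] D.proj_nrm_le[OF K KH P[OF eH[OF that, of j]] eH[OF that, of j]]
      unfolding S_def e_nrm by linarith
    then show "\<exists>C. \<forall>f\<in>L2 \<mu>. L2_norm \<mu> (S i j f) \<le> C * L2_norm \<mu> f" by blast
  qed
  have Sl: "L2_commute \<mu> (S i j) (lam x)" for i j x
    unfolding L2_commute_def
  proof (intro ballI)
    fix h assume h: "h \<in> L2 \<mu>"
    note p = P[OF eH[OF h, of j]]
    \<comment> \<open>\<open>K\<close> is invariant under \<open>Lam x\<close> and under its adjoint
      \<open>Lam (- x)\<close>, so a translate of a projection is a projection of the
      translate.\<close>
    have "D.is_proj K (Lam x (e j h)) (Lam x (P (e j h)))"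
      unfolding D.is_proj_def
    proof (intro conjI allI impI ballI)
      show "Lam x (P (e j h)) \<in> H2" by (rule Lam_H2[OF PH[OF eH[OF h]]])
      show "\<exists>k\<in>K. D.nrm (Lam x (P (e j h)) - k) < r" if r: "r > 0" for r
      proof -
        obtain k where k: "k \<in> K" "D.nrm (P (e j h) - k) < r" using p r unfolding D.is_proj_def by meson
        have "Lam x (P (e j h)) - Lam x k = Lam x (P (e j h) - k)" by (simp add: Lam_def fun_eq_iff left_regular_def)
        then have "D.nrm (Lam x (P (e j h)) - Lam x k) = D.nrm (P (e j h) - k)"
          using Lam_nrm[OF D.mem_diff[OF PH[OF eH[OF h]]], of k] k(1) KH by auto
        then show ?thesis using k(2) LamK[OF k(1), of x] by (intro bexI[of _ "Lam x k"]) simp_all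
      qed
      fix k assume k: "k \<in> K"
      have d: "e j h - P (e j h) \<in> H2" by (rule D.mem_diff[OF eH[OF h] PH[OF eH[OF h]]])
      have "Lam x (e j h) - Lam x (P (e j h)) = Lam x (e j h - P (e j h))" by (simp add: Lam_def fun_eq_iff left_regular_def)
      then have "ip2 (Lam x (e j h) - Lam x (P (e j h))) k = ip2 (e j h - P (e j h)) (Lam (- x) k)"
        using Lam_adjoint[OF d, of k x] k KH by auto
      also have "\<dots> = 0" by (rule D.proj_orth[OF K KH p LamK[OF k]])
      finally show "ip2 (Lam x (e j h) - Lam x (P (e j h))) k = 0" .
    qed
    then have "eqv \<mu> (P (Lam x (e j h)) i) (Lam x (P (e j h)) i)" by (rule uniq[OF Lam_H2[OF eH[OF h]]])
    then show "AE y in \<mu>. S i j (lam x h) y = lam x (S i j h) y"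
      by (simp add: eqv_def S_def e_lam Lam_def)
  qed
  \<comment> \<open>The defining property of the bicommutant: \<open>T\<close> commutes with each
    entry of \<open>P\<close>.\<close>
  have ST: "eqv \<mu> (S i j (T h)) (T (S i j h))" if "h \<in> L2 \<mu>" for i j h
    using T So Sl that unfolding group_vN_def L2_commute_def eqv_def by blast
  define q where "q = P (e True (T f)) + P (e False (T f'))"
  have Tf: "T f \<in> L2 \<mu>" "T f' \<in> L2 \<mu>" using L2_operatorD(1)[OF To] f by auto
  have qp: "D.is_proj K (e True (T f) + e False (T f')) q"
    unfolding q_def by (rule D.proj_add[OF K KH P[OF eH[OF Tf(1)]] P[OF eH[OF Tf(2)]] eH[OF Tf(1)] eH[OF Tf(2)]])
  have qH: "q \<in> H2" by (rule D.proj_mem[OF K KH qp])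
  have S2: "S i j h \<in> L2 \<mu>" if "h \<in> L2 \<mu>" for i j h by (rule L2_operatorD(1)[OF So that])
  \<comment> \<open>\<open>P\<close> fixes \<open>\<xi>\<close> and commutes with \<open>T\<close>
    entry by entry, so \<open>q\<close> represents \<open>T\<close> applied to both components of
    \<open>\<xi>\<close>.\<close>
  have qT: "eqv \<mu> (q i) (T (\<xi> i))" for i
  proof -
    have "\<xi> = e True f + e False f'" by (auto simp: \<xi>_def e_def fun_eq_iff)
    moreover have "Lam 0 \<xi> = \<xi>" by (simp add: Lam_def lam_0)
    then have "\<xi> \<in> K" unfolding K_def by (intro complex_vector.span_base) (metis rangeI)
    ultimately have "D.is_proj K (e True f + e False f') \<xi>" using D.proj_self[OF K KH] by metis
    then have 1: "eqv \<mu> (P (e True f + e False f') i) (\<xi> i)"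
      by (rule uniq[OF D.mem_add[OF eH[OF f(1)] eH[OF f(3)]]])
    have 2: "eqv \<mu> (P (e True f + e False f') i) ((P (e True f) + P (e False f')) i)"
      by (rule uniq[OF D.mem_add[OF eH[OF f(1)] eH[OF f(3)]]
           D.proj_add[OF K KH P[OF eH[OF f(1)]] P[OF eH[OF f(3)]] eH[OF f(1)] eH[OF f(3)]]])
    have "eqv \<mu> (S i True f + S i False f') (\<xi> i)"
      using eqv_trans[OF eqv_sym[OF 2] 1] by (simp add: S_def)
    then have 3: "eqv \<mu> (T (S i True f + S i False f')) (T (\<xi> i))"
      by (rule L2_operator_eqv[OF To L2.mem_add[OF S2[OF f(1)] S2[OF f(3)]] H2_mem[OF \<xi>]])
    have 4: "eqv \<mu> (T (S i True f + S i False f')) (T (S i True f) + T (S i False f'))"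
      by (rule L2_operatorD(2)[OF To S2[OF f(1)] S2[OF f(3)]])
    have "eqv \<mu> (S i True (T f) + S i False (T f')) (T (S i True f) + T (S i False f'))"
      by (intro eqv_add ST f)
    from eqv_trans[OF this eqv_trans[OF eqv_sym[OF 4] 3]] show ?thesis by (simp add: q_def S_def)
  qed
  \<comment> \<open>\<open>q\<close> lies in the closure of \<open>K\<close>, to which
    \<open>\<eta>\<close> is orthogonal; written out in components this is the claim.\<close>
  have "ip2 q \<eta> = 0"
    by (rule D.orthogonal_limit[OF KH qH _ \<eta> \<eta>K]) (use qp in \<open>simp add: D.is_proj_def\<close>)
  moreover have qi: "L2_inner \<mu> (q i) (\<eta> i) = L2_inner \<mu> (T (\<xi> i)) (\<eta> i)" for i
    by (rule eqv_inner[OF qT H2_mem[OF qH] L2_operatorD(1)[OF To H2_mem[OF \<xi>]] H2_mem[OF \<eta>]])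
  ultimately have "L2_inner \<mu> (T f) g + L2_inner \<mu> (T f') ((-1) *\<^sub>C g') = 0"
    unfolding ip2_def qi by (simp add: \<xi>_def \<eta>_def scaleC_minus1)
  then show ?thesis by (subst (asm) L2.ip_scale_right[OF f(4) Tf(2)]) simp
qed

lemma vN_pairing_coefficient:
  assumes T: "T \<in> group_vN \<mu>" and f: "f \<in> L2 \<mu>" "g \<in> L2 \<mu>"
  shows "vN_pairing \<mu> T (coefficient \<mu> f g) = L2_inner \<mu> (T f) g"
  unfolding vN_pairing_def
proof (rule the_equality)
  show "\<forall>f'\<in>L2 \<mu>. \<forall>g'\<in>L2 \<mu>. coefficient \<mu> f g = coefficient \<mu> f' g' \<longrightarrow> L2_inner \<mu> (T f) g = L2_inner \<mu> (T f') g'"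
    using vN_pairing_well_defined[OF T f] by blast
  show "c = L2_inner \<mu> (T f) g" if "\<forall>f'\<in>L2 \<mu>. \<forall>g'\<in>L2 \<mu>. coefficient \<mu> f g = coefficient \<mu> f' g' \<longrightarrow> c = L2_inner \<mu> (T f') g'" for c
    using that f by blast
qed

end

section \<open>The norms of the Fourier algebra\<close>

lemma L2_sum_mem: "(\<And>i. i \<in> I \<Longrightarrow> f i \<in> L2 \<mu>) \<Longrightarrow> sum f I \<in> L2 \<mu>"
  by (rule complex_vector.subspace_sum[OF L2_subspace])

lemma L2_norm_sum_le:
  assumes "\<And>i. i \<in> I \<Longrightarrow> f i \<in> L2 \<mu>" "finite I"
  shows "L2_norm \<mu> (sum f I) \<le> (\<Sum>i\<in>I. L2_norm \<mu> (f i))"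
  using assms(2,1)
proof (induction I)
  case empty
  then show ?case by (simp add: L2_norm_def)
next
  case (insert i I)
  have "L2_norm \<mu> (f i + sum f I) \<le> L2_norm \<mu> (f i) + L2_norm \<mu> (sum f I)"
    using insert by (intro L2_norm_triangle L2_sum_mem) auto
  moreover have "L2_norm \<mu> (sum f I) \<le> (\<Sum>i\<in>I. L2_norm \<mu> (f i))"
    by (rule insert.IH) (use insert.prems in blast)
  ultimately show ?case unfolding sum.insert[OF insert.hyps] by linarith
qed

lemma L2_inner_sum:
  assumes "\<And>i. i \<in> I \<Longrightarrow> f i \<in> L2 \<mu>" "finite I" "g \<in> L2 \<mu>"
  shows "L2_inner \<mu> (sum f I) g = (\<Sum>i\<in>I. L2_inner \<mu> (f i) g)"
  using assms(2,1)
proof (induction I)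
  case empty
  then show ?case by (simp add: L2_inner_def)
next
  case (insert i I)
  have "L2_inner \<mu> (f i + sum f I) g = L2_inner \<mu> (f i) g + L2_inner \<mu> (sum f I) g"
    using insert assms(3) by (intro L2.ip_add L2_sum_mem) auto
  moreover have "L2_inner \<mu> (sum f I) g = (\<Sum>i\<in>I. L2_inner \<mu> (f i) g)"
    by (rule insert.IH) (use insert.prems in blast)
  ultimately show ?case unfolding sum.insert[OF insert.hyps] by (simp only:)
qed

lemma eqv_sum:
  assumes "finite I" "\<And>i. i \<in> I \<Longrightarrow> eqv \<mu> (f i) (g i)"
  shows "eqv \<mu> (sum f I) (sum g I)"
  using assms
proof (induction I)
  case empty
  then show ?case by (simp add: eqv_def)
next
  case (insert i I)
  show ?case unfolding sum.insert[OF insert.hyps]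
    by (intro eqv_add insert.IH insert.prems) simp_all
qed

definition vN_ball :: "'g::group_add measure \<Rightarrow> nat \<Rightarrow> (('g \<Rightarrow> complex) \<Rightarrow> 'g \<Rightarrow> complex) mat \<Rightarrow> bool" where
  "vN_ball \<mu> m T \<longleftrightarrow> T \<in> mats m (group_vN \<mu>) \<and> op_mat_norm \<mu> T \<le> 1"

context haar
begin

abbreviation "A \<equiv> fourier_algebra \<mu>"

lemma vN_ballD: "vN_ball \<mu> m T \<Longrightarrow> k < m \<Longrightarrow> l < m \<Longrightarrow> T $$ (k, l) \<in> group_vN \<mu>"
  by (simp add: vN_ball_def mats_iff)

lemma vN_ball_dim: "vN_ball \<mu> m T \<Longrightarrow> dim_row T = m" "vN_ball \<mu> m T \<Longrightarrow> dim_col T = m"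
  by (auto simp: vN_ball_def mats_iff)

text \<open>The entries of \<open>T\<close> are bounded operators, so the supremum in
  \<open>op_mat_norm\<close> is finite and dominates each of its members.\<close>

lemma vN_ball_L2_set:
  assumes T: "vN_ball \<mu> m T" and f: "\<And>j. j < m \<Longrightarrow> f j \<in> L2 \<mu>" "L2_set (\<lambda>j. L2_norm \<mu> (f j)) {..<m} \<le> 1"
  shows "L2_set (\<lambda>i. L2_norm \<mu> (\<Sum>j<m. (T $$ (i, j)) (f j))) {..<m} \<le> 1"
proof -
  let ?S = "{L2_set (\<lambda>i. L2_norm \<mu> (\<Sum>j<dim_col T. (T $$ (i, j)) (f j))) {..<dim_row T} |
     f :: nat \<Rightarrow> 'g \<Rightarrow> complex. (\<forall>j<dim_col T. f j \<in> L2 \<mu>) \<and> L2_set (\<lambda>j. L2_norm \<mu> (f j)) {..<dim_col T} \<le> 1}"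
  note To = vN_operator[OF vN_ballD[OF T]]
  have "\<forall>i j. \<exists>C. i < m \<longrightarrow> j < m \<longrightarrow> (\<forall>f\<in>L2 \<mu>. L2_norm \<mu> ((T $$ (i, j)) f) \<le> C * L2_norm \<mu> f)"
    using L2_operatorD(4)[OF To] by blast
  then obtain C where C: "\<And>i j f. i < m \<Longrightarrow> j < m \<Longrightarrow> f \<in> L2 \<mu> \<Longrightarrow> L2_norm \<mu> ((T $$ (i, j)) f) \<le> C i j * L2_norm \<mu> f"
    by metis
  have "bdd_above ?S"
  proof (rule bdd_aboveI)
    fix y assume "y \<in> ?S"
    then obtain f where y: "y = L2_set (\<lambda>i. L2_norm \<mu> (\<Sum>j<m. (T $$ (i, j)) (f j))) {..<m}"
      and f: "\<And>j. j < m \<Longrightarrow> f j \<in> L2 \<mu>" "L2_set (\<lambda>j. L2_norm \<mu> (f j)) {..<m} \<le> 1"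
      unfolding vN_ball_dim[OF T] by blast
    have f1: "L2_norm \<mu> (f j) \<le> 1" if "j < m" for j
      using member_le_L2_set[of "{..<m}" j "\<lambda>j. L2_norm \<mu> (f j)"] that f(2) by simp
    have "y \<le> (\<Sum>i<m. L2_norm \<mu> (\<Sum>j<m. (T $$ (i, j)) (f j)))"
      unfolding y by (rule L2_set_le_sum) (rule L2_norm_nonneg)
    also have "\<dots> \<le> (\<Sum>i<m. \<Sum>j<m. \<bar>C i j\<bar>)"
    proof (rule sum_mono)
      fix i assume i: "i \<in> {..<m}"
      have "L2_norm \<mu> (\<Sum>j<m. (T $$ (i, j)) (f j)) \<le> (\<Sum>j<m. L2_norm \<mu> ((T $$ (i, j)) (f j)))"
        by (rule L2_norm_sum_le) (use i f(1) L2_operatorD(1)[OF To] in auto)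
      also have "\<dots> \<le> (\<Sum>j<m. \<bar>C i j\<bar>)"
      proof (rule sum_mono)
        fix j assume j: "j \<in> {..<m}"
        have "L2_norm \<mu> ((T $$ (i, j)) (f j)) \<le> C i j * L2_norm \<mu> (f j)" using C i j f(1) by simp
        also have "\<dots> \<le> \<bar>C i j\<bar> * 1"
          using f1[of j] j L2_norm_nonneg[of \<mu> "f j"] by (intro mult_mono) auto
        finally show "L2_norm \<mu> ((T $$ (i, j)) (f j)) \<le> \<bar>C i j\<bar>" by simp
      qed
      finally show "L2_norm \<mu> (\<Sum>j<m. (T $$ (i, j)) (f j)) \<le> (\<Sum>j<m. \<bar>C i j\<bar>)" .
    qed
    finally show "y \<le> (\<Sum>i<m. \<Sum>j<m. \<bar>C i j\<bar>)" .
  qed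
  then have "L2_set (\<lambda>i. L2_norm \<mu> (\<Sum>j<m. (T $$ (i, j)) (f j))) {..<m} \<le> op_mat_norm \<mu> T"
    unfolding op_mat_norm_def
    by (rule cSup_upper[rotated]) (rule CollectI, rule exI[of _ f], use f vN_ball_dim[OF T] in simp)
  then show ?thesis using T by (simp add: vN_ball_def)
qed

text \<open>The unit ball estimate made homogeneous. Dividing by \<open>s + e\<close> and letting
  \<open>e\<close> tend to \<open>0\<close> avoids a separate case \<open>s = 0\<close>.\<close>

lemma vN_ball_bound:
  assumes T: "vN_ball \<mu> m T" and f: "\<And>j. j < m \<Longrightarrow> f j \<in> L2 \<mu>"
  shows "(\<Sum>i<m. (L2_norm \<mu> (\<Sum>j<m. (T $$ (i, j)) (f j)))\<^sup>2) \<le> (\<Sum>j<m. (L2_norm \<mu> (f j))\<^sup>2)"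
proof -
  note To = vN_operator[OF vN_ballD[OF T]]
  define s where "s = L2_set (\<lambda>j. L2_norm \<mu> (f j)) {..<m}"
  have s2: "s\<^sup>2 = (\<Sum>j<m. (L2_norm \<mu> (f j))\<^sup>2)" by (simp add: s_def L2_set_def sum_nonneg)
  have s0: "s \<ge> 0" by (simp add: s_def)
  have "(\<Sum>i<m. (L2_norm \<mu> (\<Sum>j<m. (T $$ (i, j)) (f j)))\<^sup>2) \<le> (s + e)\<^sup>2" if e: "e > 0" for e
  proof -
    have pos: "s + e > 0" using s0 e by simp
    define c where "c = complex_of_real (1 / (s + e))"
    have c: "cmod c = 1 / (s + e)" unfolding c_def norm_of_real using pos by simp
    have cf: "c *\<^sub>C f j \<in> L2 \<mu>" if "j < m" for j by (rule L2.mem_scale[OF f[OF that]])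
    have "L2_set (\<lambda>j. L2_norm \<mu> (c *\<^sub>C f j)) {..<m} = L2_set (\<lambda>j. cmod c * L2_norm \<mu> (f j)) {..<m}"
      by (rule L2_set_cong) (simp_all add: L2_norm_scale f)
    also have "\<dots> = cmod c * s" unfolding s_def by (rule L2_set_right_distrib[symmetric]) simp
    also have "\<dots> \<le> 1" using pos e by (simp add: c)
    finally have "L2_set (\<lambda>i. L2_norm \<mu> (\<Sum>j<m. (T $$ (i, j)) (c *\<^sub>C f j))) {..<m} \<le> 1"
      by (rule vN_ball_L2_set[OF T, where f="\<lambda>j. c *\<^sub>C f j", rotated]) (rule cf)
    then have "(\<Sum>i<m. (L2_norm \<mu> (\<Sum>j<m. (T $$ (i, j)) (c *\<^sub>C f j)))\<^sup>2) \<le> 1"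
      by (subst (asm) L2_set_le_iff) simp_all
    moreover have "L2_norm \<mu> (\<Sum>j<m. (T $$ (i, j)) (c *\<^sub>C f j)) = cmod c * L2_norm \<mu> (\<Sum>j<m. (T $$ (i, j)) (f j))"
      if i: "i < m" for i
    proof -
      have m1: "(\<Sum>j<m. (T $$ (i, j)) (c *\<^sub>C f j)) \<in> L2 \<mu>"
        by (rule L2_sum_mem) (use i cf L2_operatorD(1)[OF To] in auto)
      have m2: "(\<Sum>j<m. (T $$ (i, j)) (f j)) \<in> L2 \<mu>"
        by (rule L2_sum_mem) (use i f L2_operatorD(1)[OF To] in auto)
      have "eqv \<mu> (\<Sum>j<m. (T $$ (i, j)) (c *\<^sub>C f j)) (\<Sum>j<m. c *\<^sub>C (T $$ (i, j)) (f j))"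
        by (rule eqv_sum) (use i f L2_operatorD(3)[OF To] in auto)
      then have "eqv \<mu> (\<Sum>j<m. (T $$ (i, j)) (c *\<^sub>C f j)) (c *\<^sub>C (\<Sum>j<m. (T $$ (i, j)) (f j)))"
        by (simp only: complex_vector.scale_sum_right)
      then have "L2_norm \<mu> (\<Sum>j<m. (T $$ (i, j)) (c *\<^sub>C f j)) = L2_norm \<mu> (c *\<^sub>C (\<Sum>j<m. (T $$ (i, j)) (f j)))"
        by (rule eqv_norm[OF _ m1 L2.mem_scale[OF m2]])
      then show ?thesis by (simp only: L2_norm_scale[OF m2])
    qed
    then have "(\<Sum>i<m. (L2_norm \<mu> (\<Sum>j<m. (T $$ (i, j)) (c *\<^sub>C f j)))\<^sup>2)
        = (cmod c)\<^sup>2 * (\<Sum>i<m. (L2_norm \<mu> (\<Sum>j<m. (T $$ (i, j)) (f j)))\<^sup>2)"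
      by (simp add: power_mult_distrib flip: sum_distrib_left)
    ultimately show ?thesis using pos by (simp add: c power_divide field_simps)
  qed note le = this
  have "(\<Sum>i<m. (L2_norm \<mu> (\<Sum>j<m. (T $$ (i, j)) (f j)))\<^sup>2) \<le> (s + 0)\<^sup>2"
  proof (rule tendsto_lowerbound)
    show "((\<lambda>e. (s + e)\<^sup>2) \<longlongrightarrow> (s + 0)\<^sup>2) (at_right 0)" by (intro tendsto_intros)
    show "\<forall>\<^sub>F e in at_right 0. (\<Sum>i<m. (L2_norm \<mu> (\<Sum>j<m. (T $$ (i, j)) (f j)))\<^sup>2) \<le> (s + e)\<^sup>2"
      unfolding eventually_at_right_field using le by (intro exI[of _ 1]) simp
  qed simp
  then show ?thesis using s2 by simp
qed

lemma coefficient_scale: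
  assumes f: "f \<in> L2 \<mu>" "g \<in> L2 \<mu>"
  shows "coefficient \<mu> (c *\<^sub>C f) g = c *\<^sub>C coefficient \<mu> f g"
proof
  fix x
  show "coefficient \<mu> (c *\<^sub>C f) g x = (c *\<^sub>C coefficient \<mu> f g) x"
    unfolding scaleC_fun_def[of c "coefficient \<mu> f g"]
    by (simp only: coefficient_def lam_scale L2.ip_scale[OF lam_L2[OF f(1)] f(2)] scaleC_complex_def)
qed

lemma A_E:
  assumes "u \<in> A" obtains f g where "f \<in> L2 \<mu>" "g \<in> L2 \<mu>" "u = coefficient \<mu> f g"
  using assms by (auto simp: fourier_algebra_def)

lemma coefficient_mem: "f \<in> L2 \<mu> \<Longrightarrow> g \<in> L2 \<mu> \<Longrightarrow> coefficient \<mu> f g \<in> A"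
  by (auto simp: fourier_algebra_def)

lemma A_scale: "u \<in> A \<Longrightarrow> c *\<^sub>C u \<in> A"
  by (metis A_E coefficient_scale coefficient_mem L2.mem_scale)

lemma A_zero: "0 \<in> A"
proof -
  have "0 \<in> L2 \<mu>" by (rule complex_vector.subspace_0[OF L2_subspace])
  from A_scale[OF coefficient_mem[OF this this], of 0] show ?thesis by simp
qed

lemma pairing_scale:
  assumes T: "T \<in> group_vN \<mu>" and u: "u \<in> A"
  shows "vN_pairing \<mu> T (c *\<^sub>C u) = c * vN_pairing \<mu> T u"
proof -
  obtain f g where f: "f \<in> L2 \<mu>" "g \<in> L2 \<mu>" "u = coefficient \<mu> f g" using u by (rule A_E)
  note To = vN_operator[OF T]
  have "vN_pairing \<mu> T (c *\<^sub>C u) = L2_inner \<mu> (T (c *\<^sub>C f)) g"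
    unfolding f(3) coefficient_scale[OF f(1,2), symmetric] by (rule vN_pairing_coefficient[OF T L2.mem_scale[OF f(1)] f(2)])
  also have "\<dots> = L2_inner \<mu> (c *\<^sub>C T f) g"
    by (rule eqv_inner[OF L2_operatorD(3)[OF To f(1)] L2_operatorD(1)[OF To L2.mem_scale[OF f(1)]]
          L2.mem_scale[OF L2_operatorD(1)[OF To f(1)]] f(2)])
  also have "\<dots> = c * L2_inner \<mu> (T f) g" by (rule L2.ip_scale[OF L2_operatorD(1)[OF To f(1)] f(2)])
  finally show ?thesis unfolding f(3) vN_pairing_coefficient[OF T f(1,2)] .
qed

lemma pairing_zero: "T \<in> group_vN \<mu> \<Longrightarrow> vN_pairing \<mu> T 0 = 0"
  using pairing_scale[OF _ A_zero, of T 0] by simp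

lemma pairing_lam: "u \<in> A \<Longrightarrow> vN_pairing \<mu> (lam x) u = u x"
  by (metis A_E vN_pairing_coefficient lam_vN coefficient_def)

text \<open>The scalars \<open>v l\<close> are absorbed into \<open>f\<close>, and Cauchy-Schwarz
  against \<open>g\<close> leaves \<open>T\<close> acting on multiples of \<open>f\<close>. The
  bound depends on neither \<open>m\<close> nor \<open>T\<close>, so the suprema over unit balls are
  finite.\<close>

lemma pairing_opb:
  assumes T: "vN_ball \<mu> m T" and f: "f \<in> L2 \<mu>" "g \<in> L2 \<mu>"
  shows "opb {..<m} {..<m} (\<lambda>k l. vN_pairing \<mu> (T $$ (k, l)) (coefficient \<mu> f g)) ((L2_norm \<mu> f * L2_norm \<mu> g)\<^sup>2)"
proof (rule opbI)
  fix v :: "nat \<Rightarrow> complex"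
  note TvN = vN_ballD[OF T]
  note To = vN_operator[OF TvN]
  have vf: "v l *\<^sub>C f \<in> L2 \<mu>" for l by (rule L2.mem_scale[OF f(1)])
  have Tm: "(T $$ (k, l)) (v l *\<^sub>C f) \<in> L2 \<mu>" if "k < m" "l < m" for k l by (rule L2_operatorD(1)[OF To[OF that] vf])
  have "(cmod (\<Sum>l<m. vN_pairing \<mu> (T $$ (k, l)) (coefficient \<mu> f g) * v l))\<^sup>2
      \<le> (L2_norm \<mu> (\<Sum>l<m. (T $$ (k, l)) (v l *\<^sub>C f)))\<^sup>2 * (L2_norm \<mu> g)\<^sup>2" if k: "k < m" for k
  proof -
    have "vN_pairing \<mu> (T $$ (k, l)) (coefficient \<mu> f g) * v l = L2_inner \<mu> ((T $$ (k, l)) (v l *\<^sub>C f)) g" if l: "l < m" for l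
    proof -
      have "vN_pairing \<mu> (T $$ (k, l)) (coefficient \<mu> f g) * v l = vN_pairing \<mu> (T $$ (k, l)) (v l *\<^sub>C coefficient \<mu> f g)"
        using pairing_scale[OF TvN[OF k l] coefficient_mem[OF f]] by simp
      also have "\<dots> = L2_inner \<mu> ((T $$ (k, l)) (v l *\<^sub>C f)) g"
        unfolding coefficient_scale[OF f, symmetric] by (rule vN_pairing_coefficient[OF TvN[OF k l] vf f(2)])
      finally show ?thesis .
    qed
    then have e: "(\<Sum>l<m. vN_pairing \<mu> (T $$ (k, l)) (coefficient \<mu> f g) * v l) = L2_inner \<mu> (\<Sum>l<m. (T $$ (k, l)) (v l *\<^sub>C f)) g"
      using Tm[OF k] f(2) by (subst L2_inner_sum) auto
    have mem: "(\<Sum>l<m. (T $$ (k, l)) (v l *\<^sub>C f)) \<in> L2 \<mu>" by (rule L2_sum_mem) (use Tm[OF k] in auto)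
    have "cmod (\<Sum>l<m. vN_pairing \<mu> (T $$ (k, l)) (coefficient \<mu> f g) * v l)
        \<le> L2_norm \<mu> (\<Sum>l<m. (T $$ (k, l)) (v l *\<^sub>C f)) * L2_norm \<mu> g"
      unfolding e by (rule L2_cauchy_schwarz[OF mem f(2)])
    from power_mono[OF this, of 2] show ?thesis by (simp add: power_mult_distrib)
  qed
  then have "(\<Sum>k<m. (cmod (\<Sum>l<m. vN_pairing \<mu> (T $$ (k, l)) (coefficient \<mu> f g) * v l))\<^sup>2)
      \<le> (\<Sum>k<m. (L2_norm \<mu> (\<Sum>l<m. (T $$ (k, l)) (v l *\<^sub>C f)))\<^sup>2 * (L2_norm \<mu> g)\<^sup>2)"
    by (intro sum_mono) auto
  also have "\<dots> \<le> (\<Sum>l<m. (L2_norm \<mu> (v l *\<^sub>C f))\<^sup>2) * (L2_norm \<mu> g)\<^sup>2"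
    unfolding sum_distrib_right[symmetric] by (intro mult_right_mono vN_ball_bound[OF T] vf) simp
  also have "\<dots> = (L2_norm \<mu> f * L2_norm \<mu> g)\<^sup>2 * (\<Sum>l<m. (cmod (v l))\<^sup>2)"
    by (simp only: L2_norm_scale[OF f(1)] power_mult_distrib sum_distrib_right[symmetric])
      (rule trans[OF mult.assoc mult.commute])
  finally show "(\<Sum>k<m. (cmod (\<Sum>l<m. vN_pairing \<mu> (T $$ (k, l)) (coefficient \<mu> f g) * v l))\<^sup>2)
    \<le> (L2_norm \<mu> f * L2_norm \<mu> g)\<^sup>2 * (\<Sum>l<m. (cmod (v l))\<^sup>2)" .
qed

section \<open>The predual operator space structure\<close>

definition pmat :: "(('g \<Rightarrow> complex) \<Rightarrow> 'g \<Rightarrow> complex) mat \<Rightarrow> (nat \<Rightarrow> nat \<Rightarrow> 'g \<Rightarrow> complex) \<Rightarrow> nat \<times> nat \<Rightarrow> nat \<times> nat \<Rightarrow> complex" where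
  "pmat T u \<kappa> \<nu> = vN_pairing \<mu> (T $$ (fst \<kappa>, fst \<nu>)) (u (snd \<kappa>) (snd \<nu>))"

lemma opb_prod_iff:
  "opb ({..<m} \<times> {..<n}) ({..<m} \<times> {..<n}) a K \<longleftrightarrow>
    (\<forall>v. (\<Sum>k<m. \<Sum>i<n. (cmod (\<Sum>l<m. \<Sum>j<n. a (k, i) (l, j) * v (l, j)))\<^sup>2) \<le> K * (\<Sum>l<m. \<Sum>j<n. (cmod (v (l, j)))\<^sup>2))"
  unfolding opb_def by (simp add: sum.cartesian_product')

text \<open>Finiteness of the supremum in \<open>fourier_mat_norm\<close>. The estimate goes entry
  by entry and is crude in \<open>n\<close>, but uniform over all \<open>m\<close> and
  \<open>T\<close>.\<close>

lemma pmat_bound_ex: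
  assumes u: "\<And>i j. i < n \<Longrightarrow> j < n \<Longrightarrow> u i j \<in> A"
  shows "\<exists>K\<ge>0. \<forall>m T. vN_ball \<mu> m T \<longrightarrow> opb ({..<m} \<times> {..<n}) ({..<m} \<times> {..<n}) (pmat T u) K"
proof -
  have "\<forall>i j. \<exists>K. i < n \<longrightarrow> j < n \<longrightarrow> (0 \<le> K \<and> (\<forall>m T. vN_ball \<mu> m T \<longrightarrow> opb {..<m} {..<m} (\<lambda>k l. vN_pairing \<mu> (T $$ (k, l)) (u i j)) K))"
  proof (intro allI)
    fix i j
    show "\<exists>K. i < n \<longrightarrow> j < n \<longrightarrow> (0 \<le> K \<and> (\<forall>m T. vN_ball \<mu> m T \<longrightarrow> opb {..<m} {..<m} (\<lambda>k l. vN_pairing \<mu> (T $$ (k, l)) (u i j)) K))"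
    proof (cases "i < n \<and> j < n")
      case True
      then obtain f g where "f \<in> L2 \<mu>" "g \<in> L2 \<mu>" "u i j = coefficient \<mu> f g" using u A_E by metis
      then show ?thesis using pairing_opb by (intro exI[of _ "(L2_norm \<mu> f * L2_norm \<mu> g)\<^sup>2"]) simp
    qed auto
  qed
  then obtain K where K: "\<And>i j. i < n \<Longrightarrow> j < n \<Longrightarrow> 0 \<le> K i j"
    "\<And>i j m T. i < n \<Longrightarrow> j < n \<Longrightarrow> vN_ball \<mu> m T \<Longrightarrow> opb {..<m} {..<m} (\<lambda>k l. vN_pairing \<mu> (T $$ (k, l)) (u i j)) (K i j)"
    by metis
  \<comment> \<open>The factor \<open>n\<close> is the price of Cauchy-Schwarz over the columns
    \<open>j\<close>.\<close>
  define C where "C = real n * (\<Sum>i<n. \<Sum>j<n. K i j)"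
  have C0: "0 \<le> C" unfolding C_def using K(1) by (intro mult_nonneg_nonneg sum_nonneg) auto
  have "opb ({..<m} \<times> {..<n}) ({..<m} \<times> {..<n}) (pmat T u) C" if T: "vN_ball \<mu> m T" for m T
    unfolding opb_prod_iff
  proof
    fix v :: "nat \<times> nat \<Rightarrow> complex"
    let ?z = "\<lambda>k i j. \<Sum>l<m. vN_pairing \<mu> (T $$ (k, l)) (u i j) * v (l, j)"
    have "(\<Sum>k<m. \<Sum>i<n. (cmod (\<Sum>l<m. \<Sum>j<n. pmat T u (k, i) (l, j) * v (l, j)))\<^sup>2)
        = (\<Sum>i<n. \<Sum>k<m. (cmod (\<Sum>j<n. ?z k i j))\<^sup>2)"
    proof -
      have "(\<Sum>l<m. \<Sum>j<n. pmat T u (k, i) (l, j) * v (l, j)) = (\<Sum>j<n. ?z k i j)" for k i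
        unfolding pmat_def fst_conv snd_conv by (rule sum.swap)
      then show ?thesis by (simp only: sum.swap[of _ "{..<n}" "{..<m}"])
    qed
    also have "\<dots> \<le> (\<Sum>i<n. \<Sum>k<m. real n * (\<Sum>j<n. (cmod (?z k i j))\<^sup>2))"
    proof (intro sum_mono)
      fix i k
      have "(cmod (\<Sum>j<n. ?z k i j))\<^sup>2 \<le> (\<Sum>j<n. cmod (?z k i j))\<^sup>2"
        by (intro power_mono norm_sum) simp
      also have "\<dots> \<le> real n * (\<Sum>j<n. (cmod (?z k i j))\<^sup>2)"
        using sum_squared_le_sum_of_squares[of "\<lambda>j. cmod (?z k i j)" "{..<n}"] by (simp add: mult.commute)
      finally show "(cmod (\<Sum>j<n. ?z k i j))\<^sup>2 \<le> real n * (\<Sum>j<n. (cmod (?z k i j))\<^sup>2)" .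
    qed
    also have "\<dots> = real n * (\<Sum>i<n. \<Sum>j<n. \<Sum>k<m. (cmod (?z k i j))\<^sup>2)"
      by (simp only: sum_distrib_left[symmetric] sum.swap[of _ "{..<m}" "{..<n}"])
    also have "\<dots> \<le> real n * (\<Sum>i<n. \<Sum>j<n. K i j * (\<Sum>l<m. \<Sum>j<n. (cmod (v (l, j)))\<^sup>2))"
    proof (intro mult_left_mono sum_mono)
      fix i j assume ij: "i \<in> {..<n}" "j \<in> {..<n}"
      have "(\<Sum>k<m. (cmod (?z k i j))\<^sup>2) \<le> K i j * (\<Sum>l<m. (cmod (v (l, j)))\<^sup>2)"
        by (rule opbD[OF K(2)]) (use ij T in auto)
      also have "\<dots> \<le> K i j * (\<Sum>l<m. \<Sum>j<n. (cmod (v (l, j)))\<^sup>2)"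
        using ij K(1)[of i j] by (intro mult_left_mono sum_mono member_le_sum[of j "{..<n}"]) auto
      finally show "(\<Sum>k<m. (cmod (?z k i j))\<^sup>2) \<le> K i j * (\<Sum>l<m. \<Sum>j<n. (cmod (v (l, j)))\<^sup>2)" .
    qed simp
    also have "\<dots> = C * (\<Sum>l<m. \<Sum>j<n. (cmod (v (l, j)))\<^sup>2)"
      unfolding C_def by (simp only: sum_distrib_right[symmetric] mult.assoc)
    finally show "(\<Sum>k<m. \<Sum>i<n. (cmod (\<Sum>l<m. \<Sum>j<n. pmat T u (k, i) (l, j) * v (l, j)))\<^sup>2)
      \<le> C * (\<Sum>l<m. \<Sum>j<n. (cmod (v (l, j)))\<^sup>2)" .
  qed
  then show ?thesis using C0 by blast
qed

lemma pmat_opb_iff: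
  "opb ({..<m} \<times> {..<n}) ({..<m} \<times> {..<n}) (pmat T u) K \<longleftrightarrow>
   opb {..<m * n} {..<m * n} (\<lambda>r s. vN_pairing \<mu> (T $$ (r div n, s div n)) (u (r mod n) (s mod n))) K"
  using opb_reindex[OF bij_betw_div_mod[of n m] bij_betw_div_mod[of n m], of "pmat T u" K]
  by (simp add: pmat_def)

abbreviation "FN \<equiv> fourier_mat_norm \<mu>"

definition pairing_mat :: "nat \<Rightarrow> (('g \<Rightarrow> complex) \<Rightarrow> 'g \<Rightarrow> complex) mat \<Rightarrow> nat \<Rightarrow> (nat \<Rightarrow> nat \<Rightarrow> 'g \<Rightarrow> complex) \<Rightarrow> complex mat" where
  "pairing_mat m T n u = mat (m * n) (m * n) (\<lambda>(r, s). vN_pairing \<mu> (T $$ (r div n, s div n)) (u (r mod n) (s mod n)))"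

lemma FN_eq: "FN (fmat n u) = Sup {mat_opnorm (pairing_mat m T n u) | m T. vN_ball \<mu> m T}"
proof -
  have "pairing_mat m T n u = mat (m * dim_row (fmat n u)) (m * dim_col (fmat n u))
       (\<lambda>(r, s). vN_pairing \<mu> (T $$ (r div dim_row (fmat n u), s div dim_col (fmat n u))) (fmat n u $$ (r mod dim_row (fmat n u), s mod dim_col (fmat n u))))"
    for m T
  proof (cases "n = 0")
    case False
    show ?thesis unfolding pairing_mat_def dim_row_mat dim_col_mat
      by (rule cong_mat) (use False in simp_all)
  next
    case True
    then show ?thesis by (intro eq_matI) (simp_all add: pairing_mat_def)
  qed
  then show ?thesis unfolding fourier_mat_norm_def vN_ball_def by simp
qed

lemma vN_ball_0: "vN_ball \<mu> 0 (mat 0 0 (\<lambda>_. lam 0))"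
  by (auto simp: vN_ball_def mats_iff op_mat_norm_def)

text \<open>The uniform bound makes the supremum finite, so that it dominates each single pairing
  matrix; the ball of size \<open>0\<close> shows that it is nonnegative.\<close>

lemma FN_props:
  assumes u: "\<And>i j. i < n \<Longrightarrow> j < n \<Longrightarrow> u i j \<in> A"
  shows FN_nonneg: "0 \<le> FN (fmat n u)"
    and FN_bound: "vN_ball \<mu> m T \<Longrightarrow> opb ({..<m} \<times> {..<n}) ({..<m} \<times> {..<n}) (pmat T u) ((FN (fmat n u))\<^sup>2)"
proof -
  let ?S = "{mat_opnorm (pairing_mat m T n u) | m T. vN_ball \<mu> m T}"
  obtain K where K: "K \<ge> 0" "\<And>m T. vN_ball \<mu> m T \<Longrightarrow> opb ({..<m} \<times> {..<n}) ({..<m} \<times> {..<n}) (pmat T u) K"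
    using pmat_bound_ex[of n u, OF u] by auto
  have bdd: "bdd_above ?S"
  proof (rule bdd_aboveI)
    fix y assume "y \<in> ?S"
    then obtain m T where y: "y = mat_opnorm (pairing_mat m T n u)" "vN_ball \<mu> m T" by blast
    show "y \<le> sqrt K" unfolding y(1) pairing_mat_def
      by (rule mat_opnorm_mat_le) (use K(1) K(2)[OF y(2)] pmat_opb_iff in simp_all)
  qed
  have up: "mat_opnorm (pairing_mat m T n u) \<le> FN (fmat n u)" if "vN_ball \<mu> m T" for m T
    unfolding FN_eq by (rule cSup_upper[OF _ bdd]) (use that in blast)
  show nn: "0 \<le> FN (fmat n u)" using up[OF vN_ball_0] mat_opnorm_nonneg order_trans by blast
  show "opb ({..<m} \<times> {..<n}) ({..<m} \<times> {..<n}) (pmat T u) ((FN (fmat n u))\<^sup>2)" if T: "vN_ball \<mu> m T"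
  proof -
    have c: "pairing_mat m T n u \<in> carrier_mat (m * n) (m * n)" by (simp add: pairing_mat_def)
    have "opb {..<m * n} {..<m * n} (\<lambda>i j. pairing_mat m T n u $$ (i, j)) ((FN (fmat n u))\<^sup>2)"
      by (rule opb_mono[OF opb_mat[OF c] power_mono[OF up[OF T] mat_opnorm_nonneg]])
    then show ?thesis unfolding pmat_opb_iff
      by (subst opb_cong) (simp_all add: pairing_mat_def)
  qed
qed

lemma FN_le:
  assumes C: "C \<ge> 0" and o: "\<And>m T. vN_ball \<mu> m T \<Longrightarrow> opb ({..<m} \<times> {..<n}) ({..<m} \<times> {..<n}) (pmat T u) (C\<^sup>2)"
  shows "FN (fmat n u) \<le> C"
  unfolding FN_eq
proof (rule cSup_least)
  show "{mat_opnorm (pairing_mat m T n u) | m T. vN_ball \<mu> m T} \<noteq> {}" using vN_ball_0 by blast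
  fix y assume "y \<in> {mat_opnorm (pairing_mat m T n u) | m T. vN_ball \<mu> m T}"
  then obtain m T where y: "y = mat_opnorm (pairing_mat m T n u)" "vN_ball \<mu> m T" by blast
  show "y \<le> C" unfolding y(1) pairing_mat_def
    by (rule mat_opnorm_mat_le[OF C]) (use o[OF y(2)] pmat_opb_iff in simp)
qed

text \<open>Scalars pass through the pairing. A direct sum pairs with \<open>T\<close> to a matrix
  that is block diagonal after regrouping the indices, because \<open>T\<close> pairs with
  \<open>0\<close> to \<open>0\<close>.\<close>

lemma FN_gauge: "matrix_gauge A FN"
  unfolding matrix_gauge_def
proof (intro conjI allI ballI)
  show "0 \<in> A" by (rule A_zero)
  show "c *\<^sub>C u \<in> A" if "u \<in> A" for c u by (rule A_scale[OF that])
  show "0 \<le> FN x" if x: "x \<in> mats n A" for n x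
    by (subst mats_fmat[OF x]) (rule FN_nonneg, use x in \<open>simp add: mats_iff\<close>)
  show "FN (map_mat (scaleC c) x) \<le> cmod c * FN x" if x: "x \<in> mats n A" for n c x
  proof -
    define u where "u i j = x $$ (i, j)" for i j
    have xu: "x = fmat n u" unfolding u_def by (rule mats_fmat[OF x])
    have uA: "u i j \<in> A" if "i < n" "j < n" for i j using x that by (simp add: u_def mats_iff)
    have "FN (fmat n (\<lambda>i j. c *\<^sub>C u i j)) \<le> cmod c * FN (fmat n u)"
    proof (rule FN_le)
      show "0 \<le> cmod c * FN (fmat n u)" using FN_nonneg[OF uA] by simp
      fix m T assume T: "vN_ball \<mu> m T"
      have "opb ({..<m} \<times> {..<n}) ({..<m} \<times> {..<n}) (\<lambda>\<kappa> \<nu>. c * pmat T u \<kappa> \<nu>) ((cmod c)\<^sup>2 * (FN (fmat n u))\<^sup>2)"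
        by (rule opb_scale[OF FN_bound[OF uA T]])
      moreover have "pmat T (\<lambda>i j. c *\<^sub>C u i j) \<kappa> \<nu> = c * pmat T u \<kappa> \<nu>"
        if "\<kappa> \<in> {..<m} \<times> {..<n}" "\<nu> \<in> {..<m} \<times> {..<n}" for \<kappa> \<nu>
        unfolding pmat_def by (rule pairing_scale) (use that vN_ballD[OF T] uA in auto)
      ultimately show "opb ({..<m} \<times> {..<n}) ({..<m} \<times> {..<n}) (pmat T (\<lambda>i j. c *\<^sub>C u i j)) ((cmod c * FN (fmat n u))\<^sup>2)"
        by (subst opb_cong) (simp_all add: power_mult_distrib)
    qed
    moreover have "map_mat (scaleC c) x = fmat n (\<lambda>i j. c *\<^sub>C u i j)" unfolding xu by (rule eq_matI) auto
    ultimately show ?thesis using xu by simp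
  qed
  show "FN (four_block_mat x (0\<^sub>m n1 n2) (0\<^sub>m n2 n1) y) \<le> max (FN x) (FN y)"
    if x: "x \<in> mats n1 A" and y: "y \<in> mats n2 A" for n1 n2 x y
  proof -
    define u1 u2 where "u1 i j = x $$ (i, j)" and "u2 i j = y $$ (i, j)" for i j
    have xu: "x = fmat n1 u1" "y = fmat n2 u2" unfolding u1_def u2_def by (rule mats_fmat[OF x], rule mats_fmat[OF y])
    have u1: "u1 i j \<in> A" if "i < n1" "j < n1" for i j using x that by (simp add: u1_def mats_iff)
    have u2: "u2 i j \<in> A" if "i < n2" "j < n2" for i j using y that by (simp add: u2_def mats_iff)
    define w where "w i j = (if i < n1 \<and> j < n1 then u1 i j else if n1 \<le> i \<and> n1 \<le> j then u2 (i - n1) (j - n1) else 0)" for i j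
    define C where "C = max (FN x) (FN y)"
    have C: "0 \<le> C" "(FN (fmat n1 u1))\<^sup>2 \<le> C\<^sup>2" "(FN (fmat n2 u2))\<^sup>2 \<le> C\<^sup>2"
      using FN_nonneg[of n1 u1, OF u1] FN_nonneg[of n2 u2, OF u2] unfolding C_def xu by (auto intro!: power_mono)
    have "FN (fmat (n1 + n2) w) \<le> C"
    proof (rule FN_le[OF C(1)])
      fix m T assume T: "vN_ball \<mu> m T"
      note z = pairing_zero[OF vN_ballD[OF T]]
      show "opb ({..<m} \<times> {..<n1 + n2}) ({..<m} \<times> {..<n1 + n2}) (pmat T w) (C\<^sup>2)"
        unfolding opb_prod_iff
      proof
        fix v :: "nat \<times> nat \<Rightarrow> complex"
        \<comment> \<open>The part of \<open>v\<close> on the second block, with its index shifted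
          back.\<close>
        define v2 where "v2 z = v (fst z, n1 + snd z)" for z
        have i1: "(\<Sum>l<m. \<Sum>j<n1 + n2. pmat T w (k, i) (l, j) * v (l, j)) = (\<Sum>l<m. \<Sum>j<n1. pmat T u1 (k, i) (l, j) * v (l, j))"
          if "k < m" "i < n1" for k i
        proof (rule sum.cong[OF refl])
          fix l assume l: "l \<in> {..<m}"
          have "(\<Sum>j<n2. pmat T w (k, i) (l, n1 + j) * v (l, n1 + j)) = 0"
            by (rule sum.neutral) (use that l z in \<open>simp add: pmat_def w_def\<close>)
          moreover have "(\<Sum>j<n1. pmat T w (k, i) (l, j) * v (l, j)) = (\<Sum>j<n1. pmat T u1 (k, i) (l, j) * v (l, j))"
            by (rule sum.cong) (use that in \<open>simp_all add: pmat_def w_def\<close>)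
          ultimately show "(\<Sum>j<n1 + n2. pmat T w (k, i) (l, j) * v (l, j)) = (\<Sum>j<n1. pmat T u1 (k, i) (l, j) * v (l, j))"
            unfolding sum_lessThan_add by simp
        qed
        have i2: "(\<Sum>l<m. \<Sum>j<n1 + n2. pmat T w (k, n1 + i) (l, j) * v (l, j)) = (\<Sum>l<m. \<Sum>j<n2. pmat T u2 (k, i) (l, j) * v2 (l, j))"
          if "k < m" "i < n2" for k i
        proof (rule sum.cong[OF refl])
          fix l assume l: "l \<in> {..<m}"
          have "(\<Sum>j<n1. pmat T w (k, n1 + i) (l, j) * v (l, j)) = 0"
            by (rule sum.neutral) (use that l z in \<open>simp add: pmat_def w_def\<close>)
          moreover have "(\<Sum>j<n2. pmat T w (k, n1 + i) (l, n1 + j) * v (l, n1 + j)) = (\<Sum>j<n2. pmat T u2 (k, i) (l, j) * v2 (l, j))"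
            by (rule sum.cong) (use that in \<open>simp_all add: pmat_def w_def v2_def\<close>)
          ultimately show "(\<Sum>j<n1 + n2. pmat T w (k, n1 + i) (l, j) * v (l, j)) = (\<Sum>j<n2. pmat T u2 (k, i) (l, j) * v2 (l, j))"
            unfolding sum_lessThan_add by simp
        qed
        have "(\<Sum>k<m. \<Sum>i<n1 + n2. (cmod (\<Sum>l<m. \<Sum>j<n1 + n2. pmat T w (k, i) (l, j) * v (l, j)))\<^sup>2)
          = (\<Sum>k<m. \<Sum>i<n1. (cmod (\<Sum>l<m. \<Sum>j<n1. pmat T u1 (k, i) (l, j) * v (l, j)))\<^sup>2)
          + (\<Sum>k<m. \<Sum>i<n2. (cmod (\<Sum>l<m. \<Sum>j<n2. pmat T u2 (k, i) (l, j) * v2 (l, j)))\<^sup>2)"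
          unfolding sum_lessThan_add[of _ n1 n2, where f="\<lambda>i. (cmod (_ i))\<^sup>2"] sum.distrib[symmetric]
          by (intro sum.cong refl) (simp add: sum_lessThan_add[of "\<lambda>i. (cmod (_ i))\<^sup>2"] i1 i2)
        also have "\<dots> \<le> C\<^sup>2 * (\<Sum>l<m. \<Sum>j<n1. (cmod (v (l, j)))\<^sup>2) + C\<^sup>2 * (\<Sum>l<m. \<Sum>j<n2. (cmod (v2 (l, j)))\<^sup>2)"
          using opb_mono[OF FN_bound[of n1 u1, OF u1 T] C(2)] opb_mono[OF FN_bound[of n2 u2, OF u2 T] C(3)]
          unfolding opb_prod_iff by (intro add_mono) blast+
        also have "\<dots> = C\<^sup>2 * (\<Sum>l<m. \<Sum>j<n1 + n2. (cmod (v (l, j)))\<^sup>2)"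
          by (simp add: sum_lessThan_add sum.distrib v2_def distrib_left)
        finally show "(\<Sum>k<m. \<Sum>i<n1 + n2. (cmod (\<Sum>l<m. \<Sum>j<n1 + n2. pmat T w (k, i) (l, j) * v (l, j)))\<^sup>2)
          \<le> C\<^sup>2 * (\<Sum>l<m. \<Sum>j<n1 + n2. (cmod (v (l, j)))\<^sup>2)" .
      qed
    qed
    moreover have "fmat (n1 + n2) w = four_block_mat x (0\<^sub>m n1 n2) (0\<^sub>m n2 n1) y"
      unfolding w_def xu by (rule fmat_four_block)
    ultimately show ?thesis by (simp add: C_def)
  qed
qed

lemma vN_ball_lam: "vN_ball \<mu> 1 (mat 1 1 (\<lambda>_. lam x))"
proof -
  have z: "0 \<in> L2 \<mu>" by (rule complex_vector.subspace_0[OF L2_subspace])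
  have n0: "L2_norm \<mu> 0 = 0" by (simp add: L2_norm_def)
  have "op_mat_norm \<mu> (mat 1 1 (\<lambda>_. lam x)) \<le> 1"
    unfolding op_mat_norm_def
  proof (rule cSup_least)
    show "{L2_set (\<lambda>i. L2_norm \<mu> (\<Sum>j<dim_col (mat 1 1 (\<lambda>_. lam x)). (mat 1 1 (\<lambda>_. lam x) $$ (i, j)) (f j))) {..<dim_row (mat 1 1 (\<lambda>_. lam x))} |
      f. (\<forall>j<dim_col (mat 1 1 (\<lambda>_. lam x)). f j \<in> L2 \<mu>) \<and> L2_set (\<lambda>j. L2_norm \<mu> (f j)) {..<dim_col (mat 1 1 (\<lambda>_. lam x))} \<le> 1} \<noteq> {}"
      using z n0 by (auto simp: L2_set_def intro!: exI[of _ "\<lambda>_. 0"])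
  qed (auto simp: L2_set_def lam_norm L2_norm_nonneg)
  then show ?thesis by (simp add: vN_ball_def mats_iff lam_vN)
qed

text \<open>Evaluation at \<open>x\<close> is the pairing with \<open>lam x\<close>, which lies in
  the unit ball of size \<open>1\<close>. The matrix form says that evaluation is completely
  contractive.\<close>

lemma FN_eval:
  assumes u: "\<And>i j. i < n \<Longrightarrow> j < n \<Longrightarrow> u i j \<in> A"
  shows "opb {..<n} {..<n} (\<lambda>i j. u i j x) ((FN (fmat n u))\<^sup>2)"
proof (rule opbI)
  fix v :: "nat \<Rightarrow> complex"
  have "pmat (mat 1 1 (\<lambda>_. lam x)) u (0, i) (0, j) = u i j x" if "i < n" "j < n" for i j
    using pairing_lam[OF u[OF that], of x] by (simp add: pmat_def)
  then have e: "(\<Sum>j<n. pmat (mat 1 1 (\<lambda>_. lam x)) u (0, i) (0, j) * v j) = (\<Sum>j<n. u i j x * v j)" if "i < n" for i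
    using that by (intro sum.cong) auto
  have "(\<Sum>i<n. (cmod (\<Sum>j<n. pmat (mat 1 1 (\<lambda>_. lam x)) u (0, i) (0, j) * v j))\<^sup>2) \<le> (FN (fmat n u))\<^sup>2 * (\<Sum>j<n. (cmod (v j))\<^sup>2)"
    using FN_bound[of n u, OF u vN_ball_lam[of x]] unfolding opb_prod_iff by (auto dest!: spec[of _ "\<lambda>z. v (snd z)"])
  then show "(\<Sum>i<n. (cmod (\<Sum>j<n. u i j x * v j))\<^sup>2) \<le> (FN (fmat n u))\<^sup>2 * (\<Sum>j<n. (cmod (v j))\<^sup>2)"
    using e by simp
qed

lemma norm1_FN_eval:
  assumes "u \<in> A" shows "cmod (u x) \<le> norm1 FN u"
proof -
  have "(cmod (u x))\<^sup>2 \<le> (norm1 FN u)\<^sup>2"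
    using opbD[OF FN_eval[of 1 "\<lambda>_ _. u" x], of "\<lambda>_. 1"] assms by (simp add: norm1_fmat)
  then show ?thesis by (rule power2_le_imp_le) (use FN_nonneg[of 1 "\<lambda>_ _. u"] assms in \<open>simp add: norm1_fmat\<close>)
qed

lemma norm1_FN_le:
  assumes f: "f \<in> L2 \<mu>" "g \<in> L2 \<mu>"
  shows "norm1 FN (coefficient \<mu> f g) \<le> L2_norm \<mu> f * L2_norm \<mu> g"
  unfolding norm1_fmat
proof (rule FN_le)
  show "0 \<le> L2_norm \<mu> f * L2_norm \<mu> g" by (simp add: L2_norm_nonneg)
  fix m T assume T: "vN_ball \<mu> m T"
  show "opb ({..<m} \<times> {..<1}) ({..<m} \<times> {..<1}) (pmat T (\<lambda>_ _. coefficient \<mu> f g)) ((L2_norm \<mu> f * L2_norm \<mu> g)\<^sup>2)"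
    unfolding opb_prod_iff
    using opbD[OF pairing_opb[OF T f]] by (simp add: pmat_def)
qed

lemma fourier_norm_props:
  assumes u: "u \<in> A"
  shows fourier_norm_nonneg: "0 \<le> fourier_norm \<mu> u"
    and fourier_norm_eval: "cmod (u x) \<le> fourier_norm \<mu> u"
    and fourier_norm_scale: "fourier_norm \<mu> (c *\<^sub>C u) \<le> cmod c * fourier_norm \<mu> u"
proof -
  let ?B = "\<lambda>T. T \<in> group_vN \<mu> \<and> op_mat_norm \<mu> (mat 1 1 (\<lambda>_. T)) \<le> 1"
  have ball: "vN_ball \<mu> 1 (mat 1 1 (\<lambda>_. T))" if "?B T" for T using that by (simp add: vN_ball_def mats_iff)
  obtain f g where f: "f \<in> L2 \<mu>" "g \<in> L2 \<mu>" "u = coefficient \<mu> f g" using u by (rule A_E)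
  have bdd: "bdd_above {cmod (vN_pairing \<mu> T u) | T. ?B T}"
  proof (rule bdd_aboveI)
    fix y assume "y \<in> {cmod (vN_pairing \<mu> T u) | T. ?B T}"
    then obtain T where y: "y = cmod (vN_pairing \<mu> T u)" "?B T" by blast
    have "(cmod (vN_pairing \<mu> T u))\<^sup>2 \<le> (L2_norm \<mu> f * L2_norm \<mu> g)\<^sup>2"
      using opbD[OF pairing_opb[OF ball[OF y(2)] f(1,2)], of "\<lambda>_. 1"] f(3) by simp
    then show "y \<le> L2_norm \<mu> f * L2_norm \<mu> g"
      unfolding y(1) by (rule power2_le_imp_le) (simp add: L2_norm_nonneg)
  qed
  have up: "cmod (vN_pairing \<mu> T u) \<le> fourier_norm \<mu> u" if "?B T" for T
    unfolding fourier_norm_def by (rule cSup_upper[OF _ bdd]) (use that in blast)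
  have lamB: "?B (lam x)" for x using vN_ball_lam[of x] by (simp add: vN_ball_def mats_iff)
  show "cmod (u x) \<le> fourier_norm \<mu> u" using up[OF lamB[of x]] pairing_lam[OF u] by simp
  then show nn: "0 \<le> fourier_norm \<mu> u" using norm_ge_zero order_trans by blast
  show "fourier_norm \<mu> (c *\<^sub>C u) \<le> cmod c * fourier_norm \<mu> u"
    unfolding fourier_norm_def[of \<mu> "c *\<^sub>C u"]
  proof (rule cSup_least)
    show "{cmod (vN_pairing \<mu> T (c *\<^sub>C u)) | T. ?B T} \<noteq> {}" using lamB by blast
    fix y assume "y \<in> {cmod (vN_pairing \<mu> T (c *\<^sub>C u)) | T. ?B T}"
    then obtain T where y: "y = cmod (vN_pairing \<mu> T (c *\<^sub>C u))" "?B T" by blast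
    have "y = cmod c * cmod (vN_pairing \<mu> T u)" unfolding y(1) using pairing_scale[of T u c] y(2) u by (simp add: norm_mult)
    also have "\<dots> \<le> cmod c * fourier_norm \<mu> u" by (intro mult_left_mono up y) simp
    finally show "y \<le> cmod c * fourier_norm \<mu> u" .
  qed
qed

text \<open>Feeds \<open>NB_coefficient\<close>, by which approximation in \<open>L2\<close> yields
  approximation in the Segal algebra.\<close>

lemma fourier_norm_le:
  assumes f: "f \<in> L2 \<mu>" "g \<in> L2 \<mu>"
  shows "fourier_norm \<mu> (coefficient \<mu> f g) \<le> L2_norm \<mu> f * L2_norm \<mu> g"
  unfolding fourier_norm_def
proof (rule cSup_least)
  show "{cmod (vN_pairing \<mu> T (coefficient \<mu> f g)) | T. T \<in> group_vN \<mu> \<and> op_mat_norm \<mu> (mat 1 1 (\<lambda>_. T)) \<le> 1} \<noteq> {}"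
    using vN_ball_lam by (auto simp: vN_ball_def mats_iff)
  fix y assume "y \<in> {cmod (vN_pairing \<mu> T (coefficient \<mu> f g)) | T. T \<in> group_vN \<mu> \<and> op_mat_norm \<mu> (mat 1 1 (\<lambda>_. T)) \<le> 1}"
  then obtain T where y: "y = cmod (vN_pairing \<mu> T (coefficient \<mu> f g))" "vN_ball \<mu> 1 (mat 1 1 (\<lambda>_. T))"
    by (auto simp: vN_ball_def mats_iff)
  have "(cmod (vN_pairing \<mu> T (coefficient \<mu> f g)))\<^sup>2 \<le> (L2_norm \<mu> f * L2_norm \<mu> g)\<^sup>2"
    using opbD[OF pairing_opb[OF y(2) f], of "\<lambda>_. 1"] by simp
  then show "y \<le> L2_norm \<mu> f * L2_norm \<mu> g"
    unfolding y(1) by (rule power2_le_imp_le) (simp add: L2_norm_nonneg)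
qed

lemma fourier_gauge: "gauge_on A (fourier_norm \<mu>)"
  unfolding gauge_on_def using A_zero A_scale fourier_norm_nonneg fourier_norm_scale by blast

end

section \<open>Density and continuity\<close>

abbreviation ind :: "'g set \<Rightarrow> 'g \<Rightarrow> complex" where
  "ind S \<equiv> indicator S"

lemma cmod_ind_sq: "(cmod (ind S x))\<^sup>2 = indicator S x"
  by (simp add: indicator_def)

text \<open>Used for \<open>compact_span\<close> in \<open>L2\<close> and for the finitely supported
  functions in the Segal algebra.\<close>

lemma closure_subspace:
  assumes N: "seminorm_on H N" and V: "complex_vector.subspace V" "V \<subseteq> H"
  shows "complex_vector.subspace {f \<in> H. \<forall>e>0. \<exists>h\<in>V. N (f - h) < e}" (is "complex_vector.subspace ?C")
proof (rule complex_vector.subspaceI)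
  note H = seminorm_onD(1)[OF N]
  show "0 \<in> ?C"
    using complex_vector.subspace_0[OF H] complex_vector.subspace_0[OF V(1)] seminorm_on_0[OF N]
    by (intro CollectI conjI allI impI bexI[of _ 0]) simp_all
next
  note H = seminorm_onD(1)[OF N]
  fix f g assume f: "f \<in> ?C" and g: "g \<in> ?C"
  then have fg: "f \<in> H" "g \<in> H" by simp_all
  have "\<exists>h\<in>V. N (f + g - h) < e" if "e > 0" for e
  proof -
    have e2: "e / 2 > 0" using that by simp
    obtain h where h: "h \<in> V" "N (f - h) < e / 2" using f e2 by blast
    obtain k where k: "k \<in> V" "N (g - k) < e / 2" using g e2 by blast
    have hk: "h \<in> H" "k \<in> H" using h k V(2) by auto
    have eq: "f + g - (h + k) = (f - h) + (g - k)" by simp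
    have "N (f + g - (h + k)) \<le> N (f - h) + N (g - k)"
      unfolding eq by (rule seminorm_onD(3)[OF N subspace_minus[OF H fg(1) hk(1)] subspace_minus[OF H fg(2) hk(2)]])
    then have "N (f + g - (h + k)) < e" using h k by simp
    then show ?thesis using complex_vector.subspace_add[OF V(1) h(1) k(1)] by blast
  qed
  then show "f + g \<in> ?C" using complex_vector.subspace_add[OF H fg] by simp
next
  note H = seminorm_onD(1)[OF N]
  fix c f assume f: "f \<in> ?C"
  then have fL: "f \<in> H" by simp
  have "\<exists>h\<in>V. N (c *\<^sub>C f - h) < e" if "e > 0" for e
  proof -
    have pos: "1 + cmod c > 0" by (simp add: add_pos_nonneg)
    have "e / (1 + cmod c) > 0" using that pos by simp
    then obtain h where h: "h \<in> V" "N (f - h) < e / (1 + cmod c)" using f by blast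
    have d: "f - h \<in> H" using subspace_minus[OF H fL] h(1) V(2) by blast
    have "N (c *\<^sub>C f - c *\<^sub>C h) = cmod c * N (f - h)"
      using seminorm_onD(4)[OF N d, of c] by (simp only: complex_vector.scale_right_diff_distrib)
    also have "\<dots> \<le> (1 + cmod c) * N (f - h)" using seminorm_onD(2)[OF N d] by (intro mult_right_mono) simp_all
    also have "\<dots> < (1 + cmod c) * (e / (1 + cmod c))" by (rule mult_strict_left_mono[OF h(2) pos])
    also have "\<dots> = e" using pos by simp
    finally show ?thesis using complex_vector.subspace_scale[OF V(1) h(1)] by blast
  qed
  then show "c *\<^sub>C f \<in> ?C" using complex_vector.subspace_scale[OF H fL] by simp
qed

context haar
begin

section \<open>Regularity of Haar measure and density in \<open>L2\<close>\<close>

lemma L2_norm_diff_triangle: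
  assumes "f \<in> L2 \<mu>" "g \<in> L2 \<mu>" "h \<in> L2 \<mu>"
  shows "L2_norm \<mu> (f - h) \<le> L2_norm \<mu> (f - g) + L2_norm \<mu> (g - h)"
proof -
  have eq: "f - h = (f - g) + (g - h)" by simp
  show ?thesis unfolding eq by (rule L2_norm_triangle[OF L2.mem_diff[OF assms(1,2)] L2.mem_diff[OF assms(2,3)]])
qed

lemma L2_norm_minus_commute: "f \<in> L2 \<mu> \<Longrightarrow> g \<in> L2 \<mu> \<Longrightarrow> L2_norm \<mu> (f - g) = L2_norm \<mu> (g - f)"
  by (rule seminorm_on_minus_commute[OF L2_norm_seminorm])

lemma L2_norm_lessI: "(L2_norm \<mu> f)\<^sup>2 < e\<^sup>2 \<Longrightarrow> 0 < e \<Longrightarrow> L2_norm \<mu> f < e"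
  by (rule power_less_imp_less_base[of _ 2]) simp_all

lemma L2_ind: "S \<in> sets \<mu> \<Longrightarrow> emeasure \<mu> S < \<infinity> \<Longrightarrow> ind S \<in> L2 \<mu>"
  unfolding L2_def by (simp add: cmod_ind_sq)

lemma L2_norm_ind_diff:
  assumes "S \<in> sets \<mu>" "U \<in> sets \<mu>" "S \<subseteq> U" "emeasure \<mu> U < \<infinity>"
  shows "(L2_norm \<mu> (ind U - ind S))\<^sup>2 = measure \<mu> U - measure \<mu> S"
proof -
  have "(cmod ((ind U - ind S) x))\<^sup>2 = indicator (U - S) x" for x using assms(3) by (auto simp: indicator_def)
  then have "(L2_norm \<mu> (ind U - ind S))\<^sup>2 = (\<integral>x. indicator (U - S) x \<partial>\<mu>)" by (simp add: L2_norm_sq)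
  also have "\<dots> = measure \<mu> (U - S)" using assms by (simp add: space_mu)
  also have "\<dots> = measure \<mu> U - measure \<mu> S"
    using assms emeasure_mono[OF assms(3,2)] by (intro measure_Diff) auto
  finally show ?thesis .
qed

lemma open_sets: "open U \<Longrightarrow> U \<in> sets \<mu>" by (simp add: sets_mu)

lemma compact_sets: "compact K \<Longrightarrow> K \<in> sets \<mu>" by (simp add: sets_mu borel_closed compact_imp_closed)

lemma compact_finite: "compact K \<Longrightarrow> emeasure \<mu> K < \<infinity>"
  using haar by (simp add: left_haar_measure_def)

lemma outer_open:
  assumes S: "S \<in> sets \<mu>" "emeasure \<mu> S < \<infinity>" and e: "e > 0"
  shows "\<exists>U. open U \<and> S \<subseteq> U \<and> emeasure \<mu> U < \<infinity> \<and> measure \<mu> U < measure \<mu> S + e"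
proof -
  have "emeasure \<mu> S = (INF U\<in>{U. open U \<and> S \<subseteq> U}. emeasure \<mu> U)"
    using haar[unfolded left_haar_measure_def, THEN conjunct2, THEN conjunct2, THEN conjunct1] S(1)
    unfolding sets_mu by (rule bspec)
  moreover have Sm: "emeasure \<mu> S = ennreal (measure \<mu> S)" using S(2) by (intro emeasure_eq_ennreal_measure) simp
  then have "emeasure \<mu> S < ennreal (measure \<mu> S + e)" using e by (simp add: ennreal_lessI)
  ultimately have "(INF U\<in>{U. open U \<and> S \<subseteq> U}. emeasure \<mu> U) < ennreal (measure \<mu> S + e)" by (simp only:)
  then obtain U where "U \<in> {U. open U \<and> S \<subseteq> U}" and U3: "emeasure \<mu> U < ennreal (measure \<mu> S + e)"
    unfolding INF_less_iff ..
  then have U: "open U" "S \<subseteq> U" "emeasure \<mu> U < ennreal (measure \<mu> S + e)" by simp_all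
  have fin: "emeasure \<mu> U < \<infinity>" using U(3) by (simp add: less_trans[OF _ ennreal_less_top])
  have "ennreal (measure \<mu> U) < ennreal (measure \<mu> S + e)"
    using U(3) fin by (subst emeasure_eq_ennreal_measure[symmetric]) simp_all
  then have "measure \<mu> U < measure \<mu> S + e" by (simp add: ennreal_less_iff)
  then show ?thesis using U fin by blast
qed

lemma inner_compact:
  assumes U: "open U" "emeasure \<mu> U < \<infinity>" and e: "e > 0"
  shows "\<exists>K. compact K \<and> K \<subseteq> U \<and> measure \<mu> U < measure \<mu> K + e"
\<comment> \<open>The split keeps \<open>measure \<mu> U - e\<close> nonnegative, where
  \<open>ennreal\<close> does not truncate.\<close>
proof (cases "measure \<mu> U < e")
  case True
  then show ?thesis by (intro exI[of _ "{}"]) simp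
next
  case False
  have "emeasure \<mu> U = (SUP K\<in>{K. compact K \<and> K \<subseteq> U}. emeasure \<mu> K)"
    using haar U(1) unfolding left_haar_measure_def by blast
  moreover have Um: "emeasure \<mu> U = ennreal (measure \<mu> U)" using U(2) by (intro emeasure_eq_ennreal_measure) simp
  then have "ennreal (measure \<mu> U - e) < emeasure \<mu> U" using e False by (simp add: ennreal_lessI)
  ultimately obtain K where K: "compact K" "K \<subseteq> U" "ennreal (measure \<mu> U - e) < emeasure \<mu> K"
    by (auto simp: less_SUP_iff)
  have "emeasure \<mu> K = ennreal (measure \<mu> K)"
    using compact_finite[OF K(1)] by (intro emeasure_eq_ennreal_measure) simp
  then have "measure \<mu> U - e < measure \<mu> K" using K(3) False by (simp add: ennreal_less_iff)
  then show ?thesis using K by (intro exI[of _ K]) simp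
qed

definition L2_closure :: "('g \<Rightarrow> complex) set \<Rightarrow> ('g \<Rightarrow> complex) set" where
  "L2_closure V = {f \<in> L2 \<mu>. \<forall>e>0. \<exists>h\<in>V. L2_norm \<mu> (f - h) < e}"

lemma L2_closure_subspace:
  "complex_vector.subspace V \<Longrightarrow> V \<subseteq> L2 \<mu> \<Longrightarrow> complex_vector.subspace (L2_closure V)"
  unfolding L2_closure_def by (rule closure_subspace[OF L2_norm_seminorm])

definition compact_span :: "('g \<Rightarrow> complex) set" where
  "compact_span = complex_vector.span {ind K | K. compact K}"

lemma compact_span_L2: "compact_span \<subseteq> L2 \<mu>"
  unfolding compact_span_def
  by (rule complex_vector.span_minimal[OF _ L2_subspace]) (use L2_ind compact_sets compact_finite in blast)

text \<open>Inner regularity is given for open sets, so \<open>S\<close> is compared with a compact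
  set through an open superset of nearly the same measure.\<close>

lemma ind_closure:
  assumes S: "S \<in> sets \<mu>" "emeasure \<mu> S < \<infinity>"
  shows "ind S \<in> L2_closure compact_span"
proof -
  have "\<exists>h\<in>compact_span. L2_norm \<mu> (ind S - h) < e" if e: "e > 0" for e
  proof -
    have e2: "(e / 2)\<^sup>2 > 0" using e by simp
    obtain U where U: "open U" "S \<subseteq> U" "emeasure \<mu> U < \<infinity>" "measure \<mu> U < measure \<mu> S + (e / 2)\<^sup>2"
      using outer_open[OF S e2] by blast
    obtain K where K: "compact K" "K \<subseteq> U" "measure \<mu> U < measure \<mu> K + (e / 2)\<^sup>2"
      using inner_compact[OF U(1,3) e2] by blast
    have L: "ind S \<in> L2 \<mu>" "ind U \<in> L2 \<mu>" "ind K \<in> L2 \<mu>"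
      using L2_ind S U open_sets K compact_sets compact_finite by blast+
    have "(L2_norm \<mu> (ind U - ind S))\<^sup>2 < (e / 2)\<^sup>2"
      unfolding L2_norm_ind_diff[OF S(1) open_sets[OF U(1)] U(2,3)] using U(4) by linarith
    then have n1: "L2_norm \<mu> (ind U - ind S) < e / 2" by (rule L2_norm_lessI) (use e in simp)
    have "(L2_norm \<mu> (ind U - ind K))\<^sup>2 < (e / 2)\<^sup>2"
      unfolding L2_norm_ind_diff[OF compact_sets[OF K(1)] open_sets[OF U(1)] K(2) U(3)] using K(3) by linarith
    then have n2: "L2_norm \<mu> (ind U - ind K) < e / 2" by (rule L2_norm_lessI) (use e in simp)
    have "L2_norm \<mu> (ind S - ind K) < e"
      using L2_norm_diff_triangle[OF L] L2_norm_minus_commute[OF L(1,2)] n1 n2 by linarith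
    moreover have "ind K \<in> compact_span" unfolding compact_span_def
      by (rule complex_vector.span_base) (use K(1) in blast)
    ultimately show ?thesis by blast
  qed
  then show ?thesis unfolding L2_closure_def using L2_ind[OF S] by blast
qed

lemma simple_closure:
  assumes s: "simple_function \<mu> s" and L: "s \<in> L2 \<mu>"
  shows "s \<in> L2_closure compact_span"
proof -
  have fin: "finite (range s)" using simple_functionD(1)[OF s] by (simp add: space_mu)
  have sm: "s -` {y} \<in> sets \<mu>" for y using simple_functionD(2)[OF s, of "{y}"] by (simp add: space_mu)
  have "s = (\<Sum>y\<in>range s. y *\<^sub>C ind (s -` {y}))"
  proof
    fix x
    have "(\<Sum>y\<in>range s. y *\<^sub>C ind (s -` {y})) x = (\<Sum>y\<in>range s. y * ind (s -` {y}) x)"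
    proof -
      have "(sum g I) x = (\<Sum>i\<in>I. g i x)" for g :: "complex \<Rightarrow> 'g \<Rightarrow> complex" and I
        by (induction I rule: infinite_finite_induct) auto
      then show ?thesis by (simp add: scaleC_fun_def scaleC_complex_def)
    qed
    also have "\<dots> = (\<Sum>y\<in>range s. if y = s x then y else 0)" by (rule sum.cong) (auto simp: indicator_def)
    also have "\<dots> = s x" using fin by (simp add: sum.delta)
    finally show "s x = (\<Sum>y\<in>range s. y *\<^sub>C ind (s -` {y})) x" by simp
  qed
  moreover have "(\<Sum>y\<in>range s. y *\<^sub>C ind (s -` {y})) \<in> L2_closure compact_span"
  proof (rule complex_vector.subspace_sum)
    show sub: "complex_vector.subspace (L2_closure compact_span)"
      by (rule L2_closure_subspace[OF _ compact_span_L2]) (simp add: compact_span_def complex_vector.subspace_span)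
    fix y assume "y \<in> range s"
    show "y *\<^sub>C ind (s -` {y}) \<in> L2_closure compact_span"
    \<comment> \<open>The level set of \<open>0\<close> may have infinite measure, but its term
      vanishes; the other level sets have finite measure by square integrability.\<close>
    proof (cases "y = 0")
      case True
      then show ?thesis using complex_vector.subspace_0[OF sub] by (simp only: complex_vector.scale_zero_left)
    next
      case False
      have "(\<integral>\<^sup>+x. ennreal ((cmod y)\<^sup>2) * indicator (s -` {y}) x \<partial>\<mu>) \<le> (\<integral>\<^sup>+x. ennreal ((cmod (s x))\<^sup>2) \<partial>\<mu>)"
        by (rule nn_integral_mono) (auto simp: indicator_def)
      also have "\<dots> < \<infinity>" using L2D(2)[OF L] by (simp add: integrable_iff_bounded)
      finally have "ennreal ((cmod y)\<^sup>2) * emeasure \<mu> (s -` {y}) < \<infinity>"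
        using sm by (simp add: nn_integral_cmult_indicator)
      then have "emeasure \<mu> (s -` {y}) < \<infinity>" using False by (auto simp: ennreal_mult_less_top)
      then show ?thesis using ind_closure[OF sm] complex_vector.subspace_scale[OF sub] by blast
    qed
  qed
  ultimately show ?thesis by (simp only:)
qed

lemma compact_span_dense:
  assumes f: "f \<in> L2 \<mu>" and e: "e > 0"
  shows "\<exists>h\<in>compact_span. L2_norm \<mu> (f - h) < e"
proof -
  obtain F where F: "\<And>i. simple_function \<mu> (F i)" "\<And>x. (\<lambda>i. F i x) \<longlonglongrightarrow> f x"
    "\<And>i x. dist (F i x) 0 \<le> 2 * dist (f x) 0"
    using borel_measurable_implies_sequence_metric[OF L2D(1)[OF f], of 0] by (auto simp: space_mu)
  have Fb: "(cmod (F i x))\<^sup>2 \<le> 4 * (cmod (f x))\<^sup>2" for i x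
    using power_mono[OF F(3)[of i x], of 2] by (simp add: power_mult_distrib)
  have Fm: "F i \<in> borel_measurable \<mu>" for i by (rule borel_measurable_simple_function[OF F(1)])
  have FL: "F i \<in> L2 \<mu>" for i
    by (rule L2_bound[OF Fm _ Fb]) (use L2D(2)[OF f] in simp)
  have "(\<lambda>i. \<integral>x. (cmod (f x - F i x))\<^sup>2 \<partial>\<mu>) \<longlonglongrightarrow> (\<integral>x. 0 \<partial>\<mu>)"
  proof (rule integral_dominated_convergence)
    \<comment> \<open>\<open>10 = 2 + 2 * 4\<close>, since the modulus of \<open>F i\<close> is at
      most twice that of \<open>f\<close>.\<close>
    show "integrable \<mu> (\<lambda>x. 10 * (cmod (f x))\<^sup>2)" using L2D(2)[OF f] by simp
    show "(\<lambda>x. (cmod (f x - F i x))\<^sup>2) \<in> borel_measurable \<mu>" for i using L2D(1)[OF f] Fm by measurable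
    show "AE x in \<mu>. (\<lambda>i. (cmod (f x - F i x))\<^sup>2) \<longlonglongrightarrow> 0"
    proof (rule AE_I2)
      fix x
      have "(\<lambda>i. (cmod (f x - F i x))\<^sup>2) \<longlonglongrightarrow> (cmod (f x - f x))\<^sup>2" by (intro tendsto_intros F(2))
      then show "(\<lambda>i. (cmod (f x - F i x))\<^sup>2) \<longlonglongrightarrow> 0" by simp
    qed
    show "AE x in \<mu>. norm ((cmod (f x - F i x))\<^sup>2) \<le> 10 * (cmod (f x))\<^sup>2" for i
    proof (rule AE_I2)
      fix x
      show "norm ((cmod (f x - F i x))\<^sup>2) \<le> 10 * (cmod (f x))\<^sup>2"
        using cmod_add_squared_le2[of "f x" "- F i x"] Fb[of i x] by simp
    qed
  qed simp
  then have "\<forall>\<^sub>F i in sequentially. (\<integral>x. (cmod (f x - F i x))\<^sup>2 \<partial>\<mu>) < (e / 2)\<^sup>2"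
    by (rule order_tendstoD(2)) (use e in simp)
  then obtain i where "(\<integral>x. (cmod (f x - F i x))\<^sup>2 \<partial>\<mu>) < (e / 2)\<^sup>2" by (auto simp: eventually_sequentially)
  then have "(L2_norm \<mu> (f - F i))\<^sup>2 < (e / 2)\<^sup>2" by (simp add: L2_norm_sq)
  then have i: "L2_norm \<mu> (f - F i) < e / 2" by (rule L2_norm_lessI) (use e in simp)
  have "e / 2 > 0" using e by simp
  then obtain h where h: "h \<in> compact_span" "L2_norm \<mu> (F i - h) < e / 2"
    using simple_closure[OF F(1) FL, of i] unfolding L2_closure_def by blast
  have hL: "h \<in> L2 \<mu>" using h(1) compact_span_L2 by blast
  have "L2_norm \<mu> (f - h) < e" using L2_norm_diff_triangle[OF f FL[of i] hL] i h(2) by linarith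
  then show ?thesis using h(1) by blast
qed

text \<open>A tube argument: continuity of addition gives product neighbourhoods around the points
  of \<open>K\<close>, and compactness leaves finitely many of them.\<close>

lemma shift_compact_subset:
  assumes K: "compact K" and U: "open U" "K \<subseteq> U"
  shows "\<forall>\<^sub>F x in nhds (0::'g). (\<forall>k\<in>K. x + k \<in> U)"
proof -
  have "\<forall>k\<in>K. \<exists>P B. open P \<and> 0 \<in> P \<and> open B \<and> k \<in> B \<and> (\<forall>x\<in>P. \<forall>y\<in>B. x + y \<in> U)"
  proof
    fix k assume "k \<in> K"
    then have "0 + k \<in> U" using U(2) by auto
    moreover have "((\<lambda>z. fst z + snd z) \<longlongrightarrow> 0 + k) (nhds 0 \<times>\<^sub>F nhds k)"
      using tendsto_add_Pair[of "0::'g" k] by (simp add: case_prod_unfold)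
    ultimately have "\<forall>\<^sub>F z in nhds 0 \<times>\<^sub>F nhds k. fst z + snd z \<in> U" using U(1) by (auto simp: tendsto_def)
    then obtain P Q where PQ: "eventually P (nhds 0)" "eventually Q (nhds k)" "\<And>x y. P x \<Longrightarrow> Q y \<Longrightarrow> x + y \<in> U"
      by (auto simp: eventually_prod_filter)
    then show "\<exists>P B. open P \<and> 0 \<in> P \<and> open B \<and> k \<in> B \<and> (\<forall>x\<in>P. \<forall>y\<in>B. x + y \<in> U)"
      unfolding eventually_nhds by meson
  qed
  then obtain P B where PB: "\<And>k. k \<in> K \<Longrightarrow> open (P k) \<and> 0 \<in> P k \<and> open (B k) \<and> k \<in> B k \<and> (\<forall>x\<in>P k. \<forall>y\<in>B k. x + y \<in> U)"
    by metis
  obtain C where C: "C \<subseteq> K" "finite C" "K \<subseteq> (\<Union>c\<in>C. B c)"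
    by (rule compactE_image[OF K, of K B]) (use PB in auto)
  have "\<forall>\<^sub>F x in nhds (0::'g). \<forall>c\<in>C. x \<in> P c"
    using C PB by (intro eventually_ball_finite ballI) (auto simp: eventually_nhds)
  then show ?thesis by eventually_elim (use C PB in blast)
qed

section \<open>Continuity of translation and of coefficient functions\<close>

lemma emeasure_shift: "S \<in> sets \<mu> \<Longrightarrow> emeasure \<mu> ((+) x ` S) = emeasure \<mu> S"
  using haar by (simp add: left_haar_measure_def sets_mu)

lemma lam_ind: "lam x (ind S) = ind ((+) x ` S)"
proof
  fix t
  have "- x + t \<in> S \<longleftrightarrow> t \<in> (+) x ` S"
  proof
    assume "- x + t \<in> S"
    moreover have "t = x + (- x + t)" by (simp add: add.assoc[symmetric])
    ultimately show "t \<in> (+) x ` S" by blast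
  qed (auto simp: add.assoc[symmetric])
  then show "lam x (ind S) t = ind ((+) x ` S) t" by (simp add: left_regular_def indicator_def)
qed

lemma shift_compact: "compact K \<Longrightarrow> compact ((+) (x::'g) ` K)"
  by (rule compact_continuous_image) (intro continuous_intros)

text \<open>For small \<open>x\<close> both \<open>K\<close> and its translate lie in one open set
  of almost the same measure, so both indicators are close to the indicator of that set.\<close>

lemma lam_continuous_ind:
  assumes K: "compact K" and e: "e > 0"
  shows "\<forall>\<^sub>F x in nhds (0::'g). L2_norm \<mu> (lam x (ind K) - ind K) < e"
proof -
  have e2: "(e / 2)\<^sup>2 > 0" using e by simp
  obtain U where U: "open U" "K \<subseteq> U" "emeasure \<mu> U < \<infinity>" "measure \<mu> U < measure \<mu> K + (e / 2)\<^sup>2"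
    using outer_open[OF compact_sets[OF K] compact_finite[OF K] e2] by blast
  show ?thesis using shift_compact_subset[OF K U(1,2)]
  proof eventually_elim
    case (elim x)
    let ?K = "(+) x ` K"
    have K': "compact ?K" by (rule shift_compact[OF K])
    have KU: "?K \<subseteq> U" using elim by (intro image_subsetI) (rule bspec)
    have mK: "measure \<mu> ?K = measure \<mu> K" using emeasure_shift[OF compact_sets[OF K]] by (simp add: measure_def)
    note L = L2_ind[OF compact_sets[OF K'] compact_finite[OF K']] L2_ind[OF open_sets[OF U(1)] U(3)]
      L2_ind[OF compact_sets[OF K] compact_finite[OF K]]
    have "(L2_norm \<mu> (ind U - ind ?K))\<^sup>2 < (e / 2)\<^sup>2"
      unfolding L2_norm_ind_diff[OF compact_sets[OF K'] open_sets[OF U(1)] KU U(3)] using U(4) mK by linarith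
    then have n1: "L2_norm \<mu> (ind U - ind ?K) < e / 2" by (rule L2_norm_lessI) (use e in simp)
    have "(L2_norm \<mu> (ind U - ind K))\<^sup>2 < (e / 2)\<^sup>2"
      unfolding L2_norm_ind_diff[OF compact_sets[OF K] open_sets[OF U(1)] U(2,3)] using U(4) by linarith
    then have n2: "L2_norm \<mu> (ind U - ind K) < e / 2" by (rule L2_norm_lessI) (use e in simp)
    show ?case unfolding lam_ind
      using L2_norm_diff_triangle[OF L] L2_norm_minus_commute[OF L(1,2)] n1 n2 by linarith
  qed
qed

text \<open>Strong continuity of the regular representation at the identity. Translations are
  isometries, so it passes from the dense span of compact indicators to all of
  \<open>L2\<close>.\<close>

lemma lam_continuous:
  assumes f: "f \<in> L2 \<mu>" and e: "e > 0"
  shows "\<forall>\<^sub>F x in nhds (0::'g). L2_norm \<mu> (lam x f - f) < e"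
proof -
  have span: "h \<in> L2 \<mu> \<and> (\<forall>e>0. \<forall>\<^sub>F x in nhds (0::'g). L2_norm \<mu> (lam x h - h) < e)" if "h \<in> compact_span" for h
    using that unfolding compact_span_def
  proof (induction rule: complex_vector.span_induct_alt)
    case base
    have "L2_norm \<mu> (lam x 0 - 0) = 0" for x by (simp add: lam_zero L2_norm_def)
    then show ?case using complex_vector.subspace_0[OF L2_subspace] by (intro conjI allI impI) (simp_all only: eventually_True)
  next
    case (step c k h)
    then obtain K where k: "k = ind K" "compact K" by blast
    have kL: "k \<in> L2 \<mu>" unfolding k by (rule L2_ind[OF compact_sets[OF k(2)] compact_finite[OF k(2)]])
    have hL: "h \<in> L2 \<mu>" using step.IH ..
    have "\<forall>\<^sub>F x in nhds (0::'g). L2_norm \<mu> (lam x (c *\<^sub>C k + h) - (c *\<^sub>C k + h)) < e" if e: "e > 0" for e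
    proof -
      have pos: "1 + cmod c > 0" by (simp add: add_pos_nonneg)
      have e2: "e / 2 > 0" and e3: "e / 2 / (1 + cmod c) > 0" using e pos by simp_all
      have "\<forall>\<^sub>F x in nhds (0::'g). L2_norm \<mu> (lam x h - h) < e / 2"
        by (rule step.IH[THEN conjunct2, rule_format, OF e2])
      with lam_continuous_ind[OF k(2) e3] show ?thesis
      proof eventually_elim
        case (elim x)
        have kd: "lam x k - k \<in> L2 \<mu>" and hd: "lam x h - h \<in> L2 \<mu>"
          by (rule L2.mem_diff[OF lam_L2[OF kL] kL], rule L2.mem_diff[OF lam_L2[OF hL] hL])
        have eq: "lam x (c *\<^sub>C k + h) - (c *\<^sub>C k + h) = c *\<^sub>C (lam x k - k) + (lam x h - h)"
          by (simp add: lam_add lam_scale complex_vector.scale_right_diff_distrib)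
        have "cmod c * L2_norm \<mu> (lam x k - k) \<le> (1 + cmod c) * L2_norm \<mu> (lam x k - k)"
          using L2_norm_nonneg[of \<mu> "lam x k - k"] by (intro mult_right_mono) simp_all
        also have "\<dots> < (1 + cmod c) * (e / 2 / (1 + cmod c))"
          using elim(1) pos unfolding k(1) by (rule mult_strict_left_mono)
        also have "\<dots> = e / 2" using pos by (subst times_divide_eq_right) (rule nonzero_mult_div_cancel_left, linarith)
        finally have "cmod c * L2_norm \<mu> (lam x k - k) < e / 2" .
        moreover have "L2_norm \<mu> (lam x (c *\<^sub>C k + h) - (c *\<^sub>C k + h))
            \<le> cmod c * L2_norm \<mu> (lam x k - k) + L2_norm \<mu> (lam x h - h)"
          unfolding eq using L2_norm_triangle[OF L2.mem_scale[OF kd, of c] hd] unfolding L2_norm_scale[OF kd] .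
        ultimately show ?case using elim(2) by linarith
      qed
    qed
    then show ?case using L2.mem_add[OF L2.mem_scale[OF kL, of c] hL] by (intro conjI allI impI)
  qed
  have "e / 3 > 0" using e by simp
  then obtain h where h: "h \<in> compact_span" "L2_norm \<mu> (f - h) < e / 3" using compact_span_dense[OF f] by blast
  have hL: "h \<in> L2 \<mu>" using h(1) compact_span_L2 by blast
  have "\<forall>\<^sub>F x in nhds (0::'g). L2_norm \<mu> (lam x h - h) < e / 3"
    by (rule span[OF h(1), THEN conjunct2, rule_format, OF \<open>e / 3 > 0\<close>])
  then show ?thesis
  proof eventually_elim
    case (elim x)
    have eq: "lam x f - lam x h = lam x (f - h)" by (simp add: left_regular_def fun_eq_iff)
    have "L2_norm \<mu> (lam x f - lam x h) = L2_norm \<mu> (f - h)"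
      unfolding eq by (rule lam_norm[OF L2.mem_diff[OF f hL]])
    then show ?case
      using h(2) elim L2_norm_minus_commute[OF f hL] L2_norm_diff_triangle[OF lam_L2[OF f] lam_L2[OF hL] f, of x x]
        L2_norm_diff_triangle[OF lam_L2[OF hL] hL f, of x] by linarith
  qed
qed

text \<open>Translation by \<open>y\<close> is isometric and reduces continuity at \<open>y\<close>
  to strong continuity at the identity.\<close>

lemma A_continuous:
  assumes "u \<in> A" shows "continuous_on UNIV u"
proof -
  obtain f g where f: "f \<in> L2 \<mu>" "g \<in> L2 \<mu>" "u = coefficient \<mu> f g" using assms by (rule A_E)
  have "(u \<longlongrightarrow> u y) (nhds y)" for y
  proof (rule tendstoI)
    fix e :: real assume e: "e > 0"
    have pos: "L2_norm \<mu> g + 1 > 0" using L2_norm_nonneg[of \<mu> g] by simp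
    have "((\<lambda>x. - y + x) \<longlongrightarrow> - y + y) (nhds y)" by (intro tendsto_intros) (simp add: filterlim_ident)
    then have "filterlim (\<lambda>x. - y + x) (nhds 0) (nhds y)" by simp
    from eventually_compose_filterlim[OF lam_continuous[OF f(1), of "e / (L2_norm \<mu> g + 1)"] this]
    have "\<forall>\<^sub>F x in nhds y. L2_norm \<mu> (lam (- y + x) f - f) < e / (L2_norm \<mu> g + 1)" using e pos by simp
    then show "\<forall>\<^sub>F x in nhds y. dist (u x) (u y) < e"
    proof eventually_elim
      case (elim x)
      let ?d = "lam (- y + x) f - f"
      have d: "?d \<in> L2 \<mu>" by (rule L2.mem_diff[OF lam_L2[OF f(1)] f(1)])
      have "lam y (lam (- y + x) f) = lam x f" by (simp add: lam_lam add.assoc[symmetric])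
      then have eq: "lam y ?d = lam x f - lam y f" by (simp add: left_regular_def fun_eq_iff)
      have "u x - u y = L2_inner \<mu> (lam y ?d) g"
        unfolding eq f(3) coefficient_def by (rule L2.ip_diff[OF lam_L2[OF f(1)] lam_L2[OF f(1)] f(2), symmetric])
      then have "cmod (u x - u y) \<le> L2_norm \<mu> (lam y ?d) * L2_norm \<mu> g"
        using L2_cauchy_schwarz[OF lam_L2[OF d] f(2)] by metis
      also have "\<dots> = L2_norm \<mu> ?d * L2_norm \<mu> g" by (simp only: lam_norm[OF d])
      also have "\<dots> \<le> (e / (L2_norm \<mu> g + 1)) * L2_norm \<mu> g"
        using elim L2_norm_nonneg[of \<mu> g] by (intro mult_right_mono) simp_all
      also have "\<dots> < e" using e pos by (simp add: field_simps)
      finally show ?case by (simp add: dist_norm)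
    qed
  qed
  then show ?thesis
    by (simp add: continuous_on_def) (metis tendsto_within_subset tendsto_at_iff_tendsto_nhds subset_UNIV)
qed

text \<open>Finitely many translates of a null open set would cover any compact set, and inner
  regularity would then make the whole group null.\<close>

lemma open_positive:
  assumes U: "open U" "U \<noteq> {}"
  shows "emeasure \<mu> U > 0"
proof (rule ccontr)
  assume "\<not> emeasure \<mu> U > 0"
  then have U0: "emeasure \<mu> U = 0" by simp
  obtain a where a: "a \<in> U" using U(2) by blast
  have sh: "open ((+) x ` U)" "emeasure \<mu> ((+) x ` U) = 0" for x
  proof -
    have "(+) x ` U = (\<lambda>t. - x + t) -` U"
    proof
      show "(\<lambda>t. - x + t) -` U \<subseteq> (+) x ` U"
      proof
        fix t assume "t \<in> (\<lambda>t. - x + t) -` U"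
        moreover have "t = x + (- x + t)" by (simp add: add.assoc[symmetric])
        ultimately show "t \<in> (+) x ` U" by blast
      qed
    qed (auto simp: add.assoc[symmetric])
    moreover have "open ((\<lambda>t. - x + t) -` U)" by (rule open_vimage[OF U(1)]) (intro continuous_intros)
    ultimately show "open ((+) x ` U)" by simp
    show "emeasure \<mu> ((+) x ` U) = 0" using emeasure_shift[OF open_sets[OF U(1)]] U0 by simp
  qed
  have "emeasure \<mu> K = 0" if K: "compact K" for K
  proof -
    have cov: "K \<subseteq> (\<Union>k\<in>K. (+) (k - a) ` U)"
    proof
      fix k assume "k \<in> K"
      moreover have "k \<in> (+) (k - a) ` U" using a by (intro image_eqI[of _ _ a]) simp_all
      ultimately show "k \<in> (\<Union>k\<in>K. (+) (k - a) ` U)" by blast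
    qed
    obtain C where C: "C \<subseteq> K" "finite C" "K \<subseteq> (\<Union>c\<in>C. (+) (c - a) ` U)"
      by (rule compactE_image[OF K _ cov]) (use sh in auto)
    have "emeasure \<mu> K \<le> emeasure \<mu> (\<Union>c\<in>C. (+) (c - a) ` U)"
      by (rule emeasure_mono[OF C(3)]) (use sh C(2) open_sets in auto)
    also have "\<dots> \<le> (\<Sum>c\<in>C. emeasure \<mu> ((+) (c - a) ` U))"
      by (rule emeasure_subadditive_finite[OF C(2)]) (use sh open_sets in auto)
    also have "\<dots> = 0" using sh by simp
    finally show ?thesis by simp
  qed
  then have "(SUP K\<in>{K. compact K \<and> K \<subseteq> UNIV}. emeasure \<mu> K) \<le> 0"
    by (intro SUP_least) simp
  moreover have "emeasure \<mu> UNIV = (SUP K\<in>{K. compact K \<and> K \<subseteq> UNIV}. emeasure \<mu> K)"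
    using haar unfolding left_haar_measure_def by (metis open_UNIV)
  ultimately have "emeasure \<mu> UNIV = 0" by simp
  then show False using haar by (simp add: left_haar_measure_def)
qed

end

locale lc_haar = haar \<mu> for \<mu> :: "'g::{topological_group_add,t2_space} measure" +
  assumes lc: "locally_compact_space (euclidean :: 'g topology)"
begin

text \<open>Local compactness provides finite measure and \<open>open_positive\<close> positive
  measure. Indicators of such neighbourhoods produce bump functions in the Fourier algebra.\<close>

lemma A_separates:
  assumes W: "open W" "0 \<in> W"
  shows "\<exists>V. open V \<and> 0 \<in> V \<and> V \<subseteq> W \<and> emeasure \<mu> V < \<infinity> \<and> measure \<mu> V > 0"
proof -
  have "\<exists>U K. open U \<and> compact K \<and> (0::'g) \<in> U \<and> U \<subseteq> K"
    using lc unfolding locally_compact_space_def by simp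
  then obtain U K :: "'g set" where UK: "open U" "compact K" "0 \<in> U" "U \<subseteq> K" by (elim exE conjE)
  have "emeasure \<mu> (U \<inter> W) \<le> emeasure \<mu> K" by (rule emeasure_mono) (use UK compact_sets in auto)
  then have fin: "emeasure \<mu> (U \<inter> W) < \<infinity>" using compact_finite[OF UK(2)] by (rule le_less_trans)
  have "emeasure \<mu> (U \<inter> W) > 0" by (rule open_positive) (use UK W in auto)
  moreover have "emeasure \<mu> (U \<inter> W) = ennreal (measure \<mu> (U \<inter> W))"
    using fin by (intro emeasure_eq_ennreal_measure) simp
  ultimately have "measure \<mu> (U \<inter> W) \<noteq> 0" by (intro notI) simp
  then have "measure \<mu> (U \<inter> W) > 0" using measure_nonneg[of \<mu> "U \<inter> W"] by linarith
  then show ?thesis using UK W fin by (intro exI[of _ "U \<inter> W"]) auto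
qed

text \<open>The coefficient at \<open>y\<close> is the measure of the intersection of
  \<open>y + V\<close> and \<open>x + V\<close>, a bump at \<open>x\<close>.\<close>

lemma coefficient_ind:
  assumes V: "open V" "emeasure \<mu> V < \<infinity>"
  shows "ind V \<in> L2 \<mu>" "lam x (ind V) \<in> L2 \<mu>"
    "coefficient \<mu> (ind V) (lam x (ind V)) x = of_real (measure \<mu> V)"
    "(+) y ` V \<inter> (+) x ` V = {} \<Longrightarrow> coefficient \<mu> (ind V) (lam x (ind V)) y = 0"
proof -
  show L: "ind V \<in> L2 \<mu>" by (rule L2_ind[OF open_sets[OF V(1)] V(2)])
  then show "lam x (ind V) \<in> L2 \<mu>" by (rule lam_L2)
  have "coefficient \<mu> (ind V) (lam x (ind V)) x = L2_inner \<mu> (ind V) (ind V)"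
    unfolding coefficient_def by (rule lam_inner[OF L L])
  also have "\<dots> = of_real (\<integral>x. indicator V x \<partial>\<mu>)" unfolding L2_inner_self cmod_ind_sq ..
  also have "\<dots> = of_real (measure \<mu> V)" by (simp add: space_mu)
  finally show "coefficient \<mu> (ind V) (lam x (ind V)) x = of_real (measure \<mu> V)" .
  assume "(+) y ` V \<inter> (+) x ` V = {}"
  then have *: "ind ((+) y ` V) t * cnj (ind ((+) x ` V) t) = 0" for t by (auto simp: indicator_def)
  show "coefficient \<mu> (ind V) (lam x (ind V)) y = 0"
    unfolding coefficient_def lam_ind L2_inner_def * by simp
qed

lemma A_nonzero: "\<exists>u\<in>A. u x \<noteq> 0"
proof -
  obtain V where V: "open V" "emeasure \<mu> V < \<infinity>" "measure \<mu> V > 0" using A_separates[of UNIV] by auto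
  note c = coefficient_ind[OF V(1,2)]
  have "coefficient \<mu> (ind V) (lam x (ind V)) x \<noteq> 0" unfolding c(3) using V(3) by simp
  then show ?thesis using coefficient_mem[OF c(1) c(2)] by (rule rev_bexI[rotated])
qed

lemma A_separates_points:
  assumes "x \<noteq> y" shows "\<exists>u\<in>A. u x \<noteq> 0 \<and> u y = 0"
proof -
  obtain P Q where PQ: "open P" "open Q" "x \<in> P" "y \<in> Q" "P \<inter> Q = {}" using hausdorff[OF assms] by blast
  \<comment> \<open>Translates by \<open>x\<close> and by \<open>y\<close> of a set inside
    \<open>W\<close> stay in the disjoint sets \<open>P\<close> and \<open>Q\<close>.\<close>
  define W where "W = (\<lambda>t. x + t) -` P \<inter> (\<lambda>t. y + t) -` Q"
  have "open W" unfolding W_def by (intro open_Int open_vimage PQ continuous_intros)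
  moreover have "0 \<in> W" using PQ by (simp add: W_def)
  ultimately obtain V where V: "open V" "emeasure \<mu> V < \<infinity>" "measure \<mu> V > 0" "V \<subseteq> W" using A_separates[of W] by blast
  have "(+) y ` V \<inter> (+) x ` V = {}"  proof -
    have "(+) x ` V \<subseteq> P" "(+) y ` V \<subseteq> Q" using V(4) by (auto simp: W_def)
    then show ?thesis using PQ(5) by blast
  qed
  note c = coefficient_ind[OF V(1,2)]
  have "coefficient \<mu> (ind V) (lam x (ind V)) x \<noteq> 0 \<and> coefficient \<mu> (ind V) (lam x (ind V)) y = 0"
    unfolding c(3) using c(4)[OF \<open>(+) y ` V \<inter> (+) x ` V = {}\<close>] V(3) by simp
  then show ?thesis using coefficient_mem[OF c(1) c(2)] by (rule rev_bexI[rotated])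
qed

end

section \<open>Segal algebras and their diagonals\<close>

text \<open>The net is indexed by finite subsets and tolerances; as a filter it is generated by the
  sets of witnesses.\<close>

lemma net_exists:
  fixes d :: "'m \<Rightarrow> 'a \<Rightarrow> real"
  assumes ex: "\<And>S e. finite S \<Longrightarrow> S \<subseteq> B \<Longrightarrow> e > 0 \<Longrightarrow> \<exists>m. Q m \<and> (\<forall>a\<in>S. d m a < e)"
    and nonneg: "\<And>m a. Q m \<Longrightarrow> a \<in> B \<Longrightarrow> 0 \<le> d m a"
  shows "\<exists>F. F \<noteq> bot \<and> eventually Q F \<and> (\<forall>a\<in>B. ((\<lambda>m. d m a) \<longlongrightarrow> 0) F)"
proof -
  define I where "I = {(S, e). finite S \<and> S \<subseteq> B \<and> (e::real) > 0}"
  define U where "U i = {m. Q m \<and> (\<forall>a\<in>fst i. d m a < snd i)}" for i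
  define F where "F = (INF i\<in>I. principal (U i))"
  have ne: "I \<noteq> {}" unfolding I_def by (intro ex_in_conv[THEN iffD1] exI[of _ "({}, 1)"]) simp
  have base: "eventually R F \<longleftrightarrow> (\<exists>i\<in>I. eventually R (principal (U i)))" for R
    unfolding F_def
  proof (rule eventually_INF_base[OF ne])
    fix i j assume ij: "i \<in> I" "j \<in> I"
    \<comment> \<open>The union of the finite sets with the smaller tolerance makes the base
      directed.\<close>
    define k where "k = (fst i \<union> fst j, min (snd i) (snd j))"
    have "k \<in> I" using ij unfolding I_def k_def by (simp add: case_prod_unfold)
    moreover have "U k \<subseteq> U i" "U k \<subseteq> U j" unfolding U_def k_def by auto
    ultimately show "\<exists>x\<in>I. principal (U x) \<le> inf (principal (U i)) (principal (U j))"
      by (intro bexI[of _ k]) simp_all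
  qed
  have mem: "eventually R F" if "i \<in> I" "\<And>m. m \<in> U i \<Longrightarrow> R m" for i R
    unfolding base eventually_principal using that by (intro bexI[of _ i] ballI)
  have "F \<noteq> bot"
  proof
    assume "F = bot"
    then have "eventually (\<lambda>_. False) F" by simp
    then obtain i where i: "i \<in> I" "\<forall>m\<in>U i. False" unfolding base eventually_principal by (elim bexE)
    then have "\<exists>m. Q m \<and> (\<forall>a\<in>fst i. d m a < snd i)"
      unfolding I_def by (intro ex) (simp_all add: case_prod_unfold)
    then show False using i(2) unfolding U_def by simp
  qed
  moreover have "eventually Q F"
    by (rule mem[of "({}, 1)"]) (simp_all add: I_def U_def)
  moreover have "((\<lambda>m. d m a) \<longlongrightarrow> 0) F" if a: "a \<in> B" for a
  proof (rule tendstoI)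
    fix e :: real assume e: "e > 0"
    show "\<forall>\<^sub>F m in F. dist (d m a) 0 < e"
    proof (rule mem[of "({a}, e)"])
      show "({a}, e) \<in> I" using a e by (simp add: I_def)
      show "dist (d m a) 0 < e" if "m \<in> U ({a}, e)" for m
      proof -
        have "Q m" "d m a < e" using that by (simp_all add: U_def)
        then show ?thesis using nonneg[OF \<open>Q m\<close> a] by (simp add: dist_real_def)
      qed
    qed
  qed
  ultimately show ?thesis by blast
qed

text \<open>The converse passage, from a filter back to one witness for finitely many
  vectors.\<close>

lemma net_member:
  assumes F: "F \<noteq> bot" "eventually Q F" and t: "\<And>a. a \<in> S \<Longrightarrow> ((\<lambda>m. d m a) \<longlongrightarrow> (0::real)) F"
    and S: "finite S" and e: "e > 0"
  shows "\<exists>m. Q m \<and> (\<forall>a\<in>S. d m a < e)"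
proof -
  have "\<forall>\<^sub>F m in F. \<forall>a\<in>S. d m a < e"
    by (rule eventually_ball_finite[OF S]) (intro ballI order_tendstoD(2)[OF t e])
  with F(2) have "\<forall>\<^sub>F m in F. Q m \<and> (\<forall>a\<in>S. d m a < e)" by (rule eventually_conj)
  then show ?thesis by (rule eventually_happens'[OF F(1)])
qed

lemma linear_between_sum:
  assumes T: "linear_between X Y T" and X: "complex_vector.subspace X" and f: "\<And>i. i \<in> I \<Longrightarrow> f i \<in> X"
  shows "T (sum f I) = (\<Sum>i\<in>I. T (f i))"
proof -
  have "T 0 = 0"
  proof -
    have "T (0 *\<^sub>C 0) = 0 *\<^sub>C T 0" by (rule linear_betweenD(3)[OF T complex_vector.subspace_0[OF X]])
    then show ?thesis by (simp only: complex_vector.scale_zero_left)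
  qed
  then show ?thesis using f
  proof (induction I rule: infinite_finite_induct)
    case (insert i I)
    have "sum f I \<in> X" by (rule complex_vector.subspace_sum[OF X]) (use insert.prems in simp)
    then have "T (f i + sum f I) = T (f i) + T (sum f I)"
      using insert.prems by (intro linear_betweenD(2)[OF T]) simp_all
    then show ?case using insert by simp
  qed simp_all
qed

lemma seminorm_on_sum_le:
  assumes N: "seminorm_on X N" and f: "\<And>i. i \<in> I \<Longrightarrow> f i \<in> X"
  shows "N (sum f I) \<le> (\<Sum>i\<in>I. N (f i))"
  using f
proof (induction I rule: infinite_finite_induct)
  case (insert i I)
  have "sum f I \<in> X" by (rule complex_vector.subspace_sum[OF seminorm_onD(1)[OF N]]) (use insert.prems in simp)
  then have "N (f i + sum f I) \<le> N (f i) + N (sum f I)"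
    using insert.prems by (intro seminorm_onD(3)[OF N]) simp_all
  moreover have "N (sum f I) \<le> (\<Sum>i\<in>I. N (f i))" using insert.IH insert.prems by simp
  ultimately show ?case unfolding sum.insert[OF insert.hyps] by linarith
qed (simp_all add: seminorm_on_0[OF N])

lemma bounded_between_compose:
  assumes S: "bounded_between X NX Y NY S" and T: "bounded_between Y NY Z NZ T" and Y: "seminorm_on Y NY"
  shows "bounded_between X NX Z NZ (\<lambda>x. T (S x))"
proof -
  obtain C where C: "C \<ge> 0" "\<And>y. y \<in> Y \<Longrightarrow> NZ (T y) \<le> C * NY y" by (rule bounded_between_nonneg_bound[OF T Y]) blast
  obtain D where D: "\<forall>x\<in>X. NY (S x) \<le> D * NX x" using S unfolding bounded_between_def by (elim conjE exE)
  have S': "linear_between X Y S" and T': "linear_between Y Z T" using S T unfolding bounded_between_def by simp_all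
  note s = linear_betweenD[OF S'] and t = linear_betweenD[OF T']
  have "NZ (T (S x)) \<le> (C * D) * NX x" if x: "x \<in> X" for x
  proof -
    have "NZ (T (S x)) \<le> C * NY (S x)" by (rule C(2)[OF s(1)[OF x]])
    also have "\<dots> \<le> C * (D * NX x)" by (rule mult_left_mono[OF bspec[OF D x] C(1)])
    finally show ?thesis by (simp only: mult.assoc)
  qed
  then show ?thesis unfolding bounded_between_def linear_between_def
    by (intro conjI ballI allI exI[of _ "C * D"]) (simp_all only: s t)
qed

lemma normed_on_cmod: "normed_on UNIV cmod"
  unfolding normed_on_def by (simp add: norm_triangle_ineq scaleC_complex_def norm_mult complex_vector.subspace_UNIV)

lemma clinear_mult_left: "clinear (\<lambda>b. a * b :: 'a::complex_algebra)"
  by (rule clinearI) (simp_all add: distrib_left mult_scaleC_right)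

lemma clinear_mult_right: "clinear (\<lambda>b. b * a :: 'a::complex_algebra)"
  by (rule clinearI) (simp_all add: distrib_right mult_scaleC_left)

lemma clinear_id: "clinear (\<lambda>b. b)"
  by (rule clinearI) simp_all

lemma linear_between_clinear:
  "clinear T \<Longrightarrow> (\<And>x. x \<in> X \<Longrightarrow> T x \<in> Y) \<Longrightarrow> linear_between X Y T"
  unfolding linear_between_def by (intro conjI ballI allI clinearD) blast+

lemma tensor_map_mem:
  assumes S: "clinear S" "\<And>x. x \<in> X \<Longrightarrow> S x \<in> X'" and R: "clinear R" "\<And>y. y \<in> Y \<Longrightarrow> R y \<in> Y'"
    and u: "u \<in> alg_tensor X Y"
  shows "tensor_map S R u \<in> alg_tensor X' Y'"
  using u unfolding alg_tensor_def[of X Y]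
proof (induction rule: complex_vector.span_induct_alt)
  case base
  have "tensor_map S R 0 = 0" by (simp add: tensor_map_def fun_eq_iff)
  then show ?case using complex_vector.subspace_0[OF subspace_alg_tensor] by (simp only:)
next
  case (step c t v)
  then obtain x y where t: "t = tensor x y" "x \<in> X" "y \<in> Y" by (elim CollectE exE conjE)
  have "tensor_map S R t \<in> alg_tensor X' Y'"
    unfolding t tensor_map_tensor[OF S(1) R(1)] by (intro tensor_mem S R t)
  then show ?case unfolding clinearD[OF clinear_tensor_map]
    using step.IH by (intro complex_vector.subspace_add[OF subspace_alg_tensor] complex_vector.subspace_scale[OF subspace_alg_tensor])
qed

text \<open>Common ground of the two versions: \<open>NB\<close> and \<open>N\<close> are norms at
  the level of Banach spaces, in the operator version those of \<open>1 \<times> 1\<close> matrices.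
  The operator structure is used to verify these assumptions and, once more, for the complete
  boundedness of the diagonal maps.\<close>

locale segal_ctx = lc_haar \<mu> for \<mu> :: "'g::{topological_group_add,t2_space} measure" +
  fixes B :: "('g \<Rightarrow> complex) set" and NB :: "('g \<Rightarrow> complex) \<Rightarrow> real"
    and N :: "('g \<Rightarrow> complex, 'g \<Rightarrow> complex) tensor \<Rightarrow> real"
  assumes B_A: "B \<subseteq> A" and NB: "normed_on B NB" and ideal: "a \<in> A \<Longrightarrow> b \<in> B \<Longrightarrow> a * b \<in> B"
    and NB_eval: "b \<in> B \<Longrightarrow> cmod (b x) \<le> NB b"
    and NB_coefficient: "f \<in> L2 \<mu> \<Longrightarrow> g \<in> L2 \<mu> \<Longrightarrow> b \<in> B \<Longrightarrow>
      NB (coefficient \<mu> f g * b) \<le> L2_norm \<mu> f * L2_norm \<mu> g * NB b"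
    and NB_mult: "b \<in> B \<Longrightarrow> c \<in> B \<Longrightarrow> NB (b * c) \<le> NB b * NB c"
    and essential: "dense_wrt NB (complex_vector.span {a * b | a b. a \<in> A \<and> b \<in> B}) B"
    and nontrivial: "\<exists>b\<in>B. b \<noteq> 0"
    and N: "seminorm_on (alg_tensor B B) N"
    and N_left: "a \<in> B \<Longrightarrow> \<exists>C. \<forall>u\<in>alg_tensor B B. N (tensor_map (\<lambda>b. a * b) (\<lambda>c. c) u) \<le> C * N u"
    and N_right: "a \<in> B \<Longrightarrow> \<exists>C. \<forall>u\<in>alg_tensor B B. N (tensor_map (\<lambda>b. b) (\<lambda>c. c * a) u) \<le> C * N u"
    and N_eval: "u \<in> alg_tensor B B \<Longrightarrow> cmod (u (\<lambda>b c. b x * c y)) \<le> N u"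
    and mult_ex: "\<exists>L. bounded_between (completion (alg_tensor B B) N) (completion_norm (alg_tensor B B) N) B NB L
      \<and> (\<forall>b\<in>B. \<forall>c\<in>B. L (completion_embed (alg_tensor B B) N (tensor b c)) = b * c)"
begin

abbreviation "X \<equiv> alg_tensor B B"

sublocale T: seminormed X N
  by standard (rule N)

abbreviation "P \<equiv> completion X N"
abbreviation "NP \<equiv> completion_norm X N"
abbreviation "te b c \<equiv> completion_embed X N (tensor b c)"

lemmas NB_seminorm = normed_on_seminorm[OF NB]
lemmas B_sub = seminorm_onD(1)[OF NB_seminorm]
lemmas P_seminorm = normed_on_seminorm[OF T.completion_normed]
lemmas P_sub = seminorm_onD(1)[OF P_seminorm]

lemma idealB: "a \<in> B \<Longrightarrow> b \<in> B \<Longrightarrow> a * b \<in> B"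
  using ideal B_A by blast

lemma te_mem: "b \<in> B \<Longrightarrow> c \<in> B \<Longrightarrow> te b c \<in> P"
  by (intro T.emb_mem tensor_mem)

lemma X_induct [consumes 1, case_names tensor add]:
  assumes u: "u \<in> X" and t: "\<And>b c. b \<in> B \<Longrightarrow> c \<in> B \<Longrightarrow> Q (tensor b c)"
    and a: "\<And>u v. u \<in> X \<Longrightarrow> v \<in> X \<Longrightarrow> Q u \<Longrightarrow> Q v \<Longrightarrow> Q (u + v)"
  shows "Q u"
proof (rule alg_tensor_induct[OF u])
  show "B \<noteq> {}" "B \<noteq> {}" using nontrivial by blast+
qed (rule complex_vector.subspace_scale[OF B_sub] t a; assumption)+

lemma te_unique:
  assumes W: "normed_on W NW" and L: "bounded_between P NP W NW L" "bounded_between P NP W NW L'"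
    and eq: "\<And>b c. b \<in> B \<Longrightarrow> c \<in> B \<Longrightarrow> L (te b c) = L' (te b c)" and m: "m \<in> P"
  shows "L m = L' m"
proof (rule T.bounded_unique[OF W L _ m])
  have L1: "linear_between P W L" and L2: "linear_between P W L'" using L unfolding bounded_between_def by simp_all
  fix u assume "u \<in> X"
  then show "L (T.emb u) = L' (T.emb u)"
  proof (induction rule: X_induct)
    case (add u v)
    then show ?case unfolding T.emb_add[OF add.hyps]
        linear_betweenD(2)[OF L1 T.emb_mem[OF add.hyps(1)] T.emb_mem[OF add.hyps(2)]]
        linear_betweenD(2)[OF L2 T.emb_mem[OF add.hyps(1)] T.emb_mem[OF add.hyps(2)]] by simp
  qed (rule eq)
qed

text \<open>Any bounded map with the prescribed values on elementary tensors is the one described by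
  \<open>extension\<close>; the module actions and multiplication are computed through this.\<close>

lemma extension_eq:
  assumes W: "normed_on W NW" and L: "bounded_between P NP W NW L"
    and eq: "\<And>b c. b \<in> B \<Longrightarrow> c \<in> B \<Longrightarrow> L (te b c) = \<beta> b c" and m: "m \<in> P"
  shows "extension B (\<lambda>b c. te b c) P NP W NW \<beta> m = L m"
  unfolding extension_def
proof (rule the_equality)
  show "\<exists>L'. bounded_between P NP W NW L' \<and> (\<forall>b\<in>B. \<forall>c\<in>B. L' (te b c) = \<beta> b c) \<and> L m = L' m"
    using L eq by (intro exI[of _ L] conjI ballI refl)
  fix w assume "\<exists>L'. bounded_between P NP W NW L' \<and> (\<forall>b\<in>B. \<forall>c\<in>B. L' (te b c) = \<beta> b c) \<and> w = L' m"
  then obtain L' where L': "bounded_between P NP W NW L'" "\<forall>b\<in>B. \<forall>c\<in>B. L' (te b c) = \<beta> b c" "w = L' m"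
    by (elim exE conjE)
  show "w = L m" unfolding L'(3)
    by (rule te_unique[OF W L'(1) L _ m]) (simp only: L'(2)[rule_format] eq)
qed

section \<open>Module actions and point values on the completed tensor square\<close>

abbreviation "lact a m \<equiv> left_act B (\<lambda>b c. te b c) P NP a m"
abbreviation "ract m a \<equiv> right_act B (\<lambda>b c. te b c) P NP m a"
abbreviation "mm m \<equiv> mult_map B NB (\<lambda>b c. te b c) P NP m"

lemma mult_map_props:
  obtains L where "bounded_between P NP B NB L" "\<And>b c. b \<in> B \<Longrightarrow> c \<in> B \<Longrightarrow> L (te b c) = b * c"
    "\<And>m. m \<in> P \<Longrightarrow> mm m = L m"
proof -
  obtain L where L: "bounded_between P NP B NB L" "\<forall>b\<in>B. \<forall>c\<in>B. L (te b c) = b * c" using mult_ex by (elim exE conjE)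
  have "mm m = L m" if "m \<in> P" for m
    unfolding mult_map_def by (rule extension_eq[OF NB L(1) _ that]) (simp only: L(2)[rule_format])
  with L that show thesis by blast
qed

lemma left_act_props:
  assumes a: "a \<in> B"
  obtains L where "bounded_between P NP P NP L" "\<And>b c. b \<in> B \<Longrightarrow> c \<in> B \<Longrightarrow> L (te b c) = te (a * b) c"
    "\<And>m. m \<in> P \<Longrightarrow> lact a m = L m"
proof -
  let ?T = "tensor_map (\<lambda>b. a * b) (\<lambda>c. c)"
  obtain C where C: "\<forall>u\<in>X. N (?T u) \<le> C * N u" using N_left[OF a] ..
  have lin: "linear_between X X ?T"
    by (rule linear_between_clinear[OF clinear_tensor_map])
      (rule tensor_map_mem[OF clinear_mult_left idealB[OF a] clinear_id], assumption+)
  have b: "N (?T u) \<le> C * N u" if "u \<in> X" for u using C that ..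
  note L = completion_map[of X N X N ?T C, OF N N lin]
  have L1: "bounded_between P NP P NP (completion_map X X N ?T)" by (rule L(1)) (rule b)
  have te: "completion_map X X N ?T (te b c) = te (a * b) c" if "b \<in> B" "c \<in> B" for b c
  proof -
    have "completion_map X X N ?T (te b c) = T.emb (?T (tensor b c))"
      by (rule L(3)[OF _ tensor_mem[OF that]]) (rule b)
    then show ?thesis by (simp only: tensor_map_tensor clinear_mult_left clinear_id)
  qed
  have "lact a m = completion_map X X N ?T m" if "m \<in> P" for m
    unfolding left_act_def by (rule extension_eq[OF T.completion_normed L1 te that])
  then show thesis using that[OF L1 te] by blast
qed

lemma right_act_props:
  assumes a: "a \<in> B"
  obtains L where "bounded_between P NP P NP L" "\<And>b c. b \<in> B \<Longrightarrow> c \<in> B \<Longrightarrow> L (te b c) = te b (c * a)"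
    "\<And>m. m \<in> P \<Longrightarrow> ract m a = L m"
proof -
  let ?T = "tensor_map (\<lambda>b. b) (\<lambda>c. c * a)"
  obtain C where C: "\<forall>u\<in>X. N (?T u) \<le> C * N u" using N_right[OF a] ..
  have lin: "linear_between X X ?T"
    by (rule linear_between_clinear[OF clinear_tensor_map])
      (rule tensor_map_mem[OF clinear_id _ clinear_mult_right], assumption, rule idealB[OF _ a], assumption+)
  have b: "N (?T u) \<le> C * N u" if "u \<in> X" for u using C that ..
  note L = completion_map[of X N X N ?T C, OF N N lin]
  have L1: "bounded_between P NP P NP (completion_map X X N ?T)" by (rule L(1)) (rule b)
  have te: "completion_map X X N ?T (te b c) = te b (c * a)" if "b \<in> B" "c \<in> B" for b c
  proof -
    have "completion_map X X N ?T (te b c) = T.emb (?T (tensor b c))"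
      by (rule L(3)[OF _ tensor_mem[OF that]]) (rule b)
    then show ?thesis by (simp only: tensor_map_tensor clinear_id clinear_mult_right)
  qed
  have "ract m a = completion_map X X N ?T m" if "m \<in> P" for m
    unfolding right_act_def by (rule extension_eq[OF T.completion_normed L1 te that])
  then show thesis using that[OF L1 te] by blast
qed

text \<open>Cut off outside \<open>X\<close>, as members of \<open>dual_of\<close> vanish there; an
  element of the completion can then be applied to it directly.\<close>

definition ev :: "'g \<Rightarrow> 'g \<Rightarrow> ('g \<Rightarrow> complex, 'g \<Rightarrow> complex) tensor \<Rightarrow> complex" where
  "ev x y u = (if u \<in> X then u (\<lambda>b c. b x * c y) else 0)"

lemma bilinear_eval: "bilinear_form (\<lambda>b c. b x * c y :: complex)"
  by (rule bilinear_formI) (simp_all add: algebra_simps scaleC_fun_def scaleC_complex_def)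

lemma ev_dual: "ev x y \<in> dual_of X N"
proof (rule dual_ofI[where C = 1])
  show "ev x y (u + v) = ev x y u + ev x y v" if "u \<in> X" "v \<in> X" for u v
    unfolding ev_def using that T.add_mem[OF that] by simp
  show "ev x y (c *\<^sub>C u) = c * ev x y u" if "u \<in> X" for c u
    unfolding ev_def using that T.scale_mem[OF that] by (simp add: scaleC_fun_def scaleC_complex_def)
qed (simp_all add: ev_def N_eval)

lemma ev_bound: "m \<in> P \<Longrightarrow> cmod (m (ev x y)) \<le> NP m"
  and ev_bounded: "bounded_between P NP UNIV cmod (\<lambda>m. m (ev x y))"
proof -
  have b: "cmod (ev x y u) \<le> 1 * N u" if "u \<in> X" for u using that by (simp add: ev_def N_eval)
  show "m \<in> P \<Longrightarrow> cmod (m (ev x y)) \<le> NP m" using T.eval_bounded(1)[OF ev_dual b] by simp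
  show "bounded_between P NP UNIV cmod (\<lambda>m. m (ev x y))" by (rule T.eval_bounded(2)[OF ev_dual b])
qed

lemma emb_ev: "u \<in> X \<Longrightarrow> T.emb u (ev x y) = u (\<lambda>b c. b x * c y)"
  by (simp add: completion_embed_def ev_dual) (simp add: ev_def)

lemma te_ev: "b \<in> B \<Longrightarrow> c \<in> B \<Longrightarrow> te b c (ev x y) = b x * c y"
  by (simp add: emb_ev tensor_mem tensor_eval[OF bilinear_eval])

lemma bounded_scale: "bounded_between P NP UNIV cmod f \<Longrightarrow> bounded_between P NP UNIV cmod (\<lambda>m. w * f m)"
proof -
  assume f: "bounded_between P NP UNIV cmod f"
  have "bounded_between UNIV cmod UNIV cmod (\<lambda>z. w * z)"
    unfolding bounded_between_def linear_between_def
    by (intro conjI exI[of _ "cmod w"]) (simp_all add: algebra_simps norm_mult scaleC_complex_def)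
  from bounded_between_compose[OF f this normed_on_seminorm[OF normed_on_cmod]] show ?thesis .
qed

text \<open>Both sides are bounded in \<open>m\<close> and agree on elementary tensors.\<close>

lemma lact_ev:
  assumes a: "a \<in> B" and m: "m \<in> P" shows "lact a m (ev x y) = a x * m (ev x y)"
proof -
  obtain L where L: "bounded_between P NP P NP L" "\<And>b c. b \<in> B \<Longrightarrow> c \<in> B \<Longrightarrow> L (te b c) = te (a * b) c"
    "\<And>m. m \<in> P \<Longrightarrow> lact a m = L m" by (rule left_act_props[OF a]) blast
  show ?thesis unfolding L(3)[OF m]
  proof (rule te_unique[OF normed_on_cmod bounded_between_compose[OF L(1) ev_bounded P_seminorm] bounded_scale[OF ev_bounded] _ m])
    fix b c assume bc: "b \<in> B" "c \<in> B"
    have "L (te b c) (ev x y) = (a * b) x * c y" unfolding L(2)[OF bc] by (rule te_ev[OF idealB[OF a bc(1)] bc(2)])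
    then show "L (te b c) (ev x y) = a x * te b c (ev x y)"
      by (simp add: te_ev[OF bc])
  qed
qed

lemma ract_ev:
  assumes a: "a \<in> B" and m: "m \<in> P" shows "ract m a (ev x y) = a y * m (ev x y)"
proof -
  obtain L where L: "bounded_between P NP P NP L" "\<And>b c. b \<in> B \<Longrightarrow> c \<in> B \<Longrightarrow> L (te b c) = te b (c * a)"
    "\<And>m. m \<in> P \<Longrightarrow> ract m a = L m" by (rule right_act_props[OF a]) blast
  show ?thesis unfolding L(3)[OF m]
  proof (rule te_unique[OF normed_on_cmod bounded_between_compose[OF L(1) ev_bounded P_seminorm] bounded_scale[OF ev_bounded] _ m])
    fix b c assume bc: "b \<in> B" "c \<in> B"
    have "L (te b c) (ev x y) = b x * (c * a) y" unfolding L(2)[OF bc] by (rule te_ev[OF bc(1) idealB[OF bc(2) a]])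
    then show "L (te b c) (ev x y) = a y * te b c (ev x y)"
      by (simp add: te_ev[OF bc])
  qed
qed

lemma mm_mem: "m \<in> P \<Longrightarrow> mm m \<in> B"
proof -
  assume m: "m \<in> P"
  obtain L where L: "bounded_between P NP B NB L" "\<And>m. m \<in> P \<Longrightarrow> mm m = L m" by (rule mult_map_props) blast
  show ?thesis unfolding L(2)[OF m] using L(1) linear_betweenD(1)[of P B L m] m unfolding bounded_between_def by simp
qed

lemma mm_ev:
  assumes m: "m \<in> P" shows "mm m x = m (ev x x)"
proof -
  obtain L where L: "bounded_between P NP B NB L" "\<And>b c. b \<in> B \<Longrightarrow> c \<in> B \<Longrightarrow> L (te b c) = b * c"
    "\<And>m. m \<in> P \<Longrightarrow> mm m = L m" by (rule mult_map_props) blast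
  have e: "bounded_between B NB UNIV cmod (\<lambda>b. b x)"
    unfolding bounded_between_def linear_between_def
    by (intro conjI exI[of _ 1]) (simp_all add: NB_eval scaleC_fun_def)
  show ?thesis unfolding L(3)[OF m]
  proof (rule te_unique[OF normed_on_cmod bounded_between_compose[OF L(1) e NB_seminorm] ev_bounded _ m])
    fix b c assume "b \<in> B" "c \<in> B"
    then show "L (te b c) x = te b c (ev x x)" by (simp only: L(2) te_ev times_fun_def)
  qed
qed

lemma ev_off_diagonal:
  assumes m: "m \<in> P" and comm: "\<forall>a\<in>B. lact a m = ract m a" and xy: "x \<noteq> y"
  shows "m (ev x y) = 0"
proof (cases "\<exists>b\<in>B. b x \<noteq> 0")
  case True
  then obtain b where b: "b \<in> B" "b x \<noteq> 0" ..
  obtain u where u: "u \<in> A" "u x \<noteq> 0" "u y = 0" using A_separates_points[OF xy] by (elim bexE conjE)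
  \<comment> \<open>\<open>u * b\<close> is nonzero at \<open>x\<close> and zero at
    \<open>y\<close>, so commuting with it forces the value at \<open>(x, y)\<close> to
    vanish.\<close>
  have a: "u * b \<in> B" by (rule ideal[OF u(1) b(1)])
  have "(u * b) x * m (ev x y) = (u * b) y * m (ev x y)"
    unfolding lact_ev[OF a m, of x y, symmetric] ract_ev[OF a m, of x y, symmetric] using comm a by simp
  then show ?thesis using b u by simp
next
  case False
  \<comment> \<open>If all of \<open>B\<close> vanishes at \<open>x\<close>, the evaluation is zero
    on elementary tensors and hence on the completion.\<close>
  have z: "bounded_between P NP UNIV cmod (\<lambda>m. 0 * m (ev x y))" by (rule bounded_scale[OF ev_bounded])
  have "m (ev x y) = 0 * m (ev x y)"
  proof (rule te_unique[OF normed_on_cmod ev_bounded z _ m])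
    fix b c assume bc: "b \<in> B" "c \<in> B"
    then have "b x = 0" using False by blast
    then show "te b c (ev x y) = 0 * te b c (ev x y)" by (simp add: te_ev[OF bc])
  qed
  then show ?thesis by simp
qed

lemma ev_continuous:
  assumes m: "m \<in> P" shows "continuous_on UNIV (\<lambda>y. m (ev x y))"
proof -
  obtain s where s: "represents X N s m" using m by (rule T.completionE)
  have sX: "s n \<in> X" for n by (rule T.representsD(1)[OF s])
  have cont: "continuous_on UNIV (\<lambda>y. u (\<lambda>b c. b x * c y))" if "u \<in> X" for u
    using that
  proof (induction rule: X_induct)
    case (tensor b c)
    have "continuous_on UNIV c" by (rule A_continuous) (use tensor B_A in blast)
    then show ?case unfolding tensor_eval[OF bilinear_eval] by (intro continuous_intros)
  next
    case (add u v)
    then show ?case unfolding plus_fun_def by (intro continuous_intros)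
  qed
  \<comment> \<open>The norm bounds the evaluations at \<open>(x, y)\<close> uniformly in
    \<open>y\<close>.\<close>
  have "uniform_limit UNIV (\<lambda>n y. T.emb (s n) (ev x y)) (\<lambda>y. m (ev x y)) sequentially"
  proof (rule uniform_limitI)
    fix e :: real assume e: "e > 0"
    have "\<forall>\<^sub>F n in sequentially. NP (m - T.emb (s n)) < e" by (rule order_tendstoD(2)[OF T.emb_approx[OF s] e])
    then show "\<forall>\<^sub>F n in sequentially. \<forall>y\<in>UNIV. dist (T.emb (s n) (ev x y)) (m (ev x y)) < e"
    proof eventually_elim
      case (elim n)
      have d: "m - T.emb (s n) \<in> P" by (rule subspace_minus[OF P_sub m T.emb_mem[OF sX]])
      show ?case
      proof
        fix y
        have "dist (T.emb (s n) (ev x y)) (m (ev x y)) = cmod ((m - T.emb (s n)) (ev x y))"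
          by (simp add: dist_norm norm_minus_commute)
        also have "\<dots> \<le> NP (m - T.emb (s n))" by (rule ev_bound[OF d])
        finally show "dist (T.emb (s n) (ev x y)) (m (ev x y)) < e" using elim by linarith
      qed
    qed
  qed
  moreover have "\<forall>\<^sub>F n in sequentially. continuous_on UNIV (\<lambda>y. T.emb (s n) (ev x y))"
    by (rule always_eventually) (simp only: emb_ev[OF sX] cont[OF sX] simp_thms)
  ultimately show ?thesis by (intro uniform_limit_theorem[OF _ _ sequentially_bot])
qed

lemma discrete_if_point_open:
  assumes "open {x::'g}" shows "discrete_group TYPE('g)"
proof -
  have pt: "open {z}" for z :: 'g
  proof -
    have "{z} = (\<lambda>t. x + (- z + t)) -` {x}"
    proof
      show "(\<lambda>t. x + (- z + t)) -` {x} \<subseteq> {z}"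
      proof
        fix t assume "t \<in> (\<lambda>t. x + (- z + t)) -` {x}"
        then have "x + (- z + t) = x + 0" by simp
        then have "- z + t = 0" by (simp only: add_left_cancel)
        then show "t \<in> {z}" using add.inverse_unique[of "- z" t] by simp
      qed
    qed simp
    moreover have "open ((\<lambda>t. x + (- z + t)) -` {x})" by (rule open_vimage[OF assms]) (intro continuous_intros)
    ultimately show ?thesis by simp
  qed
  have "open S" for S :: "'g set"
  proof -
    have "open (\<Union>z\<in>S. {z})" by (intro open_UN ballI pt)
    then show ?thesis by simp
  qed
  then show ?thesis unfolding discrete_group_def by (simp add: topology_eq)
qed

lemma commuting_discrete:
  assumes m: "m \<in> P" and comm: "\<forall>a\<in>B. lact a m = ract m a" and nz: "mm m \<noteq> 0"
  shows "discrete_group TYPE('g)"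
proof -
  obtain x where x: "mm m x \<noteq> 0" using nz by (auto simp: fun_eq_iff)
  have "m (ev x y) \<noteq> 0 \<longleftrightarrow> y = x" for y
    using ev_off_diagonal[OF m comm, of x y] x unfolding mm_ev[OF m] by metis
  then have "{x} = (\<lambda>y. m (ev x y)) -` (- {0})" by auto
  moreover have "open ((\<lambda>y. m (ev x y)) -` (- {0}))"
    by (rule open_vimage[OF open_Compl[OF closed_singleton] ev_continuous[OF m]])
  ultimately show ?thesis by (intro discrete_if_point_open[of x]) simp
qed

lemma near_nonzero:
  assumes "b \<in> B" "b \<noteq> 0" shows "0 < NB b" "NB (0 - b) = NB b"
proof -
  have "0 \<le> NB b" "NB b \<noteq> 0" using NB assms unfolding normed_on_def by simp_all
  then show "0 < NB b" by simp
  show "NB (0 - b) = NB b"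
    using seminorm_onD(4)[OF NB_seminorm assms(1), of "-1"] by (simp add: scaleC_minus1)
qed

lemma pseudo_contractible_discrete:
  assumes "pseudo_contractible_via B NB (\<lambda>b c. te b c) P NP" shows "discrete_group TYPE('g)"
proof -
  obtain F where F: "F \<noteq> bot" "\<forall>\<^sub>F m in F. m \<in> P \<and> (\<forall>a\<in>B. lact a m = ract m a)"
    "\<forall>a\<in>B. ((\<lambda>m. NB (mm m * a - a)) \<longlongrightarrow> 0) F"
    using assms unfolding pseudo_contractible_via_def by (elim exE conjE)
  obtain b where b: "b \<in> B" "b \<noteq> 0" using nontrivial ..
  \<comment> \<open>With tolerance \<open>NB b\<close> the product \<open>mm m * b\<close> is too
    close to \<open>b\<close> to be zero.\<close>
  have "\<exists>m. (m \<in> P \<and> (\<forall>a\<in>B. lact a m = ract m a)) \<and> (\<forall>a\<in>{b}. NB (mm m * a - a) < NB b)"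
    by (rule net_member[OF F(1,2)]) (simp_all add: F(3)[rule_format, OF b(1)] near_nonzero(1)[OF b])
  then obtain m where m: "m \<in> P" "\<forall>a\<in>B. lact a m = ract m a" "NB (mm m * b - b) < NB b" by blast
  have "mm m \<noteq> 0"
  proof
    assume "mm m = 0"
    then show False using m(3) near_nonzero(2)[OF b] by simp
  qed
  then show ?thesis by (rule commuting_discrete[OF m(1,2)])
qed

text \<open>The images of the commuting tensors under multiplication form the approximate identity;
  it is two-sided because functions commute.\<close>

lemma pseudo_contractible_ai:
  assumes "pseudo_contractible_via B NB (\<lambda>b c. te b c) P NP" shows "has_approximate_identity B NB"
proof -
  obtain F where F: "F \<noteq> bot" "\<forall>\<^sub>F m in F. m \<in> P \<and> (\<forall>a\<in>B. lact a m = ract m a)"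
    "\<forall>a\<in>B. ((\<lambda>m. NB (mm m * a - a)) \<longlongrightarrow> 0) F"
    using assms unfolding pseudo_contractible_via_def by (elim exE conjE)
  let ?G = "filtermap (\<lambda>m. mm m) F"
  have "?G \<noteq> bot" using F(1) by (simp add: filtermap_bot_iff)
  moreover have "\<forall>\<^sub>F e in ?G. e \<in> B"
    unfolding eventually_filtermap using F(2) by eventually_elim (simp add: mm_mem)
  moreover have "((\<lambda>e. NB (e * a - a)) \<longlongrightarrow> 0) ?G" "((\<lambda>e. NB (a * e - a)) \<longlongrightarrow> 0) ?G" if "a \<in> B" for a
    unfolding filterlim_filtermap mult.commute[of a] using F(3) that by simp_all
  ultimately show ?thesis unfolding has_approximate_identity_def by blast
qed

lemma biprojective_discrete:
  assumes F: "F \<noteq> bot" "\<forall>\<^sub>F \<xi> in F. (\<forall>a\<in>B. \<xi> a \<in> P) \<and> bimodule_map_via B (\<lambda>b c. te b c) P NP \<xi>"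
    and lim: "\<And>a. a \<in> B \<Longrightarrow> ((\<lambda>\<xi>. NB (mm (\<xi> a) - a)) \<longlongrightarrow> 0) F"
  shows "discrete_group TYPE('g)"
proof -
  obtain b where b: "b \<in> B" "b \<noteq> 0" using nontrivial ..
  have "\<exists>\<xi>. ((\<forall>a\<in>B. \<xi> a \<in> P) \<and> bimodule_map_via B (\<lambda>b c. te b c) P NP \<xi>) \<and> (\<forall>a\<in>{b}. NB (mm (\<xi> a) - a) < NB b)"
    by (rule net_member[OF F]) (simp_all add: lim[OF b(1)] near_nonzero(1)[OF b])
  then obtain \<xi> where \<xi>: "\<And>a. a \<in> B \<Longrightarrow> \<xi> a \<in> P" "bimodule_map_via B (\<lambda>b c. te b c) P NP \<xi>" "NB (mm (\<xi> b) - b) < NB b"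
    by blast
  have "mm (\<xi> b) \<noteq> 0"
  proof
    assume "mm (\<xi> b) = 0"
    then show False using \<xi>(3) near_nonzero(2)[OF b] by simp
  qed
  moreover have "\<forall>a\<in>B. lact a (\<xi> b) = ract (\<xi> b) a"
  proof
    fix a assume "a \<in> B"
    \<comment> \<open>The two identities have equal left-hand sides because functions commute, so
      the value at \<open>b\<close> is a commuting tensor.\<close>
    then have "\<xi> (a * b) = lact a (\<xi> b)" "\<xi> (b * a) = ract (\<xi> b) a"
      using \<xi>(2) b(1) unfolding bimodule_map_via_def by blast+
    then show "lact a (\<xi> b) = ract (\<xi> b) a" by (simp only: mult.commute[of a b])
  qed
  ultimately show ?thesis by (intro commuting_discrete[OF \<xi>(1)[OF b(1)]])
qed

end

section \<open>Finitely supported diagonals\<close>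

definition finsupp :: "('a \<Rightarrow> 'b::zero) \<Rightarrow> bool" where
  "finsupp u \<longleftrightarrow> finite {z. u z \<noteq> 0}"

lemma finsupp_subspace: "complex_vector.subspace {u :: 'a \<Rightarrow> complex. finsupp u}"
proof (rule complex_vector.subspaceI)
  fix u v :: "'a \<Rightarrow> complex" assume "u \<in> {u. finsupp u}" "v \<in> {u. finsupp u}"
  then have "finite ({z. u z \<noteq> 0} \<union> {z. v z \<noteq> 0})" by (simp add: finsupp_def)
  then show "u + v \<in> {u. finsupp u}"
    unfolding finsupp_def mem_Collect_eq by (rule finite_subset[rotated]) auto
next
  fix c and u :: "'a \<Rightarrow> complex" assume "u \<in> {u. finsupp u}"
  then have "finite {z. u z \<noteq> 0}" by (simp add: finsupp_def)
  then show "c *\<^sub>C u \<in> {u. finsupp u}"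
    unfolding finsupp_def mem_Collect_eq by (rule finite_subset[rotated]) (auto simp: scaleC_fun_def scaleC_complex_def)
qed (simp add: finsupp_def)

lemma finsupp_mult: "finsupp u \<Longrightarrow> finsupp (u * b :: 'a \<Rightarrow> complex)"
  unfolding finsupp_def by (erule finite_subset[rotated]) auto

context haar
begin

text \<open>The support lies in the finite set of differences of points of the two supports.\<close>

lemma coefficient_finsupp:
  assumes "finsupp h" "finsupp k" shows "finsupp (coefficient \<mu> h k)"
proof -
  let ?D = "(\<lambda>(t, s). t - s) ` ({z. k z \<noteq> 0} \<times> {z. h z \<noteq> 0})"
  have "coefficient \<mu> h k x = 0" if "x \<notin> ?D" for x
  proof -
    have *: "h (- x + t) * cnj (k t) = 0" for t
    proof (rule ccontr)
      assume "h (- x + t) * cnj (k t) \<noteq> 0"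
      then have "(t, - x + t) \<in> {z. k z \<noteq> 0} \<times> {z. h z \<noteq> 0}" by simp
      moreover have "x = t - (- x + t)" by (simp add: diff_conv_add_uminus minus_add add.assoc[symmetric] del: add_uminus_conv_diff)
      ultimately show False using that by (metis (mono_tags, lifting) case_prod_conv image_eqI)
    qed
    show ?thesis unfolding coefficient_def L2_inner_def left_regular_def * by simp
  qed
  then have "{x. coefficient \<mu> h k x \<noteq> 0} \<subseteq> ?D" by blast
  moreover have "finite ?D" using assms by (intro finite_imageI finite_cartesian_product) (simp_all add: finsupp_def)
  ultimately show ?thesis unfolding finsupp_def by (rule finite_subset)
qed

text \<open>The error is split between the two slots, so that each function can be approximated in
  \<open>L2\<close> separately.\<close>

lemma coefficient_diff:
  assumes "f \<in> L2 \<mu>" "g \<in> L2 \<mu>" "h \<in> L2 \<mu>" "k \<in> L2 \<mu>"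
  shows "coefficient \<mu> f g = coefficient \<mu> h k + (coefficient \<mu> (f - h) g + coefficient \<mu> h (g - k))"
proof
  fix x
  have gk: "g - k \<in> L2 \<mu>" by (rule L2.mem_diff[OF assms(2,4)])
  have l: "lam x (f - h) = lam x f - lam x h" by (simp add: left_regular_def fun_eq_iff)
  have 1: "coefficient \<mu> (f - h) g x = coefficient \<mu> f g x - coefficient \<mu> h g x"
    unfolding coefficient_def l by (rule L2.ip_diff[OF lam_L2[OF assms(1)] lam_L2[OF assms(3)] assms(2)])
  have "L2_inner \<mu> (lam x h) ((g - k) + k) = L2_inner \<mu> (lam x h) (g - k) + L2_inner \<mu> (lam x h) k"
    by (rule L2.ip_add_right[OF gk assms(4) lam_L2[OF assms(3)]])
  then have 2: "coefficient \<mu> h (g - k) x = coefficient \<mu> h g x - coefficient \<mu> h k x"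
    unfolding coefficient_def by simp
  show "coefficient \<mu> f g x = (coefficient \<mu> h k + (coefficient \<mu> (f - h) g + coefficient \<mu> h (g - k))) x"
    by (simp add: 1 2)
qed

end

context segal_ctx
begin

definition diag_tensor :: "'g set \<Rightarrow> ('g \<Rightarrow> complex) \<Rightarrow> ('g \<Rightarrow> complex, 'g \<Rightarrow> complex) tensor" where
  "diag_tensor F w = (\<Sum>z\<in>F. w z *\<^sub>C tensor (ind {z}) (ind {z}))"

definition diag :: "'g set \<Rightarrow> ('g \<Rightarrow> complex) \<Rightarrow> (('g \<Rightarrow> complex, 'g \<Rightarrow> complex) tensor \<Rightarrow> complex) \<Rightarrow> complex" where
  "diag F w = T.emb (diag_tensor F w)"

text \<open>Multiplication by \<open>ind {z}\<close> leaves only the value at \<open>z\<close>, so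
  \<open>a\<close> enters as a weight. In this form the lemmas on diagonals apply.\<close>

definition xi :: "('g \<Rightarrow> complex) \<Rightarrow> ('g \<Rightarrow> complex) \<Rightarrow> (('g \<Rightarrow> complex, 'g \<Rightarrow> complex) tensor \<Rightarrow> complex) \<Rightarrow> complex" where
  "xi u a = diag {z. u z \<noteq> 0} (\<lambda>z. u z * a z)"

lemma delta_mult: "a * ind {z} = a z *\<^sub>C ind {z}"
  by (simp add: fun_eq_iff scaleC_fun_def scaleC_complex_def indicator_def)

context
  fixes F :: "'g set"
  assumes F': "\<forall>z\<in>F. ind {z} \<in> B"
begin

lemmas F = bspec[OF F']

lemma diag_term_mem: "z \<in> F \<Longrightarrow> w z *\<^sub>C tensor (ind {z}) (ind {z}) \<in> X"
  by (intro T.scale_mem tensor_mem F)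

lemma diag_tensor_mem: "diag_tensor F w \<in> X"
  unfolding diag_tensor_def by (rule complex_vector.subspace_sum[OF T.subspace diag_term_mem])

lemma diag_mem: "diag F w \<in> P"
  unfolding diag_def by (rule T.emb_mem[OF diag_tensor_mem])

lemma diag_eq: "diag F w = (\<Sum>z\<in>F. w z *\<^sub>C te (ind {z}) (ind {z}))"
proof -
  have "diag F w = (\<Sum>z\<in>F. T.emb (w z *\<^sub>C tensor (ind {z}) (ind {z})))"
    unfolding diag_def diag_tensor_def by (rule T.emb_sum[OF diag_term_mem])
  also have "\<dots> = (\<Sum>z\<in>F. w z *\<^sub>C te (ind {z}) (ind {z}))"
    by (rule sum.cong[OF refl]) (rule T.emb_scale[OF tensor_mem[OF F F]])
  finally show ?thesis .
qed

lemma bounded_diag: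
  assumes L: "bounded_between P NP W NW L"
  shows "L (diag F w) = (\<Sum>z\<in>F. w z *\<^sub>C L (te (ind {z}) (ind {z})))"
proof -
  have L': "linear_between P W L" using L unfolding bounded_between_def by simp
  have "L (diag F w) = (\<Sum>z\<in>F. L (w z *\<^sub>C te (ind {z}) (ind {z})))"
    unfolding diag_eq
    by (rule linear_between_sum[OF L' P_sub]) (rule complex_vector.subspace_scale[OF P_sub te_mem[OF F F]])
  also have "\<dots> = (\<Sum>z\<in>F. w z *\<^sub>C L (te (ind {z}) (ind {z})))"
    by (rule sum.cong[OF refl]) (rule linear_betweenD(3)[OF L' te_mem[OF F F]])
  finally show ?thesis .
qed

lemma te_scale_left: "b \<in> B \<Longrightarrow> c \<in> B \<Longrightarrow> te (w *\<^sub>C b) c = w *\<^sub>C te b c"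
  unfolding tensor_scale_left by (rule T.emb_scale[OF tensor_mem])

lemma te_scale_right: "b \<in> B \<Longrightarrow> c \<in> B \<Longrightarrow> te b (w *\<^sub>C c) = w *\<^sub>C te b c"
  unfolding tensor_scale_right by (rule T.emb_scale[OF tensor_mem])

text \<open>\<open>ind {z}\<close> absorbs \<open>a\<close> as the scalar \<open>a z\<close>, which
  changes the weight at \<open>z\<close>. The right action has the same effect, so diagonals commute
  with \<open>B\<close>.\<close>

lemma lact_diag:
  assumes a: "a \<in> B" shows "lact a (diag F w) = diag F (\<lambda>z. w z * a z)"
proof -
  obtain L where L: "bounded_between P NP P NP L" "\<And>b c. b \<in> B \<Longrightarrow> c \<in> B \<Longrightarrow> L (te b c) = te (a * b) c"
    "\<And>m. m \<in> P \<Longrightarrow> lact a m = L m" by (rule left_act_props[OF a]) blast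
  have "w z *\<^sub>C L (te (ind {z}) (ind {z})) = (w z * a z) *\<^sub>C te (ind {z}) (ind {z})" if "z \<in> F" for z
    unfolding L(2)[OF F[OF that] F[OF that]] delta_mult te_scale_left[OF F[OF that] F[OF that]]
    by (rule complex_vector.scale_scale)
  then show ?thesis unfolding L(3)[OF diag_mem] bounded_diag[OF L(1)] unfolding diag_eq by (rule sum.cong[OF refl])
qed

lemma ract_diag:
  assumes a: "a \<in> B" shows "ract (diag F w) a = diag F (\<lambda>z. w z * a z)"
proof -
  obtain L where L: "bounded_between P NP P NP L" "\<And>b c. b \<in> B \<Longrightarrow> c \<in> B \<Longrightarrow> L (te b c) = te b (c * a)"
    "\<And>m. m \<in> P \<Longrightarrow> ract m a = L m" by (rule right_act_props[OF a]) blast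
  have "w z *\<^sub>C L (te (ind {z}) (ind {z})) = (w z * a z) *\<^sub>C te (ind {z}) (ind {z})" if "z \<in> F" for z
    unfolding L(2)[OF F[OF that] F[OF that]] mult.commute[of "ind {z}" a] delta_mult te_scale_right[OF F[OF that] F[OF that]]
    by (rule complex_vector.scale_scale)
  then show ?thesis unfolding L(3)[OF diag_mem] bounded_diag[OF L(1)] unfolding diag_eq by (rule sum.cong[OF refl])
qed

lemma mm_diag:
  assumes fin: "finite F" shows "mm (diag F w) = (\<lambda>z. if z \<in> F then w z else 0)"
proof -
  obtain L where L: "bounded_between P NP B NB L" "\<And>b c. b \<in> B \<Longrightarrow> c \<in> B \<Longrightarrow> L (te b c) = b * c"
    "\<And>m. m \<in> P \<Longrightarrow> mm m = L m" by (rule mult_map_props) blast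
  have "mm (diag F w) = (\<Sum>z\<in>F. w z *\<^sub>C L (te (ind {z}) (ind {z})))"
    unfolding L(3)[OF diag_mem] by (rule bounded_diag[OF L(1)])
  also have "\<dots> = (\<Sum>z\<in>F. w z *\<^sub>C ind {z})"
  proof (rule sum.cong[OF refl])
    fix z assume z: "z \<in> F"
    have "ind {z} * ind {z} = ind {z}" by (simp add: fun_eq_iff indicator_def)
    then show "w z *\<^sub>C L (te (ind {z}) (ind {z})) = w z *\<^sub>C ind {z}" by (simp only: L(2)[OF F[OF z] F[OF z]])
  qed
  also have "\<dots> = (\<lambda>z. if z \<in> F then w z else 0)"
  proof
    fix x
    have app: "(sum g I) x = (\<Sum>i\<in>I. g i x)" for g :: "'g \<Rightarrow> 'g \<Rightarrow> complex" and I
      by (induction I rule: infinite_finite_induct) auto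
    have "(\<Sum>z\<in>F. w z *\<^sub>C ind {z}) x = (\<Sum>z\<in>F. if z = x then w z else 0)"
      unfolding app by (rule sum.cong) (simp_all add: scaleC_fun_def scaleC_complex_def indicator_def)
    then show "(\<Sum>z\<in>F. w z *\<^sub>C ind {z}) x = (if x \<in> F then w x else 0)" using fin by (simp add: sum.delta)
  qed
  finally show ?thesis .
qed

end

lemma xi_tensor: "diag_tensor {z. u z \<noteq> 0} (\<lambda>z. u z * a z) = (\<Sum>z | u z \<noteq> 0. u z *\<^sub>C tensor (ind {z} * a) (ind {z}))"
  unfolding diag_tensor_def mult.commute[of "ind _" a] delta_mult tensor_scale_left complex_vector.scale_scale ..

section \<open>Consequences of discreteness\<close>

context
  assumes discrete: "discrete_group TYPE('g)"
begin

lemma all_open: "open (S::'g set)"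
proof -
  have "openin (euclidean :: 'g topology) S" using discrete unfolding discrete_group_def by simp
  then show ?thesis by simp
qed

lemma compact_finite_set: "compact K \<Longrightarrow> finite (K::'g set)"
proof -
  assume K: "compact K"
  obtain C where "C \<subseteq> K" "finite C" "K \<subseteq> (\<Union>c\<in>C. {c})"
    by (rule compactE_image[OF K, of K "\<lambda>c. {c}"]) (use all_open in auto)
  then show ?thesis by (metis UN_singleton finite_subset)
qed

lemma compact_span_finsupp: "h \<in> compact_span \<Longrightarrow> finsupp h"
proof -
  have "compact_span \<subseteq> {u. finsupp u}"
    unfolding compact_span_def
  proof (rule complex_vector.span_minimal[OF _ finsupp_subspace], rule subsetI)
    fix f :: "'g \<Rightarrow> complex" assume "f \<in> {ind K | K. compact K}"
    then obtain K where K: "f = ind K" "compact K" by blast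
    have "{z. f z \<noteq> 0} \<subseteq> K" unfolding K by (auto simp: indicator_def)
    then show "f \<in> {u. finsupp u}" unfolding finsupp_def mem_Collect_eq using compact_finite_set[OF K(2)] by (rule finite_subset)
  qed
  then show "h \<in> compact_span \<Longrightarrow> finsupp h" by blast
qed

text \<open>The set \<open>{0}\<close> is open of finite positive measure, and the coefficient of
  its indicator against the translate by \<open>z\<close> is \<open>measure \<mu> {0}\<close> times
  the point mass.\<close>

lemma delta_A: "ind {z} \<in> A"
proof -
  have V: "open {0::'g}" "emeasure \<mu> {0} < \<infinity>" by (rule all_open, rule compact_finite) simp
  note c = coefficient_ind[OF V]
  have pos: "measure \<mu> {0::'g} \<noteq> 0"
  proof
    assume "measure \<mu> {0::'g} = 0"
    then have "emeasure \<mu> {0::'g} = 0" using V(2) emeasure_eq_ennreal_measure[of \<mu> "{0}"] by simp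
    then show False using open_positive[OF V(1)] by simp
  qed
  have "coefficient \<mu> (ind {0}) (lam z (ind {0})) = of_real (measure \<mu> {0}) *\<^sub>C ind {z}"
  proof
    fix y
    show "coefficient \<mu> (ind {0}) (lam z (ind {0})) y = (of_real (measure \<mu> {0}) *\<^sub>C ind {z}) y"
    proof (cases "y = z")
      case True
      then show ?thesis by (simp add: c(3) scaleC_fun_def scaleC_complex_def)
    next
      case False
      then have "coefficient \<mu> (ind {0}) (lam z (ind {0})) y = 0" by (intro c(4)) simp
      then show ?thesis using False by (simp add: scaleC_fun_def scaleC_complex_def)
    qed
  qed
  then have "of_real (measure \<mu> {0}) *\<^sub>C ind {z} \<in> A" using coefficient_mem[OF c(1) c(2)[of z]] by (simp only:)
  then have "(1 / of_real (measure \<mu> {0})) *\<^sub>C of_real (measure \<mu> {0}) *\<^sub>C ind {z} \<in> A" by (rule A_scale)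
  then show ?thesis unfolding complex_vector.scale_scale using pos by (simp add: scaleC_one)
qed

text \<open>The ideal property turns a nonzero value at \<open>z\<close> into the point mass. For
  this reason diagonals are taken over the support of a function in \<open>B\<close>.\<close>

lemma delta_B:
  assumes "u \<in> B" "u z \<noteq> 0" shows "ind {z} \<in> B"
proof -
  have "u z *\<^sub>C ind {z} \<in> B" using ideal[OF delta_A assms(1), of z] unfolding mult.commute[of _ u] delta_mult .
  then have "(1 / u z) *\<^sub>C u z *\<^sub>C ind {z} \<in> B" by (rule complex_vector.subspace_scale[OF B_sub])
  then show ?thesis unfolding complex_vector.scale_scale using assms(2) by (simp add: scaleC_one)
qed

text \<open>The two \<open>L2\<close> functions of the coefficient are replaced one after the other;
  \<open>h\<close> is fixed before \<open>k\<close>, because the tolerance for \<open>k\<close>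
  depends on the norm of \<open>h\<close>. Adding \<open>1\<close> to the norms avoids division by
  zero.\<close>

lemma finsupp_approx_product:
  assumes a: "a \<in> A" and b: "b \<in> B" and e: "e > 0"
  shows "\<exists>v\<in>{u \<in> B. finsupp u}. NB (a * b - v) < e"
proof -
  obtain f g where f: "f \<in> L2 \<mu>" "g \<in> L2 \<mu>" "a = coefficient \<mu> f g" using a by (rule A_E)
  define M where "M = NB b + 1"
  have Mb: "NB b < M" "0 \<le> NB b" "M > 0" unfolding M_def using seminorm_onD(2)[OF NB_seminorm b] by simp_all
  define G where "G = L2_norm \<mu> g + 1"
  have G: "L2_norm \<mu> g \<le> G" "G > 0" unfolding G_def using L2_norm_nonneg[of \<mu> g] by simp_all
  have "e / 2 / (G * M) > 0" using e G Mb by simp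
  then obtain h where h: "h \<in> compact_span" "L2_norm \<mu> (f - h) < e / 2 / (G * M)"
    using compact_span_dense[OF f(1)] by blast
  define H where "H = L2_norm \<mu> h + 1"
  have H: "L2_norm \<mu> h \<le> H" "H > 0" unfolding H_def using L2_norm_nonneg[of \<mu> h] by simp_all
  have "e / 2 / (H * M) > 0" using e H Mb by simp
  then obtain k where k: "k \<in> compact_span" "L2_norm \<mu> (g - k) < e / 2 / (H * M)"
    using compact_span_dense[OF f(2)] by blast
  have hL: "h \<in> L2 \<mu>" "k \<in> L2 \<mu>" using h(1) k(1) compact_span_L2 by blast+
  have d: "f - h \<in> L2 \<mu>" "g - k \<in> L2 \<mu>" by (intro L2.mem_diff f hL)+
  let ?v = "coefficient \<mu> h k * b" and ?p = "coefficient \<mu> (f - h) g * b" and ?q = "coefficient \<mu> h (g - k) * b"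
  have mem: "?v \<in> B" "?p \<in> B" "?q \<in> B" by (intro ideal[OF _ b] coefficient_mem hL d f)+
  have "a * b - ?v = ?p + ?q" unfolding f(3) coefficient_diff[OF f(1,2) hL] by (simp add: algebra_simps)
  then have "NB (a * b - ?v) \<le> NB ?p + NB ?q" using seminorm_onD(3)[OF NB_seminorm mem(2,3)] by simp
  moreover have "NB ?p < e / 2"
  proof -
    have "NB ?p \<le> L2_norm \<mu> (f - h) * L2_norm \<mu> g * NB b" by (rule NB_coefficient[OF d(1) f(2) b])
    also have "\<dots> \<le> L2_norm \<mu> (f - h) * (G * M)"
      unfolding mult.assoc using G Mb by (intro mult_left_mono mult_mono L2_norm_nonneg) simp_all
    also have "\<dots> < (e / 2 / (G * M)) * (G * M)" using G Mb by (intro mult_strict_right_mono[OF h(2)]) simp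
    also have "\<dots> = e / 2" using G Mb by simp
    finally show ?thesis .
  qed
  moreover have "NB ?q < e / 2"
  proof -
    have "NB ?q \<le> L2_norm \<mu> h * L2_norm \<mu> (g - k) * NB b" by (rule NB_coefficient[OF hL(1) d(2) b])
    also have "\<dots> = L2_norm \<mu> (g - k) * (L2_norm \<mu> h * NB b)" by (simp only: mult_ac)
    also have "\<dots> \<le> L2_norm \<mu> (g - k) * (H * M)"
      using H Mb by (intro mult_left_mono mult_mono L2_norm_nonneg) simp_all
    also have "\<dots> < (e / 2 / (H * M)) * (H * M)" using H Mb by (intro mult_strict_right_mono[OF k(2)]) simp
    also have "\<dots> = e / 2" using H Mb by simp
    finally show ?thesis .
  qed
  ultimately have "NB (a * b - ?v) < e" by linarith
  moreover have "?v \<in> {u \<in> B. finsupp u}"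
    using mem(1) finsupp_mult[OF coefficient_finsupp[OF compact_span_finsupp[OF h(1)] compact_span_finsupp[OF k(1)]]] by simp
  ultimately show ?thesis by (rule bexI)
qed

text \<open>Essentiality enters here: the closure of the finitely supported functions is a subspace
  and contains the products of \<open>A\<close> with \<open>B\<close>, whose span is dense.\<close>

lemma finsupp_dense:
  assumes b: "b \<in> B" and e: "e > 0" shows "\<exists>v. v \<in> B \<and> finsupp v \<and> NB (b - v) < e"
proof -
  let ?V = "{u \<in> B. finsupp u}"
  have V: "complex_vector.subspace ?V"
    using complex_vector.subspace_inter[OF B_sub finsupp_subspace] by (simp add: Int_def)
  let ?C = "{f \<in> B. \<forall>e>0. \<exists>h\<in>?V. NB (f - h) < e}"
  have "complex_vector.span {a * b | a b. a \<in> A \<and> b \<in> B} \<subseteq> ?C"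
  proof (rule complex_vector.span_minimal, rule subsetI)
    show "complex_vector.subspace ?C" by (rule closure_subspace[OF NB_seminorm V]) simp
    fix f assume "f \<in> {a * b | a b. a \<in> A \<and> b \<in> B}"
    then obtain a c where f: "f = a * c" "a \<in> A" "c \<in> B" by blast
    show "f \<in> ?C" unfolding f(1) mem_Collect_eq
      by (intro conjI allI impI ideal[OF f(2,3)] finsupp_approx_product[OF f(2,3), unfolded mem_Collect_eq])
  qed
  moreover have e2: "e / 2 > 0" using e by simp
  obtain w where w: "w \<in> complex_vector.span {a * b | a b. a \<in> A \<and> b \<in> B}" "NB (b - w) < e / 2"
    using essential b e2 unfolding dense_wrt_def by blast
  ultimately have wC: "w \<in> ?C" by blast
  then obtain v where v: "v \<in> ?V" "NB (w - v) < e / 2" using e2 by blast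
  have mem: "w \<in> B" "v \<in> B" using wC v(1) by simp_all
  have eq: "b - v = (b - w) + (w - v)" by simp
  have "NB (b - v) \<le> NB (b - w) + NB (w - v)" unfolding eq
    by (rule seminorm_onD(3)[OF NB_seminorm subspace_minus[OF B_sub b mem(1)] subspace_minus[OF B_sub mem]])
  then have "NB (b - v) < e" using v(2) w(2) by linarith
  then show ?thesis using v(1) by (intro exI[of _ v]) simp
qed

text \<open>An approximate unit \<open>w\<close> is perturbed to finite support; submultiplicativity
  controls the effect on the finitely many given functions.\<close>

lemma finsupp_approximate_unit:
  assumes ai: "has_approximate_identity B NB" and S: "finite S" "S \<subseteq> B" and e: "e > 0"
  shows "\<exists>u. (u \<in> B \<and> finsupp u) \<and> (\<forall>a\<in>S. NB (u * a - a) < e)"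
proof -
  obtain F where F: "F \<noteq> bot" "\<forall>\<^sub>F e in F. e \<in> B"
    "\<forall>a\<in>B. ((\<lambda>e. NB (e * a - a)) \<longlongrightarrow> 0) F \<and> ((\<lambda>e. NB (a * e - a)) \<longlongrightarrow> 0) F"
    using ai unfolding has_approximate_identity_def by (elim exE conjE)
  have e2: "e / 2 > 0" using e by simp
  have "\<exists>w. w \<in> B \<and> (\<forall>a\<in>S. NB (w * a - a) < e / 2)"
  proof (rule net_member[OF F(1,2) _ S(1) e2])
    fix a assume "a \<in> S"
    then show "((\<lambda>e. NB (e * a - a)) \<longlongrightarrow> 0) F" using F(3) S(2) by blast
  qed
  then obtain w where w: "w \<in> B" "\<And>a. a \<in> S \<Longrightarrow> NB (w * a - a) < e / 2" by blast
  have nn: "0 \<le> NB a" if "a \<in> S" for a using seminorm_onD(2)[OF NB_seminorm] S(2) that by blast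
  \<comment> \<open>A common bound for the norms of the members of \<open>S\<close>, kept positive
    for the division.\<close>
  define M where "M = 1 + (\<Sum>a\<in>S. NB a)"
  have M0: "M > 0" unfolding M_def by (simp add: add_pos_nonneg sum_nonneg nn)
  have M: "NB a \<le> M" if "a \<in> S" for a
    unfolding M_def using member_le_sum[OF that _ S(1), of NB] nn by simp
  have "e / 2 / M > 0" using e M0 by simp
  then obtain u where u: "u \<in> B" "finsupp u" "NB (w - u) < e / 2 / M" using finsupp_dense[OF w(1)] by blast
  have uw: "u - w \<in> B" by (rule subspace_minus[OF B_sub u(1) w(1)])
  have uw': "NB (u - w) < e / 2 / M" using u(3) seminorm_on_minus_commute[OF NB_seminorm u(1) w(1)] by simp
  have "NB (u * a - a) < e" if a: "a \<in> S" for a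
  proof -
    have aB: "a \<in> B" using a S(2) by blast
    have eq: "u * a - a = (u - w) * a + (w * a - a)" by (simp add: algebra_simps)
    have "NB (u * a - a) \<le> NB ((u - w) * a) + NB (w * a - a)" unfolding eq
      by (rule seminorm_onD(3)[OF NB_seminorm idealB[OF uw aB] subspace_minus[OF B_sub idealB[OF w(1) aB] aB]])
    moreover have "NB ((u - w) * a) \<le> NB (u - w) * NB a" by (rule NB_mult[OF uw aB])
    moreover have "NB (u - w) * NB a \<le> (e / 2 / M) * M"
      using uw' M[OF a] nn[OF a] e M0 by (intro mult_mono) simp_all
    moreover have "(e / 2 / M) * M = e / 2" using M0 by simp
    ultimately show ?thesis using w(2)[OF a] by linarith
  qed
  then show ?thesis using u(1,2) by blast
qed

lemma finsupp_net:
  assumes "has_approximate_identity B NB"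
  shows "\<exists>F. F \<noteq> bot \<and> (\<forall>\<^sub>F u in F. u \<in> B \<and> finsupp u) \<and> (\<forall>a\<in>B. ((\<lambda>u. NB (u * a - a)) \<longlongrightarrow> 0) F)"
proof (rule net_exists)
  show "0 \<le> NB (u * a - a)" if "u \<in> B \<and> finsupp u" "a \<in> B" for u a
    using that by (intro seminorm_onD(2)[OF NB_seminorm] subspace_minus[OF B_sub] idealB) simp_all
qed (rule finsupp_approximate_unit[OF assms])

lemma xi_mem: "u \<in> B \<Longrightarrow> xi u a \<in> P"
  unfolding xi_def by (rule diag_mem) (simp add: delta_B)

text \<open>Left and right actions both multiply the weights, as does multiplying the
  argument.\<close>

lemma xi_bimodule:
  assumes u: "u \<in> B" shows "bimodule_map_via B (\<lambda>b c. te b c) P NP (xi u)"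
proof -
  have F: "\<forall>z\<in>{z. u z \<noteq> 0}. ind {z} \<in> B" by (simp add: delta_B[OF u])
  have "xi u (a * b) = lact a (xi u b)" "xi u (a * b) = ract (xi u a) b" if "a \<in> B" "b \<in> B" for a b
    unfolding xi_def lact_diag[OF F that(1)] ract_diag[OF F that(2)] by (simp_all add: mult_ac)
  then show ?thesis unfolding bimodule_map_via_def by blast
qed

lemma mm_xi:
  assumes u: "u \<in> B" "finsupp u" shows "mm (xi u a) = u * a"
proof -
  have F: "\<forall>z\<in>{z. u z \<noteq> 0}. ind {z} \<in> B" by (simp add: delta_B[OF u(1)])
  show ?thesis unfolding xi_def mm_diag[OF F u(2)[unfolded finsupp_def]] by (auto simp: fun_eq_iff)
qed

lemma pseudo_contractible_if_discrete:
  assumes "has_approximate_identity B NB" shows "pseudo_contractible_via B NB (\<lambda>b c. te b c) P NP"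
proof -
  obtain F where F: "F \<noteq> bot" "\<forall>\<^sub>F u in F. u \<in> B \<and> finsupp u" "\<forall>a\<in>B. ((\<lambda>u. NB (u * a - a)) \<longlongrightarrow> 0) F"
    using finsupp_net[OF assms] by blast
  let ?m = "\<lambda>u. diag {z. u z \<noteq> 0} u"
  have diag: "?m u \<in> P \<and> (\<forall>a\<in>B. lact a (?m u) = ract (?m u) a)" "mm (?m u) = u" if u: "u \<in> B \<and> finsupp u" for u
  proof -
    have F: "\<forall>z\<in>{z. u z \<noteq> 0}. ind {z} \<in> B" using u by (simp add: delta_B[of u])
    show "?m u \<in> P \<and> (\<forall>a\<in>B. lact a (?m u) = ract (?m u) a)"
      by (intro conjI ballI diag_mem[OF F]) (simp_all only: lact_diag[OF F] ract_diag[OF F])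
    have "finite {z. u z \<noteq> 0}" using u by (simp add: finsupp_def)
    then show "mm (?m u) = u" by (auto simp: mm_diag[OF F] fun_eq_iff)
  qed
  have "filtermap ?m F \<noteq> bot" using F(1) by (simp add: filtermap_bot_iff)
  moreover have "\<forall>\<^sub>F m in filtermap ?m F. m \<in> P \<and> (\<forall>a\<in>B. lact a m = ract m a)"
    unfolding eventually_filtermap using F(2) by eventually_elim (rule diag(1))
  moreover have "((\<lambda>m. NB (mm m * a - a)) \<longlongrightarrow> 0) (filtermap ?m F)" if a: "a \<in> B" for a
    unfolding filterlim_filtermap
  proof (rule Lim_transform_eventually[OF F(3)[rule_format, OF a]])
    show "\<forall>\<^sub>F u in F. NB (u * a - a) = NB (mm (?m u) * a - a)"
      using F(2) by eventually_elim (simp only: diag(2))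
  qed
  ultimately show ?thesis unfolding pseudo_contractible_via_def by blast
qed

lemma xi_net:
  assumes "has_approximate_identity B NB"
  shows "\<exists>F. F \<noteq> bot \<and> (\<forall>\<^sub>F \<xi> in F. \<exists>u. u \<in> B \<and> finsupp u \<and> \<xi> = xi u)
    \<and> (\<forall>a\<in>B. ((\<lambda>\<xi>. NB (mm (\<xi> a) - a)) \<longlongrightarrow> 0) F)"
proof -
  obtain F where F: "F \<noteq> bot" "\<forall>\<^sub>F u in F. u \<in> B \<and> finsupp u" "\<forall>a\<in>B. ((\<lambda>u. NB (u * a - a)) \<longlongrightarrow> 0) F"
    using finsupp_net[OF assms] by blast
  have "filtermap xi F \<noteq> bot" using F(1) by (simp add: filtermap_bot_iff)
  moreover have "\<forall>\<^sub>F \<xi> in filtermap xi F. \<exists>u. u \<in> B \<and> finsupp u \<and> \<xi> = xi u"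
    unfolding eventually_filtermap using F(2) by eventually_elim blast
  moreover have "((\<lambda>\<xi>. NB (mm (\<xi> a) - a)) \<longlongrightarrow> 0) (filtermap xi F)" if a: "a \<in> B" for a
    unfolding filterlim_filtermap
  proof (rule Lim_transform_eventually[OF F(3)[rule_format, OF a]])
    show "\<forall>\<^sub>F u in F. NB (u * a - a) = NB (mm (xi u a) - a)"
      using F(2) by eventually_elim (simp only: mm_xi)
  qed
  ultimately show ?thesis by blast
qed

lemma xi_linear:
  assumes u: "u \<in> B" shows "linear_between B P (xi u)"
proof -
  have F: "\<forall>z\<in>{z. u z \<noteq> 0}. ind {z} \<in> B" by (simp add: delta_B[OF u])
  have "xi u (a + b) = xi u a + xi u b" for a b
    unfolding xi_def diag_eq[OF F]
    by (simp add: sum.distrib[symmetric] distrib_left scaleC_add_left)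
  moreover have "xi u (c *\<^sub>C a) = c *\<^sub>C xi u a" for c a
    unfolding xi_def diag_eq[OF F]
    by (simp add: complex_vector.scale_sum_right complex_vector.scale_scale scaleC_fun_def[of c a] scaleC_complex_def mult_ac)
  ultimately show ?thesis unfolding linear_between_def using xi_mem[OF u] by blast
qed

lemma xi_bounded:
  assumes u: "u \<in> B" shows "bounded_between B NB P NP (xi u)"
proof -
  let ?C = "\<Sum>z | u z \<noteq> 0. cmod (u z) * N (tensor (ind {z}) (ind {z}))"
  have F: "\<forall>z\<in>{z. u z \<noteq> 0}. ind {z} \<in> B" by (simp add: delta_B[OF u])
  have "NP (xi u a) \<le> ?C * NB a" if a: "a \<in> B" for a
  proof -
    have "NP (xi u a) \<le> (\<Sum>z | u z \<noteq> 0. NP ((u z * a z) *\<^sub>C te (ind {z}) (ind {z})))"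
      unfolding xi_def diag_eq[OF F]
      by (rule seminorm_on_sum_le[OF P_seminorm]) (rule complex_vector.subspace_scale[OF P_sub te_mem[OF bspec[OF F] bspec[OF F]]])
    also have "\<dots> \<le> (\<Sum>z | u z \<noteq> 0. cmod (u z) * N (tensor (ind {z}) (ind {z})) * NB a)"
    proof (rule sum_mono)
      fix z assume z: "z \<in> {z. u z \<noteq> 0}"
      have t: "tensor (ind {z}) (ind {z}) \<in> X" by (rule tensor_mem[OF bspec[OF F z] bspec[OF F z]])
      have "NP ((u z * a z) *\<^sub>C te (ind {z}) (ind {z})) = cmod (u z * a z) * N (tensor (ind {z}) (ind {z}))"
        using seminorm_onD(4)[OF P_seminorm T.emb_mem[OF t]] by (simp only: T.cn_emb[OF t])
      also have "\<dots> = cmod (u z) * N (tensor (ind {z}) (ind {z})) * cmod (a z)" by (simp only: norm_mult mult_ac)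
      also have "\<dots> \<le> cmod (u z) * N (tensor (ind {z}) (ind {z})) * NB a"
        using NB_eval[OF a] T.N_nonneg[OF t] by (intro mult_left_mono mult_nonneg_nonneg) simp_all
      finally show "NP ((u z * a z) *\<^sub>C te (ind {z}) (ind {z})) \<le> cmod (u z) * N (tensor (ind {z}) (ind {z})) * NB a" .
    qed
    also have "\<dots> = ?C * NB a" by (rule sum_distrib_right[symmetric])
    finally show ?thesis .
  qed
  then show ?thesis unfolding bounded_between_def using xi_linear[OF u] by blast
qed

end

end

section \<open>The equivalences\<close>

lemma alg_tensor_mono: "X \<subseteq> X' \<Longrightarrow> Y \<subseteq> Y' \<Longrightarrow> alg_tensor X Y \<subseteq> alg_tensor X' Y'"
  unfolding alg_tensor_def by (rule complex_vector.span_mono) blast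

text \<open>Meant for the norm of \<open>1 \<times> 1\<close> matrices and the norm of the
  completion, which agree on \<open>P\<close>.\<close>

lemma pseudo_contractible_via_cong:
  assumes eq: "\<forall>m\<in>P. NP m = NP' m"
  shows "left_act B te P NP = left_act B te P NP'" "right_act B te P NP = right_act B te P NP'"
    "mult_map B NB te P NP = mult_map B NB te P NP'"
    "pseudo_contractible_via B NB te P NP = pseudo_contractible_via B NB te P NP'"
    "bimodule_map_via B te P NP = bimodule_map_via B te P NP'"
proof -
  note NP = bspec[OF eq]
  show l: "left_act B te P NP = left_act B te P NP'"
    by (rule ext)+ (simp only: left_act_def extension_cong[OF NP NP])
  show r: "right_act B te P NP = right_act B te P NP'"
    by (rule ext)+ (simp only: right_act_def extension_cong[OF NP NP])
  show m: "mult_map B NB te P NP = mult_map B NB te P NP'"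
    by (rule ext) (simp only: mult_map_def extension_cong[OF NP refl])
  show "pseudo_contractible_via B NB te P NP = pseudo_contractible_via B NB te P NP'"
    unfolding pseudo_contractible_via_def l r m ..
  show "bimodule_map_via B te P NP = bimodule_map_via B te P NP'"
    by (rule ext) (simp only: bimodule_map_via_def l r)
qed

text \<open>The module structure provides multiplication on the completed product of
  \<open>A\<close> with \<open>B\<close>. Composition with the natural map from the completed square
  of \<open>B\<close>, which does not increase norms, gives the one on \<open>B\<close>.\<close>

lemma multiplication_restrict:
  assumes N: "seminorm_on (alg_tensor B B) N" and N': "seminorm_on (alg_tensor A B) N'" and AB: "B \<subseteq> A"
    and le: "\<And>u. u \<in> alg_tensor B B \<Longrightarrow> N' u \<le> N u"
    and L: "contraction_between (completion (alg_tensor A B) N') (completion_norm (alg_tensor A B) N') B NB L"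
      "\<And>a b. a \<in> A \<Longrightarrow> b \<in> B \<Longrightarrow> L (completion_embed (alg_tensor A B) N' (tensor a b)) = a * b"
  shows "\<exists>L. bounded_between (completion (alg_tensor B B) N) (completion_norm (alg_tensor B B) N) B NB L
      \<and> (\<forall>b\<in>B. \<forall>c\<in>B. L (completion_embed (alg_tensor B B) N (tensor b c)) = b * (c::'a::complex_algebra))"
proof -
  interpret N': seminormed "alg_tensor A B" N' by standard (rule N')
  let ?J = "completion_map (alg_tensor B B) (alg_tensor A B) N' (\<lambda>u. u)"
  have sub: "alg_tensor B B \<subseteq> alg_tensor A B" by (rule alg_tensor_mono[OF AB subset_refl])
  have lin: "linear_between (alg_tensor B B) (alg_tensor A B) (\<lambda>u. u)"
    unfolding linear_between_def using sub by blast
  note J = completion_map[of "alg_tensor B B" N "alg_tensor A B" N' "\<lambda>u. u" 1, OF N N' lin]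
  have J1: "bounded_between (completion (alg_tensor B B) N) (completion_norm (alg_tensor B B) N)
      (completion (alg_tensor A B) N') (completion_norm (alg_tensor A B) N') ?J"
    by (rule J(1)) (simp add: le)
  have J3: "?J (completion_embed (alg_tensor B B) N u) = completion_embed (alg_tensor A B) N' u" if "u \<in> alg_tensor B B" for u
    by (rule J(3)[OF _ that]) (simp add: le)
  have Lb: "bounded_between (completion (alg_tensor A B) N') (completion_norm (alg_tensor A B) N') B NB L"
    using L(1) unfolding contraction_between_def bounded_between_def
    by (intro conjI exI[of _ 1]) simp_all
  have "bounded_between (completion (alg_tensor B B) N) (completion_norm (alg_tensor B B) N) B NB (\<lambda>m. L (?J m))"
    by (rule bounded_between_compose[OF J1 Lb normed_on_seminorm[OF N'.completion_normed]])
  moreover have "L (?J (completion_embed (alg_tensor B B) N (tensor b c))) = b * c" if "b \<in> B" "c \<in> B" for b c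
    unfolding J3[OF tensor_mem[OF that]] using AB that by (intro L(2)) blast+
  ultimately show ?thesis by blast
qed

context segal_ctx
begin

text \<open>\<open>R\<close> stands for boundedness in one version and complete boundedness in the
  other. Discreteness follows from maps with values in \<open>P\<close>; for the converse the maps
  \<open>xi u\<close> have to satisfy \<open>R\<close>.\<close>

lemma equivalences:
  assumes PC: "PC \<longleftrightarrow> pseudo_contractible_via B NB (\<lambda>b c. te b c) P NP"
    and BP: "BP \<longleftrightarrow> (\<exists>F. F \<noteq> bot \<and> (\<forall>\<^sub>F \<xi> in F. R \<xi> \<and> bimodule_map_via B (\<lambda>b c. te b c) P NP \<xi>)
      \<and> (\<forall>a\<in>B. ((\<lambda>\<xi>. NB (mm (\<xi> a) - a)) \<longlongrightarrow> 0) F))"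
    and R: "\<And>\<xi> a. R \<xi> \<Longrightarrow> a \<in> B \<Longrightarrow> \<xi> a \<in> P"
    and xi: "\<And>u. discrete_group TYPE('g) \<Longrightarrow> u \<in> B \<Longrightarrow> R (xi u)"
  shows "((has_approximate_identity B NB \<and> discrete_group TYPE('g)) \<longleftrightarrow> (has_approximate_identity B NB \<and> BP))
    \<and> ((has_approximate_identity B NB \<and> BP) \<longleftrightarrow> PC)"
proof -
  have 1: BP if ai: "has_approximate_identity B NB" and d: "discrete_group TYPE('g)"
  proof -
    obtain F where F: "F \<noteq> bot" "\<forall>\<^sub>F \<xi> in F. \<exists>u. u \<in> B \<and> finsupp u \<and> \<xi> = xi u"
      "\<forall>a\<in>B. ((\<lambda>\<xi>. NB (mm (\<xi> a) - a)) \<longlongrightarrow> 0) F"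
      using xi_net[OF d ai] by blast
    have "\<forall>\<^sub>F \<xi> in F. R \<xi> \<and> bimodule_map_via B (\<lambda>b c. te b c) P NP \<xi>"
      using F(2)
    proof eventually_elim
      case (elim \<xi>)
      then obtain u where u: "u \<in> B" "\<xi> = xi u" by (elim exE conjE)
      then show ?case using xi[OF d u(1)] xi_bimodule[OF d u(1)] by simp
    qed
    then show ?thesis unfolding BP using F(1,3) by blast
  qed
  have 2: "discrete_group TYPE('g)" if bp: BP
  proof -
    obtain F where F: "F \<noteq> bot" "\<forall>\<^sub>F \<xi> in F. R \<xi> \<and> bimodule_map_via B (\<lambda>b c. te b c) P NP \<xi>"
      "\<forall>a\<in>B. ((\<lambda>\<xi>. NB (mm (\<xi> a) - a)) \<longlongrightarrow> 0) F"
      using bp unfolding BP by (elim exE conjE)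
    have "\<forall>\<^sub>F \<xi> in F. (\<forall>a\<in>B. \<xi> a \<in> P) \<and> bimodule_map_via B (\<lambda>b c. te b c) P NP \<xi>"
      using F(2) by eventually_elim (simp add: R)
    from biprojective_discrete[OF F(1) this F(3)[rule_format]] show ?thesis .
  qed
  have 3: PC if "has_approximate_identity B NB" "discrete_group TYPE('g)"
    unfolding PC by (rule pseudo_contractible_if_discrete[OF that(2,1)])
  have 4: "has_approximate_identity B NB" "discrete_group TYPE('g)" if PC
    using that unfolding PC by (rule pseudo_contractible_ai, rule pseudo_contractible_discrete)
  show ?thesis using 1 2 3 4 by blast
qed

end

section \<open>The Banach algebra version and the operator version\<close>

context lc_haar
begin

text \<open>If \<open>B\<close> were zero, density would put \<open>0\<close> close to a function
  with a nonzero value, against the bound of values by the norm.\<close>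

lemma dense_nontrivial:
  assumes dense: "dense_wrt NA B A" and le: "\<And>u x. u \<in> A \<Longrightarrow> cmod (u x) \<le> NA u"
  shows "\<exists>b\<in>B. b \<noteq> 0"
proof (rule ccontr)
  assume "\<not> (\<exists>b\<in>B. b \<noteq> 0)"
  then have 0: "b = 0" if "b \<in> B" for b using that by blast
  obtain a where a: "a \<in> A" "a 0 \<noteq> 0" using A_nonzero[of 0] ..
  have "cmod (a 0) > 0" using a(2) by simp
  then obtain d where d: "d \<in> B" "NA (a - d) < cmod (a 0)" using dense a(1) unfolding dense_wrt_def by blast
  have "NA a < cmod (a 0)" using d(2) unfolding 0[OF d(1)] by simp
  then show False using le[OF a(1), of 0] by simp
qed

lemma segal_equivalences:
  assumes S: "segal_algebra A (fourier_norm \<mu>) B NB"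
  shows "((has_approximate_identity B NB \<and> discrete_group TYPE('g)) \<longleftrightarrow> (has_approximate_identity B NB \<and> approximately_biprojective B NB))
    \<and> ((has_approximate_identity B NB \<and> approximately_biprojective B NB) \<longleftrightarrow> pseudo_contractible B NB)"
proof -
  let ?NA = "fourier_norm \<mu>"
  have dense: "dense_wrt ?NA B A" and ideal: "\<And>a b. a \<in> A \<Longrightarrow> b \<in> B \<Longrightarrow> a * b \<in> B"
    and ban: "banach_on B NB" and con: "contraction_between B NB A ?NA (\<lambda>b. b)"
    and ess: "dense_wrt NB (complex_vector.span {a * b | a b. a \<in> A \<and> b \<in> B}) B"
    using S unfolding segal_algebra_def by blast+
  obtain L where L: "contraction_between (ptensor A ?NA B NB) (ptensor_norm A ?NA B NB) B NB L"
    "\<forall>a\<in>A. \<forall>b\<in>B. L (ptensor_elem A ?NA B NB a b) = a * b"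
    using S unfolding segal_algebra_def by blast
  have NB: "normed_on B NB" using ban unfolding banach_on_def by simp
  note sB = normed_on_seminorm[OF NB]
  have BA: "B \<subseteq> A" using dense unfolding dense_wrt_def by simp
  have AleB: "?NA b \<le> NB b" if "b \<in> B" for b using con that unfolding contraction_between_def by simp
  have gB: "gauge_on B NB" by (rule seminorm_on_gauge[OF sB])
  let ?X = "alg_tensor B B" and ?N = "proj_norm B NB B NB"
  let ?XA = "alg_tensor A B" and ?NAB = "proj_norm A ?NA B NB"
  have sN: "seminorm_on ?X ?N" by (rule proj_norm_seminorm[OF gB gB])
  have sNA: "seminorm_on ?XA ?NAB" by (rule proj_norm_seminorm[OF fourier_gauge gB])
  interpret XA: seminormed ?XA ?NAB by standard (rule sNA)
  \<comment> \<open>The contractive multiplication map is applied to an elementary tensor, whose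
    norm is at most the product of the norms.\<close>
  have prod: "NB (a * b) \<le> ?NA a * NB b" if ab: "a \<in> A" "b \<in> B" for a b
  proof -
    have t: "tensor a b \<in> ?XA" by (rule tensor_mem[OF ab])
    have "NB (a * b) = NB (L (XA.emb (tensor a b)))" using L(2) ab by (simp add: ptensor_elem_def)
    also have "\<dots> \<le> XA.cn (XA.emb (tensor a b))"
      using L(1) XA.emb_mem[OF t] unfolding contraction_between_def ptensor_def ptensor_norm_def by blast
    also have "\<dots> = ?NAB (tensor a b)" by (rule XA.cn_emb[OF t])
    also have "\<dots> \<le> ?NA a * NB b" by (rule proj_norm_tensor_le[OF fourier_gauge gB ab])
    finally show ?thesis .
  qed
  note nn = seminorm_onD(2)[OF sB]
  have prodB: "NB (b * c) \<le> NB b * NB c" if "b \<in> B" "c \<in> B" for b c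
  proof -
    have "NB (b * c) \<le> ?NA b * NB c" by (rule prod) (use that BA in blast)+
    also have "\<dots> \<le> NB b * NB c" by (rule mult_right_mono[OF AleB[OF that(1)] nn[OF that(2)]])
    finally show ?thesis .
  qed
  have eval: "cmod (b x) \<le> NB b" if "b \<in> B" for b x
    using fourier_norm_eval[of b x] AleB[OF that] BA that by (meson order_trans subsetD)
  have idB: "b * c \<in> B" if "b \<in> B" "c \<in> B" for b c using ideal[of b c] BA that by blast
  interpret segal_ctx \<mu> B NB ?N
  proof
    show "B \<subseteq> A" "normed_on B NB" "\<And>a b. a \<in> A \<Longrightarrow> b \<in> B \<Longrightarrow> a * b \<in> B" by fact+
    show "dense_wrt NB (complex_vector.span {a * b | a b. a \<in> A \<and> b \<in> B}) B" by (rule ess)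
    show "\<exists>b\<in>B. b \<noteq> 0" by (rule dense_nontrivial[OF dense fourier_norm_eval])
    show "seminorm_on ?X ?N" by (rule sN)
    show "cmod (b x) \<le> NB b" if "b \<in> B" for b x by (rule eval[OF that])
    show "NB (b * c) \<le> NB b * NB c" if "b \<in> B" "c \<in> B" for b c by (rule prodB[OF that])
    show "NB (coefficient \<mu> f g * b) \<le> L2_norm \<mu> f * L2_norm \<mu> g * NB b"
      if "f \<in> L2 \<mu>" "g \<in> L2 \<mu>" "b \<in> B" for f g b
      using prod[OF coefficient_mem[OF that(1,2)] that(3)] mult_right_mono[OF fourier_norm_le[OF that(1,2)] nn[OF that(3)]]
      by linarith
    show "\<exists>C. \<forall>u\<in>?X. ?N (tensor_map (\<lambda>b. a * b) (\<lambda>c. c) u) \<le> C * ?N u" if a: "a \<in> B" for a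
    proof (intro exI[of _ "NB a"] ballI)
      fix u assume u: "u \<in> ?X"
      have lin: "linear_between ?X ?X (tensor_map (\<lambda>b. a * b) (\<lambda>c. c))"
        by (rule linear_between_clinear[OF clinear_tensor_map])
          (rule tensor_map_mem[OF clinear_mult_left idB[OF a] clinear_id], assumption+)
      show "?N (tensor_map (\<lambda>b. a * b) (\<lambda>c. c) u) \<le> NB a * ?N u"
      proof (rule proj_norm_bound[OF gB gB lin sN nn[OF a] _ u])
        fix x y assume xy: "x \<in> B" "y \<in> B"
        have "?N (tensor (a * x) y) \<le> NB (a * x) * NB y" by (rule proj_norm_tensor_le[OF gB gB idB[OF a xy(1)] xy(2)])
        also have "\<dots> \<le> (NB a * NB x) * NB y" by (rule mult_right_mono[OF prodB[OF a xy(1)] nn[OF xy(2)]])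
        finally show "?N (tensor_map (\<lambda>b. a * b) (\<lambda>c. c) (tensor x y)) \<le> NB a * (NB x * NB y)"
          unfolding tensor_map_tensor[OF clinear_mult_left clinear_id] by (simp only: mult.assoc)
      qed
    qed
    show "\<exists>C. \<forall>u\<in>?X. ?N (tensor_map (\<lambda>b. b) (\<lambda>c. c * a) u) \<le> C * ?N u" if a: "a \<in> B" for a
    proof (intro exI[of _ "NB a"] ballI)
      fix u assume u: "u \<in> ?X"
      have lin: "linear_between ?X ?X (tensor_map (\<lambda>b. b) (\<lambda>c. c * a))"
        by (rule linear_between_clinear[OF clinear_tensor_map])
          (rule tensor_map_mem[OF clinear_id _ clinear_mult_right], assumption, rule idB[OF _ a], assumption+)
      show "?N (tensor_map (\<lambda>b. b) (\<lambda>c. c * a) u) \<le> NB a * ?N u"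
      proof (rule proj_norm_bound[OF gB gB lin sN nn[OF a] _ u])
        fix x y assume xy: "x \<in> B" "y \<in> B"
        have "?N (tensor x (y * a)) \<le> NB x * NB (y * a)" by (rule proj_norm_tensor_le[OF gB gB xy(1) idB[OF xy(2) a]])
        also have "\<dots> \<le> NB x * (NB y * NB a)" by (rule mult_left_mono[OF prodB[OF xy(2) a] nn[OF xy(1)]])
        finally show "?N (tensor_map (\<lambda>b. b) (\<lambda>c. c * a) (tensor x y)) \<le> NB a * (NB x * NB y)"
          unfolding tensor_map_tensor[OF clinear_id clinear_mult_right] by (simp only: mult_ac)
      qed
    qed
    show "cmod (u (\<lambda>b c. b x * c y)) \<le> ?N u" if u: "u \<in> ?X" for u x y
    proof -
      have bil: "bilinear_form (\<lambda>b c. b x * c y :: complex)"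
        by (rule bilinear_formI) (simp_all add: algebra_simps scaleC_fun_def scaleC_complex_def)
      have lin: "linear_between ?X UNIV (\<lambda>u. u (\<lambda>b c. b x * c y))"
        unfolding linear_between_def by (simp add: scaleC_fun_def)
      have "cmod (u (\<lambda>b c. b x * c y)) \<le> 1 * ?N u"
      proof (rule proj_norm_bound[OF gB gB lin normed_on_seminorm[OF normed_on_cmod] _ _ u])
        fix b c assume bc: "b \<in> B" "c \<in> B"
        show "cmod (tensor b c (\<lambda>b c. b x * c y)) \<le> 1 * (NB b * NB c)"
          unfolding tensor_eval[OF bil] norm_mult
          using mult_mono[OF eval[OF bc(1), of x] eval[OF bc(2), of y] nn[OF bc(1)]] by simp
      qed simp
      then show ?thesis by simp
    qed
    show "\<exists>L. bounded_between (completion ?X ?N) (completion_norm ?X ?N) B NB L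
      \<and> (\<forall>b\<in>B. \<forall>c\<in>B. L (completion_embed ?X ?N (tensor b c)) = b * c)"
    proof (rule multiplication_restrict[OF sN sNA \<open>B \<subseteq> A\<close>])
      show "contraction_between (completion ?XA ?NAB) (completion_norm ?XA ?NAB) B NB L"
        using L(1) unfolding ptensor_def ptensor_norm_def .
      show "L (completion_embed ?XA ?NAB (tensor a b)) = a * b" if "a \<in> A" "b \<in> B" for a b
        using L(2) that unfolding ptensor_elem_def by blast
      \<comment> \<open>The inclusion of \<open>B\<close> in \<open>A\<close> is contractive, so the
        projective norm over \<open>A\<close> and \<open>B\<close> does not exceed the one over
        \<open>B\<close>.\<close>
      fix u assume u: "u \<in> ?X"
      have lin: "linear_between ?X ?XA (\<lambda>u. u)"
        unfolding linear_between_def using alg_tensor_mono[OF BA subset_refl] by blast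
      have "?NAB u \<le> 1 * ?N u"
      proof (rule proj_norm_bound[OF gB gB lin sNA _ _ u])
        fix x y assume xy: "x \<in> B" "y \<in> B"
        have xA: "x \<in> A" using BA xy(1) ..
        show "?NAB (tensor x y) \<le> 1 * (NB x * NB y)"
          using proj_norm_tensor_le[OF fourier_gauge gB xA xy(2)] mult_right_mono[OF AleB[OF xy(1)] nn[OF xy(2)]] by simp
      qed simp
      then show "?NAB u \<le> ?N u" by simp
    qed
  qed
  have te: "ptensor_elem B NB B NB = (\<lambda>b c. completion_embed ?X ?N (tensor b c))"
    by (rule ext)+ (simp only: ptensor_elem_def)
  show ?thesis
  proof (rule equivalences)
    show "pseudo_contractible B NB \<longleftrightarrow> pseudo_contractible_via B NB (\<lambda>b c. te b c) P NP"
      unfolding pseudo_contractible_def ptensor_def ptensor_norm_def te ..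
    show "approximately_biprojective B NB \<longleftrightarrow> (\<exists>F. F \<noteq> bot
      \<and> (\<forall>\<^sub>F \<xi> in F. bounded_between B NB P NP \<xi> \<and> bimodule_map_via B (\<lambda>b c. te b c) P NP \<xi>)
      \<and> (\<forall>a\<in>B. ((\<lambda>\<xi>. NB (mm (\<xi> a) - a)) \<longlongrightarrow> 0) F))"
      unfolding approximately_biprojective_def Let_def ptensor_def ptensor_norm_def te ..
    show "\<xi> a \<in> P" if "bounded_between B NB P NP \<xi>" "a \<in> B" for \<xi> a
      using that linear_betweenD(1)[of B P \<xi> a] unfolding bounded_between_def by simp
    show "bounded_between B NB P NP (xi u)" if "discrete_group TYPE('g)" "u \<in> B" for u
      by (rule xi_bounded[OF that])
  qed
qed

lemma operator_segal_equivalences: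
  assumes S: "operator_segal_algebra A FN B NB"
  shows "((has_approximate_identity B (norm1 NB) \<and> discrete_group TYPE('g))
        \<longleftrightarrow> (has_approximate_identity B (norm1 NB) \<and> operator_approximately_biprojective B NB))
    \<and> ((has_approximate_identity B (norm1 NB) \<and> operator_approximately_biprojective B NB)
        \<longleftrightarrow> operator_pseudo_contractible B NB)"
proof -
  let ?nb = "norm1 NB"
  have dense: "dense_wrt (norm1 FN) B A" and ideal: "\<And>a b. a \<in> A \<Longrightarrow> b \<in> B \<Longrightarrow> a * b \<in> B"
    and com: "complete_operator_space B NB" and con: "complete_contraction_between B NB A FN (\<lambda>b. b)"
    and ess: "dense_wrt ?nb (complex_vector.span {a * b | a b. a \<in> A \<and> b \<in> B}) B"
    using S unfolding operator_segal_algebra_def by blast+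
  obtain L where L: "complete_contraction_between (op_ptensor A FN B NB) (op_ptensor_norm A FN B NB) B NB L"
    "\<forall>a\<in>A. \<forall>b\<in>B. L (op_ptensor_elem A FN B NB a b) = a * b"
    using S unfolding operator_segal_algebra_def by blast
  have gB: "matrix_gauge B NB" and NB: "normed_on B ?nb"
    using com operator_space_matrix_gauge unfolding complete_operator_space_def banach_on_def by blast+
  note gA = FN_gauge
  note sB = normed_on_seminorm[OF NB]
  note nn = seminorm_onD(2)[OF sB]
  have BA: "B \<subseteq> A" using dense unfolding dense_wrt_def by simp
  have AleB: "FN (fmat n x) \<le> NB (fmat n x)" if "\<And>i j. i < n \<Longrightarrow> j < n \<Longrightarrow> x i j \<in> B" for n x
  proof -
    have "FN (map_mat (\<lambda>b. b) (fmat n x)) \<le> NB (fmat n x)"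
      using con mat_in_mats[of n x B, OF that] unfolding complete_contraction_between_def by blast
    moreover have "map_mat (\<lambda>b. b) (fmat n x) = fmat n x" by (rule eq_matI) simp_all
    ultimately show ?thesis by simp
  qed
  have AleB1: "norm1 FN b \<le> ?nb b" if "b \<in> B" for b
    unfolding norm1_fmat using AleB[of 1 "\<lambda>_ _. b"] that by simp
  let ?X = "alg_tensor B B" and ?opn = "op_proj_norm B NB B NB"
  let ?N = "norm1 ?opn"
  let ?XA = "alg_tensor A B" and ?opnA = "op_proj_norm A FN B NB"
  let ?NAB = "norm1 ?opnA"
  have sN: "seminorm_on ?X ?N" by (rule opn_seminorm[OF gB gB])
  have sNA: "seminorm_on ?XA ?NAB" by (rule opn_seminorm[OF gA gB])
  interpret XA: seminormed ?XA ?NAB by standard (rule sNA)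
  \<comment> \<open>The operator tensor norm requires multiplication by \<open>a\<close> to be
    bounded on matrices of every size. This comes from the complete contraction \<open>L\<close>,
    applied to the matrix of tensors of \<open>a\<close> with the entries of
    \<open>x\<close>.\<close>
  have prod: "NB (fmat n (\<lambda>i j. a * x i j)) \<le> norm1 FN a * NB (fmat n x)"
    if a: "a \<in> A" and x: "\<And>i j. i < n \<Longrightarrow> j < n \<Longrightarrow> x i j \<in> B" for n a x
  proof -
    have t: "tensor a (x i j) \<in> ?XA" if "i < n" "j < n" for i j by (rule tensor_mem[OF a x[OF that]])
    let ?M = "fmat n (\<lambda>i j. XA.emb (tensor a (x i j)))"
    have M: "?M \<in> mats n (op_ptensor A FN B NB)"
      unfolding op_ptensor_def by (rule mat_in_mats) (rule XA.emb_mem[OF t])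
    have "fmat n (\<lambda>i j. a * x i j) = map_mat L ?M"
    proof (rule eq_matI)
      fix i j assume "i < dim_row (map_mat L ?M)" "j < dim_col (map_mat L ?M)"
      then have ij: "i < n" "j < n" by simp_all
      have "L (XA.emb (tensor a (x i j))) = a * x i j" using L(2) a x[OF ij] unfolding op_ptensor_elem_def by blast
      then show "fmat n (\<lambda>i j. a * x i j) $$ (i, j) = map_mat L ?M $$ (i, j)" using ij by simp
    qed simp_all
    then have "NB (fmat n (\<lambda>i j. a * x i j)) \<le> op_ptensor_norm A FN B NB ?M"
      using L(1) M unfolding complete_contraction_between_def by simp
    also have "\<dots> = ?opnA (fmat n (\<lambda>i j. tensor a (x i j)))"
      by (rule opn_completion_emb[OF gA gB]) (rule t)
    also have "\<dots> \<le> norm1 FN a * NB (fmat n x)"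
      by (rule opn_tensor_left_le[OF gA gB a]) (rule x)
    finally show ?thesis .
  qed
  have prod1: "?nb (a * b) \<le> norm1 FN a * ?nb b" if "a \<in> A" "b \<in> B" for a b
    unfolding norm1_fmat[of NB] by (rule prod[OF that(1)]) (rule that(2))
  have prodB: "?nb (b * c) \<le> ?nb b * ?nb c" if "b \<in> B" "c \<in> B" for b c
  proof -
    have "?nb (b * c) \<le> norm1 FN b * ?nb c" by (rule prod1) (use that BA in blast)+
    also have "\<dots> \<le> ?nb b * ?nb c" by (rule mult_right_mono[OF AleB1[OF that(1)] nn[OF that(2)]])
    finally show ?thesis .
  qed
  have eval: "cmod (b x) \<le> ?nb b" if "b \<in> B" for b x
    using norm1_FN_eval[of b x] AleB1[OF that] BA that by (meson order_trans subsetD)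
  have idB: "b * c \<in> B" if "b \<in> B" "c \<in> B" for b c using ideal[of b c] BA that by blast
  have FN0: "0 \<le> norm1 FN a" if "a \<in> A" for a
    unfolding norm1_fmat by (rule FN_nonneg) (rule that)
  \<comment> \<open>Complete contractivity of evaluation, carried from \<open>A\<close> to
    \<open>B\<close> along the completely contractive inclusion.\<close>
  have opbB: "opb {..<n} {..<n} (\<lambda>i j. u i j x) ((NB (fmat n u))\<^sup>2)"
    if u: "\<And>i j. i < n \<Longrightarrow> j < n \<Longrightarrow> u i j \<in> B" for n u x
  proof -
    have uA: "u i j \<in> A" if "i < n" "j < n" for i j using u[OF that] BA by blast
    have "opb {..<n} {..<n} (\<lambda>i j. u i j x) ((FN (fmat n u))\<^sup>2)" by (rule FN_eval) (rule uA)
    moreover have "(FN (fmat n u))\<^sup>2 \<le> (NB (fmat n u))\<^sup>2"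
      by (rule power_mono[OF AleB FN_nonneg]) (rule u uA; assumption)+
    ultimately show ?thesis by (rule opb_mono)
  qed
  interpret segal_ctx \<mu> B ?nb ?N
  proof
    show "B \<subseteq> A" "normed_on B ?nb" "\<And>a b. a \<in> A \<Longrightarrow> b \<in> B \<Longrightarrow> a * b \<in> B" by fact+
    show "dense_wrt ?nb (complex_vector.span {a * b | a b. a \<in> A \<and> b \<in> B}) B" by (rule ess)
    show "\<exists>b\<in>B. b \<noteq> 0" by (rule dense_nontrivial[OF dense norm1_FN_eval])
    show "seminorm_on ?X ?N" by (rule sN)
    show "cmod (b x) \<le> ?nb b" if "b \<in> B" for b x by (rule eval[OF that])
    show "?nb (b * c) \<le> ?nb b * ?nb c" if "b \<in> B" "c \<in> B" for b c by (rule prodB[OF that])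
    show "?nb (coefficient \<mu> f g * b) \<le> L2_norm \<mu> f * L2_norm \<mu> g * ?nb b"
      if "f \<in> L2 \<mu>" "g \<in> L2 \<mu>" "b \<in> B" for f g b
      using prod1[OF coefficient_mem[OF that(1,2)] that(3)] mult_right_mono[OF norm1_FN_le[OF that(1,2)] nn[OF that(3)]]
      by linarith
    show "\<exists>C. \<forall>u\<in>?X. ?N (tensor_map (\<lambda>b. a * b) (\<lambda>c. c) u) \<le> C * ?N u" if a: "a \<in> B" for a
    proof (intro exI ballI)
      have aA: "a \<in> A" using BA a ..
      fix u assume u: "u \<in> ?X"
      \<comment> \<open>The summands \<open>1\<close> stem from \<open>opn_tensor_map_le\<close>;
        the identity contributes \<open>1 + 1\<close>.\<close>
      show "?N (tensor_map (\<lambda>b. a * b) (\<lambda>c. c) u) \<le> (norm1 FN a + 1) * (1 + 1) * ?N u"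
        by (rule opn_tensor_map_le[OF gB gB gB gB clinear_mult_left idB[OF a] clinear_id _ FN0[OF aA] _ _ _ u])
          (simp_all add: prod[OF aA])
    qed
    show "\<exists>C. \<forall>u\<in>?X. ?N (tensor_map (\<lambda>b. b) (\<lambda>c. c * a) u) \<le> C * ?N u" if a: "a \<in> B" for a
    proof (intro exI ballI)
      have aA: "a \<in> A" using BA a ..
      fix u assume u: "u \<in> ?X"
      show "?N (tensor_map (\<lambda>b. b) (\<lambda>c. c * a) u) \<le> (1 + 1) * (norm1 FN a + 1) * ?N u"
        by (rule opn_tensor_map_le[OF gB gB gB gB clinear_id _ clinear_mult_right idB[OF _ a] _ _ FN0[OF aA] _ u])
          (simp_all add: mult.commute[of _ a] prod[OF aA])
    qed
    show "cmod (u (\<lambda>b c. b x * c y)) \<le> ?N u" if u: "u \<in> ?X" for u x y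
    proof (rule opn_functional_le[OF gB gB _ _ _ _ u])
      show "clinear (\<lambda>b. b x :: complex)" "clinear (\<lambda>b. b y :: complex)"
        by (rule clinearI; simp add: scaleC_fun_def)+
    qed (rule opbB; assumption)+
    show "\<exists>L. bounded_between (completion ?X ?N) (completion_norm ?X ?N) B ?nb L
      \<and> (\<forall>b\<in>B. \<forall>c\<in>B. L (completion_embed ?X ?N (tensor b c)) = b * c)"
    proof (rule multiplication_restrict[OF sN sNA \<open>B \<subseteq> A\<close>])
      show "contraction_between (completion ?XA ?NAB) (completion_norm ?XA ?NAB) B ?nb L"
        unfolding contraction_between_def
      proof (intro conjI ballI)
        show "linear_between (completion ?XA ?NAB) B L"
          using L(1) unfolding complete_contraction_between_def op_ptensor_def by simp
        fix m assume m: "m \<in> completion ?XA ?NAB"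
        have M: "fmat 1 (\<lambda>_ _. m) \<in> mats 1 (op_ptensor A FN B NB)"
          unfolding op_ptensor_def by (rule mat_in_mats) (rule m)
        have "map_mat L (fmat 1 (\<lambda>_ _. m)) = fmat 1 (\<lambda>_ _. L m)" by (rule eq_matI) simp_all
        then have "?nb (L m) \<le> norm1 (op_ptensor_norm A FN B NB) m"
          using L(1) M unfolding complete_contraction_between_def norm1_fmat by metis
        also have "\<dots> = completion_norm ?XA ?NAB m"
          unfolding op_ptensor_norm_def by (rule completion_mat_norm_1[OF sNA m])
        finally show "?nb (L m) \<le> completion_norm ?XA ?NAB m" .
      qed
      show "L (completion_embed ?XA ?NAB (tensor a b)) = a * b" if "a \<in> A" "b \<in> B" for a b
        using L(2) that unfolding op_ptensor_elem_def by blast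
      fix u assume u: "u \<in> ?X"
      have "?NAB u \<le> 1 * ?opn (fmat 1 (\<lambda>_ _. u))"
      proof (rule opn_le_via_rep[OF gB gB])
        show "?NAB u \<le> 1 * r" if "op_rep B NB B NB 1 (\<lambda>_ _. u) r" for r
        proof -
          have "op_rep A FN B NB 1 (\<lambda>_ _. u) r" by (rule op_rep_weaken_norm[OF that]) (use BA AleB in blast)+
          then show ?thesis unfolding norm1_fmat using op_rep_imp_le(2)[OF gA gB] by simp
        qed
      qed (simp_all add: u)
      then show "?NAB u \<le> ?N u" unfolding norm1_fmat[of ?opn] by simp
    qed
  qed
  have te: "op_ptensor_elem B NB B NB = (\<lambda>b c. completion_embed ?X ?N (tensor b c))"
    by (rule ext)+ (simp only: op_ptensor_elem_def)
  \<comment> \<open>The operator notions measure the completed product by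
    \<open>1 \<times> 1\<close> matrices; on \<open>P\<close> this is the norm of the completion, so
    the results of the locale apply.\<close>
  have NP': "\<forall>m\<in>P. norm1 (op_ptensor_norm B NB B NB) m = NP m"
    unfolding op_ptensor_norm_def by (intro ballI completion_mat_norm_1[OF sN])
  note cong = pseudo_contractible_via_cong[of P "norm1 (op_ptensor_norm B NB B NB)" NP, OF NP']
  show ?thesis
  proof (rule equivalences)
    show "operator_pseudo_contractible B NB \<longleftrightarrow> pseudo_contractible_via B ?nb (\<lambda>b c. te b c) P NP"
      unfolding operator_pseudo_contractible_def op_ptensor_def te cong(4) ..
    show "operator_approximately_biprojective B NB \<longleftrightarrow> (\<exists>F. F \<noteq> bot
      \<and> (\<forall>\<^sub>F \<xi> in F. cb_between B NB P (op_ptensor_norm B NB B NB) \<xi> \<and> bimodule_map_via B (\<lambda>b c. te b c) P NP \<xi>)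
      \<and> (\<forall>a\<in>B. ((\<lambda>\<xi>. ?nb (mm (\<xi> a) - a)) \<longlongrightarrow> 0) F))"
      unfolding operator_approximately_biprojective_def Let_def op_ptensor_def te cong(3) cong(5) ..
    show "\<xi> a \<in> P" if "cb_between B NB P (op_ptensor_norm B NB B NB) \<xi>" "a \<in> B" for \<xi> a
      using that linear_betweenD(1)[of B P \<xi> a] unfolding cb_between_def by simp
    show "cb_between B NB P (op_ptensor_norm B NB B NB) (xi u)" if d: "discrete_group TYPE('g)" and u: "u \<in> B" for u
      unfolding cb_between_def
    proof (intro conjI exI allI ballI)
      show "linear_between B P (xi u)" by (rule xi_linear[OF d u])
      let ?S = "{z. u z \<noteq> 0}"
      have dB: "ind {z} \<in> B" if "z \<in> ?S" for z using that by (simp add: delta_B[OF d u])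
      fix n x assume x: "x \<in> mats n B"
      define y where "y i j = x $$ (i, j)" for i j
      have yB: "y i j \<in> B" if "i < n" "j < n" for i j using x that unfolding mats_iff y_def by blast
      have xy: "x = fmat n y" unfolding y_def by (rule mats_fmat[OF x])
      \<comment> \<open>Moving the weight back into the left factor puts the whole matrix there,
        where multiplication by \<open>ind {z}\<close> is completely bounded by
        \<open>prod\<close>.\<close>
      let ?t = "\<lambda>z i j. tensor (ind {z} * y i j) (ind {z})"
      have t: "?t z i j \<in> ?X" if "z \<in> ?S" "i < n" "j < n" for z i j
        by (intro tensor_mem idB dB yB that)
      let ?U = "\<lambda>i j. \<Sum>z\<in>?S. u z *\<^sub>C ?t z i j"
      have U: "?U i j \<in> ?X" if "i < n" "j < n" for i j
        by (rule complex_vector.subspace_sum[OF T.subspace T.scale_mem[OF t[OF _ that]]])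
      have "map_mat (xi u) x = fmat n (\<lambda>i j. T.emb (?U i j))"
        unfolding xy xi_def diag_def xi_tensor by (rule eq_matI) simp_all
      then have "op_ptensor_norm B NB B NB (map_mat (xi u) x) = ?opn (fmat n ?U)"
        using opn_completion_emb[OF gB gB, of n ?U] U by simp
      also have "\<dots> \<le> (\<Sum>z\<in>?S. cmod (u z) * ?opn (fmat n (?t z)))"
        by (rule opn_sum_le[OF gB gB]) (rule t)
      also have "\<dots> \<le> (\<Sum>z\<in>?S. cmod (u z) * (norm1 FN (ind {z}) * ?nb (ind {z})) * NB x)"
      proof (rule sum_mono)
        fix z assume z: "z \<in> ?S"
        have "?opn (fmat n (?t z)) \<le> NB (fmat n (\<lambda>i j. ind {z} * y i j)) * ?nb (ind {z})"
          by (rule opn_tensor_le[OF gB gB idB[OF dB[OF z] yB] dB[OF z]])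
        also have "\<dots> \<le> (norm1 FN (ind {z}) * NB (fmat n y)) * ?nb (ind {z})"
          by (rule mult_right_mono[OF prod[OF delta_A[OF d] yB] nn[OF dB[OF z]]])
        finally have "?opn (fmat n (?t z)) \<le> norm1 FN (ind {z}) * ?nb (ind {z}) * NB x" unfolding xy by (simp only: mult_ac)
        then have "cmod (u z) * ?opn (fmat n (?t z)) \<le> cmod (u z) * (norm1 FN (ind {z}) * ?nb (ind {z}) * NB x)"
          by (rule mult_left_mono) simp
        then show "cmod (u z) * ?opn (fmat n (?t z)) \<le> cmod (u z) * (norm1 FN (ind {z}) * ?nb (ind {z})) * NB x"
          by (simp only: mult.assoc)
      qed
      also have "\<dots> = (\<Sum>z\<in>?S. cmod (u z) * (norm1 FN (ind {z}) * ?nb (ind {z}))) * NB x"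
        by (rule sum_distrib_right[symmetric])
      finally show "op_ptensor_norm B NB B NB (map_mat (xi u) x)
        \<le> (\<Sum>z\<in>?S. cmod (u z) * (norm1 FN (ind {z}) * ?nb (ind {z}))) * NB x" .
    qed
  qed
qed

end

theorem theorem4p2:
  fixes \<mu> :: "'g::{topological_group_add, t2_space} measure"
  assumes "locally_compact_space (euclidean :: 'g topology)"
    and "left_haar_measure \<mu>"
  shows
    "(\<forall>SA N. segal_algebra (fourier_algebra \<mu>) (fourier_norm \<mu>) SA N \<longrightarrow>
        ((has_approximate_identity SA N \<and> discrete_group TYPE('g))
           \<longleftrightarrow> (has_approximate_identity SA N \<and> approximately_biprojective SA N))
      \<and> ((has_approximate_identity SA N \<and> approximately_biprojective SA N)
           \<longleftrightarrow> pseudo_contractible SA N))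
   \<and> (\<forall>SA N. operator_segal_algebra (fourier_algebra \<mu>) (fourier_mat_norm \<mu>) SA N \<longrightarrow>
        ((has_approximate_identity SA (norm1 N) \<and> discrete_group TYPE('g))
           \<longleftrightarrow> (has_approximate_identity SA (norm1 N) \<and> operator_approximately_biprojective SA N))
      \<and> ((has_approximate_identity SA (norm1 N) \<and> operator_approximately_biprojective SA N)
           \<longleftrightarrow> operator_pseudo_contractible SA N))"
proof -
  interpret lc_haar \<mu> by standard (rule assms)+
  show ?thesis using segal_equivalences operator_segal_equivalences by blast
qed


end
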